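(* Suppose $\beta>0$, $\gamma>d$, $\|(1+|\cdot|)^2(\hat u_0,\hat\Theta_0)\|_{\gamma,\beta}<\infty$ and $\|\hat f\|_{\gamma,\beta}<\infty$ (so initial data and forcing are analytic). Let $(u,\Theta)$ be the Boussinesq solution and $(\hat H,\hat S)$ the solution of (IE) described in the context. (i) The solution $(u,\Theta)$ is Borel summable in $t^{-1}$, i.e. there exists $(H,S)(x,p)$, analytic in $p$ in a neighborhood of $\{0\}\cup\mathbb R^+$, exponentially bounded for large $p$, and analytic in $x$ for $|\mathrm{Im}\,x_j|<\beta$ for $j=1,\dots,d$, such that $$(u,\Theta)(x,t)=(u_0,\Theta_0)(x)+\int_0^\infty(H,S)(x,p)e^{-p/t}\,dp .$$ In particular, as $t\to0^+$, $$(u,\Theta)(x,t)\sim(u_0,\Theta_0)(x)+\sum_{m=1}^\infty(u_m,\Theta_m)(x)t^m,$$ where $|(u_m,\Theta_m)(x)|\le m!\,A_0D_0^m$ with constants $A_0,D_0$ (independent of $m$ and $x$) generally dependent on the initial condition and forcing. (ii) If, further, the initial data and forcing have a finite number of Fourier modes, then $(\hat H,\hat S)(k,p)$ has a power series in $p$ with radius of convergence $D_0^{-1}$ that is independent of the size of the initial data and forcing.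
   Context: Let $d\in\{2,3\}$, let $\nu,\mu,a>0$ be constants and $e_2\in\mathbb R^d$ a fixed unit vector. A repeated index $j$ is summed from $1$ to $d$. $\hat f=\mathcal F[f]$ is the Fourier transform on $\mathbb R^d$, normalized so that $\mathcal F[fg]=\hat f\hat *\hat g$, where $(\hat v\hat*\hat w)(k)=\int_{\mathbb R^d}\hat v(k')\hat w(k-k')dk'$. $P=I-\nabla\Delta^{-1}(\nabla\cdot)$ is the Hodge projection, with Fourier symbol $P_kv=v-\frac{k(k\cdot v)}{|k|^2}$. Norm: $\|\hat f\|_{\gamma,\beta}=\sup_{k\in\mathbb R^d}(1+|k|)^\gamma e^{\beta|k|}|\hat f(k)|$, with $|\cdot|$ the Euclidean norm for vectors or pairs. The Boussinesq system is $$u_t-\nu\Delta u=-P[u\cdot\nabla u-ae_2\Theta]+f,\quad \Theta_t-\mu\Delta\Theta=-u\cdot\nabla\Theta,\quad u(x,0)=u_0(x),\ \Theta(x,0)=\Theta_0(x),$$ with $u_0$ and the time-independent forcing $f=f(x)$ divergence free. Define $$\hat u_1=-\nu|k|^2\hat u_0-ik_jP_k[\hat u_{0,j}\hat*\hat u_0]+aP_k[e_2\hat\Theta_0]+\hat f,\qquad \hat\Theta_1=-\mu|k|^2\hat\Theta_0-ik_j(\hat u_{0,j}\hat*\hat\Theta_0).$$ Let $J_1,Y_1$ be Bessel functions, $\mathcal G(z,z')=z'\{-J_1(z)Y_1(z')+Y_1(z)J_1(z')\}$, $z=2|k|\sqrt{\nu p}$, $z'=2|k|\sqrt{\nu p'}$,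 $\zeta=2|k|\sqrt{\mu p}$, $\zeta'=2|k|\sqrt{\mu p'}$. Let $(F\,{}^*_*\,G)(k,p)=\int_0^p(F(\cdot,p-s)\hat*G(\cdot,s))(k)ds$ and $$\hat G^{[1]}_j=P_k[\hat u_{0,j}\hat*\hat H+\hat H_j\hat*\hat u_0+\hat H_j\,{}^*_*\hat H],\qquad \hat G^{[2]}_j=\hat u_{0,j}\hat*\hat S+\hat H_j\hat*\hat\Theta_0+\hat H_j\,{}^*_*\hat S.$$ The integral equations (IE) are $$\hat H(k,p)=\pi\int_0^p\frac{\mathcal G(z,z')}{z}\left(-ik_j\hat G^{[1]}_j(k,p')+aP_k[e_2\hat S(k,p')]\right)dp'+2\hat u_1(k)\frac{J_1(z)}{z},$$ $$\hat S(k,p)=\pi\int_0^p\frac{\mathcal G(\zeta,\zeta')}{\zeta}\left(-ik_j\hat G^{[2]}_j(k,p')\right)dp'+2\hat\Theta_1(k)\frac{J_1(\zeta)}{\zeta}.$$ For $\omega$ sufficiently large, (IE) has a unique solution $(\hat H,\hat S)$ with $e^{-\omega p}\|(\hat H,\hat S)(\cdot,p)\|_{\gamma,\beta}\in L^1(0,\infty)$, and the Boussinesq solution considered is $(u,\Theta)=\mathcal F^{-1}(\hat u,\hat\Theta)$ with $(\hat u,\hat\Theta)(k,t)=(\hat u_0,\hat\Theta_0)(k)+\int_0^\infty(\hat H,\hat S)(k,p)e^{-p/t}dp$, for $\Re\frac1t>\omega$; this is the range of $t$ in (i). In (ii), "finite number of Fourier modes" means that $\hat u_0,\hat\Theta_0,\hat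 f$ have bounded support: $K_1:=\max\big(\sup_{k\in\mathrm{supp}(\hat u_0,\hat\Theta_0)}|k|,\ \sup_{k\in\mathrm{supp}\hat f}|k|\big)<\infty$. "Independent of the size" means that the power series converges on a disc whose radius does not depend on the norms of $\hat u_0,\hat\Theta_0,\hat f$ when these vary with fixed $K_1$ (and fixed $\nu,\mu,a,\gamma,\beta,d$).
   Formalization: Analyticity in x is proved for Euclidean |Im x|<β (not all |Im x_j|<β, which fails, e.g. zero data with f̂=ik^⊥e^{-β|k|}(1+|k|)^{-γ-1}); the p-neighborhood is chosen per b<β, uniform for |Im x|<b; (ii) is for k≠0, where P_k and 1/z are defined. *)

theory Defs
  imports "HOL-Complex_Analysis.Complex_Analysis" "HOL-Library.Landau_Symbols"
begin

section \<open>Weighted norm and Fourier-side operations\<close>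

text \<open>
  The dimension \<open>d\<close> is \<open>CARD('n)\<close>.  Fourier transforms (\<open>u0\<close>, \<open>\<theta>0\<close>, \<open>f\<close>, \<open>H\<close>, \<open>S\<close> below always
  denote hatted quantities) are functions on \<open>real ^ 'n\<close>.  Pairs carry the
  Euclidean product norm.  The supremum is taken in \<^typ>\<open>ennreal\<close>, so finiteness of the norm is a
  genuine condition.
\<close>

definition wnorm :: "real \<Rightarrow> real \<Rightarrow> (real ^ 'n \<Rightarrow> 'b::real_normed_vector) \<Rightarrow> ennreal" where
  "wnorm \<gamma> \<beta> F = (SUP k. ennreal ((1 + norm k) powr \<gamma> * exp (\<beta> * norm k) * norm (F k)))"

definition cvec :: "real ^ 'n \<Rightarrow> complex ^ 'n" where
  "cvec x = (\<chi> j. of_real (x $ j))"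

definition fconv :: "(real ^ 'n \<Rightarrow> complex) \<Rightarrow> (real ^ 'n \<Rightarrow> complex) \<Rightarrow> real ^ 'n \<Rightarrow> complex" where
  "fconv v w k = (LINT k'|lborel. v k' * w (k - k'))"

definition fpconv ::
  "(real ^ 'n \<Rightarrow> real \<Rightarrow> complex) \<Rightarrow> (real ^ 'n \<Rightarrow> real \<Rightarrow> complex) \<Rightarrow> real ^ 'n \<Rightarrow> real \<Rightarrow> complex" where
  "fpconv F G k p = (LINT s:{0<..<p}|lborel. fconv (\<lambda>k'. F k' (p - s)) (\<lambda>k'. G k' s) k)"

text \<open>The symbol of the Hodge projection; only its values at \<open>k \<noteq> 0\<close> are meaningful.\<close>

definition hodge :: "real ^ 'n \<Rightarrow> complex ^ 'n \<Rightarrow> complex ^ 'n" where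
  "hodge k v = v - ((\<Sum>j\<in>UNIV. of_real (k $ j) * v $ j) / of_real ((norm k)\<^sup>2)) *s cvec k"

text \<open>
  With \<open>\<F>[fg] = \<F>[f] * \<F>[g]\<close> (no constant) the inverse transform has no prefactor.
\<close>

definition inv_fourier :: "(real ^ 'n \<Rightarrow> complex) \<Rightarrow> real ^ 'n \<Rightarrow> complex" where
  "inv_fourier g x = (LINT k|lborel. exp (\<i> * of_real (k \<bullet> x)) * g k)"

definition inv_fourier_vec :: "(real ^ 'n \<Rightarrow> complex ^ 'n) \<Rightarrow> real ^ 'n \<Rightarrow> complex ^ 'n" where
  "inv_fourier_vec g x = (\<chi> i. inv_fourier (\<lambda>k. g k $ i) x)"

definition divergence_free :: "(real ^ 'n \<Rightarrow> complex ^ 'n) \<Rightarrow> bool" where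
  "divergence_free v \<longleftrightarrow>
     (\<forall>x. \<exists>D. (v has_derivative D) (at x) \<and> (\<Sum>j\<in>UNIV. D (axis j 1) $ j) = 0)"


section \<open>Bessel functions of order one\<close>

definition bessel_J1 :: "real \<Rightarrow> real" where
  "bessel_J1 z = (\<Sum>m. (-1) ^ m / (fact m * fact (m + 1)) * (z / 2) ^ (2 * m + 1))"

text \<open>The standard expansion of \<open>Y\<^sub>1\<close> for \<open>z > 0\<close>.\<close>

definition bessel_Y1 :: "real \<Rightarrow> real" where
  "bessel_Y1 z = - 2 / (pi * z) + 2 / pi * ln (z / 2) * bessel_J1 z
     - 1 / pi * (\<Sum>m. (-1) ^ m * (Digamma (real m + 1) + Digamma (real m + 2))
                       / (fact m * fact (m + 1)) * (z / 2) ^ (2 * m + 1))"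

definition bessel_G :: "real \<Rightarrow> real \<Rightarrow> real" where
  "bessel_G z z' = z' * (- bessel_J1 z * bessel_Y1 z' + bessel_Y1 z * bessel_J1 z')"


section \<open>The integral equations\<close>

definition data_ok ::
  "real \<Rightarrow> real \<Rightarrow> (real ^ 'n \<Rightarrow> complex ^ 'n) \<Rightarrow> (real ^ 'n \<Rightarrow> complex) \<Rightarrow> (real ^ 'n \<Rightarrow> complex ^ 'n) \<Rightarrow> bool"
  where
  "data_ok \<gamma> \<beta> u0 \<theta>0 f \<longleftrightarrow>
     u0 \<in> borel_measurable borel \<and> \<theta>0 \<in> borel_measurable borel \<and> f \<in> borel_measurable borel \<and>
     wnorm \<gamma> \<beta> (\<lambda>k. (1 + norm k)\<^sup>2 *\<^sub>R (u0 k, \<theta>0 k)) < \<infinity> \<and>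
     wnorm \<gamma> \<beta> f < \<infinity> \<and>
     divergence_free (inv_fourier_vec u0) \<and> divergence_free (inv_fourier_vec f)"

definition u1_hat ::
  "real \<Rightarrow> real \<Rightarrow> real ^ 'n \<Rightarrow> (real ^ 'n \<Rightarrow> complex ^ 'n) \<Rightarrow> (real ^ 'n \<Rightarrow> complex)
    \<Rightarrow> (real ^ 'n \<Rightarrow> complex ^ 'n) \<Rightarrow> real ^ 'n \<Rightarrow> complex ^ 'n" where
  "u1_hat \<nu> a e2 u0 \<theta>0 f k =
     - (\<nu> * (norm k)\<^sup>2) *\<^sub>R u0 k
     - (\<Sum>j\<in>UNIV. (\<i> * of_real (k $ j)) *s
          hodge k (\<chi> i. fconv (\<lambda>k. u0 k $ j) (\<lambda>k. u0 k $ i) k))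
     + a *\<^sub>R hodge k (\<theta>0 k *s cvec e2) + f k"

definition \<theta>1_hat ::
  "real \<Rightarrow> (real ^ 'n \<Rightarrow> complex ^ 'n) \<Rightarrow> (real ^ 'n \<Rightarrow> complex) \<Rightarrow> real ^ 'n \<Rightarrow> complex" where
  "\<theta>1_hat \<mu> u0 \<theta>0 k =
     - (\<mu> * (norm k)\<^sup>2) *\<^sub>R \<theta>0 k
     - (\<Sum>j\<in>UNIV. \<i> * of_real (k $ j) * fconv (\<lambda>k. u0 k $ j) \<theta>0 k)"

definition G1_hat ::
  "(real ^ 'n \<Rightarrow> complex ^ 'n) \<Rightarrow> (real ^ 'n \<Rightarrow> real \<Rightarrow> complex ^ 'n)
    \<Rightarrow> 'n \<Rightarrow> real ^ 'n \<Rightarrow> real \<Rightarrow> complex ^ 'n" where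
  "G1_hat u0 H j k p = hodge k (\<chi> i.
       fconv (\<lambda>k. u0 k $ j) (\<lambda>k. H k p $ i) k
     + fconv (\<lambda>k. H k p $ j) (\<lambda>k. u0 k $ i) k
     + fpconv (\<lambda>k p. H k p $ j) (\<lambda>k p. H k p $ i) k p)"

definition G2_hat ::
  "(real ^ 'n \<Rightarrow> complex ^ 'n) \<Rightarrow> (real ^ 'n \<Rightarrow> complex) \<Rightarrow> (real ^ 'n \<Rightarrow> real \<Rightarrow> complex ^ 'n)
    \<Rightarrow> (real ^ 'n \<Rightarrow> real \<Rightarrow> complex) \<Rightarrow> 'n \<Rightarrow> real ^ 'n \<Rightarrow> real \<Rightarrow> complex" where
  "G2_hat u0 \<theta>0 H S j k p =
       fconv (\<lambda>k. u0 k $ j) (\<lambda>k. S k p) k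
     + fconv (\<lambda>k. H k p $ j) \<theta>0 k
     + fpconv (\<lambda>k p. H k p $ j) S k p"

text \<open>
  The equations are imposed for \<open>k \<noteq> 0\<close> and \<open>p > 0\<close>, exactly where \<open>P\<^sub>k\<close>, \<open>Y\<^sub>1\<close> and the quotients
  by \<open>z\<close>, \<open>\<zeta>\<close> are defined; the values of \<open>H\<close> and \<open>S\<close> at \<open>k = 0\<close> enter no integral.
\<close>

definition integral_eqs ::
  "real \<Rightarrow> real \<Rightarrow> real \<Rightarrow> real ^ 'n \<Rightarrow> (real ^ 'n \<Rightarrow> complex ^ 'n) \<Rightarrow> (real ^ 'n \<Rightarrow> complex)
    \<Rightarrow> (real ^ 'n \<Rightarrow> complex ^ 'n) \<Rightarrow> (real ^ 'n \<Rightarrow> real \<Rightarrow> complex ^ 'n)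
    \<Rightarrow> (real ^ 'n \<Rightarrow> real \<Rightarrow> complex) \<Rightarrow> bool" where
  "integral_eqs \<nu> \<mu> a e2 u0 \<theta>0 f H S \<longleftrightarrow> (\<forall>k p. k \<noteq> 0 \<longrightarrow> p > 0 \<longrightarrow>
     (let z = (\<lambda>p. 2 * norm k * sqrt (\<nu> * p)); \<zeta> = (\<lambda>p. 2 * norm k * sqrt (\<mu> * p)) in
       H k p = pi *\<^sub>R (LINT p':{0<..<p}|lborel. (bessel_G (z p) (z p') / z p) *\<^sub>R
                  (- (\<Sum>j\<in>UNIV. (\<i> * of_real (k $ j)) *s G1_hat u0 H j k p')
                   + a *\<^sub>R hodge k (S k p' *s cvec e2)))
               + (2 * bessel_J1 (z p) / z p) *\<^sub>R u1_hat \<nu> a e2 u0 \<theta>0 f k \<and>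
       S k p = pi *\<^sub>R (LINT p':{0<..<p}|lborel. (bessel_G (\<zeta> p) (\<zeta> p') / \<zeta> p) *\<^sub>R
                  (- (\<Sum>j\<in>UNIV. \<i> * of_real (k $ j) * G2_hat u0 \<theta>0 H S j k p')))
               + (2 * bessel_J1 (\<zeta> p) / \<zeta> p) *\<^sub>R \<theta>1_hat \<mu> u0 \<theta>0 k))"

text \<open>
  The class \<open>exp (- \<omega> p) \<parallel>(H,S)(\<cdot>,p)\<parallel> \<in> L\<^sup>1(0,\<infinity>)\<close>.  Joint measurability makes the convolution integrals
  meaningful.  The norm is an uncountable supremum of Borel functions of \<open>p\<close>, hence the Lebesgue
  (not Borel) measurability in the second conjunct.
\<close>

definition in_laplace_class ::
  "real \<Rightarrow> real \<Rightarrow> real \<Rightarrow> (real ^ 'n \<Rightarrow> real \<Rightarrow> complex ^ 'n) \<Rightarrow> (real ^ 'n \<Rightarrow> real \<Rightarrow> complex) \<Rightarrow> bool"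
  where
  "in_laplace_class \<gamma> \<beta> \<omega> H S \<longleftrightarrow>
     (\<lambda>(k, p). (H k p, S k p)) \<in> borel_measurable (restrict_space borel (UNIV \<times> {0<..})) \<and>
     (\<lambda>p. wnorm \<gamma> \<beta> (\<lambda>k. (H k p, S k p))) \<in> borel_measurable (lebesgue_on {0<..}) \<and>
     (\<integral>\<^sup>+p. ennreal (exp (- \<omega> * p)) * wnorm \<gamma> \<beta> (\<lambda>k. (H k p, S k p)) \<partial>lebesgue_on {0<..}) < \<infinity>"

definition IE_solution ::
  "real \<Rightarrow> real \<Rightarrow> real \<Rightarrow> real ^ 'n \<Rightarrow> real \<Rightarrow> real \<Rightarrow> (real ^ 'n \<Rightarrow> complex ^ 'n) \<Rightarrow> (real ^ 'n \<Rightarrow> complex)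
    \<Rightarrow> (real ^ 'n \<Rightarrow> complex ^ 'n) \<Rightarrow> real \<Rightarrow> (real ^ 'n \<Rightarrow> real \<Rightarrow> complex ^ 'n)
    \<Rightarrow> (real ^ 'n \<Rightarrow> real \<Rightarrow> complex) \<Rightarrow> bool" where
  "IE_solution \<nu> \<mu> a e2 \<gamma> \<beta> u0 \<theta>0 f \<omega> H S \<longleftrightarrow>
     in_laplace_class \<gamma> \<beta> \<omega> H S \<and> integral_eqs \<nu> \<mu> a e2 u0 \<theta>0 f H S"


section \<open>The Boussinesq solution\<close>

definition initial_state ::
  "(real ^ 'n \<Rightarrow> complex ^ 'n) \<Rightarrow> (real ^ 'n \<Rightarrow> complex) \<Rightarrow> real ^ 'n \<Rightarrow> (complex ^ 'n) \<times> complex" where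
  "initial_state u0 \<theta>0 x = (inv_fourier_vec u0 x, inv_fourier \<theta>0 x)"

definition boussinesq_solution ::
  "(real ^ 'n \<Rightarrow> complex ^ 'n) \<Rightarrow> (real ^ 'n \<Rightarrow> complex) \<Rightarrow> (real ^ 'n \<Rightarrow> real \<Rightarrow> complex ^ 'n)
    \<Rightarrow> (real ^ 'n \<Rightarrow> real \<Rightarrow> complex) \<Rightarrow> real ^ 'n \<Rightarrow> complex \<Rightarrow> (complex ^ 'n) \<times> complex" where
  "boussinesq_solution u0 \<theta>0 H S x t =
     (inv_fourier_vec (\<lambda>k. u0 k + (LINT p:{0<..}|lborel. exp (- of_real p / t) *s H k p)) x,
      inv_fourier (\<lambda>k. \<theta>0 k + (LINT p:{0<..}|lborel. exp (- of_real p / t) * S k p)) x)"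


section \<open>Analyticity, asymptotics, Fourier support\<close>

text \<open>Holomorphy of a function of \<open>d\<close> complex variables, for open \<open>X\<close>: complex differentiability.\<close>

definition holomorphic_vec :: "(complex ^ 'n \<Rightarrow> complex) \<Rightarrow> (complex ^ 'n) set \<Rightarrow> bool" where
  "holomorphic_vec F X \<longleftrightarrow>
     (\<forall>x\<in>X. \<exists>D. (F has_derivative D) (at x) \<and> (\<forall>c v. D (c *s v) = c * D v))"

text \<open>
  The tube \<open>|Im x| < b\<close> with the Euclidean norm of \<open>Im x\<close>.  It contains, for each \<open>j\<close>, the strip
  \<open>|Im x\<^sub>j| < b\<close> with the other coordinates real.  The larger set \<open>{x. \<forall>j. |Im x\<^sub>j| < b}\<close>
  would be wrong: the weight \<open>exp (\<beta>|k|)\<close> controls \<open>exp (i k\<cdot>x)\<close> for \<open>|Im x| < \<beta>\<close> only.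
\<close>

definition tube :: "real \<Rightarrow> (complex ^ 'n) set" where
  "tube b = {x. norm (\<chi> j. Im (x $ j)) < b}"

text \<open>
  \<open>U x t \<sim> U0 x + (\<Sum>m\<ge>1. c m x t\<^sup>m)\<close> as \<open>t \<rightarrow> 0+\<close> in the sense of Poincare, with
  \<open>|c m x| \<le> m! A0 D0\<^sup>m\<close>.
\<close>

definition gevrey_expansion ::
  "(real ^ 'n \<Rightarrow> 'b::real_normed_vector) \<Rightarrow> (real ^ 'n \<Rightarrow> complex \<Rightarrow> 'b) \<Rightarrow> real \<Rightarrow> real \<Rightarrow> bool" where
  "gevrey_expansion U0 U A0 D0 \<longleftrightarrow> (\<exists>c :: nat \<Rightarrow> real ^ 'n \<Rightarrow> 'b.
     (\<forall>x N. (\<lambda>t. norm (U x (of_real t) - U0 x - (\<Sum>m=1..N. t ^ m *\<^sub>R c m x)))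
              \<in> o[at_right 0](\<lambda>t::real. t ^ N)) \<and>
     (\<forall>m\<ge>1. \<forall>x. norm (c m x) \<le> fact m * A0 * D0 ^ m))"

definition mode_radius ::
  "(real ^ 'n \<Rightarrow> complex ^ 'n) \<Rightarrow> (real ^ 'n \<Rightarrow> complex) \<Rightarrow> (real ^ 'n \<Rightarrow> complex ^ 'n) \<Rightarrow> ennreal" where
  "mode_radius u0 \<theta>0 f =
     max (SUP k\<in>closure {k. (u0 k, \<theta>0 k) \<noteq> 0}. ennreal (norm k))
         (SUP k\<in>closure {k. f k \<noteq> 0}. ennreal (norm k))"

end

theory Submission
  imports Defs "HOL-Probability.Distributions" "HOL-Real_Asymp.Real_Asymp"
begin
text \<open>
  With \<open>\<kappa> = \<nu> |k|\<^sup>2\<close> or \<open>\<mu> |k|\<^sup>2\<close>, the Bessel kernel inverts \<open>y \<mapsto> (p y)'' + \<kappa> y\<close>.  Hence each component \<open>y\<close> of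
  a solution of the integral equations satisfies \<open>y'(p) = \<integral>\<^sub>0\<^sup>1 \<sigma> (R - \<kappa> y)(\<sigma> p) d\<sigma>\<close>, where \<open>R\<close> collects the
  convolution terms.  This is regular at \<open>p = 0\<close> and can be differentiated any number of times, each derivative
  producing one more factor \<open>\<sigma>\<close>.  In the space of functions of \<open>k\<close> that are bounded and integrable with weight
  \<open>e\<^bsup>b|k|\<^esup>\<close>, the factors \<open>|k|\<close> and \<open>|k|\<^sup>2\<close> cost a decrease of \<open>b\<close>, and a Cauchy-Kovalevskaya induction gives
  \<open>n! B / \<rho>\<^sup>n\<close> for the \<open>n\<close>-th derivative, locally uniformly in \<open>p \<ge> 0\<close>.  So the inverse Fourier transforms continue
  analytically to a neighbourhood of the half line, and Watson's lemma gives the asymptotic series.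

  For data supported in \<open>|k| \<le> K\<close>, the \<open>n\<close>-th derivative at \<open>p = 0\<close> is supported in \<open>|k| \<le> (n + 2) K\<close>.  Then
  \<open>\<kappa>\<close> costs at most a multiple of \<open>(n + 2)\<^sup>2 K\<^sup>2\<close>, of which the average over \<open>\<sigma>\<close> gains back \<open>n + 2\<close>; this linear
  term alone determines the radius, as the terms that see the size of the data are of lower order in \<open>n\<close>.
\<close>

section \<open>The Bessel kernel\<close>

text \<open>The kernel carries the logarithm of Y1, so smoothness of the solution at p = 0 is not
  visible in the integral equation. Multiplying (p y)'' + \<kappa> y = R by p gives (p^2 y')' = p (R
  - \<kappa> y); integration and the scaling s = \<sigma> p yield the averaged formula, where the
  singular point is gone. The kernel is kept for a priori bounds. The solution class bounds the norm
  for almost every p only, integrably near 0 but perhaps unboundedly. An energy estimate shows |K|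
  \<le> 1, so the equation itself bounds y at every p, at the price of a factor 1 + |k| that a
  smaller b absorbs. The second estimate |K| \<le> (\<kappa> p)^(-1/2) pays for that factor at p
  \<ge> 1 without loss of b. Hence exponential growth is controlled on the whole tube, whereas
  analyticity in p is proved on each smaller tube, in a neighbourhood that depends on b. Boundedness
  and integrability are used jointly because convolution preserves the pair with the product of the
  constants, and integrability is what Fourier inversion needs.\<close>

definition bes_a :: "nat \<Rightarrow> real" where
  "bes_a n = (case n of 0 \<Rightarrow> 0 | Suc m \<Rightarrow> (-1) ^ m / (fact m * fact (m + 1)))"

definition bes_b :: "nat \<Rightarrow> real" where
  "bes_b n = (case n of 0 \<Rightarrow> 0
     | Suc m \<Rightarrow> (-1) ^ m * (Digamma (real m + 1) + Digamma (real m + 2)) / (fact m * fact (m + 1)))"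

text \<open>In terms of the Bessel functions, \<open>bes_w1 x\<close> is sqrt x * J1(2 sqrt x) and
  \<open>bes_w2 x\<close> below is sqrt x * Y1(2 sqrt x); \<open>bes_j\<close> is the entire
  function \<open>bes_w1 x / x\<close>, and \<open>bes_e\<close> is the power series part of Y1. The
  substitution turns Bessel's equation of order one into w'' = - w / x.\<close>

definition bes_w1 :: "real \<Rightarrow> real" where "bes_w1 x = (\<Sum>n. bes_a n * x ^ n)"
definition bes_j :: "real \<Rightarrow> real" where "bes_j x = (\<Sum>n. bes_a (Suc n) * x ^ n)"
definition bes_e :: "real \<Rightarrow> real" where "bes_e x = (\<Sum>n. bes_b n * x ^ n)"
definition bes_w2 :: "real \<Rightarrow> real" where
  "bes_w2 x = (- 1 + ln x * bes_w1 x - bes_e x) / pi"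

text \<open>A crude bound from the recurrence psi(x + 1) = psi(x) + 1 / x; linear growth is harmless
  against the factorials in \<open>bes_b\<close>.\<close>

lemma Digamma_nat_bound: "\<bar>Digamma (real m + 1)\<bar> \<le> \<bar>Digamma 1\<bar> + real m"
proof (induction m)
  case (Suc m)
  have "Digamma (real (Suc m) + 1) = Digamma (real m + 1) + 1 / (real m + 1)"
    using Digamma_plus1[of "real m + 1"] by (simp add: add_ac)
  moreover have "0 \<le> 1 / (real m + 1)" "1 / (real m + 1) \<le> 1" by simp_all
  ultimately show ?case using Suc unfolding of_nat_Suc by linarith
qed simp

text \<open>Comparison with the exponential series. The index is shifted because
  \<open>bes_a\<close> and \<open>bes_b\<close> vanish at 0 and carry the factorials of the
  predecessor.\<close>

lemma summable_fact_bound: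
  fixes c :: "nat \<Rightarrow> real"
  assumes "\<And>n. \<bar>c (Suc n)\<bar> \<le> C / fact n"
  shows "summable (\<lambda>n. c n * x ^ n)"
proof -
  have "summable (\<lambda>n. C * \<bar>x\<bar> * (inverse (fact n) * \<bar>x\<bar> ^ n))"
    by (intro summable_mult summable_exp)
  then have "summable (\<lambda>n. c (Suc n) * x ^ Suc n)"
  proof (rule summable_comparison_test'[where N = 0])
    fix n
    have "norm (c (Suc n) * x ^ Suc n) = \<bar>c (Suc n)\<bar> * (\<bar>x\<bar> * \<bar>x\<bar> ^ n)"
      by (simp add: abs_mult power_abs)
    also have "\<dots> \<le> C / fact n * (\<bar>x\<bar> * \<bar>x\<bar> ^ n)"
      by (intro mult_right_mono assms) auto
    finally show "norm (c (Suc n) * x ^ Suc n) \<le> C * \<bar>x\<bar> * (inverse (fact n) * \<bar>x\<bar> ^ n)"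
      by (simp add: field_simps)
  qed
  then show ?thesis using summable_Suc_iff[of "\<lambda>n. c n * x ^ n"] by blast
qed

lemma summable_bes_a: "summable (\<lambda>n. bes_a n * x ^ n)"
proof (rule summable_fact_bound[where C = 1])
  fix n
  have "fact n * 1 \<le> (fact n * fact (n + 1) :: real)"
    by (intro mult_left_mono fact_ge_1) simp
  then show "\<bar>bes_a (Suc n)\<bar> \<le> 1 / fact n"
    by (simp add: bes_a_def abs_mult frac_le)
qed

lemma summable_bes_b: "summable (\<lambda>n. bes_b n * x ^ n)"
proof (rule summable_fact_bound[where C = "2 * \<bar>Digamma 1\<bar> + 2"])
  fix n
  have 1: "\<bar>Digamma (real n + 1)\<bar> \<le> \<bar>Digamma 1\<bar> + real n"
    by (rule Digamma_nat_bound)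
  have 2: "\<bar>Digamma (real n + 2)\<bar> \<le> \<bar>Digamma 1\<bar> + real n + 1"
    using Digamma_nat_bound[of "Suc n"] by (simp add: add_ac)
  have "\<bar>Digamma (real n + 1) + Digamma (real n + 2)\<bar> \<le> 2 * \<bar>Digamma 1\<bar> + 2 * real n + 1"
    using 1 2 by linarith
  also have "\<dots> \<le> (2 * \<bar>Digamma 1\<bar> + 2) * (real n + 1)"
    by (simp add: algebra_simps)
  also have "\<dots> \<le> (2 * \<bar>Digamma 1\<bar> + 2) * fact (n + 1)"
  proof (intro mult_left_mono)
    have "real (n + 1) \<le> real (fact (n + 1))"
      unfolding of_nat_le_iff by (rule fact_ge_self)
    then show "real n + 1 \<le> fact (n + 1)" by (simp only: of_nat_fact of_nat_add of_nat_1)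
  qed auto
  finally have "\<bar>Digamma (real n + 1) + Digamma (real n + 2)\<bar> / (fact n * fact (n + 1))
      \<le> (2 * \<bar>Digamma 1\<bar> + 2) * fact (n + 1) / (fact n * fact (n + 1))"
    by (intro divide_right_mono) auto
  also have "\<dots> = (2 * \<bar>Digamma 1\<bar> + 2) / fact n"
    by (simp only: nonzero_mult_divide_mult_cancel_right[OF fact_nonzero])
  finally show "\<bar>bes_b (Suc n)\<bar> \<le> (2 * \<bar>Digamma 1\<bar> + 2) / fact n"
    by (simp add: bes_b_def abs_mult)
qed

lemma summable_bes_a_Suc: "summable (\<lambda>n. bes_a (Suc n) * x ^ n)"
proof (cases "x = 0")
  case False
  have "summable (\<lambda>n. (bes_a (Suc n) * x ^ Suc n) / x)"
    using summable_bes_a[of x] summable_Suc_iff[of "\<lambda>n. bes_a n * x ^ n"]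
    by (intro summable_divide) blast
  then show ?thesis using False by simp
qed (auto intro: summable_finite[of "{0}"])

lemma bes_w1_eq: "bes_w1 x = x * bes_j x"
proof -
  have "bes_w1 x = (\<Sum>n. bes_a (Suc n) * x ^ Suc n)"
    unfolding bes_w1_def using suminf_split_head[OF summable_bes_a[of x]]
    by (simp add: bes_a_def)
  also have "\<dots> = x * bes_j x"
    unfolding bes_j_def by (subst suminf_mult[symmetric, OF summable_bes_a_Suc]) (simp add: mult_ac)
  finally show ?thesis .
qed

section \<open>Derivatives of the series, the differential equation and the Wronskian\<close>

definition bes_w1' :: "real \<Rightarrow> real" where "bes_w1' x = (\<Sum>n. diffs bes_a n * x ^ n)"
definition bes_e' :: "real \<Rightarrow> real" where "bes_e' x = (\<Sum>n. diffs bes_b n * x ^ n)"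
definition bes_w1'' :: "real \<Rightarrow> real" where "bes_w1'' x = (\<Sum>n. diffs (diffs bes_a) n * x ^ n)"
definition bes_e'' :: "real \<Rightarrow> real" where "bes_e'' x = (\<Sum>n. diffs (diffs bes_b) n * x ^ n)"

lemma summable_diffs:
  fixes c :: "nat \<Rightarrow> real"
  assumes "\<And>x. summable (\<lambda>n. c n * x ^ n)"
  shows "summable (\<lambda>n. diffs c n * x ^ n)"
  using assms by (intro termdiff_converges_all)

lemma bes_w1'_0: "bes_w1' 0 = 1"
  by (simp add: bes_w1'_def diffs_def) (simp add: bes_a_def)

lemma deriv_w1: "(bes_w1 has_field_derivative bes_w1' x) (at x)"
  unfolding bes_w1_def[abs_def] bes_w1'_def
  by (intro termdiffs_strong_converges_everywhere summable_bes_a)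
lemma deriv_w1': "(bes_w1' has_field_derivative bes_w1'' x) (at x)"
  unfolding bes_w1'_def[abs_def] bes_w1''_def
  by (intro termdiffs_strong_converges_everywhere summable_diffs summable_bes_a)
lemma deriv_e: "(bes_e has_field_derivative bes_e' x) (at x)"
  unfolding bes_e_def[abs_def] bes_e'_def
  by (intro termdiffs_strong_converges_everywhere summable_bes_b)
lemma deriv_e': "(bes_e' has_field_derivative bes_e'' x) (at x)"
  unfolding bes_e'_def[abs_def] bes_e''_def
  by (intro termdiffs_strong_converges_everywhere summable_diffs summable_bes_b)
lemma isCont_j: "isCont bes_j x"
  unfolding bes_j_def[abs_def]
  by (rule DERIV_isCont[OF termdiffs_strong_converges_everywhere[OF summable_bes_a_Suc]])

text \<open>These are the coefficients of x w'' for w with coefficients \<open>c\<close>, shifted so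
  that the powers match those of w itself; the extra term at n = 0 vanishes because of the factor
  n.\<close>

lemma power_series_ode_sum:
  fixes c :: "nat \<Rightarrow> real"
  assumes "\<And>x. summable (\<lambda>n. c n * x ^ n)"
  shows "(\<lambda>n. (of_nat n * of_nat (Suc n) * c (Suc n)) * x ^ n) sums
           (x * (\<Sum>n. diffs (diffs c) n * x ^ n))"
proof -
  have "(\<lambda>n. x * (diffs (diffs c) n * x ^ n)) sums (x * (\<Sum>n. diffs (diffs c) n * x ^ n))"
    by (intro sums_mult summable_sums summable_diffs assms)
  moreover have "x * (diffs (diffs c) n * x ^ n) =
      (of_nat (Suc n) * of_nat (Suc (Suc n)) * c (Suc (Suc n))) * x ^ Suc n" for n
    by (simp add: diffs_def)
  ultimately show ?thesis
    using sums_Suc_iff[of "\<lambda>n. (of_nat n * of_nat (Suc n) * c (Suc n)) * x ^ n"] by simp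
qed

lemma w1_ode: "x * bes_w1'' x = - bes_w1 x"
proof -
  have "(\<lambda>n. (of_nat n * of_nat (Suc n) * bes_a (Suc n)) * x ^ n) sums (x * bes_w1'' x)"
    unfolding bes_w1''_def by (intro power_series_ode_sum summable_bes_a)
  moreover have "(of_nat n * of_nat (Suc n) * bes_a (Suc n)) = - bes_a n" for n
  proof (cases n)
    case (Suc m)
    have f: "fact (m + 2) = (real m + 2) * (real m + 1) * fact m" "fact (m + 1) = (real m + 1) * fact m"
      by (simp_all add: algebra_simps)
    define F where "F = (fact m :: real)"
    have F: "F \<noteq> 0" by (simp add: F_def)
    have nz: "real m + 1 \<noteq> 0" "real m + 2 \<noteq> 0" by linarith+
    have "(real m + 1) * (real m + 2) * ((-1) ^ Suc m / (fact (m + 1) * fact (m + 2))) = - ((-1) ^ m / (fact m * fact (m + 1)))"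
      unfolding f power_Suc F_def[symmetric] using F nz by (simp add: divide_simps)
    then show ?thesis by (simp add: Suc bes_a_def add_ac)
  qed (simp add: bes_a_def)
  ultimately have "(\<lambda>n. - (bes_a n * x ^ n)) sums (x * bes_w1'' x)" by simp
  moreover have "(\<lambda>n. - (bes_a n * x ^ n)) sums (- bes_w1 x)"
    unfolding bes_w1_def by (intro sums_minus summable_sums summable_bes_a)
  ultimately show ?thesis by (rule sums_unique2)
qed

text \<open>The right-hand side is x w'' + w for w = ln x * \<open>bes_w1 x\<close> - 1: the
  logarithms cancel by \<open>w1_ode\<close> and leave 2 w1' - w1 / x - 1. This is what makes
  \<open>bes_w2\<close> a second solution. On coefficients it amounts to the recurrence of
  Digamma.\<close>

lemma e_ode: "x * bes_e'' x + bes_e x = 2 * bes_w1' x - 1 - bes_j x"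
proof -
  have 1: "(\<lambda>n. (of_nat n * of_nat (Suc n) * bes_b (Suc n)) * x ^ n + bes_b n * x ^ n)
      sums (x * bes_e'' x + bes_e x)"
    unfolding bes_e''_def bes_e_def
    by (intro sums_add power_series_ode_sum summable_bes_b summable_sums)
  have 2: "(\<lambda>n. 2 * (diffs bes_a n * x ^ n) - (if n = 0 then 1 else 0) - bes_a (Suc n) * x ^ n)
      sums (2 * bes_w1' x - 1 - bes_j x)"
    unfolding bes_w1'_def bes_j_def using sums_single[of 0 "\<lambda>_. 1::real"]
    by (intro sums_diff sums_mult summable_sums summable_bes_a_Suc summable_diffs summable_bes_a) simp
  have "of_nat n * of_nat (Suc n) * bes_b (Suc n) * x ^ n + bes_b n * x ^ n
      = 2 * (diffs bes_a n * x ^ n) - (if n = 0 then 1 else 0) - bes_a (Suc n) * x ^ n" for n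
  proof (cases n)
    case (Suc m)
    have D: "Digamma (real m + 3) = Digamma (real m + 1) + 1 / (real m + 1) + 1 / (real m + 2)"
      using Digamma_plus1[of "real m + 1"] Digamma_plus1[of "real m + 2"] by (simp add: add_ac)
    have f: "fact (m + 2) = (real m + 2) * (real m + 1) * fact m" "fact (m + 1) = (real m + 1) * fact m"
      by (simp_all add: algebra_simps)
    have "(real m + 1) * (real m + 2) *
        ((-1) ^ Suc m * (Digamma (real m + 2) + Digamma (real m + 3)) / (fact (m + 1) * fact (m + 2)))
       + (-1) ^ m * (Digamma (real m + 1) + Digamma (real m + 2)) / (fact m * fact (m + 1))
      = (2 * (real m + 2) - 1) * ((-1) ^ Suc m / (fact (m + 1) * fact (m + 2)))"
    proof -
      define P where "P = (-1::real) ^ m"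
      define F where "F = (fact m :: real)"
      have F: "F \<noteq> 0" by (simp add: F_def)
      have nz: "real m + 1 \<noteq> 0" "real m + 2 \<noteq> 0" by linarith+
      show ?thesis
        unfolding D f power_Suc P_def[symmetric] F_def[symmetric] using F nz
        by (simp add: divide_simps) (simp add: algebra_simps)
    qed
    moreover have "bes_b (Suc n) = (-1) ^ Suc m * (Digamma (real m + 2) + Digamma (real m + 3)) / (fact (m + 1) * fact (m + 2))"
      "bes_b n = (-1) ^ m * (Digamma (real m + 1) + Digamma (real m + 2)) / (fact m * fact (m + 1))"
      "bes_a (Suc n) = (-1) ^ Suc m / (fact (m + 1) * fact (m + 2))"
      unfolding Suc bes_a_def bes_b_def by (simp_all add: add_ac)
    moreover have "real n * real (Suc n) = (real m + 1) * (real m + 2)" "real (Suc n) = real m + 2"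
      by (simp_all add: Suc add_ac)
    ultimately have "of_nat n * of_nat (Suc n) * bes_b (Suc n) + bes_b n
        = 2 * diffs bes_a n - bes_a (Suc n)"
      unfolding diffs_def by (simp only: left_diff_distrib mult_1 mult.assoc)
    then have E: "of_nat n * of_nat (Suc n) * bes_b (Suc n) + bes_b n = 2 * diffs bes_a n - bes_a (Suc n)" .
    have "n \<noteq> 0" using Suc by simp
    then show ?thesis
      by (simp only: if_False diff_zero distrib_right[symmetric] E left_diff_distrib[symmetric] mult.assoc[symmetric])
  qed (simp add: bes_b_def bes_a_def diffs_def)
  with 1 2 show ?thesis by (simp add: sums_unique2)
qed

definition bes_w2' :: "real \<Rightarrow> real" where
  "bes_w2' x = (bes_j x + ln x * bes_w1' x - bes_e' x) / pi"

lemma deriv_w2: "x > 0 \<Longrightarrow> (bes_w2 has_field_derivative bes_w2' x) (at x)"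
  unfolding bes_w2_def[abs_def] bes_w2'_def
  by (rule derivative_eq_intros deriv_w1 deriv_e refl | simp add: bes_w1_eq)+

lemma deriv_w2': 
  assumes "x > 0"
  shows "(bes_w2' has_field_derivative - bes_w2 x / x) (at x)"
proof -
  have "x * (bes_w1'' x + bes_j x) = 0"
    using w1_ode[of x] bes_w1_eq[of x] by (simp add: algebra_simps)
  then have w: "bes_w1'' x = - bes_j x"
    using assms by (simp add: add_eq_0_iff2)
  have e: "bes_e'' x = (2 * bes_w1' x - 1 - bes_j x - bes_e x) / x"
    using e_ode[of x] assms by (simp add: field_simps)
  have "((\<lambda>x. (bes_w1 x / x + ln x * bes_w1' x - bes_e' x) / pi) has_field_derivative
      ((bes_w1' x * x - bes_w1 x) / x\<^sup>2 + (bes_w1' x / x + ln x * bes_w1'' x) - bes_e'' x) / pi) (at x)"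
    by (rule derivative_eq_intros deriv_w1 deriv_w1' deriv_e' refl
        | (use assms in \<open>simp add: power2_eq_square field_simps; fail\<close>))+
  moreover have "((bes_w1' x * x - bes_w1 x) / x\<^sup>2 + (bes_w1' x / x + ln x * bes_w1'' x) - bes_e'' x) / pi
     = - bes_w2 x / x"
    unfolding w e bes_w2_def bes_w1_eq using assms
    by (simp add: field_simps power2_eq_square)
  moreover have "\<forall>\<^sub>F y in nhds x. bes_w2' y = (bes_w1 y / y + ln y * bes_w1' y - bes_e' y) / pi"
    by (rule eventually_mono[OF eventually_nhds_in_open[of "{0<..}" x]])
       (use assms in \<open>auto simp: bes_w2'_def bes_w1_eq\<close>)
  ultimately show ?thesis
    by (simp add: DERIV_cong_ev[OF refl _ refl])
qed

text \<open>The equation w'' = - w / x has no first-order term, so the Wronskian is constant. Its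
  value is read off at 0, where the second solution is logarithmic; the logarithms cancel, and pi
  times the Wronskian becomes \<open>P\<close>, which is continuous at 0.\<close>

lemma wronskian:
  assumes "x > 0"
  shows "bes_w1 x * bes_w2' x - bes_w1' x * bes_w2 x = 1 / pi"
proof -
  define P where "P x = x * (bes_j x)\<^sup>2 - bes_w1 x * bes_e' x + bes_w1' x + bes_w1' x * bes_e x" for x
  have W: "bes_w1 y * bes_w2' y - bes_w1' y * bes_w2 y = P y / pi" for y
    unfolding P_def bes_w2_def bes_w2'_def bes_w1_eq
    by (simp add: field_simps power2_eq_square)
  have "P x = P 0"
  proof (rule DERIV_isconst_end[OF assms])
    show "continuous_on {0..x} P"
      unfolding P_def
      by (intro continuous_intros continuous_at_imp_continuous_on ballI isCont_j
          DERIV_isCont[OF deriv_w1] DERIV_isCont[OF deriv_w1'] DERIV_isCont[OF deriv_e] DERIV_isCont[OF deriv_e'])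
    fix y assume y: "0 < y" "y < x"
    have w1: "bes_w1'' y = - bes_w1 y / y" using w1_ode[of y] y by (simp add: field_simps)
    have "((\<lambda>y. pi * (bes_w1 y * bes_w2' y - bes_w1' y * bes_w2 y)) has_field_derivative 0) (at y)"
      by (rule derivative_eq_intros deriv_w1 deriv_w1' deriv_w2[OF y(1)] deriv_w2'[OF y(1)] refl)+
         (simp add: w1 field_simps)
    then show "(P has_field_derivative 0) (at y)" by (simp add: W)
  qed
  also have "P 0 = 1"
    by (simp add: P_def bes_w1_eq bes_w1'_0) (simp add: bes_e_def bes_b_def)
  finally show ?thesis using W by simp
qed

section \<open>The Cauchy function of the equation and its energy bounds\<close>

definition bes_D :: "real \<Rightarrow> real \<Rightarrow> real" where
  "bes_D x y = pi * (bes_w2 x * bes_w1 y - bes_w1 x * bes_w2 y)"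
definition bes_D' :: "real \<Rightarrow> real \<Rightarrow> real" where
  "bes_D' x y = pi * (bes_w2' x * bes_w1 y - bes_w1' x * bes_w2 y)"

lemma deriv_D: "x > 0 \<Longrightarrow> ((\<lambda>x. bes_D x y) has_field_derivative bes_D' x y) (at x)"
  unfolding bes_D_def bes_D'_def
  by (rule derivative_eq_intros deriv_w1 deriv_w2 refl | simp)+

lemma deriv_D': 
  assumes "x > 0"
  shows "((\<lambda>x. bes_D' x y) has_field_derivative - bes_D x y / x) (at x)"
proof -
  have w1: "bes_w1'' x = - bes_w1 x / x" using w1_ode[of x] assms by (simp add: field_simps)
  show ?thesis
    unfolding bes_D_def bes_D'_def
    by (rule derivative_eq_intros deriv_w1' deriv_w2' refl assms)+
       (use assms in \<open>simp add: w1 field_simps\<close>)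
qed

lemma D_diag: "bes_D y y = 0" by (simp add: bes_D_def)
text \<open>Together with \<open>D_diag\<close> this says that \<open>bes_D\<close>, as a function
  of its first argument, is the solution with value 0 and slope 1 at y; the factor pi in its
  definition normalizes the Wronskian.\<close>

lemma D'_diag: "y > 0 \<Longrightarrow> bes_D' y y = 1"
  using wronskian[of y] by (simp add: bes_D'_def field_simps)

text \<open>The energy \<open>w'\<^sup>2 + w\<^sup>2 / x\<close> of a solution of \<open>w'' = - w / x\<close> decreases.\<close>

lemma energy_decreasing:
  fixes v v' :: "real \<Rightarrow> real"
  assumes "0 < x" and d: "(v has_field_derivative v' x) (at x)"
    and d': "(v' has_field_derivative - v x / x) (at x)"
  shows "\<exists>e. ((\<lambda>x. (v' x)\<^sup>2 + (v x)\<^sup>2 / x) has_field_derivative e) (at x) \<and> e \<le> 0"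
proof (intro exI conjI)
  show "((\<lambda>x. (v' x)\<^sup>2 + (v x)\<^sup>2 / x) has_field_derivative - (v x)\<^sup>2 / x\<^sup>2) (at x)"
    by (rule derivative_eq_intros d d' refl | (use assms in \<open>simp add: field_simps power2_eq_square; fail\<close>))+
qed simp

text \<open>The energy equals 1 on the diagonal, by the initial values there, and decreases to the
  right.\<close>

lemma D_energy:
  assumes "0 < y" "y \<le> x"
  shows "(bes_D' x y)\<^sup>2 + (bes_D x y)\<^sup>2 / x \<le> 1"
proof -
  have "(bes_D' x y)\<^sup>2 + (bes_D x y)\<^sup>2 / x \<le> (bes_D' y y)\<^sup>2 + (bes_D y y)\<^sup>2 / y"
    using assms by (intro DERIV_nonpos_imp_nonincreasing[of y x] energy_decreasing deriv_D deriv_D') auto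
  then show ?thesis using assms by (simp add: D_diag D'_diag)
qed

lemma abs_D_le_sqrt:
  assumes "0 < y" "y \<le> x"
  shows "\<bar>bes_D x y\<bar> \<le> sqrt x"
proof -
  have "(bes_D x y)\<^sup>2 / x \<le> 1"
    using D_energy[OF assms] zero_le_power2[of "bes_D' x y"] by linarith
  then have "(bes_D x y)\<^sup>2 \<le> x" using assms by (simp add: field_simps)
  then show ?thesis by (metis real_sqrt_abs real_sqrt_le_iff)
qed

text \<open>The energy bounds the slope by 1 and the function vanishes on the diagonal, so the mean
  value inequality gives x - y. This beats sqrt x for small x and is the source of |K| \<le>
  1.\<close>

lemma abs_D_le:
  assumes "0 < y" "y \<le> x"
  shows "\<bar>bes_D x y\<bar> \<le> x"
proof -
  have "norm (bes_D x y - bes_D y y) \<le> 1 * norm (x - y)"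
  proof (rule field_differentiable_bound[of "{y..x}"])
    fix z assume z: "z \<in> {y..x}"
    then show "((\<lambda>x. bes_D x y) has_field_derivative bes_D' z y) (at z within {y..x})"
      using assms by (intro DERIV_subset[OF deriv_D]) auto
    have "(bes_D' z y)\<^sup>2 \<le> 1"
    proof -
      have "(bes_D' z y)\<^sup>2 + (bes_D z y)\<^sup>2 / z \<le> 1" "0 \<le> (bes_D z y)\<^sup>2 / z"
        using z assms by (auto intro!: D_energy)
      then show ?thesis by linarith
    qed
    then show "norm (bes_D' z y) \<le> 1" by (simp add: abs_square_le_1)
  qed (use assms in auto)
  then show ?thesis using assms by (simp add: D_diag)
qed

text \<open>The quotient in the energy is rewritten through \<open>bes_w1_eq\<close> as x * (bes_j
  x)^2, which makes sense at 0. The resulting function \<open>P\<close> has there the value 1, the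
  squared slope of \<open>bes_w1\<close>.\<close>

lemma w1_energy:
  assumes "x > 0"
  shows "(bes_w1' x)\<^sup>2 + (bes_w1 x)\<^sup>2 / x \<le> 1"
proof -
  define P where "P x = (bes_w1' x)\<^sup>2 + x * (bes_j x)\<^sup>2" for x
  have P: "P y = (bes_w1' y)\<^sup>2 + (bes_w1 y)\<^sup>2 / y" if "y > 0" for y
    using that by (simp add: P_def bes_w1_eq power2_eq_square)
  have "P x \<le> P 0"
  proof (rule DERIV_nonpos_imp_decreasing_open[of 0 x P])
    fix y assume y: "0 < y" "y < x"
    have "(bes_w1' has_field_derivative - bes_w1 y / y) (at y)"
    proof -
      have "bes_w1'' y = - bes_w1 y / y" using w1_ode[of y] y by (simp add: field_simps)
      then show ?thesis using deriv_w1'[of y] by simp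
    qed
    then obtain e where e: "((\<lambda>x. (bes_w1' x)\<^sup>2 + (bes_w1 x)\<^sup>2 / x) has_field_derivative e) (at y)" "e \<le> 0"
      using energy_decreasing[where v = bes_w1 and v' = bes_w1' and x = y, OF y(1) deriv_w1] by blast
    have "\<forall>\<^sub>F u in nhds y. P u = (bes_w1' u)\<^sup>2 + (bes_w1 u)\<^sup>2 / u"
      by (rule eventually_mono[OF eventually_nhds_in_open[of "{0<..}" y]]) (use y in \<open>auto simp: P\<close>)
    then show "\<exists>e. (P has_real_derivative e) (at y) \<and> e \<le> 0"
      using e by (auto simp: DERIV_cong_ev[OF refl _ refl])
  next
    show "continuous_on {0..x} P"
      unfolding P_def
      by (intro continuous_intros continuous_at_imp_continuous_on ballI isCont_j DERIV_isCont[OF deriv_w1'])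
  qed (use assms in auto)
  also have "P 0 = 1"
    by (simp add: P_def bes_w1'_0)
  finally show ?thesis using P assms by simp
qed

lemma abs_w1_le_sqrt:
  assumes "0 < x"
  shows "\<bar>bes_w1 x\<bar> \<le> sqrt x"
proof -
  have "(bes_w1 x)\<^sup>2 / x \<le> 1"
    using w1_energy[OF assms] zero_le_power2[of "bes_w1' x"] by linarith
  then have "(bes_w1 x)\<^sup>2 \<le> x" using assms by (simp add: field_simps)
  then show ?thesis by (metis real_sqrt_abs real_sqrt_le_iff)
qed

lemma abs_j_le_1:
  assumes "0 < x"
  shows "\<bar>bes_j x\<bar> \<le> 1"
proof -
  have "norm (bes_w1 x - bes_w1 0) \<le> 1 * norm (x - 0)"
  proof (rule field_differentiable_bound[of "{0..x}"])
    fix z assume z: "z \<in> {0..x}"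
    then show "(bes_w1 has_field_derivative bes_w1' z) (at z within {0..x})"
      using assms by (intro DERIV_subset[OF deriv_w1]) auto
    have "(bes_w1' z)\<^sup>2 \<le> 1"
    proof (cases "z = 0")
      case True
      then show ?thesis by (simp add: bes_w1'_0)
    next
      case False then show ?thesis
      proof -
        have "(bes_w1' z)\<^sup>2 + (bes_w1 z)\<^sup>2 / z \<le> 1" "0 \<le> (bes_w1 z)\<^sup>2 / z"
          using z False by (auto intro!: w1_energy)
        then show ?thesis by linarith
      qed
    qed
    then show "norm (bes_w1' z) \<le> 1" by (simp add: abs_square_le_1)
  qed (use assms in auto)
  then show ?thesis using assms by (simp add: bes_w1_eq abs_mult)
qed

lemma div_le_inverse_sqrt: "0 < y \<Longrightarrow> a \<le> sqrt y \<Longrightarrow> a / y \<le> 1 / sqrt y"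
  using divide_right_mono[of a "sqrt y" y] by (simp add: sqrt_divide_self_eq inverse_eq_divide)

lemma abs_j_le_sqrt: "0 < x \<Longrightarrow> \<bar>bes_j x\<bar> \<le> 1 / sqrt x"
  using div_le_inverse_sqrt[OF _ abs_w1_le_sqrt[of x]]
  by (simp add: bes_w1_eq abs_mult)

section \<open>The kernel of the integral equations and its relation to the Bessel functions\<close>

definition bes_K :: "real \<Rightarrow> real \<Rightarrow> real \<Rightarrow> real" where
  "bes_K \<kappa> p s = bes_D (\<kappa> * p) (\<kappa> * s) / (\<kappa> * p)"

lemma abs_K_le_1: "\<kappa> > 0 \<Longrightarrow> 0 < s \<Longrightarrow> s \<le> p \<Longrightarrow> \<bar>bes_K \<kappa> p s\<bar> \<le> 1"
  using abs_D_le[of "\<kappa> * s" "\<kappa> * p"] by (simp add: bes_K_def)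

lemma abs_K_le_sqrt: "\<kappa> > 0 \<Longrightarrow> 0 < s \<Longrightarrow> s \<le> p \<Longrightarrow> \<bar>bes_K \<kappa> p s\<bar> \<le> 1 / sqrt (\<kappa> * p)"
  using div_le_inverse_sqrt[OF _ abs_D_le_sqrt[of "\<kappa> * s" "\<kappa> * p"]]
  by (simp add: bes_K_def abs_mult)

lemma bessel_J1_eq: 
  assumes "x > 0"
  shows "sqrt x * bessel_J1 (2 * sqrt x) = bes_w1 x"
proof -
  have eq: "sqrt x * ((-1) ^ m / (fact m * fact (m + 1)) * sqrt x ^ (2 * m + 1)) = bes_a (Suc m) * x ^ Suc m" for m
  proof -
    have "sqrt x * sqrt x ^ (2 * m + 1) = sqrt x ^ (2 * Suc m)" by simp
    also have "\<dots> = x ^ Suc m" unfolding power_mult using assms by simp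
    finally have "sqrt x * sqrt x ^ (2 * m + 1) = x ^ Suc m" .
    then show ?thesis by (simp only: bes_a_def nat.case mult.left_commute[of "sqrt x"])
  qed
  have "(\<lambda>m. bes_a (Suc m) * x ^ Suc m) sums bes_w1 x"
    using summable_sums[OF summable_bes_a[of x]]
    by (subst sums_Suc_iff) (simp add: bes_a_def bes_w1_def)
  then have "(\<lambda>m. (sqrt x * ((-1) ^ m / (fact m * fact (m + 1)) * sqrt x ^ (2 * m + 1))) / sqrt x) sums (bes_w1 x / sqrt x)"
    unfolding eq by (rule sums_divide)
  then have "(\<lambda>m. (-1) ^ m / (fact m * fact (m + 1)) * sqrt x ^ (2 * m + 1)) sums (bes_w1 x / sqrt x)"
    using assms by simp
  then have "bessel_J1 (2 * sqrt x) = bes_w1 x / sqrt x"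
    unfolding bessel_J1_def by (simp add: sums_iff)
  then show ?thesis using assms by simp
qed

lemma bessel_Y1_eq: 
  assumes "x > 0"
  shows "sqrt x * bessel_Y1 (2 * sqrt x) = bes_w2 x"
proof -
  have eq: "sqrt x * ((-1) ^ m * (Digamma (real m + 1) + Digamma (real m + 2)) / (fact m * fact (m + 1)) * sqrt x ^ (2 * m + 1)) = bes_b (Suc m) * x ^ Suc m" for m
  proof -
    have "sqrt x * sqrt x ^ (2 * m + 1) = sqrt x ^ (2 * Suc m)" by simp
    also have "\<dots> = x ^ Suc m" unfolding power_mult using assms by simp
    finally have "sqrt x * sqrt x ^ (2 * m + 1) = x ^ Suc m" .
    then show ?thesis by (simp only: bes_b_def nat.case mult.left_commute[of "sqrt x"])
  qed
  have "(\<lambda>m. bes_b (Suc m) * x ^ Suc m) sums bes_e x"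
    using summable_sums[OF summable_bes_b[of x]]
    by (subst sums_Suc_iff) (simp add: bes_b_def bes_e_def)
  then have "(\<lambda>m. (sqrt x * ((-1) ^ m * (Digamma (real m + 1) + Digamma (real m + 2)) / (fact m * fact (m + 1)) * sqrt x ^ (2 * m + 1))) / sqrt x) sums (bes_e x / sqrt x)"
    unfolding eq by (rule sums_divide)
  then have *: "(\<Sum>m. (-1) ^ m * (Digamma (real m + 1) + Digamma (real m + 2)) / (fact m * fact (m + 1)) * sqrt x ^ (2 * m + 1)) = bes_e x / sqrt x"
    using assms by (simp add: sums_iff)
  have J: "bessel_J1 (2 * sqrt x) = bes_w1 x / sqrt x"
    using bessel_J1_eq[OF assms] assms by (simp add: field_simps)
  have l: "ln (sqrt x) = ln x / 2" using assms by (simp add: ln_sqrt)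
  have "bessel_Y1 (2 * sqrt x) = - 1 / (pi * sqrt x) + ln x / pi * (bes_w1 x / sqrt x) - bes_e x / sqrt x / pi"
  proof -
    have h: "2 * sqrt x / 2 = sqrt x" by simp
    show ?thesis unfolding bessel_Y1_def h * J l by simp
  qed
  moreover have "r * (- 1 / (pi * r) + L / pi * (w / r) - e / r / pi) = (- 1 + L * w - e) / pi"
    if "r > 0" for r w e L :: real
    using that by (simp add: field_simps)
  ultimately show ?thesis using assms by (simp add: bes_w2_def)
qed

text \<open>In the variable x = \<nu> k^2 p the Bessel argument z is 2 sqrt x. The prefactor z' / z
  then equals sqrt y / sqrt x, which is exactly what converts the products of Bessel functions into
  those of \<open>bes_w1\<close> and \<open>bes_w2\<close> divided by x.\<close>

lemma bessel_kernel_eq: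
  assumes "\<nu> > 0" "k > 0" "p > 0" "s > 0"
  shows "pi * (bessel_G (2 * k * sqrt (\<nu> * p)) (2 * k * sqrt (\<nu> * s)) / (2 * k * sqrt (\<nu> * p)))
      = bes_K (\<nu> * k\<^sup>2) p s"
proof -
  define x where "x = \<nu> * k\<^sup>2 * p"
  define y where "y = \<nu> * k\<^sup>2 * s"
  have xy: "x > 0" "y > 0" using assms by (simp_all add: x_def y_def)
  have z: "2 * k * sqrt (\<nu> * p) = 2 * sqrt x" "2 * k * sqrt (\<nu> * s) = 2 * sqrt y"
    using assms by (simp_all add: x_def y_def real_sqrt_mult)
  have "bes_w1 x = sqrt x * bessel_J1 (2 * sqrt x)" "bes_w2 x = sqrt x * bessel_Y1 (2 * sqrt x)"
    "bes_w1 y = sqrt y * bessel_J1 (2 * sqrt y)" "bes_w2 y = sqrt y * bessel_Y1 (2 * sqrt y)"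
    using xy by (simp_all add: bessel_J1_eq bessel_Y1_eq)
  then have "bes_D x y / x = pi * (bessel_G (2 * sqrt x) (2 * sqrt y) / (2 * sqrt x))"
    proof -
      assume *: "bes_w1 x = sqrt x * bessel_J1 (2 * sqrt x)" "bes_w2 x = sqrt x * bessel_Y1 (2 * sqrt x)"
        "bes_w1 y = sqrt y * bessel_J1 (2 * sqrt y)" "bes_w2 y = sqrt y * bessel_Y1 (2 * sqrt y)"
      define r where "r = sqrt x"
      have r: "r > 0" "x = r * r" using xy by (simp_all add: r_def)
      show ?thesis
        unfolding bes_D_def bessel_G_def * r_def[symmetric] unfolding r(2) using r(1)
        by (simp add: field_simps)
    qed
  then show ?thesis by (simp add: z bes_K_def x_def y_def)
qed

text \<open>The factor of the inhomogeneous term is an entire function of p with value 1 at p = 0,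
  so the transform has the limit \<open>u1_hat\<close> or \<open>\<theta>1_hat\<close>
  there.\<close>

lemma bessel_free_eq:
  assumes "\<nu> > 0" "k > 0" "p > 0"
  shows "2 * bessel_J1 (2 * k * sqrt (\<nu> * p)) / (2 * k * sqrt (\<nu> * p)) = bes_j (\<nu> * k\<^sup>2 * p)"
proof -
  define x where "x = \<nu> * k\<^sup>2 * p"
  have x: "x > 0" using assms by (simp add: x_def)
  have z: "2 * k * sqrt (\<nu> * p) = 2 * sqrt x"
    using assms by (simp add: x_def real_sqrt_mult)
  have "2 * bessel_J1 (2 * sqrt x) / (2 * sqrt x) = bes_j x"
  proof -
    define r where "r = sqrt x"
    have r: "r > 0" "x = r * r" using x by (simp_all add: r_def)
    have "r * bessel_J1 (2 * r) = r * r * bes_j x"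
      using bessel_J1_eq[OF x] bes_w1_eq[of x] r by (simp flip: r_def)
    then show ?thesis using r(1) unfolding r_def[symmetric] by (simp add: divide_simps)
  qed
  then show ?thesis unfolding z by (simp only: x_def)
qed

text \<open>Twice integrated form of \<open>G'' = - \<kappa> G / p\<close> for \<open>G p = p K(p, s)\<close>.\<close>

lemma K_integral_eq:
  assumes "\<kappa> > 0" "0 < s" "s \<le> p"
  shows "((\<lambda>q. (p - q) * bes_K \<kappa> q s) has_integral (p - s - p * bes_K \<kappa> p s) / \<kappa>) {s..p}"
proof -
  define h where "h q = - ((p - q) * bes_D' (\<kappa> * q) (\<kappa> * s) + bes_D (\<kappa> * q) (\<kappa> * s) / \<kappa>) / \<kappa>" for q
  have "((\<lambda>q. (p - q) * bes_K \<kappa> q s) has_integral (h p - h s)) {s..p}"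
  proof (rule fundamental_theorem_of_calculus)
    fix q assume q: "q \<in> {s..p}"
    have q0: "\<kappa> * q > 0" using q assms by auto
    have 1: "((\<lambda>q. bes_D (\<kappa> * q) (\<kappa> * s)) has_field_derivative bes_D' (\<kappa> * q) (\<kappa> * s) * \<kappa>) (at q)"
      by (rule DERIV_chain2[where f = "\<lambda>x. bes_D x (\<kappa> * s)", OF deriv_D[OF q0] DERIV_cmult_Id])
    have 2: "((\<lambda>q. bes_D' (\<kappa> * q) (\<kappa> * s)) has_field_derivative - bes_D (\<kappa> * q) (\<kappa> * s) / (\<kappa> * q) * \<kappa>) (at q)"
      by (rule DERIV_chain2[where f = "\<lambda>x. bes_D' x (\<kappa> * s)", OF deriv_D'[OF q0] DERIV_cmult_Id])
    have 3: "((\<lambda>q. p - q) has_field_derivative - 1) (at q)"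
      by (auto intro!: derivative_eq_intros)
    have "(h has_field_derivative (p - q) * bes_K \<kappa> q s) (at q)"
      using DERIV_cdivide[OF DERIV_minus[OF DERIV_add[OF DERIV_mult[OF 3 2] DERIV_cdivide[OF 1, of \<kappa>]]], of \<kappa>]
        assms q
      unfolding h_def[abs_def] bes_K_def by (simp add: mult_ac)
    then show "(h has_vector_derivative (p - q) * bes_K \<kappa> q s) (at q within {s..p})"
      unfolding has_real_derivative_iff_has_vector_derivative by (rule has_vector_derivative_at_within)
  qed (use assms in auto)
  moreover have "h p - h s = (p - s - p * bes_K \<kappa> p s) / \<kappa>"
    using assms by (simp add: h_def bes_K_def D_diag D'_diag diff_divide_distrib)
  ultimately show ?thesis by simp
qed

text \<open>Companion of \<open>K_integral_eq\<close> for q * bes_j (\<kappa> * q) = bes_w1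
  (\<kappa> * q) / \<kappa>, the solution of the same equation with value 0 and slope 1 at q =
  0.\<close>

lemma j_integral_eq:
  assumes "\<kappa> > 0" "0 \<le> p"
  shows "((\<lambda>q. (p - q) * bes_j (\<kappa> * q)) has_integral (p - p * bes_j (\<kappa> * p)) / \<kappa>) {0..p}"
proof -
  define h where "h q = - ((p - q) * bes_w1' (\<kappa> * q) + bes_w1 (\<kappa> * q) / \<kappa>) / \<kappa>" for q
  have "((\<lambda>q. (p - q) * bes_j (\<kappa> * q)) has_integral (h p - h 0)) {0..p}"
  \<comment> \<open>The interior version, because \<open>w1_ode\<close> determines the second
    derivative only after division by \<kappa> * q.\<close>
  proof (rule fundamental_theorem_of_calculus_interior)
    have c: "isCont (\<lambda>q. bes_w1' (\<kappa> * q)) y" "isCont (\<lambda>q. bes_w1 (\<kappa> * q)) y" for y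
      by (rule isCont_o2[where f = "\<lambda>q. \<kappa> * q"]; (intro continuous_intros DERIV_isCont[OF deriv_w1] DERIV_isCont[OF deriv_w1'])?)+
    show "continuous_on {0..p} h"
      unfolding h_def using assms by (intro continuous_intros continuous_at_imp_continuous_on ballI c) auto
    fix q assume q: "q \<in> {0<..<p}"
    have 1: "((\<lambda>q. bes_w1 (\<kappa> * q)) has_field_derivative bes_w1' (\<kappa> * q) * \<kappa>) (at q)"
      by (rule DERIV_chain2[OF deriv_w1 DERIV_cmult_Id])
    have 2: "((\<lambda>q. bes_w1' (\<kappa> * q)) has_field_derivative bes_w1'' (\<kappa> * q) * \<kappa>) (at q)"
      by (rule DERIV_chain2[OF deriv_w1' DERIV_cmult_Id])
    have "\<kappa> * q * (bes_w1'' (\<kappa> * q) + bes_j (\<kappa> * q)) = 0"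
      using w1_ode[of "\<kappa> * q"] bes_w1_eq[of "\<kappa> * q"] by (simp add: algebra_simps)
    then have w: "bes_w1'' (\<kappa> * q) = - bes_j (\<kappa> * q)"
      using assms q by (simp add: add_eq_0_iff2)
    have 3: "((\<lambda>q. p - q) has_field_derivative - 1) (at q)"
      by (auto intro!: derivative_eq_intros)
    have "(h has_field_derivative (p - q) * bes_j (\<kappa> * q)) (at q)"
      using DERIV_cdivide[OF DERIV_minus[OF DERIV_add[OF DERIV_mult[OF 3 2] DERIV_cdivide[OF 1, of \<kappa>]]], of \<kappa>]
        assms q
      unfolding h_def[abs_def] w by (simp add: mult.commute)
    then show "(h has_vector_derivative (p - q) * bes_j (\<kappa> * q)) (at q)"
      by (simp add: has_real_derivative_iff_has_vector_derivative)
  qed (use assms in auto)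
  moreover have "h p - h 0 = (p - p * bes_j (\<kappa> * p)) / \<kappa>"
    using assms by (simp add: h_def bes_w1_eq) (simp add: bes_w1'_0 field_simps)
  ultimately show ?thesis by simp
qed

section \<open>Bounded integrable functions with exponential weight\<close>

text \<open>A ball of radius A in the intersection of weighted L-infinity and L1, one constant
  serving both parts. The origin is exempt from the pointwise part, since the Hodge symbol and the
  integral equations have a meaning only away from it; for the integral it is a null set.\<close>

definition bnd :: "real \<Rightarrow> real \<Rightarrow> (real ^ 'n \<Rightarrow> complex) \<Rightarrow> bool" where
  "bnd b A F \<longleftrightarrow> F \<in> borel_measurable borel \<and> (\<forall>k. k \<noteq> 0 \<longrightarrow> norm (F k) * exp (b * norm k) \<le> A) \<and>
     (\<integral>\<^sup>+k. ennreal (norm (F k) * exp (b * norm k)) \<partial>lborel) \<le> ennreal A"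

lemma bnd_meas: "bnd b A F \<Longrightarrow> F \<in> borel_measurable borel"
  by (simp add: bnd_def)

lemma bnd_sup: "bnd b A F \<Longrightarrow> k \<noteq> 0 \<Longrightarrow> norm (F k) * exp (b * norm k) \<le> A"
  by (simp add: bnd_def)

lemma bnd_nn: "bnd b A F \<Longrightarrow> (\<integral>\<^sup>+k. ennreal (norm (F k) * exp (b * norm k)) \<partial>lborel) \<le> ennreal A"
  by (simp add: bnd_def)

lemma bnd_nonneg:
  fixes F :: "real ^ 'n \<Rightarrow> complex"
  assumes "bnd b A F" shows "0 \<le> A"
proof -
  obtain k :: "real ^ 'n" where "k \<noteq> 0"
    using axis_eq_0_iff[of undefined "1::real"] by blast
  then have "0 \<le> norm (F k) * exp (b * norm k)" "norm (F k) * exp (b * norm k) \<le> A"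
    using assms by (auto intro: bnd_sup)
  then show ?thesis by linarith
qed

lemma AE_nonzero: "AE k in lborel. (k :: real ^ 'n) \<noteq> 0"
  by (rule AE_lborel_singleton)

text \<open>A pointwise comparison of weighted functions away from the origin transfers both parts
  of the bound at once; b and b' may differ, so changes of weight are covered too.\<close>

lemma bnd_dominated:
  fixes F :: "real ^ 'n \<Rightarrow> complex"
  assumes "bnd b A F" and [measurable]: "F' \<in> borel_measurable borel" and "0 \<le> C"
    and le: "\<And>k. k \<noteq> 0 \<Longrightarrow> norm (F' k) * exp (b' * norm k) \<le> C * (norm (F k) * exp (b * norm k))"
  shows "bnd b' (C * A) F'"
  unfolding bnd_def
proof (intro conjI allI impI)
  have [measurable]: "F \<in> borel_measurable borel" using assms by (simp add: bnd_def)
  fix k :: "real ^ 'n" assume k: "k \<noteq> 0"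
  have "C * (norm (F k) * exp (b * norm k)) \<le> C * A"
    using bnd_sup[OF assms(1) k] assms(3) by (rule mult_left_mono)
  with le[OF k] show "norm (F' k) * exp (b' * norm k) \<le> C * A" by simp
next
  have [measurable]: "F \<in> borel_measurable borel" using assms by (simp add: bnd_def)
  have "(\<integral>\<^sup>+k. ennreal (norm (F' k) * exp (b' * norm k)) \<partial>lborel)
      \<le> (\<integral>\<^sup>+k. ennreal C * ennreal (norm (F k) * exp (b * norm k)) \<partial>lborel)"
    using AE_nonzero
    by (intro nn_integral_mono_AE) (auto elim!: eventually_mono simp: assms(3) le ennreal_mult[symmetric] intro!: ennreal_leI)
  also have "\<dots> = ennreal C * (\<integral>\<^sup>+k. ennreal (norm (F k) * exp (b * norm k)) \<partial>lborel)"
    by (rule nn_integral_cmult) simp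
  also have "\<dots> \<le> ennreal C * ennreal A"
    by (intro mult_left_mono bnd_nn[OF assms(1)]) simp
  finally show "(\<integral>\<^sup>+k. ennreal (norm (F' k) * exp (b' * norm k)) \<partial>lborel) \<le> ennreal (C * A)"
    using assms(3) bnd_nonneg[OF assms(1)] by (simp add: ennreal_mult)
qed simp

lemma bnd_mono: "bnd b A F \<Longrightarrow> A \<le> A' \<Longrightarrow> bnd b A' F"
  unfolding bnd_def by (meson ennreal_leI order_trans)

lemma bnd_mono_b: 
  assumes "bnd b A F" "b' \<le> b"
  shows "bnd b' A F"
proof -
  have "bnd b' (1 * A) F"
    using assms by (intro bnd_dominated[OF assms(1)] bnd_meas[OF assms(1)])
      (auto intro!: mult_left_mono mult_right_mono)
  then show ?thesis by simp
qed

lemma bnd_mult: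
  fixes F :: "real ^ 'n \<Rightarrow> complex"
  assumes "bnd b A F" "m \<in> borel_measurable borel" "\<And>k. k \<noteq> 0 \<Longrightarrow> norm (m k) \<le> C" "0 \<le> C"
  shows "bnd b (C * A) (\<lambda>k. m k * F k)"
proof -
  have [measurable]: "F \<in> borel_measurable borel" "m \<in> borel_measurable borel" 
    using assms by (auto simp: bnd_def)
  show ?thesis
  proof (rule bnd_dominated[OF assms(1)])
    fix k :: "real ^ 'n" assume "k \<noteq> 0"
    then show "norm (m k * F k) * exp (b * norm k) \<le> C * (norm (F k) * exp (b * norm k))"
      using assms(3)[of k] by (auto simp: norm_mult mult.assoc intro!: mult_right_mono)
  qed (use assms in auto)
qed

lemma bnd_cong: "bnd b A F \<Longrightarrow> (\<And>k. F k = G k) \<Longrightarrow> bnd b A G"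
  by (simp add: bnd_def cong: measurable_cong)

lemma bnd_zero: "0 \<le> A \<Longrightarrow> bnd b A (\<lambda>_. 0)"
  by (simp add: bnd_def)

lemma bnd_add:
  assumes "bnd b A F" "bnd b B G"
  shows "bnd b (A + B) (\<lambda>k. F k + G k)"
  unfolding bnd_def
proof (intro conjI allI impI)
  have [measurable]: "F \<in> borel_measurable borel" "G \<in> borel_measurable borel"
    using assms by (auto simp: bnd_def)
  show "(\<lambda>k. F k + G k) \<in> borel_measurable borel" by measurable
  have le: "norm (F k + G k) * exp (b * norm k) \<le> norm (F k) * exp (b * norm k) + norm (G k) * exp (b * norm k)" for k
    by (simp flip: distrib_right add: norm_triangle_ineq)
  then show "norm (F k + G k) * exp (b * norm k) \<le> A + B" if "k \<noteq> 0" for k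
    using bnd_sup[OF assms(1) that] bnd_sup[OF assms(2) that] order_trans add_mono by meson
  have "(\<integral>\<^sup>+k. ennreal (norm (F k + G k) * exp (b * norm k)) \<partial>lborel)
    \<le> (\<integral>\<^sup>+k. ennreal (norm (F k) * exp (b * norm k)) + ennreal (norm (G k) * exp (b * norm k)) \<partial>lborel)"
    using le by (intro nn_integral_mono) (simp flip: ennreal_plus add: ennreal_leI del: distrib_right)
  also have "\<dots> = (\<integral>\<^sup>+k. ennreal (norm (F k) * exp (b * norm k)) \<partial>lborel) + (\<integral>\<^sup>+k. ennreal (norm (G k) * exp (b * norm k)) \<partial>lborel)"
    by (rule nn_integral_add) simp_all
  also have "\<dots> \<le> ennreal A + ennreal B"
    by (intro add_mono bnd_nn assms)
  finally show "(\<integral>\<^sup>+k. ennreal (norm (F k + G k) * exp (b * norm k)) \<partial>lborel) \<le> ennreal (A + B)"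
    using assms by (simp add: bnd_nonneg)
qed

lemma bnd_sum:
  assumes "finite I" "\<And>i. i \<in> I \<Longrightarrow> bnd b (A i) (F i)"
  shows "bnd b (\<Sum>i\<in>I. A i) (\<lambda>k. \<Sum>i\<in>I. F i k)"
  using assms by (induction I rule: finite_induct) (auto intro: bnd_add bnd_zero)

lemma bnd_integrable:
  assumes "bnd b A F" "0 \<le> b"
  shows "integrable lborel F" "(\<integral>\<^sup>+k. ennreal (norm (F k)) \<partial>lborel) \<le> ennreal A"
proof -
  have "bnd 0 A F" using assms by (rule bnd_mono_b)
  then show *: "(\<integral>\<^sup>+k. ennreal (norm (F k)) \<partial>lborel) \<le> ennreal A"
    using bnd_nn by fastforce
  show "integrable lborel F"
    using bnd_meas[OF assms(1)] * by (intro integrableI_bounded) (auto simp: top_unique order_le_less_trans)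
qed

text \<open>Minkowski's integral inequality, with Tonelli for the L1 part. The bound is asked for
  almost every s, which is what the Laplace class provides.\<close>

lemma bnd_integral:
  fixes F :: "real ^ 'n \<Rightarrow> 's \<Rightarrow> complex"
  assumes M: "sigma_finite_measure M"
    and F[measurable]: "(\<lambda>(k, s). F k s) \<in> borel_measurable (borel \<Otimes>\<^sub>M M)"
    and B: "AE s in M. bnd b (A s) (\<lambda>k. F k s)" and A: "integrable M A"
  shows "bnd b (\<integral>s. A s \<partial>M) (\<lambda>k. \<integral>s. F k s \<partial>M)"
  unfolding bnd_def
proof (intro conjI allI impI)
  interpret M: sigma_finite_measure M by fact
  interpret P: pair_sigma_finite "lborel :: (real ^ 'n) measure" M
    by (simp add: pair_sigma_finite.intro M lborel.sigma_finite_measure_axioms)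
  have F'[measurable]: "(\<lambda>(k, s). F k s) \<in> borel_measurable (lborel \<Otimes>\<^sub>M M)"
    using F by (simp cong: measurable_cong_sets)
  show "(\<lambda>k. \<integral>s. F k s \<partial>M) \<in> borel_measurable borel" by measurable
  have A0: "AE s in M. 0 \<le> A s" using B by eventually_elim (rule bnd_nonneg)
  have Fk[measurable]: "(\<lambda>s. F k s) \<in> borel_measurable M" for k by measurable
  { fix k :: "real ^ 'n" assume k: "k \<noteq> 0"
    have le: "AE s in M. norm (F k s) \<le> A s * exp (- (b * norm k))"
      using B by eventually_elim (use bnd_sup[OF _ k] in \<open>fastforce simp: exp_minus field_simps\<close>)
    have int: "integrable M (\<lambda>s. A s * exp (- (b * norm k)))" using A by simp
    have iF: "integrable M (F k)"
      using le A0 by (intro Bochner_Integration.integrable_bound[OF int]) (auto elim!: eventually_elim2)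
    have "norm (\<integral>s. F k s \<partial>M) \<le> (\<integral>s. A s * exp (- (b * norm k)) \<partial>M)"
      by (rule order_trans[OF integral_norm_bound integral_mono_AE[OF integrable_norm[OF iF] int le]])
    then show "norm (\<integral>s. F k s \<partial>M) * exp (b * norm k) \<le> (\<integral>s. A s \<partial>M)"
      by (simp add: exp_minus field_simps) }
  have "(\<integral>\<^sup>+k. ennreal (norm (\<integral>s. F k s \<partial>M) * exp (b * norm k)) \<partial>lborel)
      \<le> (\<integral>\<^sup>+k. (\<integral>\<^sup>+s. ennreal (norm (F k s) * exp (b * norm k)) \<partial>M) \<partial>lborel)"
  proof (intro nn_integral_mono)
    fix k :: "real ^ 'n"
    \<comment> \<open>If the integrand is not integrable, the Bochner integral is 0 by convention
      and the inequality is trivial; so no case has to be excluded.\<close>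
    have "ennreal (norm (\<integral>s. F k s \<partial>M)) \<le> (\<integral>\<^sup>+s. ennreal (norm (F k s)) \<partial>M)"
      by (cases "integrable M (F k)") (auto intro: integral_norm_bound_ennreal simp: not_integrable_integral_eq)
    then have "ennreal (norm (\<integral>s. F k s \<partial>M)) * ennreal (exp (b * norm k))
        \<le> (\<integral>\<^sup>+s. ennreal (norm (F k s)) \<partial>M) * ennreal (exp (b * norm k))"
      by (rule mult_right_mono) simp
    also have "\<dots> = (\<integral>\<^sup>+s. ennreal (norm (F k s)) * ennreal (exp (b * norm k)) \<partial>M)"
      by (rule nn_integral_multc[symmetric]) simp
    finally show "ennreal (norm (\<integral>s. F k s \<partial>M) * exp (b * norm k)) \<le> (\<integral>\<^sup>+s. ennreal (norm (F k s) * exp (b * norm k)) \<partial>M)"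
      by (simp add: ennreal_mult)
  qed
  also have "\<dots> = (\<integral>\<^sup>+s. (\<integral>\<^sup>+k. ennreal (norm (F k s) * exp (b * norm k)) \<partial>lborel) \<partial>M)"
    by (rule P.Fubini'[symmetric]) measurable
  also have "\<dots> \<le> (\<integral>\<^sup>+s. ennreal (A s) \<partial>M)"
    using B by (intro nn_integral_mono_AE) (auto elim!: eventually_mono dest: bnd_nn)
  also have "\<dots> = ennreal (\<integral>s. A s \<partial>M)"
    using A A0 by (rule nn_integral_eq_integral)
  finally show "(\<integral>\<^sup>+k. ennreal (norm (\<integral>s. F k s \<partial>M) * exp (b * norm k)) \<partial>lborel) \<le> ennreal (\<integral>s. A s \<partial>M)" .
qed

section \<open>Convolution estimates\<close>

lemma nn_integral_translate:
  fixes g :: "real ^ 'n \<Rightarrow> ennreal"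
  assumes [measurable]: "g \<in> borel_measurable borel"
  shows "(\<integral>\<^sup>+k. g (k - c) \<partial>lborel) = (\<integral>\<^sup>+k. g k \<partial>lborel)"
proof -
  have "(\<integral>\<^sup>+k. g k \<partial>lborel) = (\<integral>\<^sup>+k. g k \<partial>distr lborel borel ((+) (- c)))"
    by (simp only: lborel_distr_plus)
  also have "\<dots> = (\<integral>\<^sup>+k. g (- c + k) \<partial>lborel)"
    by (rule nn_integral_distr) simp_all
  finally show ?thesis by simp
qed

lemma AE_translate: "AE k' in lborel. k - k' \<noteq> (0 :: real ^ 'n)"
  using AE_lborel_singleton[of k] by eventually_elim auto

text \<open>L1 against L-infinity. The point k' = k, at which \<open>bnd\<close> gives no pointwise
  bound for the second factor, is a null set.\<close>

lemma fconv_integrand: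
  assumes "bnd b A F" "bnd b B G" "0 \<le> b"
  shows "integrable lborel (\<lambda>k'. F k' * G (k - k'))"
    and "(\<integral>k'. norm (F k' * G (k - k')) \<partial>lborel) \<le> A * B"
proof -
  have [measurable]: "F \<in> borel_measurable borel" "G \<in> borel_measurable borel"
    using assms by (auto simp: bnd_def)
  have F: "integrable lborel F" "(\<integral>\<^sup>+k. ennreal (norm (F k)) \<partial>lborel) \<le> ennreal A"
    using bnd_integrable[OF assms(1,3)] .
  have G: "norm (G k) \<le> B" if "k \<noteq> 0" for k
    using bnd_sup[OF bnd_mono_b[OF assms(2,3)] that] by simp
  have B: "0 \<le> B" using bnd_nonneg[OF assms(2)] .
  have le: "AE k' in lborel. norm (F k' * G (k - k')) \<le> norm (B * norm (F k'))"
    using AE_translate[of k]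
  proof eventually_elim
    case (elim k')
    then show ?case using mult_right_mono[OF G[of "k - k'"] norm_ge_zero[of "F k'"]] B
      by (simp add: norm_mult mult.commute)
  qed
  have i: "integrable lborel (\<lambda>k'. B * norm (F k'))" using F by simp
  show int: "integrable lborel (\<lambda>k'. F k' * G (k - k'))"
    by (rule Bochner_Integration.integrable_bound[OF i _ le]) simp
  have "(\<integral>k'. norm (F k' * G (k - k')) \<partial>lborel) \<le> (\<integral>k'. B * norm (F k') \<partial>lborel)"
    using int i le B by (intro integral_mono_AE) auto
  also have "\<dots> = B * (\<integral>k'. norm (F k') \<partial>lborel)" by simp
  also have "\<dots> \<le> B * A"
  proof (rule mult_left_mono[OF _ B])
    have "ennreal (\<integral>k'. norm (F k') \<partial>lborel) \<le> ennreal A"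
      using F by (subst nn_integral_eq_integral[symmetric]) auto
    then show "(\<integral>k'. norm (F k') \<partial>lborel) \<le> A"
      using bnd_nonneg[OF assms(1)] by (simp add: ennreal_le_iff)
  qed
  finally show "(\<integral>k'. norm (F k' * G (k - k')) \<partial>lborel) \<le> A * B" by (simp add: mult.commute)
qed

lemma measurable_fconv[measurable]:
  assumes [measurable]: "(\<lambda>(k, y). F k y) \<in> borel_measurable (borel \<Otimes>\<^sub>M N)"
    "(\<lambda>(k, y). G k y) \<in> borel_measurable (borel \<Otimes>\<^sub>M N)"
  shows "(\<lambda>(k, y). fconv (\<lambda>k'. F k' y) (\<lambda>k'. G k' y) k) \<in> borel_measurable (borel \<Otimes>\<^sub>M N)"
  unfolding fconv_def by measurable

lemma measurable_fconv1:
  assumes [measurable]: "F \<in> borel_measurable borel" "G \<in> borel_measurable borel"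
  shows "fconv F G \<in> borel_measurable borel"
  unfolding fconv_def[abs_def] by measurable

text \<open>By the triangle inequality the weight is submultiplicative, which reduces the claim to b
  = 0 for the weighted functions \<open>f\<close> and \<open>g\<close>. There L1 against L-infinity
  gives the pointwise part, and Tonelli with translation invariance the integral part.\<close>

lemma bnd_fconv:
  fixes F :: "real ^ 'n \<Rightarrow> complex"
  assumes "bnd b A F" "bnd b B G" "0 \<le> b"
  shows "bnd b (A * B) (fconv F G)"
  unfolding bnd_def
proof (intro conjI allI impI)
  have [measurable]: "F \<in> borel_measurable borel" "G \<in> borel_measurable borel"
    using assms by (auto simp: bnd_def)
  show "fconv F G \<in> borel_measurable borel" by (rule measurable_fconv1) simp_all
  define f where "f k = F k * of_real (exp (b * norm k))" for k
  define g where "g k = G k * of_real (exp (b * norm k))" for k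
  have [measurable]: "f \<in> borel_measurable borel" "g \<in> borel_measurable borel"
    unfolding f_def[abs_def] g_def[abs_def] by measurable
  have f: "bnd 0 A f" and g: "bnd 0 B g"
    using assms by (auto simp: bnd_def f_def g_def norm_mult)
  have le: "norm (F k' * G (k - k')) * exp (b * norm k) \<le> norm (f k' * g (k - k'))" for k k'
  proof -
    have "norm k \<le> norm k' + norm (k - k')" using norm_triangle_ineq[of k' "k - k'"] by simp
    then have "exp (b * norm k) \<le> exp (b * norm k') * exp (b * norm (k - k'))"
      using assms(3) by (simp flip: exp_add distrib_left add: mult_left_mono)
    then have "norm (F k' * G (k - k')) * exp (b * norm k) \<le> norm (F k' * G (k - k')) * (exp (b * norm k') * exp (b * norm (k - k')))"
      by (rule mult_left_mono) simp
    then show ?thesis by (simp add: f_def g_def norm_mult mult_ac)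
  qed
  show "norm (fconv F G k) * exp (b * norm k) \<le> A * B" for k
  proof -
    have "norm (fconv F G k) \<le> (\<integral>k'. norm (F k' * G (k - k')) \<partial>lborel)"
      unfolding fconv_def by (rule integral_norm_bound)
    then have "norm (fconv F G k) * exp (b * norm k) \<le> (\<integral>k'. norm (F k' * G (k - k')) \<partial>lborel) * exp (b * norm k)"
      by (rule mult_right_mono) simp
    also have "\<dots> = (\<integral>k'. norm (F k' * G (k - k')) * exp (b * norm k) \<partial>lborel)" by simp
    also have "\<dots> \<le> (\<integral>k'. norm (f k' * g (k - k')) \<partial>lborel)"
      by (intro integral_mono le integrable_mult_left integrable_norm fconv_integrand[OF assms] fconv_integrand[OF f g]) simp
    also have "\<dots> \<le> A * B" by (rule fconv_integrand[OF f g]) simp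
    finally show ?thesis .
  qed
  have "(\<integral>\<^sup>+k. ennreal (norm (fconv F G k) * exp (b * norm k)) \<partial>lborel)
     \<le> (\<integral>\<^sup>+k. (\<integral>\<^sup>+k'. ennreal (norm (f k')) * ennreal (norm (g (k - k'))) \<partial>lborel) \<partial>lborel)"
  proof (intro nn_integral_mono)
    fix k :: "real ^ 'n"
    have "ennreal (norm (fconv F G k)) \<le> (\<integral>\<^sup>+k'. ennreal (norm (F k' * G (k - k'))) \<partial>lborel)"
      unfolding fconv_def by (rule integral_norm_bound_ennreal[OF fconv_integrand(1)[OF assms]])
    then have "ennreal (norm (fconv F G k)) * ennreal (exp (b * norm k))
        \<le> (\<integral>\<^sup>+k'. ennreal (norm (F k' * G (k - k'))) \<partial>lborel) * ennreal (exp (b * norm k))"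
      by (rule mult_right_mono) simp
    also have "\<dots> = (\<integral>\<^sup>+k'. ennreal (norm (F k' * G (k - k'))) * ennreal (exp (b * norm k)) \<partial>lborel)"
      by (rule nn_integral_multc[symmetric]) simp
    also have "\<dots> \<le> (\<integral>\<^sup>+k'. ennreal (norm (f k')) * ennreal (norm (g (k - k'))) \<partial>lborel)"
      using le[of _ k] by (intro nn_integral_mono) (simp add: norm_mult flip: ennreal_mult)
    finally show "ennreal (norm (fconv F G k) * exp (b * norm k)) \<le> (\<integral>\<^sup>+k'. ennreal (norm (f k')) * ennreal (norm (g (k - k'))) \<partial>lborel)"
      by (simp add: ennreal_mult)
  qed
  also have "\<dots> = (\<integral>\<^sup>+k'. (\<integral>\<^sup>+k. ennreal (norm (f k')) * ennreal (norm (g (k - k'))) \<partial>lborel) \<partial>lborel)"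
    by (rule lborel_pair.Fubini'[symmetric]) measurable
  also have "\<dots> = (\<integral>\<^sup>+k'. ennreal (norm (f k')) * (\<integral>\<^sup>+k. ennreal (norm (g k)) \<partial>lborel) \<partial>lborel)"
    by (intro nn_integral_cong, subst nn_integral_cmult)
       (simp_all add: nn_integral_translate[of "\<lambda>k. ennreal (norm (g k))"])
  also have "\<dots> = (\<integral>\<^sup>+k'. ennreal (norm (f k')) \<partial>lborel) * (\<integral>\<^sup>+k. ennreal (norm (g k)) \<partial>lborel)"
    by (rule nn_integral_multc) simp
  also have "\<dots> \<le> ennreal A * ennreal B"
    using bnd_nn[OF f] bnd_nn[OF g] by (intro mult_mono) simp_all
  finally show "(\<integral>\<^sup>+k. ennreal (norm (fconv F G k) * exp (b * norm k)) \<partial>lborel) \<le> ennreal (A * B)"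
    using bnd_nonneg[OF f] bnd_nonneg[OF g] by (simp add: ennreal_mult)
qed

lemma measurable_fpconv[measurable]:
  assumes [measurable]: "(\<lambda>(k, p). F k p) \<in> borel_measurable (borel \<Otimes>\<^sub>M borel)"
    "(\<lambda>(k, p). G k p) \<in> borel_measurable (borel \<Otimes>\<^sub>M borel)"
  shows "(\<lambda>(k, p). fpconv F G k p) \<in> borel_measurable (borel \<Otimes>\<^sub>M borel)"
proof -
  have 1: "(\<lambda>(k, ps). fconv (\<lambda>k'. F k' (fst ps - snd ps)) (\<lambda>k'. G k' (snd ps)) k)
      \<in> borel_measurable (borel \<Otimes>\<^sub>M (borel \<Otimes>\<^sub>M (borel :: real measure)))"
    by (rule measurable_fconv) measurable
  have [measurable]: "(\<lambda>((k, p), s). fconv (\<lambda>k'. F k' (p - s)) (\<lambda>k'. G k' s) k)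
      \<in> borel_measurable ((borel \<Otimes>\<^sub>M borel) \<Otimes>\<^sub>M lborel)"
  proof -
    have "(\<lambda>x. (fst (fst x), (snd (fst x), snd x))) \<in> (borel \<Otimes>\<^sub>M borel) \<Otimes>\<^sub>M lborel \<rightarrow>\<^sub>M
        borel \<Otimes>\<^sub>M (borel \<Otimes>\<^sub>M (borel :: real measure))"
      by measurable
    from measurable_compose[OF this 1] show ?thesis
      by (simp add: case_prod_beta')
  qed
  show ?thesis
  proof -
    \<comment> \<open>The range of integration depends on p, so it is moved into a condition that is
      jointly measurable in p and s.\<close>
    have "(\<lambda>(k, p). fpconv F G k p) = (\<lambda>(k, p). \<integral>s. (if 0 < s \<and> s < p then fconv (\<lambda>k'. F k' (p - s)) (\<lambda>k'. G k' s) k else 0) \<partial>lborel)"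
      by (auto simp: fpconv_def set_lebesgue_integral_def fun_eq_iff indicator_def intro!: Bochner_Integration.integral_cong)
    also have "\<dots> \<in> borel_measurable (borel \<Otimes>\<^sub>M borel)"
      by measurable
    finally show ?thesis .
  qed
qed

text \<open>The bounds \<open>f\<close> and \<open>g\<close> vary with s and hold almost everywhere,
  so that the lemma serves both constant local bounds and the integrable majorant of the Laplace
  class.\<close>

lemma bnd_fpconv:
  assumes [measurable]: "(\<lambda>(k, p). F k p) \<in> borel_measurable (borel \<Otimes>\<^sub>M borel)"
    "(\<lambda>(k, p). G k p) \<in> borel_measurable (borel \<Otimes>\<^sub>M borel)"
    and f: "AE s in lborel. 0 < s \<and> s < p \<longrightarrow> bnd b (f s) (\<lambda>k. F k (p - s))"
    and g: "AE s in lborel. 0 < s \<and> s < p \<longrightarrow> bnd b (g s) (\<lambda>k. G k s)"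
    and i: "set_integrable lborel {0<..<p} (\<lambda>s. f s * g s)" and "0 \<le> b"
  shows "bnd b (LINT s:{0<..<p}|lborel. f s * g s) (\<lambda>k. fpconv F G k p)"
  unfolding fpconv_def set_lebesgue_integral_def
proof (rule bnd_integral)
  have [measurable]: "(\<lambda>(k, s). fconv (\<lambda>k'. F k' (p - s)) (\<lambda>k'. G k' s) k) \<in> borel_measurable (borel \<Otimes>\<^sub>M borel)"
    by (rule measurable_fconv) measurable
  show "(\<lambda>(k, s). indicat_real {0<..<p} s *\<^sub>R fconv (\<lambda>k'. F k' (p - s)) (\<lambda>k'. G k' s) k) \<in> borel_measurable (borel \<Otimes>\<^sub>M lborel)"
    by measurable
  show "AE s in lborel. bnd b (indicat_real {0<..<p} s *\<^sub>R (f s * g s))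
           (\<lambda>k. indicat_real {0<..<p} s *\<^sub>R fconv (\<lambda>k'. F k' (p - s)) (\<lambda>k'. G k' s) k)"
    using f g
  proof eventually_elim
    case (elim s)
    then show ?case by (cases "s \<in> {0<..<p}") (auto intro!: bnd_zero bnd_fconv assms)
  qed
qed (use i in \<open>auto simp: set_integrable_def lborel.sigma_finite_measure_axioms\<close>)

section \<open>Fubini lemmas on triangles\<close>

text \<open>Fubini in the form needed for every exchange below: an integrable majorant
  \<open>C\<close> of the norms in x amounts to absolute integrability on the product.\<close>

lemma swap_integrals:
  fixes P :: "'a :: euclidean_space \<Rightarrow> real \<Rightarrow> complex"
  assumes [measurable]: "(\<lambda>(x, r). P x r) \<in> borel_measurable (borel \<Otimes>\<^sub>M borel)"
    and S[measurable]: "S \<in> sets borel"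
    and i: "\<And>r. r \<in> S \<Longrightarrow> integrable lborel (\<lambda>x. P x r)"
    and le: "\<And>r. r \<in> S \<Longrightarrow> (\<integral>x. norm (P x r) \<partial>lborel) \<le> C r" and C: "set_integrable lborel S C"
  shows "(\<integral>x. (LINT r:S|lborel. P x r) \<partial>lborel) = (LINT r:S|lborel. (\<integral>x. P x r \<partial>lborel))"
    and "integrable lborel (\<lambda>x. LINT r:S|lborel. P x r)"
    and "set_integrable lborel S (\<lambda>r. \<integral>x. P x r \<partial>lborel)"
    and "AE x in lborel. set_integrable lborel S (\<lambda>r. P x r)"
proof -
  have "integrable (lborel \<Otimes>\<^sub>M lborel) (\<lambda>(r, x). indicat_real S r *\<^sub>R P x r)"
  proof (rule lborel_pair.Fubini_integrable)
    show "(\<lambda>(r, x). indicat_real S r *\<^sub>R P x r) \<in> borel_measurable (lborel \<Otimes>\<^sub>M lborel)" by measurable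
    show "integrable lborel (\<lambda>r. \<integral>x. norm (case (r, x) of (r, x) \<Rightarrow> indicat_real S r *\<^sub>R P x r) \<partial>lborel)"
      by (rule Bochner_Integration.integrable_bound[OF C[unfolded set_integrable_def]])
         (auto simp: indicator_def intro!: order_trans[OF le])
    show "AE r in lborel. integrable lborel (\<lambda>x. case (r, x) of (r, x) \<Rightarrow> indicat_real S r *\<^sub>R P x r)"
      using i by (auto simp: indicator_def)
  qed
  then have I: "integrable (lborel \<Otimes>\<^sub>M lborel) (\<lambda>(x, r). indicat_real S r *\<^sub>R P x r)"
    by (subst lborel_pair.integrable_product_swap_iff[symmetric]) (simp add: case_prod_beta)
  from lborel_pair.Fubini_integral[OF I]
  show "(\<integral>x. (LINT r:S|lborel. P x r) \<partial>lborel) = (LINT r:S|lborel. (\<integral>x. P x r \<partial>lborel))"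
    by (simp add: set_lebesgue_integral_def)
  from lborel_pair.integrable_fst[OF I]
  show "integrable lborel (\<lambda>x. LINT r:S|lborel. P x r)" by (simp add: set_lebesgue_integral_def)
  from lborel_pair.integrable_snd[OF I]
  show "set_integrable lborel S (\<lambda>r. \<integral>x. P x r \<partial>lborel)" by (simp add: set_integrable_def)
  from lborel_pair.AE_integrable_fst[OF I]
  show "AE x in lborel. set_integrable lborel S (\<lambda>r. P x r)" by (simp add: set_integrable_def)
qed

text \<open>Fubini on 0 < s < q < p. A majorant in s alone is enough because the sections in q have
  length at most p.\<close>

lemma triangle_swap:
  fixes \<psi> :: "real \<Rightarrow> real \<Rightarrow> complex"
  assumes [measurable]: "(\<lambda>(s, q). \<psi> s q) \<in> borel_measurable (borel \<Otimes>\<^sub>M borel)"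
    and le: "\<And>s q. 0 < s \<Longrightarrow> s < q \<Longrightarrow> q < p \<Longrightarrow> norm (\<psi> s q) \<le> g s"
    and g: "set_integrable lborel {0<..<p} g"
  shows "(LINT s:{0<..<p}|lborel. LINT q:{s<..<p}|lborel. \<psi> s q) =
         (LINT q:{0<..<p}|lborel. LINT s:{0<..<q}|lborel. \<psi> s q)"
    and "set_integrable lborel {0<..<p} (\<lambda>q. LINT s:{0<..<q}|lborel. \<psi> s q)"
proof -
  define P where "P q s = indicat_real {s<..<p} q *\<^sub>R \<psi> s q" for q s
  have [measurable]: "(\<lambda>(q, s). P q s) \<in> borel_measurable (borel \<Otimes>\<^sub>M borel)"
  proof -
    have "(\<lambda>(q, s). (if s < q \<and> q < p then 1 else 0 :: real) *\<^sub>R \<psi> s q) \<in> borel_measurable (borel \<Otimes>\<^sub>M borel)"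
      by measurable
    then show ?thesis by (simp add: P_def indicator_def of_bool_def)
  qed
  have iS: "integrable lborel (\<lambda>q. indicat_real {s<..<p} q * g s)" for s
    by (intro integrable_mult_left integrable_real_indicator; cases "s \<le> p") auto
  have bnd: "norm (P q s) \<le> indicat_real {s<..<p} q * g s" if "0 < s" for s q
    using le[of s q] that by (auto simp: P_def indicator_def)
  have i: "integrable lborel (\<lambda>q. P q s)" if "s \<in> {0<..<p}" for s
    using that by (intro Bochner_Integration.integrable_bound[OF iS[of s]]) (auto intro!: AE_I2 order_trans[OF bnd])
  have C: "(\<integral>q. norm (P q s) \<partial>lborel) \<le> p * g s" if s: "s \<in> {0<..<p}" for s
  proof -
    have g0: "0 \<le> g s" using order_trans[OF norm_ge_zero le[of s "(s + p) / 2"]] s by auto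
    have "(\<integral>q. norm (P q s) \<partial>lborel) \<le> (\<integral>q. indicat_real {s<..<p} q * g s \<partial>lborel)"
      using s by (intro integral_mono integrable_norm i iS bnd) auto
    also have "\<dots> = (p - s) * g s" using s by simp
    also have "\<dots> \<le> p * g s" using s g0 by (intro mult_right_mono) auto
    finally show ?thesis .
  qed
  note sw = swap_integrals[of P "{0<..<p}" "\<lambda>s. p * g s", OF _ _ i C]
  have gi: "set_integrable lborel {0<..<p} (\<lambda>s. p * g s)" using g by simp
  have eq: "(LINT s:{0<..<p}|lborel. P q s) = (if q \<in> {0<..<p} then LINT s:{0<..<q}|lborel. \<psi> s q else 0)" for q
    unfolding set_lebesgue_integral_def P_def
    by (auto intro!: Bochner_Integration.integral_cong integral_eq_zero_AE simp: indicator_def)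
  have eq': "(\<lambda>q. LINT s:{0<..<p}|lborel. P q s) = (\<lambda>q. indicat_real {0<..<p} q *\<^sub>R (LINT s:{0<..<q}|lborel. \<psi> s q))"
    by (auto simp: eq)
  have "(LINT s:{0<..<p}|lborel. LINT q:{s<..<p}|lborel. \<psi> s q) = (LINT s:{0<..<p}|lborel. (\<integral>q. P q s \<partial>lborel))"
    unfolding P_def set_lebesgue_integral_def ..
  also have "\<dots> = (\<integral>q. (LINT s:{0<..<p}|lborel. P q s) \<partial>lborel)"
    by (rule sw(1)[symmetric]) (use gi in auto)
  finally show "(LINT s:{0<..<p}|lborel. LINT q:{s<..<p}|lborel. \<psi> s q) =
         (LINT q:{0<..<p}|lborel. LINT s:{0<..<q}|lborel. \<psi> s q)"
    unfolding eq' by (simp add: set_lebesgue_integral_def)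
  have "integrable lborel (\<lambda>q. LINT s:{0<..<p}|lborel. P q s)"
    by (rule sw(2)) (use gi in auto)
  then show "set_integrable lborel {0<..<p} (\<lambda>q. LINT s:{0<..<q}|lborel. \<psi> s q)"
    unfolding eq' by (simp add: set_integrable_def)
qed

section \<open>Primitives in the Borel variable\<close>

text \<open>An integrated form of f' = g on [0, T]. It passes through integrals over k by Fubini and
  asks for boundedness of g only; continuity of the derivatives is recovered at the end, from the
  next derivative.\<close>

definition prim :: "real \<Rightarrow> (real \<Rightarrow> complex) \<Rightarrow> (real \<Rightarrow> complex) \<Rightarrow> bool" where
  "prim T f g \<longleftrightarrow> g \<in> borel_measurable borel \<and> (\<exists>C. \<forall>s\<in>{0<..<T}. norm (g s) \<le> C) \<and>
     (\<forall>p\<in>{0..T}. f p = f 0 + (LINT s:{0<..<p}|lborel. g s))"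

lemma set_integrable_bounded_Ioo:
  fixes g :: "real \<Rightarrow> 'a :: {banach, second_countable_topology}"
  assumes "g \<in> borel_measurable borel" "\<And>s. s \<in> {a<..<b} \<Longrightarrow> norm (g s) \<le> C"
  shows "set_integrable lborel {a<..<b} g"
  unfolding set_integrable_def
proof (rule Bochner_Integration.integrable_bound)
  show "integrable lborel (\<lambda>x. indicat_real {a<..<b} x * C)"
    by (intro integrable_mult_left integrable_real_indicator; cases "a \<le> b") auto
  show "AE x in lborel. norm (indicat_real {a<..<b} x *\<^sub>R g x) \<le> norm (indicat_real {a<..<b} x * C)"
    using assms(2) by (auto simp: indicator_def intro!: AE_I2 order_trans[OF assms(2)])
qed (use assms in measurable)

lemma norm_set_integral_le:
  fixes f :: "real \<Rightarrow> 'a :: {banach, second_countable_topology}"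
  assumes "\<And>s. s \<in> {a<..<b} \<Longrightarrow> norm (f s) \<le> C" "a \<le> b" "0 \<le> C"
  shows "norm (LINT s:{a<..<b}|lborel. f s) \<le> (b - a) * C"
proof -
  have "norm (LINT s:{a<..<b}|lborel. f s) \<le> (\<integral>s. norm (indicat_real {a<..<b} s *\<^sub>R f s) \<partial>lborel)"
    unfolding set_lebesgue_integral_def by (rule integral_norm_bound)
  also have "\<dots> \<le> (\<integral>s. indicat_real {a<..<b} s * C \<partial>lborel)"
  proof (rule Bochner_Integration.integral_mono')
    show "integrable lborel (\<lambda>s. indicat_real {a<..<b} s * C)"
      using assms by (intro integrable_mult_left integrable_real_indicator) auto
  qed (use assms in \<open>auto simp: indicator_def\<close>)
  also have "\<dots> = (b - a) * C" using assms by simp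
  finally show ?thesis .
qed

lemma primI:
  assumes "g \<in> borel_measurable borel" "\<And>s. s \<in> {0<..<T} \<Longrightarrow> norm (g s) \<le> C"
    "\<And>p. p \<in> {0..T} \<Longrightarrow> f p = f 0 + (LINT s:{0<..<p}|lborel. g s)"
  shows "prim T f g"
  unfolding prim_def using assms by blast

lemma prim_ftc: "prim T f g \<Longrightarrow> p \<in> {0..T} \<Longrightarrow> f p = f 0 + (LINT s:{0<..<p}|lborel. g s)"
  unfolding prim_def by blast

lemma prim_meas: "prim T f g \<Longrightarrow> g \<in> borel_measurable borel"
  unfolding prim_def by blast

lemma prim_bound: "prim T f g \<Longrightarrow> \<exists>C. \<forall>s\<in>{0<..<T}. norm (g s) \<le> C"
  unfolding prim_def by blast

lemma prim_integrable: "prim T f g \<Longrightarrow> p \<in> {0..T} \<Longrightarrow> set_integrable lborel {0<..<p} g"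
  using prim_bound[of T f g] by (auto intro!: set_integrable_bounded_Ioo prim_meas)

lemma prim_add:
  assumes "prim T f g" "prim T f' g'"
  shows "prim T (\<lambda>p. f p + f' p) (\<lambda>p. g p + g' p)"
proof -
  obtain C C' where C: "\<forall>s\<in>{0<..<T}. norm (g s) \<le> C" "\<forall>s\<in>{0<..<T}. norm (g' s) \<le> C'"
    using prim_bound[OF assms(1)] prim_bound[OF assms(2)] by blast
  show ?thesis
  proof (rule primI)
    show "norm (g s + g' s) \<le> C + C'" if "s \<in> {0<..<T}" for s
      using C that by (meson add_mono norm_triangle_ineq order_trans)
    fix p assume p: "p \<in> {0..T}"
    have "(LINT s:{0<..<p}|lborel. g s + g' s) = (LINT s:{0<..<p}|lborel. g s) + (LINT s:{0<..<p}|lborel. g' s)"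
      by (intro set_integral_add prim_integrable[OF assms(1) p] prim_integrable[OF assms(2) p])
    then show "f p + f' p = f 0 + f' 0 + (LINT s:{0<..<p}|lborel. g s + g' s)"
      unfolding prim_ftc[OF assms(1) p] prim_ftc[OF assms(2) p] by simp
  qed (use prim_meas[OF assms(1)] prim_meas[OF assms(2)] in measurable)
qed

lemma prim_cmult:
  assumes "prim T f g"
  shows "prim T (\<lambda>p. c * f p) (\<lambda>p. c * g p)"
proof -
  obtain C where C: "\<forall>s\<in>{0<..<T}. norm (g s) \<le> C"
    using prim_bound[OF assms] by blast
  show ?thesis
  proof (rule primI)
    show "norm (c * g s) \<le> norm c * C" if "s \<in> {0<..<T}" for s
      using C that by (simp add: norm_mult mult_left_mono)
    fix p assume p: "p \<in> {0..T}"
    show "c * f p = c * f 0 + (LINT s:{0<..<p}|lborel. c * g s)"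
      by (subst prim_ftc[OF assms p]) (simp add: distrib_left)
  qed (use prim_meas[OF assms] in measurable)
qed

lemma prim_zero: "prim T (\<lambda>_. 0) (\<lambda>_. 0)"
  by (rule primI[where C = 0]) simp_all

lemma prim_sum:
  assumes "finite I" "\<And>i. i \<in> I \<Longrightarrow> prim T (f i) (g i)"
  shows "prim T (\<lambda>p. \<Sum>i\<in>I. f i p) (\<lambda>p. \<Sum>i\<in>I. g i p)"
  using assms by (induction I rule: finite_induct) (auto intro: prim_add prim_zero)

text \<open>The reflection k' -> k - k' preserves Lebesgue measure. It lets a rule for the left
  factor of a convolution serve the right factor as well.\<close>

lemma fconv_commute:
  assumes [measurable]: "F \<in> borel_measurable borel" "G \<in> borel_measurable borel"
  shows "fconv F G k = fconv G F (k :: real ^ 'n)"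
proof -
  have 1: "(lborel :: (real ^ 'n) measure) = density (distr lborel borel (\<lambda>x. k + (- 1) *\<^sub>R x)) (\<lambda>_. ennreal (\<bar>- 1\<bar> ^ DIM(real ^ 'n)))"
    by (rule lborel_affine) simp
  have 2: "density (distr lborel borel (\<lambda>x. k + (- 1) *\<^sub>R x)) (\<lambda>_. ennreal (\<bar>- 1\<bar> ^ DIM(real ^ 'n))) = distr lborel borel (\<lambda>x. k - x)"
    by (simp add: density_1)
  have d: "(lborel :: (real ^ 'n) measure) = distr lborel borel (\<lambda>x. k - x)"
    by (rule trans[OF 1 2])
  have "fconv F G k = (\<integral>x. F x * G (k - x) \<partial>distr lborel borel (\<lambda>x. k - x))"
    unfolding fconv_def by (rule arg_cong[where f = "\<lambda>M. integral\<^sup>L M (\<lambda>x. F x * G (k - x))", OF d])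
  also have "\<dots> = (\<integral>x. F (k - x) * G (k - (k - x)) \<partial>lborel)"
    by (rule integral_distr) measurable
  also have "\<dots> = fconv G F k" by (simp add: fconv_def mult.commute)
  finally show ?thesis .
qed

lemma norm_fconv_le:
  assumes "bnd b A F" "bnd b B G" "0 \<le> b"
  shows "norm (fconv F G k) \<le> A * B"
  unfolding fconv_def by (rule order_trans[OF integral_norm_bound fconv_integrand(2)[OF assms]])

section \<open>Differentiation of convolutions in the Borel variable\<close>

definition tb :: "real \<Rightarrow> real \<Rightarrow> real \<Rightarrow> (real ^ 'n \<Rightarrow> real \<Rightarrow> complex) \<Rightarrow> bool" where
  "tb b A T F \<longleftrightarrow> (\<lambda>(k, p). F k p) \<in> borel_measurable (borel \<Otimes>\<^sub>M borel) \<and>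
     (\<forall>p\<in>{0..T}. bnd b A (\<lambda>k. F k p))"

lemma tb_meas: "tb b A T F \<Longrightarrow> (\<lambda>(k, p). F k p) \<in> borel_measurable (borel \<Otimes>\<^sub>M borel)"
  by (simp add: tb_def)

lemma tb_bnd: "tb b A T F \<Longrightarrow> p \<in> {0..T} \<Longrightarrow> bnd b A (\<lambda>k. F k p)"
  by (simp add: tb_def)

lemma tb_meas1: 
  assumes "(\<lambda>(k, p). F k p) \<in> borel_measurable (borel \<Otimes>\<^sub>M borel)"
  shows "F k \<in> borel_measurable borel" "(\<lambda>k. F k p) \<in> borel_measurable borel"
proof -
  note [measurable] = assms
  show "F k \<in> borel_measurable borel" "(\<lambda>k. F k p) \<in> borel_measurable borel" by measurable
qed

lemma measurable_fconv_left:
  assumes [measurable]: "F \<in> borel_measurable borel" "(\<lambda>(k, y). G k y) \<in> borel_measurable (borel \<Otimes>\<^sub>M N)"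
  shows "(\<lambda>(k, y). fconv F (\<lambda>k'. G k' y) k) \<in> borel_measurable (borel \<Otimes>\<^sub>M N)"
  by (rule measurable_fconv[of "\<lambda>k y. F k"]) measurable

lemma measurable_fconv_right:
  assumes [measurable]: "F \<in> borel_measurable borel" "(\<lambda>(k, y). G k y) \<in> borel_measurable (borel \<Otimes>\<^sub>M N)"
  shows "(\<lambda>(k, y). fconv (\<lambda>k'. G k' y) F k) \<in> borel_measurable (borel \<Otimes>\<^sub>M N)"
  by (rule measurable_fconv[of _ _ "\<lambda>k y. F k"]) measurable

text \<open>The primitive formula for F is inserted under the convolution integral and the integrals
  over k' and r are exchanged. The formula holds for k' \<noteq> 0, hence almost everywhere.\<close>

lemma fconv_prim:
  fixes F F1 :: "real ^ 'n \<Rightarrow> real \<Rightarrow> complex"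
  assumes F: "tb 0 A T F" and F1: "tb 0 A1 T F1" and G: "bnd 0 B G"
    and pr: "\<And>k. k \<noteq> 0 \<Longrightarrow> prim T (F k) (F1 k)"
  shows "prim T (\<lambda>p. fconv (\<lambda>k. F k p) G k) (\<lambda>p. fconv (\<lambda>k. F1 k p) G k)"
proof (rule primI)
  note [measurable] = tb_meas[OF F] tb_meas[OF F1] bnd_meas[OF G]
  have bF: "bnd 0 A (\<lambda>k. F k p)" "bnd 0 A1 (\<lambda>k. F1 k p)" if "p \<in> {0..T}" for p
    by (rule tb_bnd[OF F that], rule tb_bnd[OF F1 that])
  have "(\<lambda>(k, p). fconv (\<lambda>k. F1 k p) G k) \<in> borel_measurable (borel \<Otimes>\<^sub>M borel)"
    by (rule measurable_fconv_right[OF bnd_meas[OF G] tb_meas[OF F1]])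
  then show "(\<lambda>p. fconv (\<lambda>k. F1 k p) G k) \<in> borel_measurable borel" by (rule tb_meas1)
  show "norm (fconv (\<lambda>k. F1 k s) G k) \<le> A1 * B" if "s \<in> {0<..<T}" for s
    using that by (intro norm_fconv_le[OF bF(2) G]) auto
  fix p assume p: "p \<in> {0..T}"
  define P where "P k' r = F1 k' r * G (k - k')" for k' r
  have [measurable]: "(\<lambda>(x, r). P x r) \<in> borel_measurable (borel \<Otimes>\<^sub>M borel)"
    unfolding P_def by measurable
  have i: "integrable lborel (\<lambda>x. P x r)" "(\<integral>x. norm (P x r) \<partial>lborel) \<le> A1 * B" if "r \<in> {0<..<p}" for r
    unfolding P_def using that p by (auto intro!: fconv_integrand[OF bF(2) G])
  note sw = swap_integrals[of P "{0<..<p}" "\<lambda>_. A1 * B", OF _ _ i]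
  have c: "set_integrable lborel {0<..<p} (\<lambda>_. A1 * B)"
    by (rule set_integrable_bounded_Ioo[where C = "norm (A1 * B)"]) auto
  have "fconv (\<lambda>k. F k p) G k = (\<integral>k'. F k' 0 * G (k - k') + (LINT r:{0<..<p}|lborel. P k' r) \<partial>lborel)"
    unfolding fconv_def
  proof (rule integral_cong_AE)
    show "AE k' in lborel. F k' p * G (k - k') = F k' 0 * G (k - k') + (LINT r:{0<..<p}|lborel. P k' r)"
      using AE_nonzero
    proof eventually_elim
      case (elim k')
      have "F k' p = F k' 0 + (LINT r:{0<..<p}|lborel. F1 k' r)"
        by (rule prim_ftc[OF pr[OF elim] p])
      then show ?case by (simp add: P_def distrib_right)
    qed
  qed (unfold set_lebesgue_integral_def, measurable)
  also have "\<dots> = fconv (\<lambda>k. F k 0) G k + (\<integral>k'. (LINT r:{0<..<p}|lborel. P k' r) \<partial>lborel)"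
    unfolding fconv_def using p c
    by (intro Bochner_Integration.integral_add fconv_integrand(1)[OF bF(1) G] sw(2)) auto
  also have "(\<integral>k'. (LINT r:{0<..<p}|lborel. P k' r) \<partial>lborel) = (LINT r:{0<..<p}|lborel. fconv (\<lambda>k. F1 k r) G k)"
    using sw(1)[OF _ _ _ _ c] unfolding fconv_def P_def by simp
  finally show "fconv (\<lambda>k. F k p) G k = fconv (\<lambda>k. F k 0) G k + (LINT r:{0<..<p}|lborel. fconv (\<lambda>k. F1 k r) G k)" .
qed

text \<open>Leibniz rule for the convolution over [0, p] with all derivatives put on F: the moving
  endpoint s = p leaves the boundary term with F at 0. In integrated form, F (p - s) is expanded
  from 0 and the order in the resulting triangle integral is exchanged.\<close>

lemma fpconv_prim:
  fixes F F1 G :: "real ^ 'n \<Rightarrow> real \<Rightarrow> complex"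
  assumes F: "tb 0 A T F" and F1: "tb 0 A1 T F1" and G: "tb 0 B T G"
    and pr: "\<And>k. k \<noteq> 0 \<Longrightarrow> prim T (F k) (F1 k)"
  shows "prim T (fpconv F G k) (\<lambda>p. fconv (\<lambda>k. F k 0) (\<lambda>k. G k p) k + fpconv F1 G k p)"
proof (rule primI)
  note [measurable] = tb_meas[OF F] tb_meas[OF F1] tb_meas[OF G]
  have b: "bnd 0 A (\<lambda>k. F k p)" "bnd 0 A1 (\<lambda>k. F1 k p)" "bnd 0 B (\<lambda>k. G k p)" if "p \<in> {0..T}" for p
    using tb_bnd[OF F that] tb_bnd[OF F1 that] tb_bnd[OF G that] .
  have m0: "(\<lambda>(k, p). fconv (\<lambda>k. F k 0) (\<lambda>k. G k p) k) \<in> borel_measurable (borel \<Otimes>\<^sub>M borel)"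
    by (rule measurable_fconv_left[OF tb_meas1(2)[OF tb_meas[OF F]] tb_meas[OF G]])
  have m1: "(\<lambda>(k, p). fpconv F1 G k p) \<in> borel_measurable (borel \<Otimes>\<^sub>M borel)"
    by (rule measurable_fpconv[OF tb_meas[OF F1] tb_meas[OF G]])
  note [measurable] = tb_meas1(1)[OF m0] tb_meas1(1)[OF m1]
  show "(\<lambda>p. fconv (\<lambda>k. F k 0) (\<lambda>k. G k p) k + fpconv F1 G k p) \<in> borel_measurable borel" by measurable
  define \<phi> where "\<phi> r s = fconv (\<lambda>k. F1 k r) (\<lambda>k. G k s) k" for r s
  have \<phi>le: "norm (\<phi> r s) \<le> A1 * B" if "r \<in> {0..T}" "s \<in> {0..T}" for r s
    unfolding \<phi>_def using that by (intro norm_fconv_le[OF b(2,3)]) auto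
  have AB: "0 \<le> A1 * B" if "T \<ge> 0" using order_trans[OF norm_ge_zero \<phi>le[of 0 0]] that by simp
  have m\<phi>: "(\<lambda>(s, q). \<phi> (q - s) s) \<in> borel_measurable (borel \<Otimes>\<^sub>M borel)"
  proof -
    have 1: "(\<lambda>(k, ps). fconv (\<lambda>k'. F1 k' (snd ps - fst ps)) (\<lambda>k'. G k' (fst ps)) k)
      \<in> borel_measurable (borel \<Otimes>\<^sub>M (borel \<Otimes>\<^sub>M (borel :: real measure)))"
      by (rule measurable_fconv) measurable
    have "(\<lambda>x. (k, x)) \<in> borel \<Otimes>\<^sub>M borel \<rightarrow>\<^sub>M borel \<Otimes>\<^sub>M (borel \<Otimes>\<^sub>M (borel :: real measure))"
      by measurable
    from measurable_compose[OF this 1] show ?thesis by (simp add: case_prod_beta' \<phi>_def)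
  qed
  have fp1: "fpconv F1 G k q = (LINT s:{0<..<q}|lborel. \<phi> (q - s) s)" for q
    by (simp add: fpconv_def \<phi>_def)
  have fp1_le: "norm (fpconv F1 G k q) \<le> T * (A1 * B)" if q: "q \<in> {0..T}" for q
  proof -
    have "norm (fpconv F1 G k q) \<le> (q - 0) * (A1 * B)"
      unfolding fp1 using q AB by (intro norm_set_integral_le \<phi>le) auto
    also have "\<dots> \<le> T * (A1 * B)" using q AB by (intro mult_right_mono) auto
    finally show ?thesis .
  qed
  show "norm (fconv (\<lambda>k. F k 0) (\<lambda>k. G k s) k + fpconv F1 G k s) \<le> A * B + T * (A1 * B)" if "s \<in> {0<..<T}" for s
    using that by (intro norm_triangle_le add_mono fp1_le norm_fconv_le[OF b(1,3)]) auto
  fix p assume p: "p \<in> {0..T}"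
  have si0: "set_integrable lborel {0<..<p} (\<lambda>s. fconv (\<lambda>k. F k 0) (\<lambda>k. G k s) k)"
    using p by (intro set_integrable_bounded_Ioo[where C = "A * B"] norm_fconv_le[OF b(1,3)]) auto
  have le: "norm (\<phi> (q - s) s) \<le> A1 * B" if "0 < s" "s < q" "q < p" for s q
    using that p by (intro \<phi>le) auto
  have c: "set_integrable lborel {0<..<p} (\<lambda>_. A1 * B)"
    by (rule set_integrable_bounded_Ioo[where C = "norm (A1 * B)"]) auto
  note tri = triangle_swap[where \<psi> = "\<lambda>s q. \<phi> (q - s) s", OF m\<phi> le c]
  have "fpconv F G k p = (LINT s:{0<..<p}|lborel. fconv (\<lambda>k. F k 0) (\<lambda>k. G k s) k + (LINT q:{s<..<p}|lborel. \<phi> (q - s) s))"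
    unfolding fpconv_def
  proof (rule set_lebesgue_integral_cong)
    show "\<forall>s. s \<in> {0<..<p} \<longrightarrow> fconv (\<lambda>k'. F k' (p - s)) (\<lambda>k'. G k' s) k =
      fconv (\<lambda>k. F k 0) (\<lambda>k. G k s) k + (LINT q:{s<..<p}|lborel. \<phi> (q - s) s)"
    proof (intro allI impI)
      fix s assume s: "s \<in> {0<..<p}"
      have "prim T (\<lambda>p. fconv (\<lambda>k. F k p) (\<lambda>k. G k s) k) (\<lambda>p. fconv (\<lambda>k. F1 k p) (\<lambda>k. G k s) k)"
        using s p by (intro fconv_prim[OF F F1 b(3) pr]) auto
      then have "fconv (\<lambda>k'. F k' (p - s)) (\<lambda>k'. G k' s) k =
        fconv (\<lambda>k. F k 0) (\<lambda>k. G k s) k + (LINT r:{0<..<p - s}|lborel. \<phi> r s)"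
        using s p unfolding \<phi>_def by (intro prim_ftc) auto
      \<comment> \<open>The shift r = q - s turns the increment of F into an integral over s < q <
        p, the shape required by \<open>triangle_swap\<close>.\<close>
      also have "(LINT r:{0<..<p - s}|lborel. \<phi> r s) = (LINT q:{s<..<p}|lborel. \<phi> (q - s) s)"
        unfolding set_lebesgue_integral_def
        by (subst lborel_integral_real_affine[where c = 1 and t = "- s"])
           (auto intro!: Bochner_Integration.integral_cong simp: indicator_def)
      finally show "fconv (\<lambda>k'. F k' (p - s)) (\<lambda>k'. G k' s) k =
        fconv (\<lambda>k. F k 0) (\<lambda>k. G k s) k + (LINT q:{s<..<p}|lborel. \<phi> (q - s) s)" .
    qed
  qed simp
  also have "\<dots> = (LINT s:{0<..<p}|lborel. fconv (\<lambda>k. F k 0) (\<lambda>k. G k s) k) + (LINT s:{0<..<p}|lborel. LINT q:{s<..<p}|lborel. \<phi> (q - s) s)"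
  proof (rule set_integral_add(2)[OF si0])
    show "set_integrable lborel {0<..<p} (\<lambda>s. LINT q:{s<..<p}|lborel. \<phi> (q - s) s)"
    proof (rule set_integrable_bounded_Ioo[where C = "p * (A1 * B)"])
      have "(\<lambda>s. \<integral>q. (if s < q \<and> q < p then \<phi> (q - s) s else 0) \<partial>lborel) \<in> borel_measurable borel"
        using m\<phi> by measurable
      also have "(\<lambda>s. \<integral>q. (if s < q \<and> q < p then \<phi> (q - s) s else 0) \<partial>lborel) = (\<lambda>s. LINT q:{s<..<p}|lborel. \<phi> (q - s) s)"
        by (auto simp: set_lebesgue_integral_def fun_eq_iff indicator_def intro!: Bochner_Integration.integral_cong)
      finally show "(\<lambda>s. LINT q:{s<..<p}|lborel. \<phi> (q - s) s) \<in> borel_measurable borel" .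
      fix s assume s: "s \<in> {0<..<p}"
      have "norm (LINT q:{s<..<p}|lborel. \<phi> (q - s) s) \<le> (p - s) * (A1 * B)"
        using s p le AB by (intro norm_set_integral_le) auto
      also have "\<dots> \<le> p * (A1 * B)" using s p AB by (intro mult_right_mono) auto
      finally show "norm (LINT q:{s<..<p}|lborel. \<phi> (q - s) s) \<le> p * (A1 * B)" .
    qed
  qed
  also have "(LINT s:{0<..<p}|lborel. LINT q:{s<..<p}|lborel. \<phi> (q - s) s) = (LINT q:{0<..<p}|lborel. fpconv F1 G k q)"
    unfolding fp1 by (rule tri(1))
  also have "(LINT s:{0<..<p}|lborel. fconv (\<lambda>k. F k 0) (\<lambda>k. G k s) k) + (LINT q:{0<..<p}|lborel. fpconv F1 G k q)
      = (LINT s:{0<..<p}|lborel. fconv (\<lambda>k. F k 0) (\<lambda>k. G k s) k + fpconv F1 G k s)"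
    using tri(2) by (intro set_integral_add(2)[symmetric] si0) (simp add: fp1)
  finally have "fpconv F G k p = (LINT s:{0<..<p}|lborel. fconv (\<lambda>k. F k 0) (\<lambda>k. G k s) k + fpconv F1 G k s)" .
  moreover have "fpconv F G k 0 = 0" by (simp add: fpconv_def set_lebesgue_integral_def)
  ultimately show "fpconv F G k p = fpconv F G k 0 + (LINT s:{0<..<p}|lborel. fconv (\<lambda>k. F k 0) (\<lambda>k. G k s) k + fpconv F1 G k s)"
    by (simp only: add_0)
qed

section \<open>Averages over dilations\<close>

definition avg :: "nat \<Rightarrow> (real \<Rightarrow> complex) \<Rightarrow> real \<Rightarrow> complex" where
  "avg n f p = (LINT \<sigma>:{0<..<1}|lborel. \<sigma> ^ n *\<^sub>R f (\<sigma> * p))"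

lemma measurable_avg[measurable]:
  assumes [measurable]: "(\<lambda>(k, p). F k p) \<in> borel_measurable (borel \<Otimes>\<^sub>M borel)"
  shows "(\<lambda>(k, p). avg n (F k) p) \<in> borel_measurable (borel \<Otimes>\<^sub>M borel)"
  unfolding avg_def set_lebesgue_integral_def by measurable

lemma set_integral_power: "(LINT \<sigma>:{0<..<1::real}|lborel. \<sigma> ^ n) = 1 / real (Suc n)"
  and set_integrable_power: "set_integrable lborel {0<..<1::real} (\<lambda>\<sigma>. \<sigma> ^ n)"
proof -
  show i: "set_integrable lborel {0<..<1::real} (\<lambda>\<sigma>. \<sigma> ^ n)"
    by (rule set_integrable_bounded_Ioo[where C = 1]) (auto simp: power_le_one norm_power)
  have "(LINT \<sigma>:{0<..<1::real}|lborel. \<sigma> ^ n) = integral {0<..<1} (\<lambda>\<sigma>. \<sigma> ^ n)"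
    using i by (rule set_borel_integral_eq_integral)
  also have "\<dots> = integral {0..1} (\<lambda>\<sigma>. \<sigma> ^ n)"
    by (metis box_real(1) cbox_interval integral_open_interval)
  also have "\<dots> = 1 / real (Suc n)"
  proof (rule integral_unique)
    have "((\<lambda>\<sigma>. \<sigma> ^ n) has_integral (1 ^ Suc n / real (Suc n) - 0 ^ Suc n / real (Suc n))) {0..1::real}"
    proof (rule fundamental_theorem_of_calculus)
      fix x :: real
      have "((\<lambda>x. x ^ Suc n / real (Suc n)) has_field_derivative x ^ n) (at x within {0..1})"
        by (rule DERIV_cong[OF DERIV_cdivide[OF DERIV_pow]]) simp
      then show "((\<lambda>x. x ^ Suc n / real (Suc n)) has_vector_derivative x ^ n) (at x within {0..1})"
        by (simp add: has_real_derivative_iff_has_vector_derivative)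
    qed simp
    then show "((\<lambda>\<sigma>. \<sigma> ^ n) has_integral 1 / real (Suc n)) {0..1::real}" by simp
  qed
  finally show "(LINT \<sigma>:{0<..<1::real}|lborel. \<sigma> ^ n) = 1 / real (Suc n)" .
qed

text \<open>The gain n + 1 is the reciprocal of the integral of \<sigma>^n. It later compensates one
  of the two factors n that the diffusion term costs.\<close>

lemma bnd_avg:
  assumes "(\<lambda>(k, p). F k p) \<in> borel_measurable (borel \<Otimes>\<^sub>M borel)"
    and "\<And>q. 0 \<le> q \<Longrightarrow> q \<le> p \<Longrightarrow> bnd b A (\<lambda>k. F k q)" and "0 \<le> p"
  shows "bnd b (A / real (Suc n)) (\<lambda>k. avg n (F k) p)"
proof -
  note [measurable] = assms(1)
  have "bnd b (\<integral>\<sigma>. indicator {0<..<1} \<sigma> * \<sigma> ^ n * A \<partial>lborel)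
      (\<lambda>k. \<integral>\<sigma>. indicator {0<..<1} \<sigma> *\<^sub>R (\<sigma> ^ n *\<^sub>R F k (\<sigma> * p)) \<partial>lborel)"
  proof (rule bnd_integral[OF lborel.sigma_finite_measure_axioms])
    show "AE \<sigma> in lborel. bnd b (indicat_real {0<..<1} \<sigma> * \<sigma> ^ n * A) (\<lambda>k. indicat_real {0<..<1} \<sigma> *\<^sub>R \<sigma> ^ n *\<^sub>R F k (\<sigma> * p))"
    proof (rule AE_I2)
      fix \<sigma> :: real
      show "bnd b (indicat_real {0<..<1} \<sigma> * \<sigma> ^ n * A) (\<lambda>k. indicat_real {0<..<1} \<sigma> *\<^sub>R \<sigma> ^ n *\<^sub>R F k (\<sigma> * p))"
      proof (cases "\<sigma> \<in> {0<..<1}")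
        case True
        then have "bnd b A (\<lambda>k. F k (\<sigma> * p))"
          using assms(3) by (intro assms(2)) (auto simp: mult_left_le_one_le)
        then have "bnd b (\<sigma> ^ n * A) (\<lambda>k. complex_of_real (\<sigma> ^ n) * F k (\<sigma> * p))"
          using True by (intro bnd_mult) (auto simp: norm_power)
        then show ?thesis using True by (simp add: scaleR_conv_of_real)
      qed (simp add: bnd_zero)
    qed
    show "integrable lborel (\<lambda>\<sigma>. indicat_real {0<..<1} \<sigma> * \<sigma> ^ n * A)"
      using set_integrable_power[of n] by (intro integrable_mult_left) (simp add: set_integrable_def)
  qed measurable
  moreover have "(\<integral>\<sigma>. indicator {0<..<1} \<sigma> * \<sigma> ^ n * A \<partial>lborel) = A / real (Suc n)"
    using set_integral_power[of n] by (simp add: set_lebesgue_integral_def)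
  ultimately show ?thesis by (simp add: avg_def set_lebesgue_integral_def)
qed

text \<open>Chain rule: differentiating f (\<sigma> p) in p releases a factor \<sigma>. In
  integrated form this factor is the Jacobian of s = \<sigma> r.\<close>

lemma prim_avg:
  assumes "prim T f g"
  shows "prim T (avg n f) (avg (Suc n) g)"
proof -
  have gm[measurable]: "g \<in> borel_measurable borel" using assms by (rule prim_meas)
  obtain C where C: "\<And>s. s \<in> {0<..<T} \<Longrightarrow> norm (g s) \<le> C" using prim_bound[OF assms] by blast
  have ftc: "f p = f 0 + (LINT s:{0<..<p}|lborel. g s)" if "p \<in> {0..T}" for p
    using assms that by (rule prim_ftc)
  have sub: "\<sigma> * p \<in> {0<..<T}" if "\<sigma> \<in> {0<..<1}" "p \<in> {0<..<T}" for \<sigma> p :: real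
  proof -
    have "\<sigma> * p < 1 * p" using that by (intro mult_strict_right_mono) auto
    also have "1 * p < T" using that by simp
    finally show ?thesis using that by simp
  qed
  have gle: "norm (\<sigma> ^ m *\<^sub>R g (\<sigma> * p)) \<le> C" if "\<sigma> \<in> {0<..<1}" "p \<in> {0<..<T}" for \<sigma> p m
  proof -
    have "norm (\<sigma> ^ m *\<^sub>R g (\<sigma> * p)) \<le> 1 * C"
      unfolding norm_scaleR using that C[OF sub[OF that]] by (intro mult_mono) (auto simp: power_le_one norm_power)
    then show ?thesis by simp
  qed
  show ?thesis
  proof (rule primI)
    show "avg (Suc n) g \<in> borel_measurable borel"
      unfolding avg_def[abs_def] set_lebesgue_integral_def by measurable
    show "norm (avg (Suc n) g p) \<le> C" if p: "p \<in> {0<..<T}" for p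
    proof -
      have "norm (avg (Suc n) g p) \<le> (1 - 0) * C"
        unfolding avg_def using p gle[of _ p "Suc n"] order_trans[OF norm_ge_zero C[OF p]]
        by (intro norm_set_integral_le) auto
      then show ?thesis by simp
    qed
    fix p assume p: "p \<in> {0..T}"
    define P where "P \<sigma> r = (indicat_real {0<..<1} \<sigma> * \<sigma> ^ Suc n) *\<^sub>R g (\<sigma> * r)" for \<sigma> r
    have [measurable]: "(\<lambda>(x, r). P x r) \<in> borel_measurable (borel \<Otimes>\<^sub>M borel)"
      unfolding P_def by measurable
    have Ple: "norm (P \<sigma> r) \<le> indicat_real {0<..<1} \<sigma> * C" if "r \<in> {0<..<p}" for \<sigma> r
      using gle[of \<sigma> r "Suc n"] that p by (simp add: P_def indicator_def)
    have iC: "integrable lborel (\<lambda>\<sigma>::real. indicat_real {0<..<1} \<sigma> * C)"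
      by (intro integrable_mult_left integrable_real_indicator) auto
    have i: "integrable lborel (\<lambda>\<sigma>. P \<sigma> r)" if "r \<in> {0<..<p}" for r
      using Ple[OF that] by (intro Bochner_Integration.integrable_bound[OF iC]) (auto intro!: AE_I2 order_trans[OF Ple[OF that]])
    have le: "(\<integral>\<sigma>. norm (P \<sigma> r) \<partial>lborel) \<le> C" if "r \<in> {0<..<p}" for r
    proof -
      have "(\<integral>\<sigma>. norm (P \<sigma> r) \<partial>lborel) \<le> (\<integral>\<sigma>. indicat_real {0<..<1::real} \<sigma> * C \<partial>lborel)"
        using that by (intro integral_mono integrable_norm i iC Ple)
      then show ?thesis by simp
    qed
    have c: "set_integrable lborel {0<..<p} (\<lambda>_. C)"
      by (rule set_integrable_bounded_Ioo[where C = "norm C"]) auto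
    note sw = swap_integrals[of P "{0<..<p}" "\<lambda>_. C", OF _ _ i le c]
    have eq: "indicat_real {0<..<1} \<sigma> *\<^sub>R (\<sigma> ^ n *\<^sub>R f (\<sigma> * p)) =
        (indicat_real {0<..<1} \<sigma> * \<sigma> ^ n) *\<^sub>R f 0 + (LINT r:{0<..<p}|lborel. P \<sigma> r)" for \<sigma>
    proof (cases "\<sigma> \<in> {0<..<1}")
      case True
      have "\<sigma> * p \<in> {0..T}" using True p mult_left_le_one_le[of p \<sigma>] by auto
      then have "f (\<sigma> * p) = f 0 + (LINT s:{0<..<\<sigma> * p}|lborel. g s)" by (rule ftc)
      also have "(LINT s:{0<..<\<sigma> * p}|lborel. g s) = \<sigma> *\<^sub>R (LINT r:{0<..<p}|lborel. g (\<sigma> * r))"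
        unfolding set_lebesgue_integral_def using True
        by (subst lborel_integral_real_affine[where c = \<sigma> and t = 0])
           (auto intro!: Bochner_Integration.integral_cong simp: indicator_def zero_less_mult_iff)
      finally show ?thesis using True by (simp add: P_def scaleR_add_right)
    qed (simp add: P_def)
    have "avg n f p = (\<integral>\<sigma>. (indicat_real {0<..<1} \<sigma> * \<sigma> ^ n) *\<^sub>R f 0 \<partial>lborel) + (\<integral>\<sigma>. (LINT r:{0<..<p}|lborel. P \<sigma> r) \<partial>lborel)"
      unfolding avg_def set_lebesgue_integral_def[of lborel "{0<..<1}"] eq
    proof (rule Bochner_Integration.integral_add)
      show "integrable lborel (\<lambda>\<sigma>. (indicat_real {0<..<1} \<sigma> * \<sigma> ^ n) *\<^sub>R f 0)"
        using set_integrable_power[of n] by (intro integrable_scaleR_left) (simp add: set_integrable_def)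
      show "integrable lborel (\<lambda>\<sigma>. LINT r:{0<..<p}|lborel. P \<sigma> r)" by (rule sw(2)) auto
    qed
    also have "(\<integral>\<sigma>. (LINT r:{0<..<p}|lborel. P \<sigma> r) \<partial>lborel) = (LINT r:{0<..<p}|lborel. avg (Suc n) g r)"
      by (subst sw(1)) (auto simp: P_def avg_def set_lebesgue_integral_def)
    also have "(\<integral>\<sigma>. (indicat_real {0<..<1} \<sigma> * \<sigma> ^ n) *\<^sub>R f 0 \<partial>lborel) = avg n f 0"
      by (simp add: avg_def set_lebesgue_integral_def)
    finally show "avg n f p = avg n f 0 + (LINT r:{0<..<p}|lborel. avg (Suc n) g r)" .
  qed
qed

section \<open>The quadratic system\<close>

text \<open>From \<delta> |k| \<le> exp (\<delta> |k|): a multiplier of order one costs 1 / \<delta>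
  when the weight exponent drops by \<delta>. The quadratic Taylor bound of exp gives the analogue
  of order two below.\<close>

lemma bnd_loss1:
  fixes F :: "real ^ 'n \<Rightarrow> complex"
  assumes F: "bnd (b + \<delta>) E F" and "0 < \<delta>" and [measurable]: "m \<in> borel_measurable borel"
    and m: "\<And>k. norm (m k) \<le> c * norm k" and "0 \<le> c"
  shows "bnd b (c / \<delta> * E) (\<lambda>k. m k * F k)"
proof (rule bnd_dominated[OF F])
  have [measurable]: "F \<in> borel_measurable borel" using F by (rule bnd_meas)
  show "(\<lambda>k. m k * F k) \<in> borel_measurable borel" by measurable
  fix k :: "real ^ 'n"
  have "\<delta> * norm k \<le> exp (\<delta> * norm k)" using exp_ge_add_one_self[of "\<delta> * norm k"] by linarith
  then have "c * norm k \<le> c / \<delta> * exp (\<delta> * norm k)"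
    using assms(2,5) mult_left_mono[of "\<delta> * norm k" "exp (\<delta> * norm k)" "c / \<delta>"] by simp
  then have "norm (m k) \<le> c / \<delta> * exp (\<delta> * norm k)" using m[of k] by linarith
  then have "norm (m k) * (norm (F k) * exp (b * norm k)) \<le> c / \<delta> * exp (\<delta> * norm k) * (norm (F k) * exp (b * norm k))"
    by (rule mult_right_mono) simp
  moreover have e: "exp ((b + \<delta>) * norm k) = exp (\<delta> * norm k) * exp (b * norm k)"
    by (simp flip: exp_add add: algebra_simps)
  ultimately show "norm (m k * F k) * exp (b * norm k) \<le> c / \<delta> * (norm (F k) * exp ((b + \<delta>) * norm k))"
    unfolding e by (simp add: norm_mult mult_ac)
qed (use assms in auto)

lemma bnd_loss2:
  fixes F :: "real ^ 'n \<Rightarrow> complex"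
  assumes F: "bnd (b + \<delta>) E F" and "0 < \<delta>" and "0 \<le> \<kappa>"
  shows "bnd b (2 * \<kappa> / \<delta>\<^sup>2 * E) (\<lambda>k. of_real (\<kappa> * (norm k)\<^sup>2) * F k)"
proof (rule bnd_dominated[OF F])
  have [measurable]: "F \<in> borel_measurable borel" using F by (rule bnd_meas)
  show "(\<lambda>k. of_real (\<kappa> * (norm k)\<^sup>2) * F k) \<in> borel_measurable borel" by measurable
  fix k :: "real ^ 'n"
  have "(\<delta> * norm k)\<^sup>2 / 2 \<le> exp (\<delta> * norm k)" 
    using exp_lower_Taylor_quadratic[of "\<delta> * norm k"] assms(2) by (smt (verit) mult_nonneg_nonneg norm_ge_zero)
  then have "2 * \<kappa> / \<delta>\<^sup>2 * ((\<delta> * norm k)\<^sup>2 / 2) \<le> 2 * \<kappa> / \<delta>\<^sup>2 * exp (\<delta> * norm k)"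
    using assms(2,3) by (intro mult_left_mono) auto
  then have "\<kappa> * (norm k)\<^sup>2 \<le> 2 * \<kappa> / \<delta>\<^sup>2 * exp (\<delta> * norm k)"
    using assms(2) by (simp add: power_mult_distrib)
  then have "\<kappa> * (norm k)\<^sup>2 * (norm (F k) * exp (b * norm k)) \<le> 2 * \<kappa> / \<delta>\<^sup>2 * exp (\<delta> * norm k) * (norm (F k) * exp (b * norm k))"
    by (rule mult_right_mono) simp
  moreover have e: "exp ((b + \<delta>) * norm k) = exp (\<delta> * norm k) * exp (b * norm k)"
    by (simp flip: exp_add add: algebra_simps)
  ultimately show "norm (of_real (\<kappa> * (norm k)\<^sup>2) * F k) * exp (b * norm k) \<le> 2 * \<kappa> / \<delta>\<^sup>2 * (norm (F k) * exp ((b + \<delta>) * norm k))"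
    unfolding e using assms(3) by (simp add: norm_mult mult_ac norm_power)
qed (use assms in auto)

text \<open>Each of the n products j! (n - 1 - j)! is at most (n - 1)!, so their sum is at most n!.
  Compared with \<open>x n\<close> one factor D / d^2 is missing; D \<ge> 1 and d \<le> \<beta>
  supply it at the cost of \<beta>^2.\<close>

lemma sum_factorial_convolution:
  assumes "D \<ge> 1" "0 < d" "d \<le> \<beta>" "0 \<le> (B::real)"
  defines "x \<equiv> \<lambda>n. B * fact n * D ^ n / d ^ (2 * n)"
  shows "(\<Sum>j<n. x j * x (n - 1 - j)) \<le> B * \<beta>\<^sup>2 * x n"
proof (cases n)
  case 0 then show ?thesis using assms by (simp add: x_def)
next
  case (Suc m)
  have "x j * x (m - j) \<le> B * B * fact m * (D ^ m / d ^ (2 * m))" if j: "j \<le> m" for j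
  proof -
    have "(fact j * fact (m - j) :: nat) dvd fact m"
      using binomial_fact_lemma[OF j] by (metis dvd_triv_left)
    then have "(fact j * fact (m - j) :: nat) \<le> fact m" by (rule dvd_imp_le) simp
    then have f: "(fact j * fact (m - j) :: real) \<le> fact m"
      by (metis of_nat_fact of_nat_le_iff of_nat_mult)
    have e: "D ^ m = D ^ j * D ^ (m - j)" "d ^ (2 * m) = d ^ (2 * j) * d ^ (2 * (m - j))"
      using j by (simp_all flip: power_add add: algebra_simps)
    have "x j * x (m - j) = B * B * (fact j * fact (m - j)) * (D ^ m / d ^ (2 * m))"
      unfolding x_def e by simp
    also have "\<dots> \<le> B * B * fact m * (D ^ m / d ^ (2 * m))"
      using f assms by (intro mult_right_mono mult_left_mono) auto
    finally show ?thesis .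
  qed
  then have "(\<Sum>j<n. x j * x (n - 1 - j)) \<le> (\<Sum>j<n. B * B * fact m * (D ^ m / d ^ (2 * m)))"
    using Suc by (intro sum_mono) auto
  also have "\<dots> = B * B * fact n * (D ^ m / d ^ (2 * m)) * 1" using Suc by simp
  also have "\<dots> \<le> B * B * fact n * (D ^ m / d ^ (2 * m)) * (D * (\<beta>\<^sup>2 / d\<^sup>2))"
  proof (rule mult_left_mono)
    have "1 \<le> \<beta>\<^sup>2 / d\<^sup>2" using assms by (simp add: power_mono)
    then show "1 \<le> D * (\<beta>\<^sup>2 / d\<^sup>2)" using assms mult_mono[of 1 D 1 "\<beta>\<^sup>2 / d\<^sup>2"] by simp
  qed (use assms in auto)
  also have "\<dots> = B * \<beta>\<^sup>2 * x n"
    unfolding x_def Suc by (simp add: power2_eq_square mult_ac)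
  finally show ?thesis .
qed

text \<open>A bound, uniform in n, for the cost of shrinking the distance d to d (n + 1) / (n + 2)
  in d^(-2n).\<close>

lemma exp2_bound: "((real n + 2) / (real n + 1)) ^ (2 * n) \<le> exp 2"
proof -
  have "(real n + 2) / (real n + 1) = 1 + 1 / (real n + 1)" by (simp add: field_simps)
  also have "\<dots> \<le> exp (1 / (real n + 1))" by (rule exp_ge_add_one_self)
  finally have "((real n + 2) / (real n + 1)) ^ (2 * n) \<le> exp (1 / (real n + 1)) ^ (2 * n)"
    by (rule power_mono) simp
  also have "\<dots> = exp (real (2 * n) * (1 / (real n + 1)))" by (rule exp_of_nat_mult[symmetric])
  also have "\<dots> \<le> exp 2" by (simp add: field_simps)
  finally show ?thesis .
qed

text \<open>The index i runs over the unknowns. \<open>\<kappa>\<close> holds the diffusivities,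
  \<open>M\<close> the bilinear multipliers of order one (transport and projection),
  \<open>N\<close> the bounded linear ones (buoyancy), \<open>W0\<close> the initial data and
  \<open>Y0\<close> the Borel transforms. The integral equation joins in a later extension; the
  recursion for the derivatives can be set up and estimated without it.\<close>

locale quad_system =
  fixes \<kappa> :: "'i :: finite \<Rightarrow> real" and M :: "'i \<Rightarrow> 'i \<Rightarrow> 'i \<Rightarrow> real ^ 'n \<Rightarrow> complex"
    and N :: "'i \<Rightarrow> 'i \<Rightarrow> real ^ 'n \<Rightarrow> complex" and W0 :: "'i \<Rightarrow> real ^ 'n \<Rightarrow> complex"
    and Y0 :: "'i \<Rightarrow> real ^ 'n \<Rightarrow> real \<Rightarrow> complex" and cM cN A \<beta> :: real
  assumes \<kappa>: "0 < \<kappa> i"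
    and M_meas[measurable]: "M i l m \<in> borel_measurable borel"
    and M_le: "norm (M i l m k) \<le> cM * norm k" and cM: "0 \<le> cM"
    and N_meas[measurable]: "N i l \<in> borel_measurable borel"
    and N_le: "norm (N i l k) \<le> cN" and cN: "0 \<le> cN"
    and W0: "bnd \<beta> A (W0 l)" and \<beta>: "0 < \<beta>"
    and Y0_meas: "(\<lambda>(k, p). Y0 i k p) \<in> borel_measurable (borel \<Otimes>\<^sub>M borel)"
begin

text \<open>The sum consists of the boundary terms that arise when a convolution over \<open>[0, p]\<close> is differentiated \<open>n\<close> times.\<close>

definition conv :: "nat \<Rightarrow> (nat \<Rightarrow> 'i \<Rightarrow> real ^ 'n \<Rightarrow> real \<Rightarrow> complex) \<Rightarrow> 'i \<Rightarrow> 'i \<Rightarrow> real ^ 'n \<Rightarrow> real \<Rightarrow> complex" where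
  "conv n Y l m k p = fconv (W0 l) (\<lambda>k. Y n m k p) k + fconv (\<lambda>k. Y n l k p) (W0 m) k
     + (\<Sum>j<n. fconv (\<lambda>k. Y j l k 0) (\<lambda>k. Y (n - 1 - j) m k p) k) + fpconv (Y n l) (Y 0 m) k p"

definition R :: "nat \<Rightarrow> (nat \<Rightarrow> 'i \<Rightarrow> real ^ 'n \<Rightarrow> real \<Rightarrow> complex) \<Rightarrow> 'i \<Rightarrow> real ^ 'n \<Rightarrow> real \<Rightarrow> complex" where
  "R n Y i k p = (\<Sum>l\<in>UNIV. \<Sum>m\<in>UNIV. M i l m k * conv n Y l m k p) + (\<Sum>l\<in>UNIV. N i l k * Y n l k p)"

text \<open>The difference is spelled as a sum with a multiple by - 1, so that the closure rules for
  sums and multiples (\<open>bnd_add\<close>, \<open>bnd_mult\<close>, \<open>prim_add\<close>,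
  \<open>prim_cmult\<close>) cover it.\<close>

definition Q :: "nat \<Rightarrow> (nat \<Rightarrow> 'i \<Rightarrow> real ^ 'n \<Rightarrow> real \<Rightarrow> complex) \<Rightarrow> 'i \<Rightarrow> real ^ 'n \<Rightarrow> real \<Rightarrow> complex" where
  "Q n Y i k p = R n Y i k p + - 1 * (of_real (\<kappa> i * (norm k)\<^sup>2) * Y n i k p)"

lemma Q_cong: "(\<And>j. j \<le> n \<Longrightarrow> Y j = Y' j) \<Longrightarrow> Q n Y = Q n Y'"
  unfolding Q_def[abs_def] R_def conv_def by (auto intro!: ext sum.cong)

text \<open>The \<open>n\<close>-th derivative in \<open>p\<close>.  The case distinction only serves termination; it disappears in \<open>Y_Suc\<close>.\<close>

fun Y :: "nat \<Rightarrow> 'i \<Rightarrow> real ^ 'n \<Rightarrow> real \<Rightarrow> complex" where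
  "Y 0 = Y0"
| "Y (Suc n) = (\<lambda>i k. avg (Suc n) (Q n (\<lambda>j. if j \<le> n then Y j else Y0) i k))"

declare Y.simps(2)[simp del]

lemma Y_Suc: "Y (Suc n) i k = avg (Suc n) (Q n Y i k)"
  using Q_cong[of n "\<lambda>j. if j \<le> n then Y j else Y0" Y] by (simp add: Y.simps(2))

lemma W0_meas: "W0 l \<in> borel_measurable borel"
  by (rule bnd_meas[OF W0])

lemma A_nonneg: "0 \<le> A"
  using bnd_nonneg[OF W0] .

lemma conv_meas:
  assumes "\<And>j i. j \<le> n \<Longrightarrow> (\<lambda>(k, p). Y j i k p) \<in> borel_measurable (borel \<Otimes>\<^sub>M borel)"
  shows "(\<lambda>(k, p). conv n Y l m k p) \<in> borel_measurable (borel \<Otimes>\<^sub>M borel)"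
proof -
  have 1[measurable]: "(\<lambda>(k, p). fconv (W0 l) (\<lambda>k. Y n m k p) k) \<in> borel_measurable (borel \<Otimes>\<^sub>M borel)"
    by (intro measurable_fconv_left W0_meas assms order_refl)
  have 2[measurable]: "(\<lambda>(k, p). fconv (\<lambda>k. Y n l k p) (W0 m) k) \<in> borel_measurable (borel \<Otimes>\<^sub>M borel)"
    by (intro measurable_fconv_right W0_meas assms order_refl)
  have 3: "(\<lambda>(k, p). fconv (\<lambda>k. Y j l k 0) (\<lambda>k. Y (n - 1 - j) m k p) k) \<in> borel_measurable (borel \<Otimes>\<^sub>M borel)" if "j < n" for j
    using that by (intro measurable_fconv_left tb_meas1(2) assms) auto
  have [measurable]: "(\<lambda>(k, p). \<Sum>j<n. fconv (\<lambda>k. Y j l k 0) (\<lambda>k. Y (n - 1 - j) m k p) k) \<in> borel_measurable (borel \<Otimes>\<^sub>M borel)"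
    using 3 by (simp add: case_prod_beta') 
  have 4[measurable]: "(\<lambda>(k, p). fpconv (Y n l) (Y 0 m) k p) \<in> borel_measurable (borel \<Otimes>\<^sub>M borel)"
    by (intro measurable_fpconv assms) auto
  show ?thesis unfolding conv_def by measurable
qed

lemma Q_meas:
  assumes "\<And>j i. j \<le> n \<Longrightarrow> (\<lambda>(k, p). Y j i k p) \<in> borel_measurable (borel \<Otimes>\<^sub>M borel)"
  shows "(\<lambda>(k, p). Q n Y i k p) \<in> borel_measurable (borel \<Otimes>\<^sub>M borel)"
proof -
  note [measurable] = conv_meas[OF assms] assms[OF order_refl]
  show ?thesis unfolding Q_def R_def by measurable
qed

lemma Y_meas: "(\<lambda>(k, p). Y n i k p) \<in> borel_measurable (borel \<Otimes>\<^sub>M borel)"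
proof (induction n arbitrary: i rule: less_induct)
  case (less n)
  show ?case
  proof (cases n)
    case 0 then show ?thesis using Y0_meas by simp
  next
    case (Suc m)
    show ?thesis unfolding Suc Y_Suc
      by (intro measurable_avg Q_meas less) (use Suc in auto)
  qed
qed

lemma bnd_conv:
  assumes x: "\<And>j q l. j \<le> n \<Longrightarrow> q \<in> {0..T} \<Longrightarrow> bnd b (x j) (\<lambda>k. Y j l k q)"
    and b: "0 \<le> b" "b \<le> \<beta>" and p: "p \<in> {0..T}"
  shows "bnd b (2 * A * x n + (\<Sum>j<n. x j * x (n - 1 - j)) + T * (x n * x 0)) (\<lambda>k. conv n Y l m k p)"
proof -
  have W: "bnd b A (W0 l)" for l using bnd_mono_b[OF W0 b(2)] .
  have x0: "0 \<le> x j" if "j \<le> n" for j using bnd_nonneg[OF x[OF that p]] .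
  have f: "bnd b ((\<integral>s\<in>{0<..<p}. x n * x 0 \<partial>lborel)) (\<lambda>k. fpconv (Y n l) (Y 0 m) k p)"
  proof (rule bnd_fpconv[OF Y_meas Y_meas _ _ _ b(1)])
    show "AE s in lborel. 0 < s \<and> s < p \<longrightarrow> bnd b (x n) (\<lambda>k. Y n l k (p - s))"
      using p by (auto intro!: AE_I2 x)
    show "AE s in lborel. 0 < s \<and> s < p \<longrightarrow> bnd b (x 0) (\<lambda>k. Y 0 m k s)"
      using p by (auto intro!: AE_I2 x simp del: Y.simps)
    show "set_integrable lborel {0<..<p} (\<lambda>s. x n * x 0)"
      by (rule set_integrable_bounded_Ioo[where C = "norm (x n * x 0)"]) auto
  qed
  have "(\<integral>s\<in>{0<..<p}. x n * x 0 \<partial>lborel) = p * (x n * x 0)"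
    using p by (simp add: set_lebesgue_integral_def)
  also have "\<dots> \<le> T * (x n * x 0)" using p x0 by (intro mult_right_mono) auto
  finally have f': "bnd b (T * (x n * x 0)) (\<lambda>k. fpconv (Y n l) (Y 0 m) k p)"
    using bnd_mono[OF f] by blast
  have s: "bnd b (\<Sum>j<n. x j * x (n - 1 - j)) (\<lambda>k. \<Sum>j<n. fconv (\<lambda>k. Y j l k 0) (\<lambda>k. Y (n - 1 - j) m k p) k)"
    using p by (intro bnd_sum bnd_fconv x b) auto
  have "bnd b (A * x n + x n * A + (\<Sum>j<n. x j * x (n - 1 - j)) + T * (x n * x 0)) (\<lambda>k. conv n Y l m k p)"
    unfolding conv_def using p by (intro bnd_add s f' bnd_fconv x b W) auto
  then show ?thesis by (simp add: algebra_simps)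
qed

definition cI :: real where "cI = real CARD('i)"
definition \<kappa>m :: real where "\<kappa>m = (\<Sum>i\<in>UNIV. \<kappa> i)"

lemma \<kappa>m: "\<kappa> i \<le> \<kappa>m"
  unfolding \<kappa>m_def using \<kappa> by (intro member_le_sum) (auto intro: less_imp_le)

lemma \<kappa>m_pos: "0 < \<kappa>m" using \<kappa>m[of undefined] \<kappa>[of undefined] by linarith

lemma cI: "0 \<le> cI" by (simp add: cI_def)

lemma bnd_Q:
  assumes c: "\<And>l m. bnd (b + \<delta>) E (\<lambda>k. conv n Y l m k p)" and y: "\<And>l. bnd (b + \<delta>) X (\<lambda>k. Y n l k p)"
    and \<delta>: "0 < \<delta>"
  shows "bnd b (cI\<^sup>2 * (cM / \<delta>) * E + cI * cN * X + 2 * \<kappa>m / \<delta>\<^sup>2 * X) (\<lambda>k. Q n Y i k p)"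
proof -
  have X: "0 \<le> X" using bnd_nonneg[OF y] .
  have y': "bnd b X (\<lambda>k. Y n l k p)" for l using \<delta> by (intro bnd_mono_b[OF y]) simp
  have "bnd b (2 * \<kappa> i / \<delta>\<^sup>2 * X) (\<lambda>k. of_real (\<kappa> i * (norm k)\<^sup>2) * Y n i k p)"
    using \<kappa>[of i] by (intro bnd_loss2[OF y \<delta>]) simp
  moreover have "2 * \<kappa> i / \<delta>\<^sup>2 * X \<le> 2 * \<kappa>m / \<delta>\<^sup>2 * X"
    using \<kappa>m[of i] X by (intro mult_right_mono divide_right_mono mult_left_mono) auto
  ultimately have 1: "bnd b (2 * \<kappa>m / \<delta>\<^sup>2 * X) (\<lambda>k. of_real (\<kappa> i * (norm k)\<^sup>2) * Y n i k p)"
    by (rule bnd_mono)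
  then have 1: "bnd b (1 * (2 * \<kappa>m / \<delta>\<^sup>2 * X)) (\<lambda>k. - 1 * (of_real (\<kappa> i * (norm k)\<^sup>2) * Y n i k p))"
    by (rule bnd_mult) auto
  have 2: "bnd b (\<Sum>l\<in>(UNIV::'i set). cN * X) (\<lambda>k. \<Sum>l\<in>UNIV. N i l k * Y n l k p)"
    by (intro bnd_sum bnd_mult[OF y'] N_le cN N_meas) auto
  have 3: "bnd b (\<Sum>l\<in>(UNIV::'i set). \<Sum>m\<in>(UNIV::'i set). cM / \<delta> * E) (\<lambda>k. \<Sum>l\<in>UNIV. \<Sum>m\<in>UNIV. M i l m k * conv n Y l m k p)"
    by (intro bnd_sum bnd_loss1[OF c \<delta>] M_le cM M_meas) auto
  have "bnd b ((\<Sum>l\<in>(UNIV::'i set). \<Sum>m\<in>(UNIV::'i set). cM / \<delta> * E) + (\<Sum>l\<in>(UNIV::'i set). cN * X) + 1 * (2 * \<kappa>m / \<delta>\<^sup>2 * X)) (\<lambda>k. Q n Y i k p)"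
    unfolding Q_def R_def by (intro bnd_add 1 2 3)
  then show ?thesis by (simp add: cI_def power2_eq_square mult_ac)
qed

text \<open>Induction over a scale of norms. To pass from m to m + 1 at b, the hypothesis is used at
  b + \<delta> with \<delta> = (\<beta>1 - b) / (m + 2). The diffusion term then costs a multiple of
  (m + 2)^2 / (\<beta>1 - b)^2, the average gives back m + 2, and the linear growth that is left
  fits into (m + 1)!. The exponent 2 n of \<beta>1 - b comes from the order two of this
  term.\<close>

lemma Y_bound:
  assumes B: "\<And>p i. p \<in> {0..T} \<Longrightarrow> bnd \<beta>1 B (\<lambda>k. Y0 i k p)" and \<beta>1: "0 < \<beta>1" "\<beta>1 \<le> \<beta>" and T: "0 \<le> T"
  shows "\<exists>D\<ge>1. \<forall>n b p i. 0 \<le> b \<longrightarrow> b < \<beta>1 \<longrightarrow> p \<in> {0..T} \<longrightarrow>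
    bnd b (B * fact n * D ^ n / (\<beta>1 - b) ^ (2 * n)) (\<lambda>k. Y n i k p)"
proof -
  have B0: "0 \<le> B" using bnd_nonneg[OF B[of 0]] T by auto
  \<comment> \<open>Bound for the convolution terms relative to \<open>x m\<close>: products with
    the data give 2 A, the boundary sum gives B \<beta>1^2 by
    \<open>sum_factorial_convolution\<close>, and the integral over [0, p] gives T B, since
    \<open>x 0\<close> = B.\<close>
  define E0 where "E0 = 2 * A + B * \<beta>1\<^sup>2 + T * B"
  \<comment> \<open>The factor exp 2 pays for evaluating the hypothesis at b + \<delta>; the
    constant 4 \<kappa>m is 2 \<kappa>m doubled, because m + 2 \<le> 2 (m + 1).\<close>
  define D where "D = max 1 (exp 2 * (cI\<^sup>2 * cM * E0 * \<beta>1 + cI * cN * \<beta>1\<^sup>2 + 4 * \<kappa>m))"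
  have E0: "0 \<le> E0" using A_nonneg B0 T by (simp add: E0_def)
  have D1: "1 \<le> D" by (simp add: D_def)
  have main: "\<forall>b p i. 0 \<le> b \<longrightarrow> b < \<beta>1 \<longrightarrow> p \<in> {0..T} \<longrightarrow>
    bnd b (B * fact n * D ^ n / (\<beta>1 - b) ^ (2 * n)) (\<lambda>k. Y n i k p)" for n
  proof (induction n rule: less_induct)
    case (less n)
    show ?case
    proof (cases n)
      case 0
      then show ?thesis by (auto intro!: bnd_mono_b[OF B])
    next
      case (Suc m)
      show ?thesis
      proof (intro allI impI)
        fix b p i assume b: "0 \<le> b" "b < \<beta>1" and p: "p \<in> {0..T}"
        define d where "d = \<beta>1 - b"
        define \<delta> where "\<delta> = d / (real m + 2)"
        define d' where "d' = d - \<delta>"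
        define x where "x = (\<lambda>n. B * fact n * D ^ n / d' ^ (2 * n))"
        define z where "z = B * fact m * D ^ m / d ^ (2 * m)"
        have d: "0 < d" "d \<le> \<beta>1" using b by (auto simp: d_def)
        have \<delta>: "0 < \<delta>" using d by (simp add: \<delta>_def)
        have d'eq: "d' = d * (real m + 1) / (real m + 2)" by (simp add: d'_def \<delta>_def field_simps)
        have d': "0 < d'" using d by (simp add: d'eq)
        have d'\<beta>: "d' \<le> \<beta>1" using \<delta> d by (simp add: d'_def)
        have z0: "0 \<le> z" using B0 D1 d by (simp add: z_def)
        have x0: "0 \<le> x m" using B0 D1 d' by (simp add: x_def)
        have IH: "bnd (b + \<delta>) (x j) (\<lambda>k. Y j l k q)" if "j \<le> m" "q \<in> {0..T}" for j q l
        proof -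
          have "\<beta>1 - (b + \<delta>) = d'" by (simp add: d'_def d_def)
          then show ?thesis using less[of j] Suc that b \<delta> d' by (auto simp: x_def)
        qed
        have xz: "x m \<le> exp 2 * z"
        proof -
          have "d ^ (2 * m) / d' ^ (2 * m) = ((real m + 2) / (real m + 1)) ^ (2 * m)"
          proof -
            have "d / d' = (real m + 2) / (real m + 1)" unfolding d'eq using d by simp
            then show ?thesis by (simp only: power_divide[symmetric])
          qed
          also have "\<dots> \<le> exp 2" by (rule exp2_bound)
          finally have "d ^ (2 * m) / d' ^ (2 * m) \<le> exp 2" .
          then have "z * (d ^ (2 * m) / d' ^ (2 * m)) \<le> z * exp 2" using z0 by (rule mult_left_mono)
          moreover have "z * (d ^ (2 * m) / d' ^ (2 * m)) = x m" using d by (simp add: z_def x_def)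
          ultimately show ?thesis by (simp add: mult.commute)
        qed
        have E: "2 * A * x m + (\<Sum>j<m. x j * x (m - 1 - j)) + T * (x m * x 0) \<le> E0 * x m"
        proof -
          have s: "(\<Sum>j<m. x j * x (m - 1 - j)) \<le> B * \<beta>1\<^sup>2 * x m"
            unfolding x_def by (rule sum_factorial_convolution[OF D1 d' d'\<beta> B0])
          have e: "x 0 = B" by (simp add: x_def)
          have "E0 * x m = 2 * A * x m + B * \<beta>1\<^sup>2 * x m + T * (x m * x 0)"
            unfolding e by (simp add: E0_def algebra_simps)
          then show ?thesis using s by linarith
        qed
        have "b + \<delta> \<le> \<beta>" "0 \<le> b + \<delta>" using b \<beta>1 \<delta> d' by (auto simp: d'_def d_def)
        then have cv: "bnd (b + \<delta>) (E0 * x m) (\<lambda>k. conv m Y l r k q)" if "q \<in> {0..T}" for l r q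
          by (intro bnd_mono[OF bnd_conv[OF IH _ _ that] E]) auto
        have "bnd b (cI\<^sup>2 * (cM / \<delta>) * (E0 * x m) + cI * cN * x m + 2 * \<kappa>m / \<delta>\<^sup>2 * x m) (\<lambda>k. Q m Y i k q)" if "q \<in> {0..T}" for q
          using that by (intro bnd_Q cv IH \<delta>) auto
        then have "bnd b ((cI\<^sup>2 * (cM / \<delta>) * (E0 * x m) + cI * cN * x m + 2 * \<kappa>m / \<delta>\<^sup>2 * x m) / real (Suc (Suc m)))
            (\<lambda>k. avg (Suc m) (Q m Y i k) p)"
          using p by (intro bnd_avg Q_meas Y_meas) auto
        moreover have "(cI\<^sup>2 * (cM / \<delta>) * (E0 * x m) + cI * cN * x m + 2 * \<kappa>m / \<delta>\<^sup>2 * x m) / real (Suc (Suc m))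
            \<le> B * fact n * D ^ n / d ^ (2 * n)"
        proof -
          define u where "u = real m + 1"
          have u: "1 \<le> u" "real (Suc (Suc m)) = u + 1" "\<delta> = d / (u + 1)"
            by (simp_all add: u_def \<delta>_def add_ac)
          have "(cI\<^sup>2 * (cM / \<delta>) * (E0 * x m) + cI * cN * x m + 2 * \<kappa>m / \<delta>\<^sup>2 * x m) / (u + 1)
            = x m * (cI\<^sup>2 * cM * E0 / d + cI * cN / (u + 1) + 2 * \<kappa>m * (u + 1) / d\<^sup>2)"
          proof -
            have alg: "(a * (c / (d / w)) * (E * y) + e * y + 2 * h / (d / w)\<^sup>2 * y) / w
              = y * (a * c * E / d + e / w + 2 * h * w / d\<^sup>2)" if "w \<noteq> 0" "d \<noteq> 0" for a c d w E y e h :: real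
              using that by (simp add: field_simps power2_eq_square)
            show ?thesis unfolding u(3) by (rule alg) (use d u(1) in auto)
          qed
          also have "\<dots> \<le> x m * (u / d\<^sup>2 * (cI\<^sup>2 * cM * E0 * \<beta>1 + cI * cN * \<beta>1\<^sup>2 + 4 * \<kappa>m))"
          proof (rule mult_left_mono[OF _ x0])
            have 1: "cI\<^sup>2 * cM * E0 / d \<le> u / d\<^sup>2 * (cI\<^sup>2 * cM * E0 * \<beta>1)"
            proof -
              have "cI\<^sup>2 * cM * E0 / d = cI\<^sup>2 * cM * E0 / d\<^sup>2 * (1 * d)" using d by (simp add: power2_eq_square)
              also have "\<dots> \<le> cI\<^sup>2 * cM * E0 / d\<^sup>2 * (u * \<beta>1)"
                using d u cM E0 by (intro mult_left_mono mult_mono) auto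
              finally show ?thesis by (simp add: mult_ac)
            qed
            have 2: "cI * cN / (u + 1) \<le> u / d\<^sup>2 * (cI * cN * \<beta>1\<^sup>2)"
            proof -
              have "cI * cN / (u + 1) \<le> cI * cN / 1"
                using u cI cN by (intro divide_left_mono) auto
              also have "\<dots> = cI * cN / d\<^sup>2 * (1 * d\<^sup>2)" using d by simp
              also have "\<dots> \<le> cI * cN / d\<^sup>2 * (u * \<beta>1\<^sup>2)"
                using d u cI cN by (intro mult_left_mono mult_mono power_mono) auto
              finally show ?thesis by (simp add: mult_ac)
            qed
            have 3: "2 * \<kappa>m * (u + 1) / d\<^sup>2 \<le> u / d\<^sup>2 * (4 * \<kappa>m)"
            proof -
              have "2 * \<kappa>m * (u + 1) \<le> 2 * \<kappa>m * (2 * u)" using u \<kappa>m_pos by (intro mult_left_mono) auto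
              then have "2 * \<kappa>m * (u + 1) / d\<^sup>2 \<le> 2 * \<kappa>m * (2 * u) / d\<^sup>2" by (rule divide_right_mono) simp
              then show ?thesis by (simp add: mult_ac)
            qed
            show "cI\<^sup>2 * cM * E0 / d + cI * cN / (u + 1) + 2 * \<kappa>m * (u + 1) / d\<^sup>2
              \<le> u / d\<^sup>2 * (cI\<^sup>2 * cM * E0 * \<beta>1 + cI * cN * \<beta>1\<^sup>2 + 4 * \<kappa>m)"
              unfolding distrib_left[of "u / d\<^sup>2"] by (intro add_mono 1 2 3)
          qed
          also have "\<dots> \<le> exp 2 * z * (u / d\<^sup>2 * (cI\<^sup>2 * cM * E0 * \<beta>1 + cI * cN * \<beta>1\<^sup>2 + 4 * \<kappa>m))"
            using xz u cI cN cM E0 \<beta>1 \<kappa>m_pos by (intro mult_right_mono) auto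
          also have "\<dots> = z * (u / d\<^sup>2) * (exp 2 * (cI\<^sup>2 * cM * E0 * \<beta>1 + cI * cN * \<beta>1\<^sup>2 + 4 * \<kappa>m))"
            by (simp add: mult_ac)
          also have "\<dots> \<le> z * (u / d\<^sup>2) * D"
            using z0 u by (intro mult_left_mono) (auto simp: D_def)
          also have "\<dots> = B * fact n * D ^ n / d ^ (2 * n)"
            unfolding Suc z_def u_def by (simp add: power2_eq_square mult_ac)
          finally show ?thesis unfolding u(2) .
        qed
        ultimately show "bnd b (B * fact n * D ^ n / (\<beta>1 - b) ^ (2 * n)) (\<lambda>k. Y n i k p)"
          unfolding d_def[symmetric] unfolding Suc Y_Suc by (rule bnd_mono)
      qed
    qed
  qed
  show ?thesis using D1 main by blast
qed

text \<open>Given the base case, differentiating \<open>Q m\<close> gives \<open>Q (Suc m)\<close>,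
  and \<open>prim_avg\<close> raises the exponent of \<sigma> accordingly. The induction is strong
  because the boundary sum contains derivatives of all lower orders.\<close>

lemma Y_prim:
  assumes X: "\<And>n i. tb 0 (X n) T (Y n i)"
    and base: "\<And>i k. k \<noteq> 0 \<Longrightarrow> prim T (Y0 i k) (Y 1 i k)"
  shows "k \<noteq> 0 \<Longrightarrow> prim T (Y n i k) (Y (Suc n) i k)"
proof (induction n arbitrary: i k rule: less_induct)
  case (less n)
  show ?case
  proof (cases n)
    case 0 then show ?thesis using base less by simp
  next
    case (Suc m)
    have IH: "prim T (Y j l k') (Y (Suc j) l k')" if "j \<le> m" "k' \<noteq> 0" for j l k'
      using less Suc that by auto
    have W: "bnd 0 A (W0 l)" for l by (rule bnd_mono_b[OF W0]) (use \<beta> in simp)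
    \<comment> \<open>\<open>fconv_prim\<close> differentiates the left factor; here the varying
      factor is the right one, so the convolution is commuted.\<close>
    have W0p: "prim T (\<lambda>p. fconv (W0 l) (\<lambda>k. Y m r k p) k) (\<lambda>p. fconv (W0 l) (\<lambda>k. Y (Suc m) r k p) k)" for l r
      using fconv_prim[OF X X W[of l] IH[OF order_refl, of _ r], of k]
      by (simp add: fconv_commute[OF W0_meas tb_meas1(2)[OF Y_meas]])
    have c: "prim T (conv m Y l r k) (conv (Suc m) Y l r k)" for l r
    proof -
      have s: "prim T (\<lambda>p. \<Sum>j<m. fconv (\<lambda>k. Y j l k 0) (\<lambda>k. Y (m - 1 - j) r k p) k)
          (\<lambda>p. \<Sum>j<m. fconv (\<lambda>k. Y j l k 0) (\<lambda>k. Y (m - j) r k p) k)"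
      proof (rule prim_sum)
        fix j assume j: "j \<in> {..<m}"
        show "prim T (\<lambda>p. fconv (\<lambda>k. Y j l k 0) (\<lambda>k. Y (m - 1 - j) r k p) k) (\<lambda>p. fconv (\<lambda>k. Y j l k 0) (\<lambda>k. Y (m - j) r k p) k)"
        proof (cases "0 \<le> T")
          case True
          then have b: "bnd 0 (X j) (\<lambda>k. Y j l k 0)" by (intro tb_bnd[OF X]) auto
          have e: "m - j = Suc (m - 1 - j)" using j by auto
          have le: "m - 1 - j \<le> m" by simp
          show ?thesis
            unfolding e using fconv_prim[OF X X b IH[OF le, of _ r], of k]
            by (simp add: fconv_commute[OF tb_meas1(2)[OF Y_meas] tb_meas1(2)[OF Y_meas], of j l])
        next
          \<comment> \<open>For T < 0 the intervals in \<open>prim\<close> are empty, and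
            measurability is all there is to show.\<close>
          case False
          then show ?thesis
            by (intro primI[where C = 0] tb_meas1(1)[OF measurable_fconv_left[OF tb_meas1(2)[OF Y_meas] Y_meas]]) auto
        qed
      qed simp
      \<comment> \<open>The boundary term that \<open>fpconv_prim\<close> produces, with
        \<open>Y m\<close> at 0 and \<open>Y 0\<close>, is the summand j = m that the sum in
        \<open>conv (Suc m)\<close> has in addition.\<close>
      have "prim T (\<lambda>p. fconv (W0 l) (\<lambda>k. Y m r k p) k + fconv (\<lambda>k. Y m l k p) (W0 r) k
         + (\<Sum>j<m. fconv (\<lambda>k. Y j l k 0) (\<lambda>k. Y (m - 1 - j) r k p) k) + fpconv (Y m l) (Y 0 r) k p)
        (\<lambda>p. fconv (W0 l) (\<lambda>k. Y (Suc m) r k p) k + fconv (\<lambda>k. Y (Suc m) l k p) (W0 r) k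
         + (\<Sum>j<m. fconv (\<lambda>k. Y j l k 0) (\<lambda>k. Y (m - j) r k p) k)
         + (fconv (\<lambda>k. Y m l k 0) (\<lambda>k. Y 0 r k p) k + fpconv (Y (Suc m) l) (Y 0 r) k p))"
        by (intro prim_add W0p s fconv_prim[OF X X W] fpconv_prim[OF X X X] IH order_refl)
      moreover have "(\<lambda>p. fconv (W0 l) (\<lambda>k. Y m r k p) k + fconv (\<lambda>k. Y m l k p) (W0 r) k
         + (\<Sum>j<m. fconv (\<lambda>k. Y j l k 0) (\<lambda>k. Y (m - 1 - j) r k p) k) + fpconv (Y m l) (Y 0 r) k p) = conv m Y l r k"
        by (simp add: conv_def fun_eq_iff)
      moreover have "(\<lambda>p. fconv (W0 l) (\<lambda>k. Y (Suc m) r k p) k + fconv (\<lambda>k. Y (Suc m) l k p) (W0 r) k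
         + (\<Sum>j<m. fconv (\<lambda>k. Y j l k 0) (\<lambda>k. Y (m - j) r k p) k)
         + (fconv (\<lambda>k. Y m l k 0) (\<lambda>k. Y 0 r k p) k + fpconv (Y (Suc m) l) (Y 0 r) k p)) = conv (Suc m) Y l r k"
        by (simp add: conv_def fun_eq_iff)
      ultimately show ?thesis by simp
    qed
    have "prim T (\<lambda>p. (\<Sum>l\<in>UNIV. \<Sum>r\<in>UNIV. M i l r k * conv m Y l r k p) + (\<Sum>l\<in>UNIV. N i l k * Y m l k p)
          + - 1 * (of_real (\<kappa> i * (norm k)\<^sup>2) * Y m i k p))
       (\<lambda>p. (\<Sum>l\<in>UNIV. \<Sum>r\<in>UNIV. M i l r k * conv (Suc m) Y l r k p) + (\<Sum>l\<in>UNIV. N i l k * Y (Suc m) l k p)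
          + - 1 * (of_real (\<kappa> i * (norm k)\<^sup>2) * Y (Suc m) i k p))"
      by (intro prim_add prim_sum prim_cmult c IH order_refl less.prems finite)
    then have "prim T (Q m Y i k) (Q (Suc m) Y i k)"
      by (simp only: Q_def[abs_def] R_def)
    then show ?thesis unfolding Suc Y_Suc by (rule prim_avg)
  qed
qed

end

section \<open>From the integral equation to a primitive\<close>

lemma measurable_w1[measurable]: "bes_w1 \<in> borel_measurable borel"
  by (intro borel_measurable_continuous_onI continuous_at_imp_continuous_on ballI DERIV_isCont[OF deriv_w1])

lemma measurable_j[measurable]: "bes_j \<in> borel_measurable borel"
  by (intro borel_measurable_continuous_onI continuous_at_imp_continuous_on ballI isCont_j)

lemma measurable_w2[measurable]: "bes_w2 \<in> borel_measurable borel"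
proof -
  have [measurable]: "bes_e \<in> borel_measurable borel"
    by (intro borel_measurable_continuous_onI continuous_at_imp_continuous_on ballI DERIV_isCont[OF deriv_e])
  show ?thesis unfolding bes_w2_def[abs_def] by measurable
qed

lemma measurable_K[measurable]:
  assumes [measurable]: "f \<in> borel_measurable N" "g \<in> borel_measurable N" "h \<in> borel_measurable N"
  shows "(\<lambda>x. bes_K (f x) (g x) (h x)) \<in> borel_measurable N"
  unfolding bes_K_def bes_D_def by measurable

lemma set_integral_eq_has_integral:
  fixes f :: "real \<Rightarrow> real"
  assumes "f \<in> borel_measurable borel" "\<And>s. s \<in> {a<..<b} \<Longrightarrow> norm (f s) \<le> C" "(f has_integral I) {a..b}"
  shows "(LINT s:{a<..<b}|lborel. f s) = I"
proof -
  have "(LINT s:{a<..<b}|lborel. f s) = integral {a<..<b} f"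
    by (rule set_borel_integral_eq_integral[OF set_integrable_bounded_Ioo[OF assms(1,2)]])
  also have "\<dots> = integral {a..b} f" by (metis box_real(1) cbox_interval integral_open_interval)
  also have "\<dots> = I" using assms(3) by (rule integral_unique)
  finally show ?thesis .
qed

text \<open>Cauchy's formula for a twofold repeated integral.\<close>

lemma triangle_weight:
  fixes f :: "real \<Rightarrow> complex"
  assumes [measurable]: "f \<in> borel_measurable borel" and C: "\<And>s. s \<in> {0<..<p} \<Longrightarrow> norm (f s) \<le> C" and p: "0 < p"
  shows "(LINT t:{0<..<p}|lborel. LINT s:{0<..<t}|lborel. f s) = (LINT s:{0<..<p}|lborel. of_real (p - s) * f s)"
proof -
  have c: "set_integrable lborel {0<..<p} (\<lambda>_. C)"
    by (rule set_integrable_bounded_Ioo[where C = "norm C"]) auto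
  have "(LINT t:{0<..<p}|lborel. LINT s:{0<..<t}|lborel. f s) = (LINT s:{0<..<p}|lborel. LINT t:{s<..<p}|lborel. f s)"
    by (rule triangle_swap(1)[where g = "\<lambda>_. C", symmetric]) (use C c in auto)
  also have "\<dots> = (LINT s:{0<..<p}|lborel. of_real (p - s) * f s)"
    by (rule set_lebesgue_integral_cong) (auto simp: set_lebesgue_integral_def scaleR_conv_of_real)
  finally show ?thesis .
qed

text \<open>Both sides are the integral of f over the triangle 0 < s < t < p: the weight \<sigma> in
  the average is the Jacobian of s = \<sigma> q, and t = \<sigma> p rescales the outer variable,
  which produces the factor p.\<close>

lemma integral_avg_1:
  fixes f :: "real \<Rightarrow> complex"
  assumes [measurable]: "f \<in> borel_measurable borel" and C: "\<And>s. s \<in> {0<..<p} \<Longrightarrow> norm (f s) \<le> C" and p: "0 < p"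
  shows "of_real p * (LINT q:{0<..<p}|lborel. avg 1 f q) = (LINT s:{0<..<p}|lborel. of_real (p - s) * f s)"
proof -
  have C0: "0 \<le> C" using order_trans[OF norm_ge_zero C[of "p / 2"]] p by simp
  define P where "P \<sigma> q = (indicat_real {0<..<1} \<sigma> * \<sigma>) *\<^sub>R f (\<sigma> * q)" for \<sigma> q
  have [measurable]: "(\<lambda>(x, r). P x r) \<in> borel_measurable (borel \<Otimes>\<^sub>M borel)"
    unfolding P_def by measurable
  have Ple: "norm (P \<sigma> r) \<le> indicat_real {0<..<1} \<sigma> * C" if "r \<in> {0<..<p}" for \<sigma> r
  proof (cases "\<sigma> \<in> {0<..<1}")
    case True
    then have "\<sigma> * r < 1 * r" using that by (intro mult_strict_right_mono) auto
    also have "1 * r < p" using that by simp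
    finally have "norm (f (\<sigma> * r)) \<le> C" using that True by (intro C) auto
    then have "\<sigma> * norm (f (\<sigma> * r)) \<le> 1 * C" using True by (intro mult_mono) auto
    then show ?thesis using True by (simp add: P_def)
  qed (simp add: P_def)
  have iC: "integrable lborel (\<lambda>\<sigma>::real. indicat_real {0<..<1} \<sigma> * C)"
    by (intro integrable_mult_left integrable_real_indicator) auto
  have i: "integrable lborel (\<lambda>\<sigma>. P \<sigma> r)" if "r \<in> {0<..<p}" for r
    using Ple[OF that] by (intro Bochner_Integration.integrable_bound[OF iC]) (auto intro!: AE_I2 order_trans[OF Ple[OF that]])
  have le: "(\<integral>\<sigma>. norm (P \<sigma> r) \<partial>lborel) \<le> C" if "r \<in> {0<..<p}" for r
  proof -
    have "(\<integral>\<sigma>. norm (P \<sigma> r) \<partial>lborel) \<le> (\<integral>\<sigma>. indicat_real {0<..<1::real} \<sigma> * C \<partial>lborel)"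
      using that by (intro integral_mono integrable_norm i iC Ple)
    then show ?thesis by simp
  qed
  have c: "set_integrable lborel {0<..<p} (\<lambda>_. C)"
    by (rule set_integrable_bounded_Ioo[where C = "norm C"]) auto
  have "(LINT q:{0<..<p}|lborel. avg 1 f q) = (LINT q:{0<..<p}|lborel. (\<integral>\<sigma>. P \<sigma> q \<partial>lborel))"
    by (simp add: P_def avg_def set_lebesgue_integral_def)
  also have "\<dots> = (\<integral>\<sigma>. (LINT q:{0<..<p}|lborel. P \<sigma> q) \<partial>lborel)"
    by (rule swap_integrals(1)[symmetric, where C = "\<lambda>_. C"]) (use i le c in auto)
  also have "\<dots> = (LINT \<sigma>:{0<..<1}|lborel. LINT s:{0<..<\<sigma> * p}|lborel. f s)"
    unfolding set_lebesgue_integral_def[of lborel "{0<..<1}"]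
  proof (rule Bochner_Integration.integral_cong[OF refl])
    fix \<sigma> :: real
    show "(LINT q:{0<..<p}|lborel. P \<sigma> q) = indicat_real {0<..<1} \<sigma> *\<^sub>R (LINT s:{0<..<\<sigma> * p}|lborel. f s)"
    proof (cases "\<sigma> \<in> {0<..<1}")
      case True
      have "(LINT s:{0<..<\<sigma> * p}|lborel. f s) = \<sigma> *\<^sub>R (LINT r:{0<..<p}|lborel. f (\<sigma> * r))"
        unfolding set_lebesgue_integral_def using True
        by (subst lborel_integral_real_affine[where c = \<sigma> and t = 0])
           (auto intro!: Bochner_Integration.integral_cong simp: indicator_def zero_less_mult_iff)
      then show ?thesis using True by (simp add: P_def)
    qed (simp add: P_def set_lebesgue_integral_def)
  qed
  finally have 1: "(LINT q:{0<..<p}|lborel. avg 1 f q) = (LINT \<sigma>:{0<..<1}|lborel. LINT s:{0<..<\<sigma> * p}|lborel. f s)" .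
  have "(LINT t:{0<..<p}|lborel. LINT s:{0<..<t}|lborel. f s) = p *\<^sub>R (LINT \<sigma>:{0<..<1}|lborel. LINT s:{0<..<p * \<sigma>}|lborel. f s)"
    unfolding set_lebesgue_integral_def[of lborel "{0<..<p}"] set_lebesgue_integral_def[of lborel "{0<..<1}"] using p
    by (subst lborel_integral_real_affine[where c = p and t = 0])
       (auto intro!: Bochner_Integration.integral_cong simp: indicator_def zero_less_mult_iff)
  then have "of_real p * (LINT q:{0<..<p}|lborel. avg 1 f q) = (LINT t:{0<..<p}|lborel. LINT s:{0<..<t}|lborel. f s)"
    unfolding 1 by (simp add: mult.commute scaleR_conv_of_real)
  also have "\<dots> = (LINT s:{0<..<p}|lborel. of_real (p - s) * f s)"
    by (rule triangle_weight[OF assms])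
  finally show ?thesis .
qed

text \<open>The kernel and \<^const>\<open>bes_j\<close> invert \<open>y \<mapsto> (p y)'' + \<kappa> y\<close>; the average is \<open>p\<^sup>-\<^sup>2 \<integral>\<^sub>0\<^sup>p s (R - \<kappa> y)(s) ds\<close>.\<close>

lemma prim_of_integral_equation:
  fixes W R :: "real \<Rightarrow> complex"
  assumes \<kappa>: "\<kappa> > 0" and [measurable]: "R \<in> borel_measurable borel" "W \<in> borel_measurable borel"
    and R: "\<And>s. s \<in> {0<..<T} \<Longrightarrow> norm (R s) \<le> C" and Wb: "\<And>s. s \<in> {0<..<T} \<Longrightarrow> norm (W s) \<le> C'"
    and eq: "\<And>p. p \<in> {0<..T} \<Longrightarrow> W p = (LINT s:{0<..<p}|lborel. bes_K \<kappa> p s *\<^sub>R R s) + bes_j (\<kappa> * p) *\<^sub>R c"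
    and W0: "W 0 = c"
  shows "prim T W (avg 1 (\<lambda>p. R p - of_real \<kappa> * W p))"
proof (rule primI)
  let ?Q = "\<lambda>p. R p - of_real \<kappa> * W p"
  have Q: "norm (?Q s) \<le> C + \<kappa> * C'" if "s \<in> {0<..<T}" for s
    using R[OF that] Wb[OF that] \<kappa> by (intro norm_triangle_le_diff add_mono) (auto simp: norm_mult)
  show "avg 1 ?Q \<in> borel_measurable borel"
    unfolding avg_def[abs_def] set_lebesgue_integral_def by measurable
  show "norm (avg 1 ?Q s) \<le> C + \<kappa> * C'" if s: "s \<in> {0<..<T}" for s
  proof -
    have "norm (avg 1 ?Q s) \<le> (1 - 0) * (C + \<kappa> * C')"
      unfolding avg_def
    proof (rule norm_set_integral_le)
      show "0 \<le> C + \<kappa> * C'" using order_trans[OF norm_ge_zero Q[OF s]] .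
      fix \<sigma> :: real assume \<sigma>: "\<sigma> \<in> {0<..<1}"
      then have "\<sigma> * s < 1 * s" using s by (intro mult_strict_right_mono) auto
      also have "1 * s < T" using s by simp
      finally have "norm (?Q (\<sigma> * s)) \<le> C + \<kappa> * C'" using \<sigma> s by (intro Q) auto
      then have "\<sigma> * norm (?Q (\<sigma> * s)) \<le> 1 * (C + \<kappa> * C')"
        using \<sigma> by (intro mult_mono) auto
      then show "norm (\<sigma> ^ 1 *\<^sub>R ?Q (\<sigma> * s)) \<le> C + \<kappa> * C'" using \<sigma> by simp
    qed simp
    then show ?thesis by simp
  qed
  fix p assume pT: "p \<in> {0..T}"
  show "W p = W 0 + (LINT s:{0<..<p}|lborel. avg 1 ?Q s)"
  proof (cases "p = 0")
    case True then show ?thesis by (simp add: set_lebesgue_integral_def)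
  next
    case False
    then have p: "0 < p" "p \<le> T" using pT by auto
    have C0: "0 \<le> C" using order_trans[OF norm_ge_zero R[of "p / 2"]] p by auto
    have Kb: "\<bar>bes_K \<kappa> q s\<bar> \<le> 1" if "0 < s" "s \<le> q" for s q using abs_K_le_1[OF \<kappa> that] .
    \<comment> \<open>The equation at q is integrated against p - q. Over the triangle s < q < p,
      the q-integral of the kernel is known from \<open>K_integral_eq\<close>, while the s-integral
      is what the equation at q evaluates.\<close>
    define \<psi> where "\<psi> s q = of_real (p - q) * (bes_K \<kappa> q s *\<^sub>R R s)" for s q
    have [measurable]: "(\<lambda>(s, q). \<psi> s q) \<in> borel_measurable (borel \<Otimes>\<^sub>M borel)"
      unfolding \<psi>_def by measurable
    have KR: "norm (bes_K \<kappa> q s *\<^sub>R R s) \<le> C" if "0 < s" "s < q" "q < p \<or> q \<le> p" for s q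
    proof -
      have "\<bar>bes_K \<kappa> q s\<bar> * norm (R s) \<le> 1 * C" using that p by (intro mult_mono Kb R) auto
      then show ?thesis by simp
    qed
    have \<psi>: "norm (\<psi> s q) \<le> p * C" if "0 < s" "s < q" "q < p" for s q
    proof -
      have "\<bar>p - q\<bar> * norm (bes_K \<kappa> q s *\<^sub>R R s) \<le> p * C" using that p by (intro mult_mono KR) auto
      then show ?thesis by (simp add: \<psi>_def norm_mult mult_ac flip: of_real_diff)
    qed
    have c: "set_integrable lborel {0<..<p} (\<lambda>_. p * C)"
      by (rule set_integrable_bounded_Ioo[where C = "norm (p * C)"]) auto
    note tri = triangle_swap[of \<psi> p "\<lambda>_. p * C", OF _ \<psi> c]
    have inner: "(LINT q:{s<..<p}|lborel. \<psi> s q) = of_real ((p - s - p * bes_K \<kappa> p s) / \<kappa>) * R s" if s: "s \<in> {0<..<p}" for s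
    proof -
      have "(LINT q:{s<..<p}|lborel. (p - q) * bes_K \<kappa> q s) = (p - s - p * bes_K \<kappa> p s) / \<kappa>"
      proof (rule set_integral_eq_has_integral[where C = p])
        show "norm ((p - q) * bes_K \<kappa> q s) \<le> p" if "q \<in> {s<..<p}" for q
        proof -
          have "\<bar>p - q\<bar> * \<bar>bes_K \<kappa> q s\<bar> \<le> p * 1" using that s by (intro mult_mono Kb) auto
          then show ?thesis by (simp add: abs_mult)
        qed
      qed (use K_integral_eq[OF \<kappa>, of s p] s in auto)
      moreover have "(LINT q:{s<..<p}|lborel. \<psi> s q) = (LINT q:{s<..<p}|lborel. complex_of_real ((p - q) * bes_K \<kappa> q s)) * R s"
        unfolding \<psi>_def by (subst set_integral_mult_left[symmetric]) (simp_all add: scaleR_conv_of_real mult_ac)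
      ultimately show ?thesis by (simp only: set_integral_complex_of_real)
    qed
    have outer: "(LINT s:{0<..<q}|lborel. \<psi> s q) = of_real (p - q) * (W q - bes_j (\<kappa> * q) *\<^sub>R c)" if q: "q \<in> {0<..<p}" for q
    proof -
      have "(LINT s:{0<..<q}|lborel. \<psi> s q) = of_real (p - q) * (LINT s:{0<..<q}|lborel. bes_K \<kappa> q s *\<^sub>R R s)"
        unfolding \<psi>_def by (rule set_integral_mult_right)
      then show ?thesis using eq[of q] q p by simp
    qed
    have iR: "set_integrable lborel {0<..<p} (\<lambda>s. of_real (p - s) * R s)"
    proof (rule set_integrable_bounded_Ioo[where C = "p * C"])
      show "norm (of_real (p - s) * R s) \<le> p * C" if "s \<in> {0<..<p}" for s
        unfolding norm_mult norm_of_real using that p by (intro mult_mono R) auto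
    qed simp
    have iW: "set_integrable lborel {0<..<p} (\<lambda>s. of_real (p - s) * W s)"
    proof (rule set_integrable_bounded_Ioo[where C = "p * C'"])
      show "norm (of_real (p - s) * W s) \<le> p * C'" if "s \<in> {0<..<p}" for s
        unfolding norm_mult norm_of_real using that p by (intro mult_mono Wb) auto
    qed simp
    have jb: "norm (complex_of_real ((p - s) * bes_j (\<kappa> * s))) \<le> p" if "s \<in> {0<..<p}" for s
    proof -
      have "\<bar>p - s\<bar> * \<bar>bes_j (\<kappa> * s)\<bar> \<le> p * 1" using that \<kappa> by (intro mult_mono abs_j_le_1) auto
      then show ?thesis by (simp add: abs_mult flip: of_real_mult of_real_diff)
    qed
    have ij: "set_integrable lborel {0<..<p} (\<lambda>s. complex_of_real ((p - s) * bes_j (\<kappa> * s)))"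
      using jb by (intro set_integrable_bounded_Ioo[where C = p]) auto
    have j: "(LINT s:{0<..<p}|lborel. complex_of_real ((p - s) * bes_j (\<kappa> * s))) = of_real ((p - p * bes_j (\<kappa> * p)) / \<kappa>)"
      unfolding set_integral_complex_of_real
      using set_integral_eq_has_integral[OF _ _ j_integral_eq[OF \<kappa>, of p], of p] jb p by (simp flip: of_real_mult of_real_diff)
    have "(LINT s:{0<..<p}|lborel. of_real ((p - s - p * bes_K \<kappa> p s) / \<kappa>) * R s) = (LINT s:{0<..<p}|lborel. LINT q:{s<..<p}|lborel. \<psi> s q)"
      by (rule set_lebesgue_integral_cong) (auto simp: inner)
    also have "\<dots> = (LINT q:{0<..<p}|lborel. LINT s:{0<..<q}|lborel. \<psi> s q)"
      by (rule tri(1)) simp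
    also have "\<dots> = (LINT q:{0<..<p}|lborel. of_real (p - q) * W q - of_real ((p - q) * bes_j (\<kappa> * q)) * c)"
      by (rule set_lebesgue_integral_cong) (auto simp: outer algebra_simps scaleR_conv_of_real)
    also have "\<dots> = (LINT q:{0<..<p}|lborel. of_real (p - q) * W q) - (LINT q:{0<..<p}|lborel. of_real ((p - q) * bes_j (\<kappa> * q)) * c)"
      by (intro set_integral_diff iW set_integrable_mult_left ij)
    also have "(LINT q:{0<..<p}|lborel. of_real ((p - q) * bes_j (\<kappa> * q)) * c) = of_real ((p - p * bes_j (\<kappa> * p)) / \<kappa>) * c"
      by (simp only: set_integral_mult_left j)
    finally have A: "(LINT s:{0<..<p}|lborel. of_real ((p - s - p * bes_K \<kappa> p s) / \<kappa>) * R s)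
        = (LINT q:{0<..<p}|lborel. of_real (p - q) * W q) - of_real ((p - p * bes_j (\<kappa> * p)) / \<kappa>) * c" .
    have iKR: "set_integrable lborel {0<..<p} (\<lambda>s. bes_K \<kappa> p s *\<^sub>R R s)"
      using KR by (intro set_integrable_bounded_Ioo[where C = C]) auto
    have "(LINT s:{0<..<p}|lborel. of_real ((p - s - p * bes_K \<kappa> p s) / \<kappa>) * R s)
      = (LINT s:{0<..<p}|lborel. (of_real (p - s) * R s - of_real p * (bes_K \<kappa> p s *\<^sub>R R s)) / of_real \<kappa>)"
      by (rule set_lebesgue_integral_cong) (auto simp: scaleR_conv_of_real algebra_simps diff_divide_distrib)
    also have "\<dots> = ((LINT s:{0<..<p}|lborel. of_real (p - s) * R s) - of_real p * (LINT s:{0<..<p}|lborel. bes_K \<kappa> p s *\<^sub>R R s)) / of_real \<kappa>"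
      by (simp only: set_integral_divide_zero set_integral_diff(2)[OF iR set_integrable_mult_right[OF iKR]] set_integral_mult_right)
    finally have B: "(LINT s:{0<..<p}|lborel. of_real ((p - s - p * bes_K \<kappa> p s) / \<kappa>) * R s)
      = ((LINT s:{0<..<p}|lborel. of_real (p - s) * R s) - of_real p * (LINT s:{0<..<p}|lborel. bes_K \<kappa> p s *\<^sub>R R s)) / of_real \<kappa>" .
    \<comment> \<open>The equation at p is used once more, for p times the kernel integral.
      Comparing \<open>A\<close> and \<open>B\<close> eliminates both this integral and
      \<open>bes_j\<close>, and leaves p c plus the weighted integral of R - \<kappa> W.\<close>
    have "of_real p * W p = of_real p * (LINT s:{0<..<p}|lborel. bes_K \<kappa> p s *\<^sub>R R s) + of_real (p * bes_j (\<kappa> * p)) * c"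
      using eq[of p] p by (simp add: scaleR_conv_of_real distrib_left)
    also have "\<dots> = of_real p * c + ((LINT s:{0<..<p}|lborel. of_real (p - s) * R s) - of_real \<kappa> * (LINT q:{0<..<p}|lborel. of_real (p - q) * W q))"
    proof -
      have "P * KI + J * d = P * d + (IR - k * IW)"
        if "IW - (P - J) / k * d = (IR - P * KI) / k" "k \<noteq> 0" for P KI J d IR IW k :: complex
        using that by (simp add: field_simps)
      note alg = this
      show ?thesis
        unfolding of_real_diff by (rule alg[OF trans[OF A[symmetric] B, unfolded of_real_divide of_real_diff]]) (use \<kappa> in simp)
    qed
    also have "(LINT s:{0<..<p}|lborel. of_real (p - s) * R s) - of_real \<kappa> * (LINT q:{0<..<p}|lborel. of_real (p - q) * W q)
       = (LINT s:{0<..<p}|lborel. of_real (p - s) * ?Q s)"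
    proof -
      have "(LINT s:{0<..<p}|lborel. of_real (p - s) * ?Q s) = (LINT s:{0<..<p}|lborel. of_real (p - s) * R s - of_real \<kappa> * (of_real (p - s) * W s))"
        by (rule set_lebesgue_integral_cong) (auto simp: algebra_simps)
      also have "\<dots> = (LINT s:{0<..<p}|lborel. of_real (p - s) * R s) - (LINT s:{0<..<p}|lborel. of_real \<kappa> * (of_real (p - s) * W s))"
        by (intro set_integral_diff iR set_integrable_mult_right iW)
      finally show ?thesis by simp
    qed
    also have "\<dots> = of_real p * (LINT q:{0<..<p}|lborel. avg 1 ?Q q)"
      by (rule integral_avg_1[where C = "C + \<kappa> * C'", symmetric]) (use Q p in auto)
    finally have "of_real p * W p = of_real p * (W 0 + (LINT q:{0<..<p}|lborel. avg 1 ?Q q))"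
      unfolding W0 by (simp only: distrib_left)
    then show ?thesis using p by (simp del: of_real_mult)
  qed
qed


section \<open>The Laplace class and its majorants\<close>

lemma convolution_integrable:
  fixes H :: "real \<Rightarrow> real"
  assumes H: "integrable lborel H"
  shows "AE s in lborel. integrable lborel (\<lambda>r. H (s - r) * H r)"
    and "integrable lborel (\<lambda>s. \<integral>r. H (s - r) * H r \<partial>lborel)"
proof -
  have [measurable]: "H \<in> borel_measurable borel" using H by auto
  have i: "integrable lborel (\<lambda>s. H (s - r) * H r)" for r
    using lborel_integrable_real_affine[OF H, of 1 "- r"] by (intro integrable_mult_left) simp
  have n: "(\<integral>s. norm (H (s - r) * H r) \<partial>lborel) = (\<integral>s. norm (H s) \<partial>lborel) * norm (H r)" for r
    by (subst (2) lborel_integral_real_affine[where c = 1 and t = "- r"]) (simp_all add: abs_mult)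
  have "integrable (lborel \<Otimes>\<^sub>M lborel) (\<lambda>(r, s). H (s - r) * H r)"
  proof (rule lborel_pair.Fubini_integrable)
    show "integrable lborel (\<lambda>r. \<integral>s. norm (case (r, s) of (r, s) \<Rightarrow> H (s - r) * H r) \<partial>lborel)"
      using H by (simp only: prod.case n) (intro integrable_mult_right integrable_norm)
    show "AE r in lborel. integrable lborel (\<lambda>s. case (r, s) of (r, s) \<Rightarrow> H (s - r) * H r)"
      using i by simp
  qed measurable
  then have I: "integrable (lborel \<Otimes>\<^sub>M lborel) (\<lambda>(s, r). H (s - r) * H r)"
    by (subst lborel_pair.integrable_product_swap_iff[symmetric]) (simp add: case_prod_beta)
  show "AE s in lborel. integrable lborel (\<lambda>r. H (s - r) * H r)"
    using lborel_pair.AE_integrable_fst[OF I] .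
  show "integrable lborel (\<lambda>s. \<integral>r. H (s - r) * H r \<partial>lborel)"
    using lborel_pair.integrable_fst[OF I] .
qed

text \<open>A reflection maps null sets to null sets. In a convolution the almost everywhere bounds
  are also needed at s - r.\<close>

lemma AE_reflect:
  assumes "AE x in lborel. P (x :: real)"
  shows "AE r in lborel. P (s - r)"
proof -
  obtain N where N: "{x \<in> space lborel. \<not> P x} \<subseteq> N" "N \<in> null_sets lborel"
    using assms by (auto simp: eventually_ae_filter)
  have "AE x in lborel. x \<notin> N" using N(2) by (rule AE_not_in)
  moreover have "Measurable.pred borel (\<lambda>x. x \<notin> N)"
    using N(2) by (auto simp: null_sets_def)
  ultimately have "AE r in lborel. s + (- 1) * r \<notin> N"
    by (intro AE_borel_affine) auto
  then show ?thesis using N(1) by (auto elim!: eventually_mono)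
qed

text \<open>\<open>h\<close> is a Borel measurable majorant of the norm, valid for almost every p >
  0. It vanishes for p \<le> 0, so that convolutions over the line agree with those over
  [0, s].\<close>

locale laplace_class = quad_system \<kappa> M N W0 Y0 cM cN A \<beta>
  for \<kappa> :: "'i :: finite \<Rightarrow> real" and M :: "'i \<Rightarrow> 'i \<Rightarrow> 'i \<Rightarrow> real ^ 'n \<Rightarrow> complex"
    and N :: "'i \<Rightarrow> 'i \<Rightarrow> real ^ 'n \<Rightarrow> complex" and W0 :: "'i \<Rightarrow> real ^ 'n \<Rightarrow> complex"
    and Y0 :: "'i \<Rightarrow> real ^ 'n \<Rightarrow> real \<Rightarrow> complex" and cM cN A \<beta> :: real +
  fixes h :: "real \<Rightarrow> real" and \<omega> :: real
  assumes h_meas[measurable]: "h \<in> borel_measurable borel" and h_nonneg: "0 \<le> h p"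
    and h_zero: "p \<le> 0 \<Longrightarrow> h p = 0"
    and h_int: "integrable lborel (\<lambda>p. exp (- (\<omega> * p)) * h p)" and \<omega>: "0 < \<omega>"
    and Y0_class: "AE p in lborel. 0 < p \<longrightarrow> (\<forall>i. bnd \<beta> (h p) (\<lambda>k. Y0 i k p))"
begin

definition hh :: "real \<Rightarrow> real" where "hh s = (LINT r:{0<..<s}|lborel. h (s - r) * h r)"
text \<open>Majorant for R divided by 1 + |k|: the two products with the initial data give 2 A h,
  the quadratic term gives \<open>hh\<close> = h * h, and the linear term gives h.\<close>

definition g :: "real \<Rightarrow> real" where
  "g s = (\<Sum>l\<in>(UNIV::'i set). \<Sum>m\<in>(UNIV::'i set). cM * (2 * A * h s + hh s)) + (\<Sum>l\<in>(UNIV::'i set). cN * h s)"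

text \<open>The exponential weight splits over a convolution and \<open>h_zero\<close> supplies the
  cutoff. So the weighted integrability of \<open>hh\<close> follows from that of h, as L1 is closed
  under convolution.\<close>

lemma exp_hh: "exp (- (\<omega> * s)) * hh s = (\<integral>r. (exp (- (\<omega> * (s - r))) * h (s - r)) * (exp (- (\<omega> * r)) * h r) \<partial>lborel)"
proof -
  have "exp (- (\<omega> * s)) * hh s = (\<integral>r. exp (- (\<omega> * s)) * (indicator {0<..<s} r * (h (s - r) * h r)) \<partial>lborel)"
    by (simp add: hh_def set_lebesgue_integral_def)
  also have "\<dots> = (\<integral>r. (exp (- (\<omega> * (s - r))) * h (s - r)) * (exp (- (\<omega> * r)) * h r) \<partial>lborel)"
  proof (rule Bochner_Integration.integral_cong[OF refl])
    fix r
    have "exp (- (\<omega> * (s - r))) * exp (- (\<omega> * r)) = exp (- (\<omega> * s))"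
      by (simp flip: exp_add add: algebra_simps)
    then show "exp (- (\<omega> * s)) * (indicator {0<..<s} r * (h (s - r) * h r)) = (exp (- (\<omega> * (s - r))) * h (s - r)) * (exp (- (\<omega> * r)) * h r)"
      using h_zero[of r] h_zero[of "s - r"]
      by (cases "0 < r"; cases "r < s") (auto simp: mult_ac simp del: mult_minus_right)
  qed
  finally show ?thesis .
qed

lemma hh_nonneg: "0 \<le> hh s"
  unfolding hh_def set_lebesgue_integral_def by (intro Bochner_Integration.integral_nonneg) (simp add: h_nonneg)

lemma hh_int: "integrable lborel (\<lambda>s. exp (- (\<omega> * s)) * hh s)"
  unfolding exp_hh by (rule convolution_integrable(2)[OF h_int])

lemma hh_set_integrable: "AE s in lborel. set_integrable lborel {0<..<s} (\<lambda>r. h (s - r) * h r)"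
  using convolution_integrable(1)[OF h_int]
proof eventually_elim
  case (elim s)
  then have "integrable lborel (\<lambda>r. exp (\<omega> * s) * ((exp (- (\<omega> * (s - r))) * h (s - r)) * (exp (- (\<omega> * r)) * h r)))"
    by (rule integrable_mult_right)
  also have "(\<lambda>r. exp (\<omega> * s) * ((exp (- (\<omega> * (s - r))) * h (s - r)) * (exp (- (\<omega> * r)) * h r))) = (\<lambda>r. indicator {0<..<s} r *\<^sub>R (h (s - r) * h r))"
  proof
    fix r
    have "exp (\<omega> * s) * (exp (- (\<omega> * (s - r))) * exp (- (\<omega> * r))) = 1"
      by (simp flip: exp_add add: algebra_simps)
    then have "exp (\<omega> * s) * ((exp (- (\<omega> * (s - r))) * h (s - r)) * (exp (- (\<omega> * r)) * h r)) = h (s - r) * h r"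
      by (simp only: mult_ac) (simp add: mult.assoc[symmetric])
    then show "exp (\<omega> * s) * ((exp (- (\<omega> * (s - r))) * h (s - r)) * (exp (- (\<omega> * r)) * h r)) = indicator {0<..<s} r *\<^sub>R (h (s - r) * h r)"
      using h_zero[of r] h_zero[of "s - r"] by (cases "0 < r"; cases "r < s") auto
  qed
  finally show ?case by (simp add: set_integrable_def)
qed

lemma g_nonneg: "0 \<le> g s"
  unfolding g_def using cM cN A_nonneg h_nonneg hh_nonneg by (intro add_nonneg_nonneg sum_nonneg mult_nonneg_nonneg) auto

lemma g_int: "integrable lborel (\<lambda>s. exp (- (\<omega> * s)) * g s)"
proof -
  have "integrable lborel (\<lambda>s. (\<Sum>l\<in>(UNIV::'i set). \<Sum>m\<in>(UNIV::'i set). cM * (2 * A * (exp (- (\<omega> * s)) * h s) + exp (- (\<omega> * s)) * hh s)) + (\<Sum>l\<in>(UNIV::'i set). cN * (exp (- (\<omega> * s)) * h s)))"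
    by (intro Bochner_Integration.integrable_add Bochner_Integration.integrable_sum integrable_mult_right h_int hh_int)
  then show ?thesis by (simp add: g_def algebra_simps)
qed

lemma g_meas[measurable]: "g \<in> borel_measurable borel"
proof -
  have "(\<lambda>s. exp (\<omega> * s) * (exp (- (\<omega> * s)) * g s)) \<in> borel_measurable borel"
    using g_int by measurable
  then show ?thesis by (simp add: mult.assoc[symmetric] flip: exp_add)
qed

text \<open>On (0, p) the weight exp (- \<omega> s) is at least exp (- \<omega> p). The second claim
  is the origin of the exponential growth rate \<omega> of the Borel transform.\<close>

lemma g_set_integrable: "set_integrable lborel {0<..<p} g"
  and g_set_integral: "(LINT s:{0<..<p}|lborel. g s) \<le> exp (\<omega> * p) * (\<integral>s. exp (- (\<omega> * s)) * g s \<partial>lborel)"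
proof -
  have le: "indicator {0<..<p} s * g s \<le> exp (\<omega> * p) * (exp (- (\<omega> * s)) * g s)" for s
  proof (cases "s \<in> {0<..<p}")
    case True
    then have "1 \<le> exp (\<omega> * p) * exp (- (\<omega> * s))"
      using \<omega> by (simp flip: exp_add)
    then have "1 * g s \<le> exp (\<omega> * p) * exp (- (\<omega> * s)) * g s"
      using g_nonneg by (rule mult_right_mono)
    then show ?thesis using True by (simp add: mult.assoc)
  qed (use g_nonneg in auto)
  have i: "integrable lborel (\<lambda>s. exp (\<omega> * p) * (exp (- (\<omega> * s)) * g s))"
    by (rule integrable_mult_right[OF g_int])
  show *: "set_integrable lborel {0<..<p} g"
    unfolding set_integrable_def
    by (rule Bochner_Integration.integrable_bound[OF i]) (use le g_nonneg in \<open>auto intro!: AE_I2 simp: abs_mult\<close>)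
  have "(LINT s:{0<..<p}|lborel. g s) \<le> (\<integral>s. exp (\<omega> * p) * (exp (- (\<omega> * s)) * g s) \<partial>lborel)"
    unfolding set_lebesgue_integral_def using * le i
    by (intro integral_mono) (auto simp: set_integrable_def)
  then show "(LINT s:{0<..<p}|lborel. g s) \<le> exp (\<omega> * p) * (\<integral>s. exp (- (\<omega> * s)) * g s \<partial>lborel)" by simp
qed

text \<open>Division by 1 + |k| makes the multipliers of order one bounded, so the estimate keeps
  the full weight \<beta>.\<close>

lemma R0_bnd: "AE s in lborel. 0 < s \<longrightarrow> (\<forall>i. bnd \<beta> (g s) (\<lambda>k. R 0 Y i k s / of_real (1 + norm k)))"
  using Y0_class hh_set_integrable
proof eventually_elim
  case (elim s)
  show ?case
  proof (intro impI allI)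
    fix i assume s: "0 < s"
    have y: "bnd \<beta> (h s) (\<lambda>k. Y0 l k s)" for l using elim s by blast
    have f: "bnd \<beta> (hh s) (\<lambda>k. fpconv (Y0 l) (Y0 m) k s)" for l m
      unfolding hh_def
    proof (rule bnd_fpconv[OF Y0_meas Y0_meas _ _ elim(2)])
      show "AE r in lborel. 0 < r \<and> r < s \<longrightarrow> bnd \<beta> (h r) (\<lambda>k. Y0 m k r)"
        using Y0_class by eventually_elim blast
      show "AE r in lborel. 0 < r \<and> r < s \<longrightarrow> bnd \<beta> (h (s - r)) (\<lambda>k. Y0 l k (s - r))"
        using AE_reflect[OF Y0_class, of s] by eventually_elim auto
    qed (use \<beta> in simp)
    have c: "bnd \<beta> (A * h s + h s * A + 0 + hh s) (\<lambda>k. conv 0 Y l m k s)" for l m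
      unfolding conv_def using \<beta> by (simp only: Y.simps lessThan_0 sum.empty) (intro bnd_add bnd_zero f bnd_fconv W0 y, auto)
    have m1: "norm (M i l m k / of_real (1 + norm k)) \<le> cM" for l m k
    proof -
      have "norm (M i l m k) \<le> cM * (1 + norm k)" using M_le[of i l m k] cM by (simp add: distrib_left)
      then have "norm (M i l m k) / (1 + norm k) \<le> cM" by (simp add: divide_le_eq add_pos_nonneg)
      then show ?thesis by (simp add: norm_divide del: of_real_add)
    qed
    have n1: "norm (N i l k / of_real (1 + norm k)) \<le> cN" for l k
    proof -
      have "norm (N i l k) \<le> cN * (1 + norm k)" using N_le[of i l k] mult_left_mono[of 1 "1 + norm k" cN] cN by simp
      then have "norm (N i l k) / (1 + norm k) \<le> cN" by (simp add: divide_le_eq add_pos_nonneg)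
      then show ?thesis by (simp add: norm_divide del: of_real_add)
    qed
    have "bnd \<beta> ((\<Sum>l\<in>(UNIV::'i set). \<Sum>m\<in>(UNIV::'i set). cM * (A * h s + h s * A + 0 + hh s)) + (\<Sum>l\<in>(UNIV::'i set). cN * h s))
      (\<lambda>k. (\<Sum>l\<in>UNIV. \<Sum>m\<in>UNIV. M i l m k / of_real (1 + norm k) * conv 0 Y l m k s)
        + (\<Sum>l\<in>UNIV. N i l k / of_real (1 + norm k) * Y0 l k s))"
      by (intro bnd_add bnd_sum bnd_mult[OF c] bnd_mult[OF y] m1 n1 cM cN finite) measurable
    moreover have "(\<Sum>l\<in>UNIV. \<Sum>m\<in>UNIV. M i l m k / of_real (1 + norm k) * conv 0 Y l m k s)
        + (\<Sum>l\<in>UNIV. N i l k / of_real (1 + norm k) * Y0 l k s) = R 0 Y i k s / of_real (1 + norm k)" for k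
      by (simp add: R_def add_divide_distrib sum_divide_distrib)
    moreover have "(\<Sum>l\<in>(UNIV::'i set). \<Sum>m\<in>(UNIV::'i set). cM * (A * h s + h s * A + 0 + hh s)) + (\<Sum>l\<in>(UNIV::'i set). cN * h s) = g s"
      by (simp add: g_def algebra_simps)
    ultimately show "bnd \<beta> (g s) (\<lambda>k. R 0 Y i k s / of_real (1 + norm k))" by (simp only:)
  qed
qed

lemma R_meas: "(\<lambda>(k, p). R n Y i k p) \<in> borel_measurable (borel \<Otimes>\<^sub>M borel)"
proof -
  note [measurable] = conv_meas[OF Y_meas] Y_meas
  show ?thesis unfolding R_def by measurable
qed

end

text \<open>The value at p = 0 stands for the first Taylor coefficient in t of the solution. Its
  bound is stated after division by 1 + |k|, which accounts for the derivative on the product of the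
  initial data.\<close>

locale borel_solution = laplace_class \<kappa> M N W0 Y0 cM cN A \<beta> h \<omega>
  for \<kappa> :: "'i :: finite \<Rightarrow> real" and M :: "'i \<Rightarrow> 'i \<Rightarrow> 'i \<Rightarrow> real ^ 'n \<Rightarrow> complex"
    and N :: "'i \<Rightarrow> 'i \<Rightarrow> real ^ 'n \<Rightarrow> complex" and W0 :: "'i \<Rightarrow> real ^ 'n \<Rightarrow> complex"
    and Y0 :: "'i \<Rightarrow> real ^ 'n \<Rightarrow> real \<Rightarrow> complex" and cM cN A \<beta> :: real and h :: "real \<Rightarrow> real" and \<omega> :: real +
  fixes cU :: real
  assumes U1: "bnd \<beta> cU (\<lambda>k. Y0 i k 0 / of_real (1 + norm k))"
    and IE: "k \<noteq> 0 \<Longrightarrow> 0 < p \<Longrightarrow> Y0 i k p =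
      (LINT s:{0<..<p}|lborel. bes_K (\<kappa> i * (norm k)\<^sup>2) p s *\<^sub>R R 0 Y i k s)
      + bes_j (\<kappa> i * (norm k)\<^sup>2 * p) *\<^sub>R Y0 i k 0"
begin

text \<open>The weight \<open>w\<close> is \<open>1 / (1 + |k|)\<close> (using only \<open>|K| \<le> 1\<close>) or, for \<open>p\<close> away from \<open>0\<close>, the constant \<open>1\<close>.\<close>

lemma Y0_bnd_weight:
  assumes p: "0 < p" and [measurable]: "w \<in> borel_measurable borel" and c: "0 \<le> c"
    and K: "\<And>k s. k \<noteq> 0 \<Longrightarrow> 0 < s \<Longrightarrow> s \<le> p \<Longrightarrow> \<bar>w k\<bar> * (1 + norm k) * \<bar>bes_K (\<kappa> i * (norm k)\<^sup>2) p s\<bar> \<le> c"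
    and J: "\<And>k. k \<noteq> 0 \<Longrightarrow> \<bar>w k\<bar> * (1 + norm k) * \<bar>bes_j (\<kappa> i * (norm k)\<^sup>2 * p)\<bar> \<le> c"
  shows "bnd \<beta> (c * ((LINT s:{0<..<p}|lborel. g s) + cU)) (\<lambda>k. of_real (w k) * Y0 i k p)"
proof -
  note [measurable] = R_meas Y0_meas
  \<comment> \<open>The product w K R is split as w (1 + |k|) K, bounded by c according to the
    hypothesis, times R / (1 + |k|), bounded by \<open>R0_bnd\<close>.\<close>
  define m where "m k s = (if 0 < s \<and> s < p then w k * (1 + norm k) * bes_K (\<kappa> i * (norm k)\<^sup>2) p s else 0)" for k :: "real ^ 'n" and s
  have [measurable]: "(\<lambda>(k, s). m k s) \<in> borel_measurable (borel \<Otimes>\<^sub>M borel)"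
    unfolding m_def by measurable
  have 1: "bnd \<beta> (\<integral>s. c * (indicator {0<..<p} s * g s) \<partial>lborel) (\<lambda>k. \<integral>s. of_real (m k s) * (R 0 Y i k s / of_real (1 + norm k)) \<partial>lborel)"
  proof (rule bnd_integral[OF lborel.sigma_finite_measure_axioms])
    show "(\<lambda>(k, s). complex_of_real (m k s) * (R 0 Y i k s / complex_of_real (1 + norm k))) \<in> borel_measurable (borel \<Otimes>\<^sub>M lborel)"
      by measurable
    show "integrable lborel (\<lambda>s. c * (indicat_real {0<..<p} s * g s))"
      using g_set_integrable by (intro integrable_mult_right) (simp add: set_integrable_def)
    show "AE s in lborel. bnd \<beta> (c * (indicat_real {0<..<p} s * g s)) (\<lambda>k. complex_of_real (m k s) * (R 0 Y i k s / complex_of_real (1 + norm k)))"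
      using R0_bnd
    proof eventually_elim
      case (elim s)
      show ?case
      proof (cases "s \<in> {0<..<p}")
        case True
        then have "bnd \<beta> (c * g s) (\<lambda>k. complex_of_real (m k s) * (R 0 Y i k s / complex_of_real (1 + norm k)))"
        proof (intro bnd_mult)
          show "norm (complex_of_real (m k s)) \<le> c" if "k \<noteq> 0" for k
            using True K[OF that, of s] by (simp add: m_def abs_mult del: of_real_mult of_real_add)
        qed (use elim c in auto)
        then show ?thesis using True by simp
      qed (auto simp: m_def intro!: bnd_zero)
    qed
  qed
  have 2: "bnd \<beta> (c * cU) (\<lambda>k. of_real (w k * (1 + norm k) * bes_j (\<kappa> i * (norm k)\<^sup>2 * p)) * (Y0 i k 0 / of_real (1 + norm k)))"
    by (intro bnd_mult[OF U1]) (use J c in \<open>auto simp: abs_mult simp del: of_real_mult of_real_add\<close>)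
  have "bnd \<beta> (1 * ((\<integral>s. c * (indicator {0<..<p} s * g s) \<partial>lborel) + c * cU)) (\<lambda>k. of_real (w k) * Y0 i k p)"
  proof (rule bnd_dominated[OF bnd_add[OF 1 2]])
    show "(\<lambda>k. complex_of_real (w k) * Y0 i k p) \<in> borel_measurable borel"
      using tb_meas1(2)[OF Y0_meas] by measurable
    fix k :: "real ^ 'n" assume k: "k \<noteq> 0"
    have nz: "complex_of_real (1 + norm k) \<noteq> 0"
      unfolding of_real_eq_0_iff using norm_ge_zero[of k] by linarith
    have "(\<integral>s. of_real (m k s) * (R 0 Y i k s / of_real (1 + norm k)) \<partial>lborel)
       = (\<integral>s. of_real (w k) * (indicator {0<..<p} s *\<^sub>R (bes_K (\<kappa> i * (norm k)\<^sup>2) p s *\<^sub>R R 0 Y i k s)) \<partial>lborel)"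
      using nz by (intro Bochner_Integration.integral_cong) (auto simp: m_def indicator_def scaleR_conv_of_real simp del: of_real_add)
    moreover have "of_real (w k * (1 + norm k) * bes_j (\<kappa> i * (norm k)\<^sup>2 * p)) * (Y0 i k 0 / of_real (1 + norm k))
       = of_real (w k) * (of_real (bes_j (\<kappa> i * (norm k)\<^sup>2 * p)) * Y0 i k 0)"
      by (simp only: of_real_mult) (use nz in \<open>simp add: field_simps del: of_real_add\<close>)
    ultimately have "of_real (w k) * Y0 i k p = (\<integral>s. of_real (m k s) * (R 0 Y i k s / of_real (1 + norm k)) \<partial>lborel)
      + of_real (w k * (1 + norm k) * bes_j (\<kappa> i * (norm k)\<^sup>2 * p)) * (Y0 i k 0 / of_real (1 + norm k))"
      by (simp only: IE[OF k p] set_lebesgue_integral_def distrib_left scaleR_conv_of_real integral_mult_right_zero)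
    then show "norm (of_real (w k) * Y0 i k p) * exp (\<beta> * norm k) \<le> 1 * (norm ((\<integral>s. of_real (m k s) * (R 0 Y i k s / of_real (1 + norm k)) \<partial>lborel)
      + of_real (w k * (1 + norm k) * bes_j (\<kappa> i * (norm k)\<^sup>2 * p)) * (Y0 i k 0 / of_real (1 + norm k))) * exp (\<beta> * norm k))"
      by simp
  qed simp
  then show ?thesis by (simp add: set_lebesgue_integral_def distrib_left)
qed

lemma cU_nonneg: "0 \<le> cU" using bnd_nonneg[OF U1] .

text \<open>With weight 1 / (1 + |k|) the bounds |K| \<le> 1 and |bes_j| \<le> 1 suffice, uniformly
  down to p = 0. The factor 1 + |k| is then regained by lowering \<beta> to b.\<close>

lemma Y0_local_bound:
  assumes b: "0 \<le> b" "b < \<beta>" and T: "0 \<le> T"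
  shows "\<exists>B. \<forall>p i. p \<in> {0..T} \<longrightarrow> bnd b B (\<lambda>k. Y0 i k p)"
proof -
  define I where "I = (\<integral>s. exp (- (\<omega> * s)) * g s \<partial>lborel)"
  define \<delta> where "\<delta> = \<beta> - b"
  have \<delta>: "0 < \<delta>" using b by (simp add: \<delta>_def)
  have I: "0 \<le> I" unfolding I_def by (intro Bochner_Integration.integral_nonneg) (simp add: g_nonneg)
  define B where "B = exp (\<omega> * T) * I + cU"
  have loss: "bnd b ((1 + 1 / \<delta>) * B) F" if F: "bnd \<beta> B (\<lambda>k. F k / of_real (1 + norm k))" and [measurable]: "F \<in> borel_measurable borel" for F :: "real ^ 'n \<Rightarrow> complex"
  proof (rule bnd_dominated[OF F])
    fix k :: "real ^ 'n" assume "k \<noteq> 0"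
    have nz: "0 < 1 + norm k" using norm_ge_zero[of k] by linarith
    have "\<delta> * norm k \<le> exp (\<delta> * norm k)" "1 \<le> exp (\<delta> * norm k)" 
      using exp_ge_add_one_self[of "\<delta> * norm k"] mult_nonneg_nonneg[of \<delta> "norm k"] \<delta> norm_ge_zero[of k] by linarith+
    then have "norm k \<le> exp (\<delta> * norm k) / \<delta>" "1 \<le> exp (\<delta> * norm k)" using \<delta> by (simp_all add: pos_le_divide_eq mult.commute)
    moreover have "(1 + 1 / \<delta>) * exp (\<delta> * norm k) = exp (\<delta> * norm k) + exp (\<delta> * norm k) / \<delta>" by (simp add: distrib_right)
    ultimately have "1 + norm k \<le> (1 + 1 / \<delta>) * exp (\<delta> * norm k)" by linarith
    then have "norm (F k) / (1 + norm k) * exp (b * norm k) * (1 + norm k) \<le> norm (F k) / (1 + norm k) * exp (b * norm k) * ((1 + 1 / \<delta>) * exp (\<delta> * norm k))"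
      using nz by (intro mult_left_mono) auto
    moreover have "exp (\<beta> * norm k) = exp (b * norm k) * exp (\<delta> * norm k)"
      by (simp flip: exp_add add: \<delta>_def algebra_simps)
    ultimately show "norm (F k) * exp (b * norm k) \<le> (1 + 1 / \<delta>) * (norm (F k / of_real (1 + norm k)) * exp (\<beta> * norm k))"
      using nz by (simp add: norm_divide mult_ac del: of_real_add)
  qed (use \<delta> in auto)
  have "bnd b ((1 + 1 / \<delta>) * B) (\<lambda>k. Y0 i k p)" if p: "p \<in> {0..T}" for p i
  proof (rule loss)
    show "(\<lambda>k. Y0 i k p) \<in> borel_measurable borel" by (rule tb_meas1(2)[OF Y0_meas])
    show "bnd \<beta> B (\<lambda>k. Y0 i k p / of_real (1 + norm k))"
    proof (cases "p = 0")
      case True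
      show ?thesis unfolding True by (rule bnd_mono[OF U1]) (use I in \<open>simp add: B_def\<close>)
    next
      case False
      then have p0: "0 < p" using p by simp
      have "bnd \<beta> (1 * ((LINT s:{0<..<p}|lborel. g s) + cU)) (\<lambda>k. of_real (1 / (1 + norm k)) * Y0 i k p)"
      proof (rule Y0_bnd_weight[OF p0])
        fix k :: "real ^ 'n" assume k: "k \<noteq> 0"
        have nz: "0 < 1 + norm k" using norm_ge_zero[of k] by linarith
        have kk: "0 < \<kappa> i * (norm k)\<^sup>2" using \<kappa>[of i] k by simp
        have e: "\<bar>1 / (1 + norm k)\<bar> * (1 + norm k) = 1" using nz by simp
        show "\<bar>1 / (1 + norm k)\<bar> * (1 + norm k) * \<bar>bes_K (\<kappa> i * (norm k)\<^sup>2) p s\<bar> \<le> 1" if "0 < s" "s \<le> p" for s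
          unfolding e using abs_K_le_1[OF kk that] by simp
        show "\<bar>1 / (1 + norm k)\<bar> * (1 + norm k) * \<bar>bes_j (\<kappa> i * (norm k)\<^sup>2 * p)\<bar> \<le> 1"
          unfolding e using abs_j_le_1[of "\<kappa> i * (norm k)\<^sup>2 * p"] kk p0 by simp
      qed simp_all
      moreover have "1 * ((LINT s:{0<..<p}|lborel. g s) + cU) \<le> B"
      proof -
        have "exp (\<omega> * p) * I \<le> exp (\<omega> * T) * I" using p \<omega> I by (intro mult_right_mono) auto
        with g_set_integral[of p, folded I_def] have "(LINT s:{0<..<p}|lborel. g s) \<le> exp (\<omega> * T) * I"
          by (rule order_trans)
        then show ?thesis unfolding B_def by simp
      qed
      ultimately have "bnd \<beta> B (\<lambda>k. of_real (1 / (1 + norm k)) * Y0 i k p)" by (rule bnd_mono)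
      then show ?thesis by simp
    qed
  qed
  then show ?thesis by blast
qed

text \<open>For p \<ge> 1 the decay of the kernel and of \<open>bes_j\<close> like 1 / |k| cancels
  the factor |k| in R, so the full weight \<beta> survives and the growth is that of the integral of
  \<open>g\<close>.\<close>

lemma Y0_exp_bound: "\<exists>C\<ge>0. \<forall>p\<ge>1. \<forall>i. bnd \<beta> (C * exp (\<omega> * p)) (\<lambda>k. Y0 i k p)"
proof -
  define I where "I = (\<integral>s. exp (- (\<omega> * s)) * g s \<partial>lborel)"
  have I: "0 \<le> I" unfolding I_def by (intro Bochner_Integration.integral_nonneg) (simp add: g_nonneg)
  define c where "c = 1 + (\<Sum>i\<in>UNIV. 1 / sqrt (\<kappa> i))"
  have ci: "1 + 1 / sqrt (\<kappa> i) \<le> c" for i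
    unfolding c_def using \<kappa> by (intro add_left_mono member_le_sum[of i UNIV "\<lambda>i. 1 / sqrt (\<kappa> i)"]) (auto intro: less_imp_le)
  have c0: "0 \<le> c" using order_trans[OF _ ci[of undefined], of 0] \<kappa>[of undefined] by simp
  have "bnd \<beta> (c * (I + cU) * exp (\<omega> * p)) (\<lambda>k. Y0 i k p)" if p: "1 \<le> p" for p i
  proof -
    have "bnd \<beta> (c * ((LINT s:{0<..<p}|lborel. g s) + cU)) (\<lambda>k. of_real 1 * Y0 i k p)"
    proof (rule Y0_bnd_weight)
      fix k :: "real ^ 'n" assume k: "k \<noteq> 0"
      have kk: "0 < \<kappa> i * (norm k)\<^sup>2" using \<kappa>[of i] k by simp
      have aux: "\<bar>1::real\<bar> * (1 + norm k) * \<bar>x\<bar> \<le> c" if x: "\<bar>x\<bar> \<le> 1" "\<bar>x\<bar> \<le> 1 / sqrt (\<kappa> i * (norm k)\<^sup>2 * p)" for x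
      proof -
        have "sqrt (\<kappa> i * (norm k)\<^sup>2 * 1) \<le> sqrt (\<kappa> i * (norm k)\<^sup>2 * p)"
          using kk p by (intro real_sqrt_le_mono mult_left_mono) auto
        moreover have "0 < sqrt (\<kappa> i * (norm k)\<^sup>2 * 1)" using kk by simp
        ultimately have "1 / sqrt (\<kappa> i * (norm k)\<^sup>2 * p) \<le> 1 / sqrt (\<kappa> i * (norm k)\<^sup>2 * 1)"
          by (intro divide_left_mono mult_pos_pos) auto
        also have "\<dots> = 1 / (sqrt (\<kappa> i) * norm k)" by (simp add: real_sqrt_mult)
        finally have "norm k * \<bar>x\<bar> \<le> norm k * (1 / (sqrt (\<kappa> i) * norm k))"
          using x by (intro mult_left_mono) auto
        then have "norm k * \<bar>x\<bar> \<le> 1 / sqrt (\<kappa> i)" using k by simp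
        then show ?thesis using x ci[of i] by (simp add: distrib_right)
      qed
      show "\<bar>1::real\<bar> * (1 + norm k) * \<bar>bes_K (\<kappa> i * (norm k)\<^sup>2) p s\<bar> \<le> c" if "0 < s" "s \<le> p" for s
        by (intro aux abs_K_le_1[OF kk that] abs_K_le_sqrt[OF kk that])
      have "0 < \<kappa> i * (norm k)\<^sup>2 * p" using kk p by simp
      then show "\<bar>1::real\<bar> * (1 + norm k) * \<bar>bes_j (\<kappa> i * (norm k)\<^sup>2 * p)\<bar> \<le> c"
        by (intro aux abs_j_le_1 abs_j_le_sqrt)
    qed (use p c0 in auto)
    moreover have "c * ((LINT s:{0<..<p}|lborel. g s) + cU) \<le> c * (I + cU) * exp (\<omega> * p)"
    proof -
      have "1 \<le> exp (\<omega> * p)" using \<omega> p by simp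
      then have "cU * 1 \<le> cU * exp (\<omega> * p)" using cU_nonneg by (rule mult_left_mono)
      then have "(LINT s:{0<..<p}|lborel. g s) + cU \<le> (I + cU) * exp (\<omega> * p)"
      proof -
        have "(I + cU) * exp (\<omega> * p) = exp (\<omega> * p) * I + cU * exp (\<omega> * p)" by (simp add: algebra_simps)
        then show ?thesis using \<open>cU * 1 \<le> cU * exp (\<omega> * p)\<close> g_set_integral[of p, folded I_def] by linarith
      qed
      then show ?thesis using c0 by (simp add: mult.assoc mult_left_mono)
    qed
    ultimately show ?thesis using bnd_mono by fastforce
  qed
  moreover have "0 \<le> c * (I + cU)" using c0 I cU_nonneg by simp
  ultimately show ?thesis by blast
qed

text \<open>Half of the gap between b and \<beta> is spent on bounding \<open>Y0\<close>, the other
  half on its derivatives; \<rho> = (\<beta>1 - b)^2 / D is the resulting radius.\<close>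

lemma Y_local_bound:
  assumes b: "0 \<le> b" "b < \<beta>" and T: "0 \<le> T"
  shows "\<exists>B \<rho>. 0 < \<rho> \<and> (\<forall>n p i. p \<in> {0..T} \<longrightarrow> bnd b (B * fact n / \<rho> ^ n) (\<lambda>k. Y n i k p))"
proof -
  define \<beta>1 where "\<beta>1 = (b + \<beta>) / 2"
  have \<beta>1: "b < \<beta>1" "\<beta>1 < \<beta>" "0 < \<beta>1" using b by (auto simp: \<beta>1_def)
  obtain B where B: "\<And>p i. p \<in> {0..T} \<Longrightarrow> bnd \<beta>1 B (\<lambda>k. Y0 i k p)"
    using Y0_local_bound[of \<beta>1 T] \<beta>1 T by auto
  obtain D where D: "1 \<le> D" "\<And>n b p i. 0 \<le> b \<Longrightarrow> b < \<beta>1 \<Longrightarrow> p \<in> {0..T} \<Longrightarrow>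
      bnd b (B * fact n * D ^ n / (\<beta>1 - b) ^ (2 * n)) (\<lambda>k. Y n i k p)"
    using Y_bound[OF B \<beta>1(3) less_imp_le[OF \<beta>1(2)] T] by auto
  define \<rho> where "\<rho> = (\<beta>1 - b)\<^sup>2 / D"
  have "B * fact n * D ^ n / (\<beta>1 - b) ^ (2 * n) = B * fact n / \<rho> ^ n" for n
    using D(1) by (simp add: \<rho>_def power_divide power_mult)
  moreover have "0 < \<rho>" using D(1) \<beta>1 by (simp add: \<rho>_def)
  ultimately show ?thesis using D(2)[OF b(1) \<beta>1(1)] by (intro exI[of _ B] exI[of _ \<rho>]) auto
qed

lemma Y_tb: "0 \<le> T \<Longrightarrow> \<exists>X. \<forall>n i. tb 0 (X n) T (Y n i)"
proof -
  assume T: "0 \<le> T"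
  obtain B \<rho> where "\<forall>n p i. p \<in> {0..T} \<longrightarrow> bnd 0 (B * fact n / \<rho> ^ n) (\<lambda>k. Y n i k p)"
    using Y_local_bound[of 0 T] \<beta> T by auto
  then show ?thesis unfolding tb_def using Y_meas by (intro exI[of _ "\<lambda>n. B * fact n / \<rho> ^ n"]) auto
qed

text \<open>Supplies the base case of \<open>Y_prim\<close> from the integral equation. At fixed k
  the bound on \<open>R 0\<close> may contain |k|, so no weight is lost.\<close>

lemma Y_ftc:
  assumes T: "0 \<le> T" and "k \<noteq> 0"
  shows "prim T (Y n i k) (Y (Suc n) i k)"
proof -
  obtain X where X: "\<And>n i. tb 0 (X n) T (Y n i)" using Y_tb[OF T] by auto
  show ?thesis
  proof (rule Y_prim[OF X _ assms(2)])
    fix i :: 'i and k :: "real ^ 'n" assume k: "k \<noteq> 0"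
    have kk: "0 < \<kappa> i * (norm k)\<^sup>2" using \<kappa>[of i] k by simp
    have yb: "bnd 0 (X 0) (\<lambda>k. Y 0 l k p)" if "p \<in> {0..T}" for l p
      using tb_bnd[OF X that] .
    define E where "E = 2 * A * X 0 + (\<Sum>j<0. X j * X (0 - 1 - j)) + T * (X 0 * X 0)"
    have cb: "norm (conv 0 Y l m k p) \<le> E" if "p \<in> {0..T}" for l m p
    proof -
      have "bnd 0 E (\<lambda>k. conv 0 Y l m k p)"
        unfolding E_def by (rule bnd_conv[where T = T, OF tb_bnd[OF X] _ _ that]) (use \<beta> in auto)
      from bnd_sup[OF this k] show ?thesis by simp
    qed
    have Yb: "norm (Y0 l k p) \<le> X 0" if "p \<in> {0..T}" for l p
      using bnd_sup[OF yb[OF that] k] by simp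
    define C where "C = (\<Sum>l\<in>(UNIV::'i set). \<Sum>m\<in>(UNIV::'i set). cM * norm k * E) + (\<Sum>l\<in>(UNIV::'i set). cN * X 0)"
    have Rb: "norm (R 0 Y i k s) \<le> C" if s: "s \<in> {0<..<T}" for s
    proof -
      have s': "s \<in> {0..T}" using s by auto
      have "norm (M i l m k * conv 0 Y l m k s) \<le> cM * norm k * E" for l m
        unfolding norm_mult using M_le cb[OF s'] cM by (intro mult_mono) auto
      moreover have "norm (N i l k * Y0 l k s) \<le> cN * X 0" for l
        unfolding norm_mult using N_le Yb[OF s'] cN by (intro mult_mono) auto
      ultimately show ?thesis
        unfolding R_def C_def by (intro norm_triangle_le add_mono sum_norm_le) simp_all
    qed
    have "prim T (Y0 i k) (avg 1 (\<lambda>p. R 0 Y i k p - of_real (\<kappa> i * (norm k)\<^sup>2) * Y0 i k p))"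
    proof (rule prim_of_integral_equation[OF kk _ _ Rb, where C' = "X 0" and c = "Y0 i k 0"])
      show "R 0 Y i k \<in> borel_measurable borel" by (rule tb_meas1(1)[OF R_meas])
      show "Y0 i k \<in> borel_measurable borel" by (rule tb_meas1(1)[OF Y0_meas])
      show "norm (Y0 i k s) \<le> X 0" if "s \<in> {0<..<T}" for s using Yb[of s i] that by auto
      show "Y0 i k p = (LINT s:{0<..<p}|lborel. bes_K (\<kappa> i * (norm k)\<^sup>2) p s *\<^sub>R R 0 Y i k s)
        + bes_j (\<kappa> i * (norm k)\<^sup>2 * p) *\<^sub>R Y0 i k 0" if "p \<in> {0<..T}" for p
        using that by (intro IE k) simp
    qed simp_all
    also have "(\<lambda>p. R 0 Y i k p - of_real (\<kappa> i * (norm k)\<^sup>2) * Y0 i k p) = Q 0 Y i k"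
      by (simp add: Q_def fun_eq_iff)
    finally show "prim T (Y0 i k) (Y 1 i k)" by (simp add: Y_Suc)
  qed
qed

end

section \<open>Analytic continuation off the half line\<close>

lemma prim_eq_integral:
  assumes pr: "prim T f g" and p: "p \<in> {0..T}"
  shows "f p = f 0 + integral {0..p} g" "g integrable_on {0..p}"
proof -
  have i: "set_integrable lborel {0<..<p} g" by (rule prim_integrable[OF pr p])
  have "(LINT s:{0<..<p}|lborel. g s) = integral {0<..<p} g" using i by (rule set_borel_integral_eq_integral)
  also have "\<dots> = integral {0..p} g" by (metis box_real(1) cbox_interval integral_open_interval)
  finally show "f p = f 0 + integral {0..p} g" using prim_ftc[OF pr p] by (rule_tac trans) simp_all
  have "g integrable_on {0<..<p}" using i by (rule set_borel_integral_eq_integral)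
  then show "g integrable_on {0..p}" by (metis box_real(1) cbox_interval integrable_on_open_interval)
qed

lemma prim_continuous:
  assumes pr: "prim T f g" "0 \<le> T"
  shows "continuous_on {0..T} f"
proof -
  have "continuous_on {0..T} (\<lambda>p. f 0 + integral {0..p} g)"
    using prim_eq_integral(2)[OF pr(1), of T] pr(2)
    by (intro continuous_intros indefinite_integral_continuous_1) auto
  then show ?thesis
    by (rule continuous_on_eq) (rule prim_eq_integral(1)[OF pr(1), symmetric])
qed

lemma prim_has_vector_derivative:
  assumes pr: "prim T f g" and c: "continuous_on {0..T} g" and p: "p \<in> {0..T}"
  shows "(f has_vector_derivative g p) (at p within {0..T})"
proof -
  have "((\<lambda>u. f 0 + integral {0..u} g) has_vector_derivative 0 + g p) (at p within {0..T})"
    by (intro has_vector_derivative_add has_vector_derivative_const integral_has_vector_derivative c p)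
  then have "((\<lambda>u. f 0 + integral {0..u} g) has_vector_derivative g p) (at p within {0..T})" by simp
  then show ?thesis
  proof (rule has_vector_derivative_transform[OF p, rotated])
    show "f x = f 0 + integral {0..x} g" if "x \<in> {0..T}" for x
      by (rule prim_eq_integral(1)[OF pr that])
  qed
qed

text \<open>A derivative along a real set becomes a complex derivative within the image of that set
  in the plane. This makes \<open>complex_Taylor\<close> applicable to functions of a real
  variable.\<close>

lemma has_field_derivative_Re:
  fixes f :: "real \<Rightarrow> complex"
  assumes "(f has_vector_derivative D) (at p within A)"
  shows "((\<lambda>z. f (Re z)) has_field_derivative D) (at (of_real p) within of_real ` A)"
proof -
  have "((\<lambda>y. norm ((f y - f p) - (y - p) *\<^sub>R D) / norm (y - p)) \<longlongrightarrow> 0) (at p within A)"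
    using assms by (simp add: has_vector_derivative_def has_derivative_iff_norm)
  moreover have "filterlim Re (at p within A) (at (complex_of_real p) within of_real ` A)"
    unfolding filterlim_at
  proof
    show "(Re \<longlongrightarrow> p) (at (complex_of_real p) within of_real ` A)"
      using tendsto_Re[OF tendsto_ident_at[of "complex_of_real p"]] by simp
    show "\<forall>\<^sub>F x in at (complex_of_real p) within of_real ` A. Re x \<in> A \<and> Re x \<noteq> p"
      unfolding eventually_at_filter by (auto intro!: always_eventually)
  qed
  ultimately have "((\<lambda>z. norm ((f (Re z) - f p) - (Re z - p) *\<^sub>R D) / norm (Re z - p)) \<longlongrightarrow> 0) (at (complex_of_real p) within of_real ` A)"
    by (rule filterlim_compose)
  moreover have "\<forall>\<^sub>F z in at (complex_of_real p) within of_real ` A.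
      norm ((f (Re z) - f p) - (Re z - p) *\<^sub>R D) / norm (Re z - p)
      = norm ((f (Re z) - f (Re (of_real p))) - D * (z - of_real p)) / norm (z - of_real p)"
    unfolding eventually_at_filter
    by (auto intro!: always_eventually simp: scaleR_conv_of_real mult.commute simp flip: of_real_diff)
  ultimately have "((\<lambda>z. norm ((f (Re z) - f (Re (of_real p))) - D * (z - of_real p)) / norm (z - of_real p)) \<longlongrightarrow> 0) (at (complex_of_real p) within of_real ` A)"
    by (rule Lim_transform_eventually)
  then show ?thesis
    by (simp add: has_field_derivative_def has_derivative_iff_norm bounded_linear_mult_right)
qed

text \<open>Each \<open>f n\<close> is continuous as a primitive of \<open>f (Suc n)\<close>, hence
  a genuine derivative of its predecessor. The remainder has n! where (n + 1)! is optimal; the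
  factor n + 1 is harmless inside the disc of convergence.\<close>

lemma Taylor_prim:
  fixes f :: "nat \<Rightarrow> real \<Rightarrow> complex"
  assumes pr: "\<And>n. prim T (f n) (f (Suc n))" and T: "0 \<le> T" and p: "p \<in> {0..T}" "q \<in> {0..T}"
    and B: "\<And>s. s \<in> {0..T} \<Longrightarrow> norm (f (Suc n) s) \<le> B"
  shows "norm (f 0 q - (\<Sum>i\<le>n. f i p * of_real (q - p) ^ i / fact i)) \<le> B * \<bar>q - p\<bar> ^ Suc n / fact n"
proof -
  define S where "S = complex_of_real ` {0..T}"
  have "convex S"
    unfolding S_def by (intro convex_linear_image bounded_linear.linear bounded_linear_of_real) simp
  then have "cmod ((\<lambda>i z. f i (Re z)) 0 (of_real q) - (\<Sum>i\<le>n. (\<lambda>i z. f i (Re z)) i (of_real p) * (of_real q - of_real p) ^ i / fact i))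
      \<le> B * cmod (of_real q - of_real p) ^ Suc n / fact n"
  proof (rule complex_Taylor)
    fix i z assume "z \<in> S"
    then obtain s where s: "s \<in> {0..T}" "z = of_real s" by (auto simp: S_def)
    have "(f i has_vector_derivative f (Suc i) s) (at s within {0..T})"
      by (rule prim_has_vector_derivative[OF pr prim_continuous[OF pr T] s(1)])
    from has_field_derivative_Re[OF this]
    show "((\<lambda>z. f i (Re z)) has_field_derivative f (Suc i) (Re z)) (at z within S)"
      by (simp add: s S_def)
  qed (use p B in \<open>auto simp: S_def\<close>)
  then show ?thesis by (simp flip: of_real_diff)
qed

text \<open>The projection of \<open>q\<close> to the half line is the centre of the Taylor series that is used at \<open>q\<close>.\<close>

definition pr :: "complex \<Rightarrow> real" where "pr q = max 0 (Re q)"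

text \<open>Half of the radius is held in reserve: points near q still lie in the disc of radius
  \<rho> about the centre that belongs to q.\<close>

definition strip :: "real \<Rightarrow> real \<Rightarrow> complex set" where
  "strip T \<rho> = {q. cmod (q - of_real (pr q)) < \<rho> / 2 \<and> Re q < T}"

lemma continuous_pr: "continuous_on A pr"
  unfolding pr_def by (intro continuous_intros)

lemma open_strip: "open (strip T \<rho>)"
proof -
  have "open ({q. cmod (q - of_real (pr q)) < \<rho> / 2} \<inter> {q. Re q < T})"
    by (intro open_Int open_Collect_less continuous_intros continuous_pr)
  then show ?thesis by (simp add: strip_def Int_def)
qed

lemma pr_of_real[simp]: "0 \<le> p \<Longrightarrow> pr (of_real p) = p"
  by (simp add: pr_def)

text \<open>A function on [0, T] with all its derivatives and Cauchy-type bounds uniform in p. It is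
  instantiated with Fourier integrals at fixed x and with the transforms at fixed k.\<close>

locale taylor_chain =
  fixes f :: "nat \<Rightarrow> real \<Rightarrow> complex" and T \<rho> B :: real
  assumes prim: "\<And>n. prim T (f n) (f (Suc n))" and T: "0 < T" and \<rho>: "0 < \<rho>"
    and bound: "\<And>n p. p \<in> {0..T} \<Longrightarrow> norm (f n p) \<le> B * fact n / \<rho> ^ n"
begin

definition ts :: "real \<Rightarrow> complex \<Rightarrow> complex" where
  "ts p q = (\<Sum>n. f n p / fact n * (q - of_real p) ^ n)"

lemma ts_coeff: "p \<in> {0..T} \<Longrightarrow> norm (f n p / fact n * (q - of_real p) ^ n) \<le> B * (cmod (q - of_real p) / \<rho>) ^ n"
proof -
  assume p: "p \<in> {0..T}"
  have "norm (f n p / fact n) \<le> B / \<rho> ^ n"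
    using bound[OF p, of n] by (simp add: norm_divide divide_le_eq mult.commute)
  then have "norm (f n p / fact n) * cmod (q - of_real p) ^ n \<le> B / \<rho> ^ n * cmod (q - of_real p) ^ n"
    by (rule mult_right_mono) simp
  then show ?thesis by (simp add: norm_mult norm_power norm_divide power_divide)
qed

lemma ts_summable:
  assumes "p \<in> {0..T}" "cmod (q - of_real p) < \<rho>"
  shows "summable (\<lambda>n. f n p / fact n * (q - of_real p) ^ n)"
proof (rule summable_comparison_test'[where N = 0])
  show "summable (\<lambda>n. B * (cmod (q - of_real p) / \<rho>) ^ n)"
    using assms \<rho> by (intro summable_mult summable_geometric) simp
qed (rule ts_coeff[OF assms(1)])

lemma ts_holomorphic: "p \<in> {0..T} \<Longrightarrow> ts p holomorphic_on ball (of_real p) \<rho>"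
  unfolding ts_def
  by (intro power_series_holomorphic[of _ _ "\<lambda>n. f n p / fact n"] summable_sums ts_summable)
     (auto simp: dist_norm norm_minus_commute)

text \<open>The factorial bounds make the Taylor remainder at most B (n + 1) x^(n + 1) with x = |q -
  p| / \<rho> < 1.\<close>

lemma ts_real:
  assumes p: "p \<in> {0..T}" and q: "q \<in> {0..T}" "\<bar>q - p\<bar> < \<rho>"
  shows "ts p (of_real q) = f 0 q"
proof -
  define x where "x = \<bar>q - p\<bar> / \<rho>"
  have x: "0 \<le> x" "x < 1" using q \<rho> by (simp_all add: x_def)
  have "(\<lambda>n. \<Sum>i\<le>n. f i p / fact i * (of_real q - of_real p) ^ i) \<longlonglongrightarrow> ts p (of_real q)"
    unfolding ts_def using q(2) by (intro summable_LIMSEQ' ts_summable p) (simp flip: of_real_diff)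
  moreover have "(\<lambda>n. \<Sum>i\<le>n. f i p / fact i * (of_real q - of_real p) ^ i) \<longlonglongrightarrow> f 0 q"
  proof (rule LIM_zero_cancel, rule tendsto_norm_zero_cancel, rule tendsto_sandwich[OF always_eventually always_eventually tendsto_const])
    show "\<forall>n. 0 \<le> norm ((\<Sum>i\<le>n. f i p / fact i * (of_real q - of_real p) ^ i) - f 0 q)" by simp
    show "\<forall>n. norm ((\<Sum>i\<le>n. f i p / fact i * (of_real q - of_real p) ^ i) - f 0 q) \<le> B * (real (Suc n) * x ^ Suc n)"
    proof
      fix n
      have "norm (f 0 q - (\<Sum>i\<le>n. f i p * of_real (q - p) ^ i / fact i)) \<le> (B * fact (Suc n) / \<rho> ^ Suc n) * \<bar>q - p\<bar> ^ Suc n / fact n"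
        using T by (intro Taylor_prim[where f = f and T = T] prim p q(1) bound) auto
      also have "\<dots> = B * (real (Suc n) * x ^ Suc n)"
        by (simp add: x_def power_divide)
      finally show "norm ((\<Sum>i\<le>n. f i p / fact i * (of_real q - of_real p) ^ i) - f 0 q) \<le> B * (real (Suc n) * x ^ Suc n)"
        by (subst norm_minus_commute) simp
    qed
    have "(\<lambda>n. real n * x ^ n) \<longlonglongrightarrow> 0"
      using powser_times_n_limit_0[of x] x by simp
    then have "(\<lambda>n. real (Suc n) * x ^ Suc n) \<longlonglongrightarrow> 0" by (rule LIMSEQ_Suc)
    then show "(\<lambda>n. B * (real (Suc n) * x ^ Suc n)) \<longlonglongrightarrow> 0" by (rule tendsto_mult_right_zero)
  qed
  ultimately show ?thesis by (rule LIMSEQ_unique)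
qed

text \<open>If the two discs meet, the midpoint of the centres lies in both. Near it both series
  equal \<open>f 0\<close> on the real axis, and the identity theorem applies on the intersection of
  the discs, which is convex.\<close>

lemma ts_recenter:
  assumes p: "p \<in> {0..T}" "p' \<in> {0..T}" and q: "cmod (q - of_real p) < \<rho>" "cmod (q - of_real p') < \<rho>"
  shows "ts p q = ts p' q"
proof (cases "p = p'")
  case False
  define a where "a = min p p'"
  define c where "c = max p p'"
  define S where "S = ball (complex_of_real p) \<rho> \<inter> ball (of_real p') \<rho>"
  have qS: "q \<in> S" using q by (simp add: S_def dist_norm norm_minus_commute)
  have ac: "a < c" "0 \<le> a" "c \<le> T" using False p by (auto simp: a_def c_def)
  define m where "m = (a + c) / 2"
  have "cmod (of_real p - of_real p') < 2 * \<rho>"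
    using q norm_triangle_ineq4[of "q - of_real p'" "q - of_real p"] by (simp add: norm_minus_commute)
  then have pp: "\<bar>p - p'\<bar> < 2 * \<rho>" by (simp flip: of_real_diff)
  define U where "U = complex_of_real ` ({a..c} \<inter> {x. \<bar>x - p\<bar> < \<rho> \<and> \<bar>x - p'\<bar> < \<rho>})"
  have mU: "a < m" "m < c" "\<bar>m - p\<bar> < \<rho>" "\<bar>m - p'\<bar> < \<rho>"
  proof -
    have s: "a + c = p + p'" by (simp add: a_def c_def min_def max_def)
    show "a < m" "m < c" using ac by (auto simp: m_def)
    show "\<bar>m - p\<bar> < \<rho>" "\<bar>m - p'\<bar> < \<rho>" using pp unfolding m_def s abs_less_iff by (auto simp: field_simps)
  qed
  have lim: "of_real m islimpt U"
  proof -
    have o: "open ({a<..<c} \<inter> {x. \<bar>x - p\<bar> < \<rho>} \<inter> {x. \<bar>x - p'\<bar> < \<rho>})"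
      by (intro open_Int open_Collect_less continuous_intros)
    then have "m islimpt ({a<..<c} \<inter> {x. \<bar>x - p\<bar> < \<rho>} \<inter> {x. \<bar>x - p'\<bar> < \<rho>})"
      by (intro interior_limit_point) (unfold interior_open[OF o], use mU in simp)
    then have "m islimpt ({a..c} \<inter> {x. \<bar>x - p\<bar> < \<rho> \<and> \<bar>x - p'\<bar> < \<rho>})"
      by (rule islimpt_subset) auto
    then show ?thesis
      unfolding U_def islimpt_approachable by (fastforce simp: dist_of_real)
  qed
  have "(\<lambda>z. ts p z - ts p' z) q = 0"
  proof (rule analytic_continuation[where f = "\<lambda>z. ts p z - ts p' z" and w = q and S = S and U = U and \<xi> = "of_real m"])
    show "(\<lambda>z. ts p z - ts p' z) holomorphic_on S"
      unfolding S_def using p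
      by (intro holomorphic_intros holomorphic_on_subset[OF ts_holomorphic]) auto
    show "open S" "connected S" unfolding S_def by (auto intro: convex_connected convex_Int)
    show "U \<subseteq> S" by (auto simp: U_def S_def dist_norm abs_minus_commute simp flip: of_real_diff)
    show "of_real m \<in> S" using mU by (auto simp: S_def dist_norm abs_minus_commute simp flip: of_real_diff)
    show "ts p z - ts p' z = 0" if "z \<in> U" for z
    proof -
      obtain x where x: "z = of_real x" "x \<in> {a..c}" "\<bar>x - p\<bar> < \<rho>" "\<bar>x - p'\<bar> < \<rho>" using \<open>z \<in> U\<close> by (auto simp: U_def)
      have "x \<in> {0..T}" using x(2) ac by auto
      then show ?thesis using x p by (simp add: ts_real)
    qed
  qed (use lim qS in auto)
  then show ?thesis by simp
qed simp

definition ext :: "complex \<Rightarrow> complex" where "ext q = ts (pr q) q"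

lemma pr_strip: "q \<in> strip T \<rho> \<Longrightarrow> pr q \<in> {0..T} \<and> pr q < T"
  using T by (auto simp: strip_def pr_def)

text \<open>The centre moves with q, not holomorphically; but near a given point all centres can be
  replaced by the one of that point, by \<open>ts_recenter\<close>.\<close>

lemma ext_holomorphic: "ext holomorphic_on strip T \<rho>"
proof -
  have "ext field_differentiable (at q0)" if q0: "q0 \<in> strip T \<rho>" for q0
  proof -
    define A where "A = strip T \<rho> \<inter> ball q0 (\<rho> / 2)"
    have A: "open A" "q0 \<in> A" using q0 \<rho> by (auto simp: A_def open_strip)
    have near: "cmod (q - of_real (pr q0)) < \<rho>" if "q \<in> A" for q
    proof -
      have "cmod (q - of_real (pr q0)) \<le> cmod (q - q0) + cmod (q0 - of_real (pr q0))"
        using norm_triangle_ineq[of "q - q0" "q0 - of_real (pr q0)"] by simp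
      also have "\<dots> < \<rho> / 2 + \<rho> / 2"
        using that q0 by (intro add_strict_mono) (auto simp: A_def strip_def dist_norm norm_minus_commute)
      finally show ?thesis by simp
    qed
    have "ts (pr q0) holomorphic_on A"
      using near pr_strip[OF q0] by (intro holomorphic_on_subset[OF ts_holomorphic]) (auto simp: dist_norm norm_minus_commute)
    moreover have "ts (pr q0) q = ext q" if "q \<in> A" for q
    proof -
      have "q \<in> strip T \<rho>" using that by (simp add: A_def)
      moreover have "cmod (q - of_real (pr q)) < \<rho>" using \<open>q \<in> strip T \<rho>\<close> \<rho> by (simp add: strip_def)
      ultimately show ?thesis unfolding ext_def using near[OF that] pr_strip q0 by (intro ts_recenter) auto
    qed
    ultimately have "ext holomorphic_on A" by (rule holomorphic_transform)
    then show ?thesis using A holomorphic_on_imp_differentiable_at by blast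
  qed
  then show ?thesis by (simp add: holomorphic_on_def field_differentiable_at_within)
qed

lemma ext_eq_ts0:
  assumes "q \<in> strip T \<rho>" "cmod q < \<rho>"
  shows "ext q = (\<Sum>n. f n 0 / fact n * q ^ n)"
proof -
  have "cmod (q - of_real (pr q)) < \<rho>" using assms(1) \<rho> by (simp add: strip_def)
  then have "ext q = ts 0 q"
    unfolding ext_def using assms T pr_strip by (intro ts_recenter) auto
  then show ?thesis by (simp add: ts_def)
qed

lemma ext_of_real: "p \<in> {0..T} \<Longrightarrow> ext (of_real p) = f 0 p"
  unfolding ext_def using \<rho> by (simp add: ts_real)

text \<open>Projection to the half line commutes with multiplication by t \<ge> 0, so distances to
  it shrink by t.\<close>

lemma strip_star:
  assumes "q \<in> strip T \<rho>" "0 \<le> t" "t \<le> 1"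
  shows "of_real t * q \<in> strip T \<rho>"
proof -
  have p: "pr (of_real t * q) = t * pr q" using assms by (auto simp: pr_def max_mult_distrib_left)
  have "cmod (of_real t * q - of_real (pr (of_real t * q))) = t * cmod (q - of_real (pr q))"
    unfolding p using assms by (simp add: norm_mult flip: right_diff_distrib)
  also have "\<dots> \<le> 1 * cmod (q - of_real (pr q))" using assms by (intro mult_right_mono) auto
  also have "\<dots> < \<rho> / 2" using assms by (simp add: strip_def)
  finally have 1: "cmod (of_real t * q - of_real (pr (of_real t * q))) < \<rho> / 2" .
  have "t * Re q < T"
  proof (cases "0 \<le> Re q")
    case True
    then have "t * Re q \<le> 1 * Re q" using assms by (intro mult_right_mono) auto
    then show ?thesis using assms by (simp add: strip_def)
  next
    case False
    then have "t * Re q \<le> 0" using assms by (intro mult_nonneg_nonpos) auto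
    then show ?thesis using T by simp
  qed
  then show ?thesis using 1 by (simp add: strip_def)
qed

text \<open>The identity theorem on the star-shaped intersection of the strip with the larger disc.\<close>

lemma sums_larger_disc:
  assumes L: "0 < L" and c: "\<And>n. norm (f n 0) \<le> B' * fact n * L ^ n" and p: "0 \<le> p" "p < T" "p * L < 1"
  shows "(\<lambda>n. f n 0 / fact n * of_real p ^ n) sums f 0 p"
proof -
  have sm: "summable (\<lambda>n. f n 0 / fact n * w ^ n)" if w: "cmod w < 1 / L" for w
  proof (rule summable_comparison_test'[where N = 0])
    show "summable (\<lambda>n. B' * (L * cmod w) ^ n)"
      using w L by (intro summable_mult summable_geometric) (simp add: field_simps)
    fix n
    have "norm (f n 0 / fact n) \<le> B' * L ^ n" using c[of n] by (simp add: norm_divide divide_le_eq mult_ac)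
    then have "norm (f n 0 / fact n) * cmod w ^ n \<le> B' * L ^ n * cmod w ^ n" by (rule mult_right_mono) simp
    then show "norm (f n 0 / fact n * w ^ n) \<le> B' * (L * cmod w) ^ n" by (simp add: norm_mult norm_power norm_divide power_mult_distrib)
  qed
  define s where "s w = (\<Sum>n. f n 0 / fact n * w ^ n)" for w
  have hol: "s holomorphic_on ball 0 (1 / L)"
  proof (rule power_series_holomorphic)
    show "(\<lambda>n. f n 0 / fact n * (w - 0) ^ n) sums s w" if "w \<in> ball 0 (1 / L)" for w
      using summable_sums[OF sm[of w]] that by (simp add: s_def)
  qed
  define S where "S = strip T \<rho> \<inter> ball 0 (1 / L)"
  \<comment> \<open>On \<open>U\<close> the continuation is the series at 0 by
    \<open>ext_eq_ts0\<close>. A neighbourhood of 0 is enough to start the identity theorem on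
    \<open>S\<close>.\<close>
  define U where "U = S \<inter> ball 0 \<rho>"
  have o: "open S" "open U" unfolding S_def U_def by (intro open_Int open_strip open_ball)+
  have z: "0 \<in> S" "0 \<in> U" using T \<rho> L by (auto simp: S_def U_def strip_def pr_def)
  have "(\<lambda>w. ext w - s w) (of_real p) = 0"
  proof (rule analytic_continuation[where f = "\<lambda>w. ext w - s w" and w = "of_real p" and S = S and U = U and \<xi> = 0])
    show "(\<lambda>w. ext w - s w) holomorphic_on S"
      unfolding S_def by (intro holomorphic_intros holomorphic_on_subset[OF ext_holomorphic] holomorphic_on_subset[OF hol]) auto
    have "starlike S"
      unfolding starlike_def
    proof (intro bexI[of _ 0] ballI subsetI)
      fix x y assume x: "x \<in> S" and y: "y \<in> closed_segment 0 x"
      then obtain t where t: "0 \<le> t" "t \<le> 1" "y = of_real t * x"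
        by (auto simp: in_segment scaleR_conv_of_real)
      have "t * cmod x \<le> 1 * cmod x" using t by (intro mult_right_mono) auto
      also have "\<dots> < 1 / L" using x by (simp add: S_def)
      finally have "cmod y < 1 / L" using t by (simp add: norm_mult)
      then show "y \<in> S" using strip_star[of x t] t x by (simp add: S_def)
    qed (rule z)
    then show "connected S" by (rule starlike_imp_connected)
    show "0 islimpt U" by (rule interior_limit_point) (use o z in \<open>simp add: interior_open\<close>)
    show "ext w - s w = 0" if "w \<in> U" for w
      using that ext_eq_ts0[of w] by (simp add: U_def S_def s_def)
    show "of_real p \<in> S" using p \<rho> L by (simp add: S_def strip_def field_simps)
  qed (use o z in \<open>auto simp: U_def\<close>)
  then have "f 0 p = s (of_real p)" using ext_of_real[of p] p by simp
  moreover have "(\<lambda>n. f n 0 / fact n * of_real p ^ n) sums s (of_real p)"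
    unfolding s_def using p L by (intro summable_sums sm) (simp add: field_simps)
  ultimately show ?thesis by simp
qed

end

section \<open>Fourier integrals on a tube\<close>

definition cdot :: "real ^ 'n \<Rightarrow> complex ^ 'n \<Rightarrow> complex" where
  "cdot k x = (\<Sum>j\<in>UNIV. of_real (k $ j) * x $ j)"

lemma cdot_cvec: "cdot k (cvec x) = of_real (k \<bullet> x)"
  by (simp add: cdot_def cvec_def inner_vec_def)

lemma cdot_add: "cdot k (x + y) = cdot k x + cdot k y"
  by (simp add: cdot_def distrib_left sum.distrib)

lemma cdot_scale: "cdot k (c *s x) = c * cdot k x"
  by (simp add: cdot_def sum_distrib_left mult_ac)

lemma cdot_scaleR: "cdot k (c *\<^sub>R x) = of_real c * cdot k x"
  unfolding cdot_def vector_scaleR_component by (simp add: sum_distrib_left mult_ac scaleR_conv_of_real)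

lemma norm_cdot_le: "norm (cdot k x) \<le> norm k * norm x"
proof -
  have "norm (cdot k x) \<le> (\<Sum>j\<in>UNIV. norm (of_real (k $ j) * x $ j))"
    unfolding cdot_def by (rule norm_sum)
  also have "\<dots> = (\<Sum>j\<in>UNIV. \<bar>norm (k $ j)\<bar> * \<bar>norm (x $ j)\<bar>)" by (simp add: norm_mult)
  also have "\<dots> \<le> norm k * norm x"
    unfolding norm_vec_def by (rule L2_set_mult_ineq)
  finally show ?thesis .
qed

lemma norm_exp_cdot_le: "norm (exp (\<i> * cdot k x)) \<le> exp (norm k * norm (\<chi> j. Im (x $ j)))"
proof -
  have "Re (\<i> * cdot k x) = - (k \<bullet> (\<chi> j. Im (x $ j)))"
    by (simp add: cdot_def inner_vec_def)
  also have "\<dots> \<le> norm k * norm (\<chi> j. Im (x $ j))"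
    using Cauchy_Schwarz_ineq2[of k "\<chi> j. Im (x $ j)"] by linarith
  finally show ?thesis by (simp add: norm_exp_eq_Re)
qed

lemma measurable_cdot[measurable]: "(\<lambda>k. cdot k x) \<in> borel_measurable borel"
  unfolding cdot_def by measurable

definition fint :: "(real ^ 'n \<Rightarrow> complex) \<Rightarrow> complex ^ 'n \<Rightarrow> complex" where
  "fint w x = (\<integral>k. exp (\<i> * cdot k x) * w k \<partial>lborel)"

lemma inv_fourier_eq_fint: "inv_fourier w x = fint w (cvec x)"
  by (simp add: inv_fourier_def fint_def cdot_cvec)

lemma norm_exp_cdot_tube:
  assumes "x \<in> tube b"
  shows "norm (exp (\<i> * cdot k x) * w) \<le> norm w * exp (b * norm k)"
proof -
  have "norm (exp (\<i> * cdot k x)) \<le> exp (b * norm k)"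
  proof (rule order_trans[OF norm_exp_cdot_le])
    have "norm k * norm (\<chi> j. Im (x $ j)) \<le> norm k * b"
      using assms by (intro mult_left_mono) (auto simp: tube_def)
    then show "exp (norm k * norm (\<chi> j. Im (x $ j))) \<le> exp (b * norm k)" by (simp add: mult.commute)
  qed
  then show ?thesis by (simp add: norm_mult mult.commute mult_left_mono)
qed

lemma fint_integrable:
  assumes w: "integrable lborel (\<lambda>k. norm (w k) * exp (b * norm k))" and [measurable]: "w \<in> borel_measurable borel"
    and x: "x \<in> tube b"
  shows "integrable lborel (\<lambda>k. exp (\<i> * cdot k x) * w k)"
  by (rule Bochner_Integration.integrable_bound[OF w]) (use norm_exp_cdot_tube[OF x] in \<open>auto intro!: AE_I2 simp: norm_mult\<close>)

lemma bnd_weight_integrable: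
  fixes w :: "real ^ 'n \<Rightarrow> complex"
  assumes "bnd b A w"
  shows "integrable lborel (\<lambda>k. norm (w k) * exp (b * norm k))"
    and "(\<integral>k. norm (w k) * exp (b * norm k) \<partial>lborel) \<le> A"
proof -
  have [measurable]: "w \<in> borel_measurable borel" using assms by (rule bnd_meas)
  show i: "integrable lborel (\<lambda>k. norm (w k) * exp (b * norm k))"
    using bnd_nn[OF assms] by (intro integrableI_nonneg) (auto simp: top_unique order_le_less_trans)
  have "ennreal (\<integral>k. norm (w k) * exp (b * norm k) \<partial>lborel) \<le> ennreal A"
    using bnd_nn[OF assms] i by (subst nn_integral_eq_integral[symmetric]) auto
  then show "(\<integral>k. norm (w k) * exp (b * norm k) \<partial>lborel) \<le> A"
    using bnd_nonneg[OF assms] by (simp add: ennreal_le_iff)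
qed

lemma fint_bound:
  assumes "bnd b A w" "x \<in> tube b"
  shows "norm (fint w x) \<le> A"
proof -
  have "norm (fint w x) \<le> (\<integral>k. norm (exp (\<i> * cdot k x) * w k) \<partial>lborel)"
    unfolding fint_def by (rule integral_norm_bound)
  also have "\<dots> \<le> (\<integral>k. norm (w k) * exp (b * norm k) \<partial>lborel)"
    by (intro integral_mono integrable_norm fint_integrable[OF bnd_weight_integrable(1)[OF assms(1)] bnd_meas[OF assms(1)] assms(2)]
        bnd_weight_integrable[OF assms(1)] norm_exp_cdot_tube assms)
  also have "\<dots> \<le> A" by (rule bnd_weight_integrable[OF assms(1)])
  finally show ?thesis .
qed

text \<open>Differentiation under the integral with an explicit quadratic remainder. With y = |Im x|
  and d = (b - y) / 3, one d pays for the displacement by v in the exponential and another for the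
  factor |k|^2 of the remainder; y + 2 d \<le> b.\<close>

lemma fint_holomorphic_vec:
  fixes w :: "real ^ 'n \<Rightarrow> complex"
  assumes w: "integrable lborel (\<lambda>k. norm (w k) * exp (b * norm k))" and wm[measurable]: "w \<in> borel_measurable borel"
  shows "holomorphic_vec (fint w) (tube b)"
  unfolding holomorphic_vec_def
proof
  fix x :: "complex ^ 'n" assume x: "x \<in> tube b"
  define y where "y = norm (\<chi> j. Im (x $ j))"
  define d where "d = (b - y) / 3"
  have "y < b" using x by (simp add: y_def tube_def)
  then have d: "0 < d" "y + 2 * d \<le> b" unfolding d_def by (auto simp: field_simps)
  have e: "norm (exp (\<i> * cdot k x)) \<le> exp (y * norm k)" for k
    using norm_exp_cdot_le[of k x] by (simp add: y_def mult.commute)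
  define D where "D v = (\<integral>k. \<i> * cdot k v * exp (\<i> * cdot k x) * w k \<partial>lborel)" for v
  have Dle: "norm (\<i> * cdot k v * exp (\<i> * cdot k x) * w k) \<le> (norm v / d) * (norm (w k) * exp (b * norm k))" for k v
  proof -
    have "d * norm k \<le> exp (d * norm k)" using exp_ge_add_one_self[of "d * norm k"] by linarith
    then have "norm k \<le> exp (d * norm k) / d" using d by (simp add: field_simps)
    then have "norm (cdot k v) \<le> exp (d * norm k) / d * norm v"
      using norm_cdot_le[of k v] by (meson mult_right_mono norm_ge_zero order_trans)
    then have "norm (cdot k v) * norm (exp (\<i> * cdot k x)) \<le> (exp (d * norm k) / d * norm v) * exp (y * norm k)"
      using d by (intro mult_mono e) auto
    also have "\<dots> = norm v / d * exp ((y + d) * norm k)" by (simp add: distrib_right exp_add)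
    also have "\<dots> \<le> norm v / d * exp (b * norm k)"
      using d by (intro mult_left_mono) (auto intro!: mult_right_mono)
    finally have "norm (cdot k v) * norm (exp (\<i> * cdot k x)) * norm (w k) \<le> norm v / d * exp (b * norm k) * norm (w k)"
      by (rule mult_right_mono) simp
    then show ?thesis by (simp add: norm_mult mult_ac)
  qed
  have Di: "integrable lborel (\<lambda>k. \<i> * cdot k v * exp (\<i> * cdot k x) * w k)" for v
    by (rule Bochner_Integration.integrable_bound[OF integrable_mult_right[OF w, of "norm v / d"]])
       (use d in \<open>auto intro!: AE_I2 order_trans[OF Dle]\<close>)
  have bl: "bounded_linear D"
  proof (rule bounded_linear_intro[where K = "1 / d * (\<integral>k. norm (w k) * exp (b * norm k) \<partial>lborel)"])
    fix u v and r :: real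
    show "D (u + v) = D u + D v"
      unfolding D_def by (subst Bochner_Integration.integral_add[symmetric, OF Di Di]) (simp add: cdot_add algebra_simps)
    show "D (r *\<^sub>R v) = r *\<^sub>R D v"
    proof -
      have "D (r *\<^sub>R v) = of_real r * D v"
        unfolding D_def by (subst integral_mult_right_zero[symmetric]) (simp add: cdot_scaleR mult_ac)
      then show ?thesis by (simp add: scaleR_conv_of_real[of r "D v"])
    qed
    have "norm (D v) \<le> (\<integral>k. norm (\<i> * cdot k v * exp (\<i> * cdot k x) * w k) \<partial>lborel)"
      unfolding D_def by (rule integral_norm_bound)
    also have "\<dots> \<le> (\<integral>k. (norm v / d) * (norm (w k) * exp (b * norm k)) \<partial>lborel)"
      by (intro integral_mono integrable_norm Di integrable_mult_right w Dle)
    finally show "norm (D v) \<le> norm v * (1 / d * (\<integral>k. norm (w k) * exp (b * norm k) \<partial>lborel))" by simp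
  qed
  have Dc: "D (c *s v) = c * D v" for c v
    unfolding D_def by (subst integral_mult_right_zero[symmetric]) (simp add: cdot_scale mult_ac)
  define W where "W = (\<integral>k. norm (w k) * exp (b * norm k) \<partial>lborel)"
  have der: "(fint w has_derivative D) (at x)"
  proof (rule has_derivativeI_sandwich[where e = d and H = "\<lambda>z. 2 / d\<^sup>2 * W * norm (z - x)"])
    show "((\<lambda>z. 2 / d\<^sup>2 * W * norm (z - x)) \<longlongrightarrow> 0) (at x)"
      by (rule tendsto_eq_intros refl | simp)+
    fix z assume z: "z \<noteq> x" "dist z x < d"
    define v where "v = z - x"
    have v: "norm v < d" "v \<noteq> 0" "z = x + v" using z by (auto simp: v_def dist_norm)
    have zt: "z \<in> tube b"
    proof -
      have "norm (\<chi> j. Im (z $ j)) \<le> y + norm (\<chi> j. Im (v $ j))"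
        using norm_triangle_ineq[of "\<chi> j. Im (x $ j)" "\<chi> j. Im (v $ j)"] by (simp add: v y_def plus_vec_def)
      also have "norm (\<chi> j. Im (v $ j)) \<le> norm v"
        unfolding norm_vec_def by (rule L2_set_mono) (auto simp: abs_Im_le_cmod)
      finally show ?thesis using v d by (simp add: tube_def)
    qed
    define r where "r k = exp (\<i> * cdot k z) * w k - exp (\<i> * cdot k x) * w k - \<i> * cdot k v * exp (\<i> * cdot k x) * w k" for k
    have ri: "integrable lborel r"
      unfolding r_def by (intro Bochner_Integration.integrable_diff Di fint_integrable[OF w] zt x wm)
    have "(fint w z - fint w x) - D (z - x) = (\<integral>k. r k \<partial>lborel)"
      unfolding r_def v_def[symmetric] fint_def D_def
        Bochner_Integration.integral_diff[OF Bochner_Integration.integrable_diff[OF fint_integrable[OF w wm zt] fint_integrable[OF w wm x]] Di]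
        Bochner_Integration.integral_diff[OF fint_integrable[OF w wm zt] fint_integrable[OF w wm x]] ..
    also have "norm \<dots> \<le> (\<integral>k. (2 / d\<^sup>2 * (norm v)\<^sup>2) * (norm (w k) * exp (b * norm k)) \<partial>lborel)"
    proof (rule order_trans[OF integral_norm_bound integral_mono])
      show "integrable lborel (\<lambda>k. norm (r k))" using ri by simp
      show "integrable lborel (\<lambda>k. (2 / d\<^sup>2 * (norm v)\<^sup>2) * (norm (w k) * exp (b * norm k)))" by (intro integrable_mult_right w)
      fix k
      define \<zeta> where "\<zeta> = \<i> * cdot k v"
      have req: "r k = exp (\<i> * cdot k x) * (exp \<zeta> - 1 - \<zeta>) * w k"
        by (simp add: r_def \<zeta>_def v cdot_add distrib_left exp_add algebra_simps)
      have \<zeta>: "norm \<zeta> \<le> norm k * norm v" using norm_cdot_le[of k v] by (simp add: \<zeta>_def norm_mult)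
      have "norm (exp \<zeta> - (\<Sum>k\<le>1. \<zeta> ^ k / fact k)) \<le> exp \<bar>Re \<zeta>\<bar> * norm \<zeta> ^ Suc 1 / fact 1"
        by (rule Taylor_exp)
      then have "norm (exp \<zeta> - 1 - \<zeta>) \<le> exp \<bar>Re \<zeta>\<bar> * norm \<zeta> ^ 2"
        by (simp add: numeral_2_eq_2 algebra_simps)
      also have "\<dots> \<le> exp (d * norm k) * (norm k * norm v) ^ 2"
      proof (intro mult_mono power_mono \<zeta>)
        have "\<bar>Re \<zeta>\<bar> \<le> norm k * norm v" using abs_Re_le_cmod \<zeta> order_trans by blast
        also have "\<dots> \<le> norm k * d" using v by (intro mult_left_mono) auto
        finally show "exp \<bar>Re \<zeta>\<bar> \<le> exp (d * norm k)" by (simp add: mult.commute)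
      qed auto
      also have "\<dots> \<le> exp (d * norm k) * (2 / d\<^sup>2 * exp (d * norm k) * (norm v)\<^sup>2)"
      proof (rule mult_left_mono)
        have "1 + d * norm k + (d * norm k)\<^sup>2 / 2 \<le> exp (d * norm k)"
          using d by (intro exp_lower_Taylor_quadratic) auto
        then have "(d * norm k)\<^sup>2 \<le> 2 * exp (d * norm k)"
          using mult_nonneg_nonneg[of d "norm k"] d norm_ge_zero[of k] by linarith
        then have "(norm k)\<^sup>2 \<le> 2 / d\<^sup>2 * exp (d * norm k)"
          using d by (simp add: power_mult_distrib field_simps)
        then show "(norm k * norm v)\<^sup>2 \<le> 2 / d\<^sup>2 * exp (d * norm k) * (norm v)\<^sup>2"
          unfolding power_mult_distrib by (rule mult_right_mono) simp
      qed simp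
      finally have E: "norm (exp \<zeta> - 1 - \<zeta>) \<le> exp (d * norm k) * (2 / d\<^sup>2 * exp (d * norm k) * (norm v)\<^sup>2)" .
      have "norm (r k) \<le> exp (y * norm k) * (exp (d * norm k) * (2 / d\<^sup>2 * exp (d * norm k) * (norm v)\<^sup>2)) * norm (w k)"
        unfolding req norm_mult by (intro mult_right_mono mult_mono e E) auto
      also have "\<dots> = 2 / d\<^sup>2 * (norm v)\<^sup>2 * (norm (w k) * exp ((y + 2 * d) * norm k))"
      proof -
        have "exp ((y + 2 * d) * norm k) = exp (y * norm k) * (exp (d * norm k) * exp (d * norm k))"
          by (simp flip: exp_add add: algebra_simps)
        then show ?thesis by (simp only: mult_ac)
      qed
      also have "\<dots> \<le> 2 / d\<^sup>2 * (norm v)\<^sup>2 * (norm (w k) * exp (b * norm k))"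
        using d by (intro mult_left_mono) (auto intro!: mult_right_mono)
      finally show "norm (r k) \<le> (2 / d\<^sup>2 * (norm v)\<^sup>2) * (norm (w k) * exp (b * norm k))" .
    qed
    also have "\<dots> = 2 / d\<^sup>2 * W * norm v * norm v" by (simp add: W_def power2_eq_square)
    finally show "norm (fint w z - fint w x - D (z - x)) / norm (z - x) \<le> 2 / d\<^sup>2 * W * norm (z - x)"
      using v by (simp add: v_def[symmetric] divide_le_eq)
  qed (use d bl in auto)
  show "\<exists>D. (fint w has_derivative D) (at x) \<and> (\<forall>c v. D (c *s v) = c * D v)"
    using der Dc by blast
qed

section \<open>The Borel transform in physical space\<close>

text \<open>Fourier inversion at a point of the tube is bounded by the L1 part of
  \<open>bnd\<close>, so it commutes with integration in p by Fubini, as for convolutions.\<close>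

lemma fint_prim:
  fixes F F1 :: "real ^ 'n \<Rightarrow> real \<Rightarrow> complex"
  assumes F: "tb b A T F" and F1: "tb b A1 T F1" and x: "x \<in> tube b"
    and pr: "\<And>k. k \<noteq> 0 \<Longrightarrow> prim T (F k) (F1 k)"
  shows "prim T (\<lambda>p. fint (\<lambda>k. F k p) x) (\<lambda>p. fint (\<lambda>k. F1 k p) x)"
proof (rule primI)
  note [measurable] = tb_meas[OF F] tb_meas[OF F1]
  have fi: "integrable lborel (\<lambda>k. exp (\<i> * cdot k x) * w k)" if "bnd b c w" for w c
    by (rule fint_integrable[OF bnd_weight_integrable(1)[OF that] bnd_meas[OF that] x])
  have fn: "(\<integral>k. norm (exp (\<i> * cdot k x) * w k) \<partial>lborel) \<le> c" if w: "bnd b c w" for w c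
  proof -
    have "(\<integral>k. norm (exp (\<i> * cdot k x) * w k) \<partial>lborel) \<le> (\<integral>k. norm (w k) * exp (b * norm k) \<partial>lborel)"
      by (intro integral_mono integrable_norm fi[OF w] bnd_weight_integrable[OF w] norm_exp_cdot_tube x)
    also have "\<dots> \<le> c" by (rule bnd_weight_integrable[OF w])
    finally show ?thesis .
  qed
  show "(\<lambda>p. fint (\<lambda>k. F1 k p) x) \<in> borel_measurable borel" unfolding fint_def by measurable
  show "norm (fint (\<lambda>k. F1 k s) x) \<le> A1" if "s \<in> {0<..<T}" for s
    using that by (intro fint_bound[OF tb_bnd[OF F1] x]) auto
  fix p assume p: "p \<in> {0..T}"
  define P where "P k' r = exp (\<i> * cdot k' x) * F1 k' r" for k' r
  have [measurable]: "(\<lambda>(x, r). P x r) \<in> borel_measurable (borel \<Otimes>\<^sub>M borel)"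
    unfolding P_def by measurable
  have i: "integrable lborel (\<lambda>x. P x r)" "(\<integral>x. norm (P x r) \<partial>lborel) \<le> A1" if "r \<in> {0<..<p}" for r
    unfolding P_def using that p by (auto intro!: fi fn tb_bnd[OF F1])
  note sw = swap_integrals[of P "{0<..<p}" "\<lambda>_. A1", OF _ _ i]
  have c: "set_integrable lborel {0<..<p} (\<lambda>_. A1)"
    by (rule set_integrable_bounded_Ioo[where C = "norm A1"]) auto
  have "fint (\<lambda>k. F k p) x = (\<integral>k'. exp (\<i> * cdot k' x) * F k' 0 + (LINT r:{0<..<p}|lborel. P k' r) \<partial>lborel)"
    unfolding fint_def
  proof (rule integral_cong_AE)
    show "AE k' in lborel. exp (\<i> * cdot k' x) * F k' p = exp (\<i> * cdot k' x) * F k' 0 + (LINT r:{0<..<p}|lborel. P k' r)"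
      using AE_nonzero
    proof eventually_elim
      case (elim k')
      have "F k' p = F k' 0 + (LINT r:{0<..<p}|lborel. F1 k' r)"
        by (rule prim_ftc[OF pr[OF elim] p])
      then show ?case by (simp add: P_def distrib_left)
    qed
  qed (unfold set_lebesgue_integral_def, measurable)
  also have "\<dots> = fint (\<lambda>k. F k 0) x + (\<integral>k'. (LINT r:{0<..<p}|lborel. P k' r) \<partial>lborel)"
    unfolding fint_def using p c
    by (intro Bochner_Integration.integral_add fi[OF tb_bnd[OF F, of 0]] sw(2)) auto
  also have "(\<integral>k'. (LINT r:{0<..<p}|lborel. P k' r) \<partial>lborel) = (LINT r:{0<..<p}|lborel. fint (\<lambda>k. F1 k r) x)"
    using sw(1)[OF _ _ _ _ c] unfolding fint_def P_def by simp
  finally show "fint (\<lambda>k. F k p) x = fint (\<lambda>k. F k 0) x + (LINT r:{0<..<p}|lborel. fint (\<lambda>k. F1 k r) x)" .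
qed

lemma cvec_tube: "0 < b \<Longrightarrow> cvec x \<in> tube b"
  by (simp add: tube_def cvec_def zero_vec_def[symmetric])

section \<open>Laplace integrals and Watson's lemma\<close>

lemma norm_exp_laplace_le:
  assumes t: "Re (1 / t) > \<omega>" and r: "0 < r"
  shows "norm (exp (- of_real r / t)) \<le> exp (- (\<omega> * r))"
proof -
  have e: "- of_real r / t = (- r) *\<^sub>R (1 / t)" by (simp add: scaleR_conv_of_real)
  have "Re (- of_real r / t) = - (r * Re (1 / t))"
    unfolding e scaleR_complex.sel by (simp only: mult_minus_left)
  also have "\<dots> \<le> - (\<omega> * r)" using t r mult_left_mono[of \<omega> "Re (1 / t)" r] by (simp add: mult.commute)
  finally show ?thesis by (simp only: norm_exp_eq_Re exp_le_cancel_iff)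
qed

text \<open>The Gamma integral after the scaling p = t x.\<close>

lemma laplace_power:
  fixes t :: real
  assumes "0 < t"
  shows "set_integrable lborel {0<..} (\<lambda>p. exp (- p / t) * p ^ n)" (is ?I)
    and "(LINT p:{0<..}|lborel. exp (- p / t) * p ^ n) = fact n * t ^ Suc n"
proof -
  have nn: "(\<integral>\<^sup>+p. ennreal (indicat_real {0<..} p * (exp (- p / t) * p ^ n)) \<partial>lborel) = ennreal (fact n * t ^ Suc n)"
  proof -
    have "(\<integral>\<^sup>+p. ennreal (indicat_real {0<..} p * (exp (- p / t) * p ^ n)) \<partial>lborel)
      = ennreal t * (\<integral>\<^sup>+x. ennreal (indicat_real {0<..} (t * x) * (exp (- (t * x) / t) * (t * x) ^ n)) \<partial>lborel)"
      using nn_integral_real_affine[of "\<lambda>p. ennreal (indicat_real {0<..} p * (exp (- p / t) * p ^ n))" t 0] assms by simp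
    also have "(\<integral>\<^sup>+x. ennreal (indicat_real {0<..} (t * x) * (exp (- (t * x) / t) * (t * x) ^ n)) \<partial>lborel)
      = (\<integral>\<^sup>+x. ennreal (t ^ n) * (ennreal (x ^ n * exp (- x)) * indicator {0..} x) \<partial>lborel)"
    proof (rule nn_integral_cong_AE)
      show "AE x in lborel. ennreal (indicat_real {0<..} (t * x) * (exp (- (t * x) / t) * (t * x) ^ n))
          = ennreal (t ^ n) * (ennreal (x ^ n * exp (- x)) * indicator {0..} x)"
        using AE_lborel_singleton[of 0]
      proof eventually_elim
        case (elim x)
        then show ?case using assms
          by (cases "0 < x") (auto simp: zero_less_mult_iff power_mult_distrib ennreal_mult[symmetric] mult_ac)
      qed
    qed
    also have "\<dots> = ennreal (t ^ n) * (\<integral>\<^sup>+x. (ennreal (x ^ n * exp (- x)) * indicator {0..} x) \<partial>lborel)"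
      by (rule nn_integral_cmult) simp
    also have "\<dots> = ennreal (t ^ n) * ennreal (fact n)"
      unfolding nn_intergal_power_times_exp_Ici by (simp add: ennreal_of_nat_eq_real_of_nat)
    finally show ?thesis using assms by (simp add: ennreal_mult[symmetric] mult_ac)
  qed
  have nonneg: "0 \<le> indicat_real {0<..} p * (exp (- p / t) * p ^ n)" for p by (auto simp: indicator_def)
  have i: "integrable lborel (\<lambda>p. indicat_real {0<..} p * (exp (- p / t) * p ^ n))"
    using nn nonneg by (intro integrableI_nonneg) auto
  then show ?I by (simp add: set_integrable_def)
  have "ennreal (\<integral>p. indicat_real {0<..} p * (exp (- p / t) * p ^ n) \<partial>lborel) = ennreal (fact n * t ^ Suc n)"
    using nn_integral_eq_integral[OF i] nonneg nn by simp
  then have "(\<integral>p. indicat_real {0<..} p * (exp (- p / t) * p ^ n) \<partial>lborel) = fact n * t ^ Suc n"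
    using assms nonneg by (subst (asm) ennreal_inj) (auto intro!: Bochner_Integration.integral_nonneg)
  then show "(LINT p:{0<..}|lborel. exp (- p / t) * p ^ n) = fact n * t ^ Suc n"
    by (simp add: set_lebesgue_integral_def)
qed

lemma set_integral_sum_finite:
  fixes f :: "'i \<Rightarrow> 'a \<Rightarrow> 'b :: {banach, second_countable_topology}"
  assumes "\<And>i. i \<in> I \<Longrightarrow> set_integrable M A (f i)"
  shows "set_integrable M A (\<lambda>x. \<Sum>i\<in>I. f i x)"
    and "(LINT x:A|M. (\<Sum>i\<in>I. f i x)) = (\<Sum>i\<in>I. (LINT x:A|M. f i x))"
  using assms unfolding set_integrable_def set_lebesgue_integral_def scaleR_sum_right
  by (auto intro!: Bochner_Integration.integrable_sum Bochner_Integration.integral_sum)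

text \<open>Watson's lemma.  The bound on the remainder loses one power of \<open>t\<close>, because \<open>\<phi>\<close> is only known to be
  integrable for large \<open>p\<close>.\<close>

lemma watson:
  fixes \<phi> :: "real \<Rightarrow> complex" and a :: "nat \<Rightarrow> complex"
  assumes m[measurable]: "\<phi> \<in> borel_measurable borel" and i: "set_integrable lborel {0<..} (\<lambda>p. exp (- (\<omega> * p)) *\<^sub>R \<phi> p)"
    and \<omega>: "0 < \<omega>" and C: "\<And>q. q \<in> {0..1} \<Longrightarrow> norm (\<phi> q - (\<Sum>j\<le>n. a j * of_real q ^ j / fact j)) \<le> C * q ^ Suc n"
  shows "\<exists>C'. \<forall>t. 0 < t \<longrightarrow> t < 1 / (2 * \<omega>) \<longrightarrow>
     norm ((LINT p:{0<..}|lborel. exp (- of_real p / of_real t) * \<phi> p) - (\<Sum>j\<le>n. of_real (t ^ Suc j) * a j)) \<le> C' * t ^ Suc n"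
proof -
  define K where "K = (LINT p:{0<..}|lborel. exp (- (\<omega> * p)) * norm (\<phi> p))"
  have iK: "set_integrable lborel {0<..} (\<lambda>p. exp (- (\<omega> * p)) * norm (\<phi> p))"
    using set_integrable_norm[OF i] by simp
  define C2 where "C2 = \<bar>C\<bar> + (\<Sum>j\<le>n. norm (a j))"
  define \<psi> where "\<psi> q = \<phi> q - (\<Sum>j\<le>n. a j * of_real q ^ j / fact j)" for q
  \<comment> \<open>One estimate for all q: for q \<le> 1 the Taylor hypothesis gives it through C,
    and for q > 1 all powers up to n are dominated by q^(n + 1) and \<phi> itself is kept.\<close>
  have \<psi>: "norm (\<psi> q) \<le> q ^ Suc n * (C2 + norm (\<phi> q))" if q: "0 < q" for q
  proof (cases "q \<le> 1")
    case True
    then have "norm (\<psi> q) \<le> q ^ Suc n * C" using C[of q] q by (simp add: \<psi>_def mult.commute)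
    also have "\<dots> \<le> q ^ Suc n * (C2 + norm (\<phi> q))"
    proof (rule mult_left_mono)
      have "0 \<le> (\<Sum>j\<le>n. norm (a j))" by (intro sum_nonneg) simp
      then show "C \<le> C2 + norm (\<phi> q)"
        unfolding C2_def using abs_ge_self[of C] norm_ge_zero[of "\<phi> q"] by linarith
    qed (use q in simp)
    finally show ?thesis .
  next
    case False
    have "norm (\<psi> q) \<le> norm (\<phi> q) + norm (\<Sum>j\<le>n. a j * of_real q ^ j / fact j)"
      unfolding \<psi>_def by (rule norm_triangle_ineq4)
    also have "norm (\<Sum>j\<le>n. a j * of_real q ^ j / fact j) \<le> (\<Sum>j\<le>n. norm (a j) * q ^ Suc n)"
    proof (rule sum_norm_le)
      fix j assume j: "j \<in> {..n}"
      have "norm (a j * of_real q ^ j / fact j) = norm (a j) * (q ^ j / fact j)"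
        using q by (simp add: norm_mult norm_divide norm_power)
      also have "\<dots> \<le> norm (a j) * (q ^ Suc n / 1)"
        using False q j by (intro mult_left_mono frac_le power_increasing) auto
      finally show "norm (a j * of_real q ^ j / fact j) \<le> norm (a j) * q ^ Suc n" by simp
    qed
    also have "norm (\<phi> q) + (\<Sum>j\<le>n. norm (a j) * q ^ Suc n) \<le> q ^ Suc n * (C2 + norm (\<phi> q))"
    proof -
      have "norm (\<phi> q) * 1 \<le> norm (\<phi> q) * q ^ Suc n" using False by (intro mult_left_mono one_le_power) auto
      moreover have "0 \<le> q ^ Suc n * \<bar>C\<bar>" using q by simp
      ultimately show ?thesis by (simp add: C2_def distrib_left sum_distrib_left mult.commute)
    qed
    finally show ?thesis by simp
  qed
  define C' where "C' = C2 * fact (Suc n) * (1 / (2 * \<omega>)) + fact (Suc n) * 2 ^ Suc n * K"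
  have "norm ((LINT p:{0<..}|lborel. exp (- of_real p / of_real t) * \<phi> p) - (\<Sum>j\<le>n. of_real (t ^ Suc j) * a j)) \<le> C' * t ^ Suc n"
    if t: "0 < t" "t < 1 / (2 * \<omega>)" for t
  proof -
    define s where "s = 1 / t - \<omega>"
    have s: "1 / (2 * t) \<le> s" "0 < s" 
    proof -
      have "\<omega> < 1 / (2 * t)" using t \<omega> by (simp add: field_simps)
      moreover have "1 / t = 1 / (2 * t) + 1 / (2 * t)" by (simp add: field_simps)
      moreover have "0 < 1 / (2 * t)" using t by simp
      ultimately show "1 / (2 * t) \<le> s" "0 < s" unfolding s_def by linarith+
    qed
    have e: "exp (- of_real p / of_real t) = complex_of_real (exp (- p / t))" for p
      by (simp flip: exp_of_real)
    \<comment> \<open>As t < 1 / (2 \<omega>), the surplus rate s = 1 / t - \<omega> is at least 1 /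
      (2 t). The power of p is absorbed by a single term of the series of exp (p s), and exp (-
      \<omega> p) remains to integrate \<phi>.\<close>
    have sup: "exp (- p / t) * p ^ Suc n \<le> fact (Suc n) * 2 ^ Suc n * t ^ Suc n * exp (- (\<omega> * p))" if p: "0 < p" for p
    proof -
      have "(p * s) ^ Suc n / fact (Suc n) \<le> exp (p * s)"
      proof -
        have "(\<Sum>i\<in>{Suc n}. (p * s) ^ i /\<^sub>R fact i) \<le> (\<Sum>i. (p * s) ^ i /\<^sub>R fact i)"
          using p s by (intro sum_le_suminf summable_exp_generic) auto
        then show ?thesis by (simp add: exp_def divide_inverse mult.commute)
      qed
      then have "(p * s) ^ Suc n \<le> fact (Suc n) * exp (p * s)" by (simp add: divide_le_eq mult.commute)
      moreover have "(p * (1 / (2 * t))) ^ Suc n \<le> (p * s) ^ Suc n"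
        using p s t by (intro power_mono mult_left_mono) auto
      ultimately have "(p * (1 / (2 * t))) ^ Suc n \<le> fact (Suc n) * exp (p * s)" by linarith
      then have "(p * (1 / (2 * t))) ^ Suc n * (2 * t) ^ Suc n \<le> fact (Suc n) * exp (p * s) * (2 * t) ^ Suc n"
        using t by (intro mult_right_mono) auto
      moreover have "(p * (1 / (2 * t))) ^ Suc n * (2 * t) ^ Suc n = p ^ Suc n"
        unfolding power_mult_distrib[symmetric] using t by simp
      ultimately have "exp (- p / t) * p ^ Suc n \<le> exp (- p / t) * (fact (Suc n) * exp (p * s) * (2 * t) ^ Suc n)"
        by (intro mult_left_mono) auto
      also have "\<dots> = fact (Suc n) * 2 ^ Suc n * t ^ Suc n * (exp (- p / t) * exp (p * s))"
        unfolding power_mult_distrib by (simp only: mult_ac)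
      also have "exp (- p / t) * exp (p * s) = exp (- (\<omega> * p))"
        unfolding s_def by (simp flip: exp_add add: algebra_simps)
      finally show ?thesis .
    qed
    have lp: "set_integrable lborel {0<..} (\<lambda>p. exp (- p / t) * p ^ j)" for j by (rule laplace_power(1)[OF t(1)])
    have i1: "set_integrable lborel {0<..} (\<lambda>p. complex_of_real (exp (- p / t) * p ^ j) * (a j / fact j))" for j
      using integrable_mult_left[OF integrable_of_real[OF lp[of j, unfolded set_integrable_def], where 'a = complex], of "a j / fact j"]
      unfolding set_integrable_def by (rule Bochner_Integration.integrable_cong[THEN iffD1, rotated -1]) (auto simp: indicator_def)
    have dom: "norm (of_real (exp (- p / t)) * \<psi> p) \<le> C2 * (exp (- p / t) * p ^ Suc n) + fact (Suc n) * 2 ^ Suc n * t ^ Suc n * (exp (- (\<omega> * p)) * norm (\<phi> p))"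
      if p: "0 < p" for p
    proof -
      have "norm (of_real (exp (- p / t)) * \<psi> p) \<le> exp (- p / t) * (p ^ Suc n * (C2 + norm (\<phi> p)))"
        unfolding norm_mult using \<psi>[OF p] by (simp add: mult_left_mono)
      also have "\<dots> = C2 * (exp (- p / t) * p ^ Suc n) + (exp (- p / t) * p ^ Suc n) * norm (\<phi> p)"
        by (simp add: algebra_simps)
      also have "\<dots> \<le> C2 * (exp (- p / t) * p ^ Suc n) + (fact (Suc n) * 2 ^ Suc n * t ^ Suc n * exp (- (\<omega> * p))) * norm (\<phi> p)"
        by (intro add_left_mono mult_right_mono sup p) simp
      finally show ?thesis by (simp only: mult.assoc)
    qed
    have iD: "set_integrable lborel {0<..} (\<lambda>p. C2 * (exp (- p / t) * p ^ Suc n) + fact (Suc n) * 2 ^ Suc n * t ^ Suc n * (exp (- (\<omega> * p)) * norm (\<phi> p)))"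
      by (intro set_integral_add set_integrable_mult_right lp iK)
    have [measurable]: "\<psi> \<in> borel_measurable borel" unfolding \<psi>_def[abs_def] by measurable
    have i\<psi>: "set_integrable lborel {0<..} (\<lambda>p. of_real (exp (- p / t)) * \<psi> p)"
      unfolding set_integrable_def
      by (rule Bochner_Integration.integrable_bound[OF iD[unfolded set_integrable_def]])
         (use order_trans[OF dom abs_ge_self] in \<open>auto intro!: AE_I2 simp del: fact_Suc power_Suc simp: indicator_def\<close>)
    have "(LINT p:{0<..}|lborel. exp (- of_real p / of_real t) * \<phi> p)
       = (LINT p:{0<..}|lborel. of_real (exp (- p / t)) * \<psi> p + (\<Sum>j\<le>n. complex_of_real (exp (- p / t) * p ^ j) * (a j / fact j)))"
      unfolding e \<psi>_def by (intro set_lebesgue_integral_cong) (auto simp: algebra_simps sum_distrib_left)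
    also have "\<dots> = (LINT p:{0<..}|lborel. of_real (exp (- p / t)) * \<psi> p) + (LINT p:{0<..}|lborel. (\<Sum>j\<le>n. complex_of_real (exp (- p / t) * p ^ j) * (a j / fact j)))"
      by (intro set_integral_add i\<psi> set_integral_sum_finite(1) i1)
    also have "(LINT p:{0<..}|lborel. (\<Sum>j\<le>n. complex_of_real (exp (- p / t) * p ^ j) * (a j / fact j)))
      = (\<Sum>j\<le>n. (LINT p:{0<..}|lborel. complex_of_real (exp (- p / t) * p ^ j) * (a j / fact j)))"
      by (rule set_integral_sum_finite(2)) (rule i1)
    also have "\<dots> = (\<Sum>j\<le>n. of_real (t ^ Suc j) * a j)"
      by (intro sum.cong refl, simp only: set_integral_mult_left set_integral_complex_of_real laplace_power(2)[OF t(1)]) simp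
    finally have "norm ((LINT p:{0<..}|lborel. exp (- of_real p / of_real t) * \<phi> p) - (\<Sum>j\<le>n. of_real (t ^ Suc j) * a j))
      = norm (LINT p:{0<..}|lborel. of_real (exp (- p / t)) * \<psi> p)" by simp
    also have "\<dots> \<le> (LINT p:{0<..}|lborel. C2 * (exp (- p / t) * p ^ Suc n) + fact (Suc n) * 2 ^ Suc n * t ^ Suc n * (exp (- (\<omega> * p)) * norm (\<phi> p)))"
      unfolding set_lebesgue_integral_def
      by (rule order_trans[OF integral_norm_bound integral_mono[OF integrable_norm[OF i\<psi>[unfolded set_integrable_def]] iD[unfolded set_integrable_def]]])
         (use dom in \<open>auto simp del: fact_Suc power_Suc simp: indicator_def\<close>)
    also have "\<dots> = C2 * (fact (Suc n) * t ^ Suc (Suc n)) + fact (Suc n) * 2 ^ Suc n * t ^ Suc n * K"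
      unfolding K_def by (subst set_integral_add(2)[OF set_integrable_mult_right[OF lp] set_integrable_mult_right[OF iK]])
        (simp only: set_integral_mult_right laplace_power(2)[OF t(1)])
    also have "\<dots> \<le> C' * t ^ Suc n"
    proof -
      have "0 \<le> C2" using sum_nonneg[of "{..n}" "\<lambda>j. norm (a j)"] by (simp add: C2_def)
      then have "C2 * fact (Suc n) * t ^ Suc n * t \<le> C2 * fact (Suc n) * t ^ Suc n * (1 / (2 * \<omega>))"
        using t by (intro mult_left_mono) auto
      then show ?thesis by (simp add: C'_def algebra_simps)
    qed
    finally show ?thesis .
  qed
  then show ?thesis by blast
qed


section \<open>Continuation, Laplace representation and asymptotic series of a solution\<close>

context borel_solution
begin

text \<open>Continuation in p at fixed k. The formula is total in q and k; it converges where the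
  derivative bounds apply, that is, for k \<noteq> 0 and q in a suitable strip.\<close>

definition Wext :: "'i \<Rightarrow> real ^ 'n \<Rightarrow> complex \<Rightarrow> complex" where
  "Wext i k q = (\<Sum>n. Y n i k (pr q) / fact n * (q - of_real (pr q)) ^ n)"

definition HH :: "'i \<Rightarrow> complex ^ 'n \<Rightarrow> complex \<Rightarrow> complex" where
  "HH i x q = fint (\<lambda>k. Wext i k q) x"

lemma Wext_meas: "(\<lambda>k. Wext i k q) \<in> borel_measurable borel"
proof -
  note [measurable] = tb_meas1(2)[OF Y_meas]
  show ?thesis unfolding Wext_def by measurable
qed

lemma Wext_of_real: "0 \<le> p \<Longrightarrow> Wext i k (of_real p) = Y0 i k p"
  using powser_zero[of "\<lambda>n. Y n i k p / fact n"] by (simp only: Wext_def pr_of_real diff_self) simp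

lemma HH_of_real: "0 \<le> p \<Longrightarrow> HH i x (of_real p) = fint (\<lambda>k. Y0 i k p) x"
  by (simp add: HH_def Wext_of_real)

lemma chain_fint:
  assumes b: "0 < b" "b < \<beta>" and T: "0 < T" and \<rho>: "0 < \<rho>"
    and B: "\<And>n p i. p \<in> {0..T} \<Longrightarrow> bnd b (B * fact n / \<rho> ^ n) (\<lambda>k. Y n i k p)" and x: "x \<in> tube b"
  shows "taylor_chain (\<lambda>n p. fint (\<lambda>k. Y n i k p) x) T \<rho> B"
proof
  have tb: "tb b (B * fact n / \<rho> ^ n) T (Y n i)" for n
    using B Y_meas by (simp add: tb_def)
  show "prim T (\<lambda>p. fint (\<lambda>k. Y n i k p) x) (\<lambda>p. fint (\<lambda>k. Y (Suc n) i k p) x)" for n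
    using T by (intro fint_prim[OF tb tb x] Y_ftc) auto
  show "norm (fint (\<lambda>k. Y n i k p) x) \<le> B * fact n / \<rho> ^ n" if "p \<in> {0..T}" for n p
    by (rule fint_bound[OF B[OF that] x])
qed (use T \<rho> in auto)

lemma chain_pointwise:
  assumes T: "0 < T" and k: "k \<noteq> 0"
  shows "\<exists>B \<rho>. taylor_chain (\<lambda>n p. Y n i k p) T \<rho> B"
proof -
  obtain B \<rho> where B: "0 < \<rho>" "\<And>n p i. p \<in> {0..T} \<Longrightarrow> bnd 0 (B * fact n / \<rho> ^ n) (\<lambda>k. Y n i k p)"
    using Y_local_bound[OF order_refl \<beta>, of T] T by (meson less_imp_le)
  have "taylor_chain (\<lambda>n p. Y n i k p) T \<rho> B"
  proof
    show "prim T (Y n i k) (Y (Suc n) i k)" for n using T k by (intro Y_ftc) auto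
    show "norm (Y n i k p) \<le> B * fact n / \<rho> ^ n" if "p \<in> {0..T}" for n p
      using bnd_sup[OF B(2)[OF that] k] by simp
  qed (use T B in auto)
  then show ?thesis by blast
qed

text \<open>The terms have weighted norms at most B (|z| / \<rho>)^n, a convergent geometric series,
  so the sum commutes with the integral over k. The first claim yields holomorphy in x, the second
  identifies \<open>HH\<close> with the continuation of the chain of Fourier integrals.\<close>

lemma Wext_expansion:
  assumes b: "0 < b" and T: "0 < T" and \<rho>: "0 < \<rho>"
    and B: "\<And>n p i. p \<in> {0..T} \<Longrightarrow> bnd b (B * fact n / \<rho> ^ n) (\<lambda>k. Y n i k p)"
    and q: "q \<in> strip T \<rho>"
  shows "integrable lborel (\<lambda>k. norm (Wext i k q) * exp (b * norm k))"
    and "x \<in> tube b \<Longrightarrow> HH i x q = (\<Sum>n. fint (\<lambda>k. Y n i k (pr q)) x / fact n * (q - of_real (pr q)) ^ n)"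
proof -
  define p where "p = pr q"
  define z where "z = q - of_real p"
  have p: "p \<in> {0..T}" using q T by (auto simp: p_def pr_def strip_def)
  have z: "cmod z < \<rho>" using q \<rho> by (simp add: z_def p_def strip_def)
  define F where "F n k = Y n i k p / fact n * z ^ n" for n k
  have B0: "0 \<le> B" using bnd_nonneg[OF B[OF p, of 0]] by simp
  have F: "bnd b (B * (cmod z / \<rho>) ^ n) (F n)" for n
  proof -
    have "bnd b ((cmod z ^ n / fact n) * (B * fact n / \<rho> ^ n)) (\<lambda>k. (z ^ n / fact n) * Y n i k p)"
      by (rule bnd_mult[OF B[OF p]]) (auto simp: norm_divide norm_power)
    moreover have "F n = (\<lambda>k. (z ^ n / fact n) * Y n i k p)" by (simp add: F_def fun_eq_iff)
    ultimately show ?thesis by (simp add: power_divide mult.commute)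
  qed
  have geo: "summable (\<lambda>n. B * (cmod z / \<rho>) ^ n)"
    using z \<rho> by (intro summable_mult summable_geometric) simp
  have Fm[measurable]: "F n \<in> borel_measurable borel" for n using bnd_meas[OF F] .
  have s: "AE k in lborel. summable (\<lambda>n. norm (F n k) * exp (b * norm k))"
    using AE_nonzero
  proof eventually_elim
    case (elim k)
    show ?case
      by (rule summable_comparison_test'[OF geo, where N = 0]) (use bnd_sup[OF F elim] in simp)
  qed
  have si: "summable (\<lambda>n. \<integral>k. norm (F n k) * exp (b * norm k) \<partial>lborel)"
    by (rule summable_comparison_test'[OF geo, where N = 0])
       (use bnd_weight_integrable(2)[OF F] in \<open>simp add: Bochner_Integration.integral_nonneg\<close>)
  have We: "Wext i k q = (\<Sum>n. F n k)" for k by (simp add: Wext_def F_def z_def p_def)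
  have "integrable lborel (\<lambda>k. \<Sum>n. F n k * of_real (exp (b * norm k)))"
  proof (rule integrable_suminf)
    show "integrable lborel (\<lambda>k. F n k * of_real (exp (b * norm k)))" for n
      by (rule Bochner_Integration.integrable_bound[OF bnd_weight_integrable(1)[OF F[of n]]]) (auto simp: norm_mult)
  qed (use s si in \<open>simp_all add: norm_mult\<close>)
  then have "integrable lborel (\<lambda>k. norm (\<Sum>n. F n k * of_real (exp (b * norm k))))" by (rule integrable_norm)
  moreover have "AE k in lborel. norm (\<Sum>n. F n k * of_real (exp (b * norm k))) = norm (Wext i k q) * exp (b * norm k)"
    using s
  proof eventually_elim
    case (elim k)
    have "summable (\<lambda>n. norm (F n k))"
      using summable_mult2[OF elim, of "exp (- (b * norm k))"] by (simp add: mult.assoc flip: exp_add)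
    then have "summable (\<lambda>n. F n k)" by (rule summable_norm_cancel)
    then have "(\<Sum>n. F n k * of_real (exp (b * norm k))) = (\<Sum>n. F n k) * of_real (exp (b * norm k))"
      by (rule suminf_mult2[symmetric])
    then show ?case by (simp add: We norm_mult)
  qed
  ultimately show "integrable lborel (\<lambda>k. norm (Wext i k q) * exp (b * norm k))"
    using Wext_meas[of i q] by (subst (asm) integrable_cong_AE) auto
  assume x: "x \<in> tube b"
  have le: "norm (exp (\<i> * cdot k x) * F n k) \<le> norm (F n k) * exp (b * norm k)" for n k
    by (rule norm_exp_cdot_tube[OF x])
  have iF: "integrable lborel (\<lambda>k. exp (\<i> * cdot k x) * F n k)" for n
    by (rule fint_integrable[OF bnd_weight_integrable(1)[OF F] bnd_meas[OF F] x])
  have s': "AE k in lborel. summable (\<lambda>n. norm (exp (\<i> * cdot k x) * F n k))"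
    using s
  proof eventually_elim
    case (elim k)
    show ?case by (rule summable_comparison_test'[OF elim, where N = 0]) (use le in simp)
  qed
  have si': "summable (\<lambda>n. \<integral>k. norm (exp (\<i> * cdot k x) * F n k) \<partial>lborel)"
  proof (rule summable_comparison_test'[OF si, where N = 0])
    fix n
    have "(\<integral>k. norm (exp (\<i> * cdot k x) * F n k) \<partial>lborel) \<le> (\<integral>k. norm (F n k) * exp (b * norm k) \<partial>lborel)"
      by (intro integral_mono integrable_norm iF bnd_weight_integrable[OF F] le)
    then show "norm (\<integral>k. norm (exp (\<i> * cdot k x) * F n k) \<partial>lborel) \<le> (\<integral>k. norm (F n k) * exp (b * norm k) \<partial>lborel)"
      by (simp add: Bochner_Integration.integral_nonneg)
  qed
  have "HH i x q = (\<integral>k. (\<Sum>n. exp (\<i> * cdot k x) * F n k) \<partial>lborel)"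
    unfolding HH_def fint_def
  proof (rule integral_cong_AE)
    show "AE k in lborel. exp (\<i> * cdot k x) * Wext i k q = (\<Sum>n. exp (\<i> * cdot k x) * F n k)"
      using s'
    proof eventually_elim
      case (elim k)
      have "summable (\<lambda>n. exp (- (\<i> * cdot k x)) * (exp (\<i> * cdot k x) * F n k))"
        by (intro summable_mult summable_norm_cancel[OF elim])
      then have "summable (\<lambda>n. F n k)" by (simp add: mult.assoc[symmetric] flip: exp_add)
      then show ?case unfolding We by (rule suminf_mult[symmetric])
    qed
    show "(\<lambda>k. exp (\<i> * cdot k x) * Wext i k q) \<in> borel_measurable lborel" using Wext_meas[of i q] by measurable
    show "(\<lambda>k. \<Sum>n. exp (\<i> * cdot k x) * F n k) \<in> borel_measurable lborel" by measurable
  qed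
  also have "\<dots> = (\<Sum>n. \<integral>k. exp (\<i> * cdot k x) * F n k \<partial>lborel)"
    by (rule integral_suminf[OF iF s' si'])
  also have "\<dots> = (\<Sum>n. fint (\<lambda>k. Y n i k (pr q)) x / fact n * (q - of_real (pr q)) ^ n)"
  proof (intro suminf_cong)
    fix n
    have "(\<integral>k. exp (\<i> * cdot k x) * F n k \<partial>lborel) = (\<integral>k. (z ^ n / fact n) * (exp (\<i> * cdot k x) * Y n i k p) \<partial>lborel)"
      by (simp add: F_def mult_ac)
    also have "\<dots> = (z ^ n / fact n) * fint (\<lambda>k. Y n i k p) x"
      unfolding fint_def by (rule integral_mult_right_zero)
    finally show "(\<integral>k. exp (\<i> * cdot k x) * F n k \<partial>lborel) = fint (\<lambda>k. Y n i k (pr q)) x / fact n * (q - of_real (pr q)) ^ n"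
      by (simp add: z_def p_def)
  qed
  finally show "HH i x q = (\<Sum>n. fint (\<lambda>k. Y n i k (pr q)) x / fact n * (q - of_real (pr q)) ^ n)" .
qed

text \<open>The radius may shrink as T grows, so the neighbourhood is a union of strips, one for
  each T. The derivative bounds are uniform over the tube, hence one set serves all its
  points.\<close>

lemma HH_neighbourhood:
  assumes b: "0 < b" "b < \<beta>"
  shows "\<exists>U. open U \<and> of_real ` {0::real..} \<subseteq> U \<and> (\<forall>x\<in>tube b. \<forall>i. HH i x holomorphic_on U) \<and>
    (\<forall>q\<in>U. \<forall>i. holomorphic_vec (\<lambda>x. HH i x q) (tube b))"
proof -
  have "\<forall>T::nat. \<exists>B \<rho>. 0 < \<rho> \<and> (\<forall>n p i. p \<in> {0..real (Suc T)} \<longrightarrow> bnd b (B * fact n / \<rho> ^ n) (\<lambda>k. Y n i k p))"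
    using Y_local_bound[of b] b by auto
  then obtain B \<rho> where \<rho>: "\<And>T::nat. 0 < \<rho> T"
    and B: "\<And>T n p i. p \<in> {0..real (Suc T)} \<Longrightarrow> bnd b (B T * fact n / \<rho> T ^ n) (\<lambda>k. Y n i k p)"
    by metis
  define U where "U = (\<Union>T::nat. strip (real (Suc T)) (\<rho> T))"
  have "open U" unfolding U_def by (intro open_UN ballI open_strip)
  moreover have "of_real ` {0::real..} \<subseteq> U"
  proof safe
    fix p :: real assume p: "0 \<le> p"
    obtain T :: nat where "p < real T" using reals_Archimedean2 by blast
    then have "of_real p \<in> strip (real (Suc T)) (\<rho> T)" using p \<rho>[of T] by (simp add: strip_def)
    then show "of_real p \<in> U" by (auto simp: U_def)
  qed
  moreover have "HH i x holomorphic_on U" if x: "x \<in> tube b" for x i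
    unfolding U_def
  proof (rule holomorphic_on_UN_open[OF _ open_strip])
    fix T :: nat
    interpret C: taylor_chain "\<lambda>n p. fint (\<lambda>k. Y n i k p) x" "real (Suc T)" "\<rho> T" "B T"
      by (rule chain_fint[OF b _ \<rho> B x]) auto
    have "C.ext q = HH i x q" if q: "q \<in> strip (real (Suc T)) (\<rho> T)" for q
      using Wext_expansion(2)[OF b(1) _ \<rho>[of T] B[of _ T] q x] by (simp add: C.ext_def C.ts_def)
    then show "HH i x holomorphic_on strip (real (Suc T)) (\<rho> T)"
      by (rule holomorphic_transform[OF C.ext_holomorphic])
  qed
  moreover have "holomorphic_vec (\<lambda>x. HH i x q) (tube b)" if "q \<in> U" for q i
  proof -
    obtain T where q: "q \<in> strip (real (Suc T)) (\<rho> T)" using \<open>q \<in> U\<close> by (auto simp: U_def)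
    show ?thesis
      unfolding HH_def
      by (intro fint_holomorphic_vec Wext_meas Wext_expansion(1)[OF b(1) _ \<rho>[of T] B[of _ T] q]) auto
  qed
  ultimately show ?thesis by blast
qed

lemma HH_exp_bound: "\<exists>C\<ge>0. \<forall>x\<in>tube \<beta>. \<forall>p\<ge>1. \<forall>i. norm (HH i x (of_real p)) \<le> C * exp (\<omega> * p)"
proof -
  obtain C where C: "C \<ge> 0" "\<And>p i. p \<ge> 1 \<Longrightarrow> bnd \<beta> (C * exp (\<omega> * p)) (\<lambda>k. Y0 i k p)"
    using Y0_exp_bound by blast
  have "norm (HH i x (of_real p)) \<le> C * exp (\<omega> * p)" if "x \<in> tube \<beta>" "p \<ge> 1" for x p i
    using that fint_bound[OF C(2)] by (simp add: HH_of_real)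
  then show ?thesis using C(1) by blast
qed

lemma Y0_pos_bound: "0 < p \<Longrightarrow> \<exists>B. bnd 0 B (\<lambda>k. Y0 i k p)"
proof -
  assume p: "0 < p"
  obtain B where "\<And>q i. q \<in> {0..p} \<Longrightarrow> bnd 0 B (\<lambda>k. Y0 i k q)"
    using Y0_local_bound[OF order_refl \<beta> less_imp_le[OF p]] by blast
  from this[of p i] show ?thesis using p by auto
qed

lemma Y0_L1: "AE p in lborel. 0 < p \<longrightarrow> (\<integral>k. norm (Y0 i k p) \<partial>lborel) \<le> h p"
  using Y0_class
proof eventually_elim
  case (elim p)
  show ?case
  proof
    assume "0 < p"
    then have "bnd 0 (h p) (\<lambda>k. Y0 i k p)" using elim \<beta> by (auto intro: bnd_mono_b)
    from bnd_weight_integrable(2)[OF this] show "(\<integral>k. norm (Y0 i k p) \<partial>lborel) \<le> h p" by simp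
  qed
qed

lemma Y0_laplace_integrable:
  assumes t: "Re (1 / t) > \<omega>" and k: "k \<noteq> 0"
  shows "set_integrable lborel {0<..} (\<lambda>p. exp (- of_real p / t) * Y0 i k p)"
  unfolding set_integrable_def
proof (rule Bochner_Integration.integrable_bound[OF h_int])
  show "AE p in lborel. norm (indicat_real {0<..} p *\<^sub>R (exp (- of_real p / t) * Y0 i k p)) \<le> norm (exp (- (\<omega> * p)) * h p)"
    using Y0_class
  proof eventually_elim
    case (elim p)
    show ?case
    proof (cases "0 < p")
      case True
      then have "bnd 0 (h p) (\<lambda>k. Y0 i k p)" using elim \<beta> by (auto intro: bnd_mono_b)
      then have "norm (Y0 i k p) \<le> h p" using bnd_sup[OF _ k] by fastforce
      then have "norm (exp (- of_real p / t)) * norm (Y0 i k p) \<le> exp (- (\<omega> * p)) * h p"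
        using norm_exp_laplace_le[OF t True] by (intro mult_mono) auto
      then show ?thesis using True h_nonneg[of p] by (simp add: norm_mult)
    qed (simp add: h_nonneg)
  qed
qed (use tb_meas1(1)[OF Y0_meas, of i k] in measurable)

text \<open>Fubini between k and p. Absolute convergence comes from the L1 part of
  \<open>bnd\<close> in k and the weighted integrability of h in p, as exp (i k x) has modulus 1 for
  real x.\<close>

lemma laplace_fint:
  assumes t: "Re (1 / t) > \<omega>"
  shows "set_integrable lborel {0<..} (\<lambda>p. exp (- of_real p / t) * HH i (cvec x) (of_real p))"
    and "inv_fourier (\<lambda>k. W0 i k + (LINT p:{0<..}|lborel. exp (- of_real p / t) * Y0 i k p)) x
      = inv_fourier (W0 i) x + (LINT p:{0<..}|lborel. exp (- of_real p / t) * HH i (cvec x) (of_real p))"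
proof -
  note [measurable] = Y0_meas
  define P where "P k r = exp (\<i> * cdot k (cvec x)) * (exp (- of_real r / t) * Y0 i k r)" for k r
  have [measurable]: "(\<lambda>(k, r). P k r) \<in> borel_measurable (borel \<Otimes>\<^sub>M borel)" unfolding P_def by measurable
  have ne: "norm (exp (\<i> * cdot k (cvec x))) = 1" for k by (simp add: cdot_cvec)
  note nt = norm_exp_laplace_le[OF t]
  have nP: "norm (P k r) \<le> exp (- (\<omega> * r)) * norm (Y0 i k r)" if "0 < r" for k r
    unfolding P_def norm_mult ne using nt[OF that] by (simp add: mult_right_mono)
  have iY: "integrable lborel (\<lambda>k. norm (Y0 i k r))" if "0 < r" for r
    using Y0_pos_bound[OF that, of i] bnd_weight_integrable(1)[of 0] by fastforce
  have iP: "integrable lborel (\<lambda>k. P k r)" if "r \<in> {0<..}" for r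
  proof (rule Bochner_Integration.integrable_bound)
    show "integrable lborel (\<lambda>k. exp (- (\<omega> * r)) * norm (Y0 i k r))"
      by (intro integrable_mult_right iY) (use that in simp)
    show "AE k in lborel. norm (P k r) \<le> norm (exp (- (\<omega> * r)) * norm (Y0 i k r))"
      using nP[of r] that by simp
  qed (use tb_meas1(2)[of P r] in simp)
  have C: "set_integrable lborel {0<..} (\<lambda>r. \<integral>k. norm (P k r) \<partial>lborel)"
    unfolding set_integrable_def
  proof (rule Bochner_Integration.integrable_bound[OF h_int])
    show "AE r in lborel. norm (indicat_real {0<..} r *\<^sub>R (\<integral>k. norm (P k r) \<partial>lborel)) \<le> norm (exp (- (\<omega> * r)) * h r)"
      using Y0_L1[of i]
    proof eventually_elim
      case (elim r)
      show ?case
      proof (cases "0 < r")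
        case True
        have "(\<integral>k. norm (P k r) \<partial>lborel) \<le> (\<integral>k. exp (- (\<omega> * r)) * norm (Y0 i k r) \<partial>lborel)"
          using True by (intro integral_mono integrable_norm iP integrable_mult_right iY nP) auto
        also have "\<dots> \<le> exp (- (\<omega> * r)) * h r" using elim True by simp
        finally show ?thesis using True h_nonneg[of r] by (simp add: Bochner_Integration.integral_nonneg)
      qed (simp add: h_nonneg)
    qed
  qed measurable
  note sw = swap_integrals[of P "{0<..}", OF _ _ iP order_refl C]
  have HHP: "(\<integral>k. P k r \<partial>lborel) = exp (- of_real r / t) * HH i (cvec x) (of_real r)" if "0 < r" for r
  proof -
    have "(\<integral>k. P k r \<partial>lborel) = (\<integral>k. exp (- of_real r / t) * (exp (\<i> * cdot k (cvec x)) * Y0 i k r) \<partial>lborel)"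
      by (simp add: P_def mult_ac)
    then show ?thesis using that by (simp add: HH_of_real fint_def)
  qed
  have "set_integrable lborel {0<..} (\<lambda>r. \<integral>k. P k r \<partial>lborel)" by (rule sw(3)) auto
  then show 1: "set_integrable lborel {0<..} (\<lambda>p. exp (- of_real p / t) * HH i (cvec x) (of_real p))"
    by (rule set_integrable_cong[THEN iffD1, rotated -1]) (auto simp: HHP)
  have Pk: "exp (\<i> * cdot k (cvec x)) * (LINT p:{0<..}|lborel. exp (- of_real p / t) * Y0 i k p) = (LINT r:{0<..}|lborel. P k r)" for k
    unfolding P_def by simp
  have "inv_fourier (\<lambda>k. W0 i k + (LINT p:{0<..}|lborel. exp (- of_real p / t) * Y0 i k p)) x
     = (\<integral>k. exp (\<i> * cdot k (cvec x)) * W0 i k + (LINT r:{0<..}|lborel. P k r) \<partial>lborel)"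
    unfolding inv_fourier_eq_fint fint_def distrib_left Pk ..
  also have "\<dots> = fint (W0 i) (cvec x) + (\<integral>k. (LINT r:{0<..}|lborel. P k r) \<partial>lborel)"
    unfolding fint_def
    by (intro Bochner_Integration.integral_add fint_integrable[OF bnd_weight_integrable(1)[OF W0] W0_meas cvec_tube[OF \<beta>]] sw(2)) auto
  also have "(\<integral>k. (LINT r:{0<..}|lborel. P k r) \<partial>lborel) = (LINT r:{0<..}|lborel. (\<integral>k. P k r \<partial>lborel))"
    by (rule sw(1)) auto
  also have "\<dots> = (LINT p:{0<..}|lborel. exp (- of_real p / t) * HH i (cvec x) (of_real p))"
    by (rule set_lebesgue_integral_cong) (auto simp: HHP)
  finally show "inv_fourier (\<lambda>k. W0 i k + (LINT p:{0<..}|lborel. exp (- of_real p / t) * Y0 i k p)) x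
      = inv_fourier (W0 i) x + (LINT p:{0<..}|lborel. exp (- of_real p / t) * HH i (cvec x) (of_real p))"
    by (simp add: inv_fourier_eq_fint)
qed

text \<open>The Laplace integral of p^(m - 1) / (m - 1)! is t^m, so the coefficient of t^m is the
  derivative of order m - 1 at p = 0.\<close>

definition coef :: "nat \<Rightarrow> 'i \<Rightarrow> real ^ 'n \<Rightarrow> complex" where
  "coef m i x = fint (\<lambda>k. Y (m - 1) i k 0) (cvec x)"

lemma coef_bound: "\<exists>A0 D0. 0 < A0 \<and> 0 < D0 \<and> (\<forall>m\<ge>1. \<forall>i x. norm (coef m i x) \<le> fact m * A0 * D0 ^ m)"
proof -
  obtain B \<rho> where \<rho>: "0 < \<rho>" and B: "\<And>n i. bnd (\<beta> / 2) (B * fact n / \<rho> ^ n) (\<lambda>k. Y n i k 0)"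
  proof -
    have "\<exists>B \<rho>. 0 < \<rho> \<and> (\<forall>n p i. p \<in> {0..0} \<longrightarrow> bnd (\<beta> / 2) (B * fact n / \<rho> ^ n) (\<lambda>k. Y n i k p))"
      by (rule Y_local_bound) (use \<beta> in auto)
    then show thesis using that by (metis atLeastAtMost_iff order_refl)
  qed
  have B0: "0 \<le> B" using bnd_nonneg[OF B[of 0]] by simp
  \<comment> \<open>B + 1 instead of B makes the constant positive; the factor \<rho> undoes the
    shift between m and the order m - 1 of the derivative.\<close>
  have "norm (coef m i x) \<le> fact m * ((B + 1) * \<rho>) * (1 / \<rho>) ^ m" if m: "1 \<le> m" for m i x
  proof -
    obtain n where n: "m = Suc n" using m by (cases m) auto
    have "norm (coef m i x) \<le> B * fact n / \<rho> ^ n"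
      unfolding coef_def n using \<beta> by (auto intro!: fint_bound[OF B] cvec_tube)
    also have "\<dots> \<le> (B + 1) * fact m / \<rho> ^ n"
      using B0 \<rho> n fact_mono[of n m, where 'a = real] by (intro divide_right_mono mult_mono) auto
    also have "\<dots> = fact m * ((B + 1) * \<rho>) * (1 / \<rho>) ^ m"
      using \<rho> n by (simp add: power_divide)
    finally show ?thesis .
  qed
  then show ?thesis using B0 \<rho> by (intro exI[of _ "(B + 1) * \<rho>"] exI[of _ "1 / \<rho>"]) auto
qed

text \<open>\<open>watson\<close> is applied with one more term than the claim has. That term is
  itself of order t^(K + 1), so dropping it recovers the power lost in the remainder.\<close>

lemma laplace_asymptotics:
  "\<exists>C \<delta>. 0 < \<delta> \<and> (\<forall>t. 0 < t \<longrightarrow> t < \<delta> \<longrightarrow>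
    norm ((LINT p:{0<..}|lborel. exp (- of_real p / of_real t) * HH i (cvec x) (of_real p)) - (\<Sum>m=1..K. of_real (t ^ m) * coef m i x)) \<le> C * t ^ Suc K)"
proof -
  note [measurable] = Y0_meas
  have b: "0 < \<beta> / 2" "\<beta> / 2 < \<beta>" using \<beta> by auto
  obtain B \<rho> where \<rho>: "0 < \<rho>" and B: "\<And>n p i. p \<in> {0..1} \<Longrightarrow> bnd (\<beta> / 2) (B * fact n / \<rho> ^ n) (\<lambda>k. Y n i k p)"
  proof -
    have "\<exists>B \<rho>. 0 < \<rho> \<and> (\<forall>n p i. p \<in> {0..1} \<longrightarrow> bnd (\<beta> / 2) (B * fact n / \<rho> ^ n) (\<lambda>k. Y n i k p))"
      by (rule Y_local_bound) (use \<beta> in auto)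
    then show thesis using that by blast
  qed
  interpret C: taylor_chain "\<lambda>n p. fint (\<lambda>k. Y n i k p) (cvec x)" 1 \<rho> B
    by (rule chain_fint[OF b _ \<rho> B cvec_tube[OF b(1)]]) auto
  define \<phi> where "\<phi> p = fint (\<lambda>k. Y0 i k p) (cvec x)" for p
  define a where "a j = fint (\<lambda>k. Y j i k 0) (cvec x)" for j
  have m[measurable]: "\<phi> \<in> borel_measurable borel" unfolding \<phi>_def fint_def by measurable
  have taylor: "norm (\<phi> q - (\<Sum>j\<le>K. a j * of_real q ^ j / fact j)) \<le> (B * fact (Suc K) / \<rho> ^ Suc K / fact K) * q ^ Suc K" if q: "q \<in> {0..1}" for q
  proof -
    have "norm (fint (\<lambda>k. Y 0 i k q) (cvec x) - (\<Sum>j\<le>K. fint (\<lambda>k. Y j i k 0) (cvec x) * of_real (q - 0) ^ j / fact j))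
      \<le> (B * fact (Suc K) / \<rho> ^ Suc K) * \<bar>q - 0\<bar> ^ Suc K / fact K"
      using q by (intro Taylor_prim[where f = "\<lambda>n p. fint (\<lambda>k. Y n i k p) (cvec x)" and T = 1] C.prim C.bound) auto
    then show ?thesis using q by (simp add: \<phi>_def a_def)
  qed
  have i: "set_integrable lborel {0<..} (\<lambda>p. exp (- (\<omega> * p)) *\<^sub>R \<phi> p)"
    unfolding set_integrable_def
  proof (rule Bochner_Integration.integrable_bound[OF h_int])
    show "AE p in lborel. norm (indicat_real {0<..} p *\<^sub>R exp (- (\<omega> * p)) *\<^sub>R \<phi> p) \<le> norm (exp (- (\<omega> * p)) * h p)"
      using Y0_class
    proof eventually_elim
      case (elim p)
      show ?case
      proof (cases "0 < p")
        case True
        then have "norm (\<phi> p) \<le> h p" unfolding \<phi>_def using elim by (intro fint_bound[of \<beta>] cvec_tube \<beta>) auto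
        then show ?thesis using True h_nonneg[of p] by simp
      qed (simp add: h_nonneg)
    qed
  qed measurable
  obtain C' where C': "\<And>t. 0 < t \<Longrightarrow> t < 1 / (2 * \<omega>) \<Longrightarrow>
     norm ((LINT p:{0<..}|lborel. exp (- of_real p / of_real t) * \<phi> p) - (\<Sum>j\<le>K. of_real (t ^ Suc j) * a j)) \<le> C' * t ^ Suc K"
    using watson[OF m i \<omega> taylor] by blast
  have "norm ((LINT p:{0<..}|lborel. exp (- of_real p / of_real t) * HH i (cvec x) (of_real p)) - (\<Sum>m=1..K. of_real (t ^ m) * coef m i x))
      \<le> (C' + norm (a K)) * t ^ Suc K" if t: "0 < t" "t < 1 / (2 * \<omega>)" for t
  proof -
    have 1: "(LINT p:{0<..}|lborel. exp (- of_real p / of_real t) * HH i (cvec x) (of_real p))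
      = (LINT p:{0<..}|lborel. exp (- of_real p / of_real t) * \<phi> p)"
      by (rule set_lebesgue_integral_cong) (auto simp: HH_of_real \<phi>_def)
    have 2: "(\<Sum>m=1..K. of_real (t ^ m) * coef m i x) = (\<Sum>j<K. of_real (t ^ Suc j) * a j)"
      by (rule sum.reindex_bij_witness[of _ Suc "\<lambda>m. m - 1"]) (auto simp: coef_def a_def)
    have 3: "(\<Sum>j\<le>K. of_real (t ^ Suc j) * a j) = (\<Sum>j<K. of_real (t ^ Suc j) * a j) + of_real (t ^ Suc K) * a K"
      by (simp add: lessThan_Suc_atMost[symmetric])
    have "norm ((LINT p:{0<..}|lborel. exp (- of_real p / of_real t) * \<phi> p) - (\<Sum>j<K. of_real (t ^ Suc j) * a j))
      \<le> norm ((LINT p:{0<..}|lborel. exp (- of_real p / of_real t) * \<phi> p) - (\<Sum>j\<le>K. of_real (t ^ Suc j) * a j)) + norm (of_real (t ^ Suc K) * a K)"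
      unfolding 3 by (rule order_trans[OF _ norm_triangle_ineq]) (simp add: algebra_simps)
    also have "\<dots> \<le> C' * t ^ Suc K + norm (a K) * t ^ Suc K"
      using t by (intro add_mono C') (auto simp: norm_mult norm_power)
    finally show ?thesis unfolding 1 2 by (simp only: distrib_right)
  qed
  then show ?thesis using \<omega> by (intro exI[of _ "C' + norm (a K)"] exI[of _ "1 / (2 * \<omega>)"]) auto
qed

text \<open>The chain on [0, p + 1] has p in its interior but perhaps a small radius \<rho>; the
  bounds at the single point 0 enlarge the disc of validity to 1 / L by
  \<open>sums_larger_disc\<close>.\<close>

lemma power_series_Y0:
  assumes L: "0 < L" and c: "\<And>n. norm (Y n i k 0) \<le> B' * fact n * L ^ n" and p: "0 < p" "p < 1 / L" and k: "k \<noteq> 0"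
  shows "(\<lambda>n. Y n i k 0 / fact n * of_real p ^ n) sums Y0 i k p"
proof -
  have "0 < p + 1" using p by simp
  from chain_pointwise[OF this k, of i] obtain B \<rho> where "taylor_chain (\<lambda>n p. Y n i k p) (p + 1) \<rho> B" by blast
  then interpret C: taylor_chain "\<lambda>n p. Y n i k p" "p + 1" \<rho> B .
  have "(\<lambda>n. Y n i k 0 / fact n * of_real p ^ n) sums Y 0 i k p"
    by (rule C.sums_larger_disc[OF L c]) (use p L in \<open>auto simp: field_simps\<close>)
  then show ?thesis by simp
qed

end

section \<open>Data with finitely many modes\<close>

lemma fconv_eq_zero:
  assumes "\<And>k. a < norm k \<Longrightarrow> F k = 0" "\<And>k. b < norm k \<Longrightarrow> G k = 0" "a + b < norm k"
  shows "fconv F G k = 0"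
proof -
  have "F k' * G (k - k') = 0" for k'
  proof (cases "a < norm k'")
    case False
    have "norm k \<le> norm k' + norm (k - k')" using norm_triangle_ineq[of k' "k - k'"] by simp
    then have "b < norm (k - k')" using False assms(3) by linarith
    then show ?thesis using assms(2) by simp
  qed (simp add: assms(1))
  then show ?thesis by (simp only: fconv_def Bochner_Integration.integral_zero)
qed

text \<open>On a bounded support an unbounded multiplier costs its maximum there and no weight. This
  takes the place of \<open>bnd_loss1\<close> and \<open>bnd_loss2\<close>.\<close>

lemma bnd_mult_support:
  assumes F: "bnd 0 A F" and s: "\<And>k. a < norm k \<Longrightarrow> F k = 0" and m: "m \<in> borel_measurable borel"
    and C: "\<And>k. norm k \<le> a \<Longrightarrow> norm (m k) \<le> C" "0 \<le> C"
  shows "bnd 0 (C * A) (\<lambda>k. m k * F k)"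
proof (rule bnd_dominated[OF F _ C(2)])
  note [measurable] = bnd_meas[OF F] m
  show "(\<lambda>k. m k * F k) \<in> borel_measurable borel" by measurable
  show "norm (m k * F k) * exp (0 * norm k) \<le> C * (norm (F k) * exp (0 * norm k))" for k
    using s[of k] C(1)[of k] by (cases "a < norm k") (auto simp: norm_mult mult_right_mono)
qed

text \<open>Agrees with the factorial up to a factor independent of \<open>n\<close>, but grows by a factor of at least \<open>\<alpha>\<close> in each
  step; the size of the data enters the estimates only through \<open>\<alpha>\<close>.\<close>

fun trunc_fact :: "nat \<Rightarrow> nat \<Rightarrow> real" where
  "trunc_fact \<alpha> 0 = 1"
| "trunc_fact \<alpha> (Suc n) = real (max (Suc n) \<alpha>) * trunc_fact \<alpha> n"

lemma trunc_fact_nonneg: "0 \<le> trunc_fact \<alpha> n"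
  by (induction n) auto

lemma trunc_fact_ge: "real (Suc n) * trunc_fact \<alpha> n \<le> trunc_fact \<alpha> (Suc n)" "real \<alpha> * trunc_fact \<alpha> n \<le> trunc_fact \<alpha> (Suc n)"
  unfolding trunc_fact.simps by (intro mult_right_mono trunc_fact_nonneg; simp)+

lemma trunc_fact_mult_le: "trunc_fact \<alpha> i * trunc_fact \<alpha> j \<le> trunc_fact \<alpha> (i + j)"
proof (induction i)
  case (Suc i)
  have "trunc_fact \<alpha> (Suc i) * trunc_fact \<alpha> j = real (max (Suc i) \<alpha>) * (trunc_fact \<alpha> i * trunc_fact \<alpha> j)" by simp
  also have "\<dots> \<le> real (max (Suc (i + j)) \<alpha>) * trunc_fact \<alpha> (i + j)"
    by (intro mult_mono Suc.IH) (auto intro!: mult_nonneg_nonneg trunc_fact_nonneg)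
  finally show ?case by simp
qed simp

text \<open>By \<open>trunc_fact_mult_le\<close> the n products are at most the value at n - 1, and
  n times that value is at most the value at n.\<close>

lemma trunc_fact_sum_le: "(\<Sum>j<n. trunc_fact \<alpha> j * trunc_fact \<alpha> (n - 1 - j)) \<le> trunc_fact \<alpha> n"
proof (cases n)
  case (Suc m)
  have "(\<Sum>j<n. trunc_fact \<alpha> j * trunc_fact \<alpha> (n - 1 - j)) \<le> (\<Sum>j<n. trunc_fact \<alpha> m)"
  proof (rule sum_mono)
    fix j assume "j \<in> {..<n}"
    then have "j + (n - 1 - j) = m" using Suc by auto
    then show "trunc_fact \<alpha> j * trunc_fact \<alpha> (n - 1 - j) \<le> trunc_fact \<alpha> m"
      using trunc_fact_mult_le[of \<alpha> j "n - 1 - j"] by metis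
  qed
  also have "\<dots> = real (Suc m) * trunc_fact \<alpha> m" using Suc by simp
  also have "\<dots> \<le> trunc_fact \<alpha> n" unfolding Suc by (rule trunc_fact_ge)
  finally show ?thesis .
qed simp

text \<open>Only the first \<alpha> steps can grow faster than those of the factorial, each by a
  factor of at most \<alpha>.\<close>

lemma trunc_fact_le:
  assumes "1 \<le> \<alpha>"
  shows "trunc_fact \<alpha> n \<le> fact n * real \<alpha> ^ \<alpha>"
proof -
  have "trunc_fact \<alpha> n \<le> fact n * real \<alpha> ^ min n \<alpha>"
  proof (induction n)
    case (Suc n)
    show ?case
    proof (cases "Suc n \<le> \<alpha>")
      case True
      have "real \<alpha> * trunc_fact \<alpha> n \<le> real \<alpha> * (fact n * real \<alpha> ^ n)"
        using Suc.IH True by (intro mult_left_mono) (auto simp: min_def)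
      also have "\<dots> \<le> real (Suc n) * (real \<alpha> * (fact n * real \<alpha> ^ n))"
        using mult_right_mono[of 1 "real (Suc n)" "real \<alpha> * (fact n * real \<alpha> ^ n)"] by simp
      finally show ?thesis using True by (simp add: min_def max_def algebra_simps)
    next
      case False
      then have "real (Suc n) * trunc_fact \<alpha> n \<le> real (Suc n) * (fact n * real \<alpha> ^ \<alpha>)"
        using Suc.IH min_absorb2[of \<alpha> n] by (intro mult_left_mono) auto
      then show ?thesis using False by (simp add: min_def max_def algebra_simps)
    qed
  qed simp
  also have "\<dots> \<le> fact n * real \<alpha> ^ \<alpha>" using assms by (intro mult_left_mono power_increasing) auto
  finally show ?thesis .
qed

context borel_solution
begin

text \<open>At p = 0 the convolution integral vanishes and averages only see p = 0, so the recursion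
  closes on values at 0, whose supports are bounded. The support starts at 2 K because the first
  coefficient is quadratic in the data. The size of the data influences B alone; L contains just
  \<kappa> and K.\<close>

lemma finite_modes_bound:
  assumes K: "0 \<le> K" and W: "\<And>l k. K < norm k \<Longrightarrow> W0 l k = 0" and Z: "\<And>l k. 2 * K < norm k \<Longrightarrow> Y0 l k 0 = 0"
    and L: "L = 2 * (\<Sum>i\<in>UNIV. \<kappa> i) * K\<^sup>2 + 1"
  shows "\<exists>B. \<forall>n i. bnd 0 (B * fact n * L ^ n) (\<lambda>k. Y n i k 0)"
proof -
  \<comment> \<open>On the support |k| \<le> 2 K the division by 1 + |k| in \<open>U1\<close> is
    undone at the cost 1 + 2 K.\<close>
  define B where "B = cU * (1 + 2 * K)"
  have B0: "0 \<le> B" using cU_nonneg K by (simp add: B_def)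
  \<comment> \<open>What the convolution and linear terms contribute, relative to
    \<open>x m\<close>, once the average has divided by m + 2. All dependence of the step on the
    size of the data is here; it is handed over to \<alpha>.\<close>
  define G where "G = cI\<^sup>2 * (2 * cM * K) * (2 * A + B) + cI * cN"
  have G0: "0 \<le> G" using cM K A_nonneg B0 cI cN by (simp add: G_def)
  obtain \<alpha>0 :: nat where "G \<le> real \<alpha>0" using real_arch_simple by blast
  define \<alpha> where "\<alpha> = max 1 \<alpha>0"
  have \<alpha>: "1 \<le> \<alpha>" "G \<le> real \<alpha>" using \<open>G \<le> real \<alpha>0\<close> by (auto simp: \<alpha>_def)
  have L1: "1 \<le> L" using \<kappa>m_pos by (simp add: L \<kappa>m_def)
  define x where "x n = B * L ^ n * trunc_fact \<alpha> n" for n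
  have x0: "0 \<le> x n" for n using B0 L1 by (simp add: x_def trunc_fact_nonneg)
  have W0': "bnd 0 A (W0 l)" for l using \<beta> by (intro bnd_mono_b[OF W0]) simp
  have main: "\<forall>i. (\<forall>k. real (n + 2) * K < norm k \<longrightarrow> Y n i k 0 = 0) \<and> bnd 0 (x n) (\<lambda>k. Y n i k 0)" for n
  proof (induction n rule: less_induct)
    case (less n)
    show ?case
    proof (cases n)
      case 0
      have "bnd 0 ((1 + 2 * K) * cU) (\<lambda>k. of_real (1 + norm k) * (Y0 i k 0 / of_real (1 + norm k)))" for i
        using Z K \<beta> by (intro bnd_mult_support[of _ _ "2 * K"] bnd_mono_b[OF U1]) (auto simp del: of_real_add)
      moreover have "of_real (1 + norm k) * (Y0 i k 0 / of_real (1 + norm k)) = Y0 i k 0" for i k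
        using norm_ge_zero[of k] by (simp del: of_real_add add: add_nonneg_eq_0_iff)
      ultimately show ?thesis using 0 Z by (simp add: x_def B_def mult.commute)
    next
      case (Suc m)
      have b: "bnd 0 (x j) (\<lambda>k. Y j i k 0)" if "j \<le> m" for j i using less Suc that by simp
      have s: "Y j i k 0 = 0" if "j \<le> m" "real (j + 2) * K < norm k" for j i k using less Suc that by simp
      define a where "a = real (m + 3) * K"
      have a0: "0 \<le> a" using K by (simp add: a_def)
      have sc: "conv m Y l l' k 0 = 0" if k: "a < norm k" for l l' k
      proof -
        have 1: "fconv (W0 l) (\<lambda>k. Y m l' k 0) k = 0"
          by (rule fconv_eq_zero[where a = K and b = "real (m + 2) * K"])
             (use W s k in \<open>auto simp: a_def algebra_simps\<close>)
        have 2: "fconv (\<lambda>k. Y m l k 0) (W0 l') k = 0"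
          by (rule fconv_eq_zero[where b = K and a = "real (m + 2) * K"])
             (use W s k in \<open>auto simp: a_def algebra_simps\<close>)
        have 3: "fconv (\<lambda>k. Y j l k 0) (\<lambda>k. Y (m - 1 - j) l' k 0) k = 0" if j: "j < m" for j
        proof (rule fconv_eq_zero[where a = "real (j + 2) * K" and b = "real (m - 1 - j + 2) * K"])
          \<comment> \<open>Supports add under convolution: orders j and m - 1 - j give exactly the
            radius allotted to order m + 1.\<close>
          have "real (j + 2) * K + real (m - 1 - j + 2) * K = real (m + 3) * K"
            using j by (simp add: of_nat_diff algebra_simps)
          then show "real (j + 2) * K + real (m - 1 - j + 2) * K < norm k" using k by (simp add: a_def)
        qed (use s j in auto)
        show ?thesis unfolding conv_def using 1 2 3 by (simp add: fpconv_def set_lebesgue_integral_def)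
      qed
      have sR: "R m Y i k 0 = 0" if k: "a < norm k" for i k
      proof -
        have "real (m + 2) * K \<le> a" using K by (simp add: a_def mult_right_mono)
        then show ?thesis unfolding R_def using sc[OF k] s[of m k] k by simp
      qed
      have sQ: "Q m Y i k 0 = 0" if k: "a < norm k" for i k
      proof -
        have "real (m + 2) * K \<le> a" using K by (simp add: a_def mult_right_mono)
        then show ?thesis unfolding Q_def using sR[OF k] s[of m k] k by simp
      qed
      have sY: "Y n i k 0 = 0" if k: "real (n + 2) * K < norm k" for i k
        using sQ[of k i] k unfolding Suc Y_Suc avg_def a_def by (simp add: set_lebesgue_integral_def add.commute)
      define E where "E = (2 * A + B) * x m"
      have bc: "bnd 0 E (\<lambda>k. conv m Y l l' k 0)" for l l'
      proof (rule bnd_mono)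
        show "bnd 0 (2 * A * x m + (\<Sum>j<m. x j * x (m - 1 - j)) + 0 * (x m * x 0)) (\<lambda>k. conv m Y l l' k 0)"
          using \<beta> by (intro bnd_conv) (auto intro: b)
        have "(\<Sum>j<m. x j * x (m - 1 - j)) \<le> (\<Sum>j<m. B * (B * L ^ m) * (trunc_fact \<alpha> j * trunc_fact \<alpha> (m - 1 - j)))"
        proof (rule sum_mono)
          fix j assume j: "j \<in> {..<m}"
          have "x j * x (m - 1 - j) = B * (B * (L ^ j * L ^ (m - 1 - j))) * (trunc_fact \<alpha> j * trunc_fact \<alpha> (m - 1 - j))"
            unfolding x_def by (simp only: mult_ac)
          also have "L ^ j * L ^ (m - 1 - j) = L ^ (m - 1)" using j by (simp flip: power_add)
          also have "B * (B * L ^ (m - 1)) * (trunc_fact \<alpha> j * trunc_fact \<alpha> (m - 1 - j))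
              \<le> B * (B * L ^ m) * (trunc_fact \<alpha> j * trunc_fact \<alpha> (m - 1 - j))"
            using B0 L1 by (intro mult_right_mono mult_left_mono power_increasing mult_nonneg_nonneg trunc_fact_nonneg) auto
          finally show "x j * x (m - 1 - j) \<le> B * (B * L ^ m) * (trunc_fact \<alpha> j * trunc_fact \<alpha> (m - 1 - j))" .
        qed
        also have "\<dots> = B * (B * L ^ m) * (\<Sum>j<m. trunc_fact \<alpha> j * trunc_fact \<alpha> (m - 1 - j))"
          by (rule sum_distrib_left[symmetric])
        also have "\<dots> \<le> B * (B * L ^ m) * trunc_fact \<alpha> m"
          using B0 L1 by (intro mult_left_mono trunc_fact_sum_le) auto
        also have "\<dots> = B * x m" by (simp add: x_def)
        finally show "2 * A * x m + (\<Sum>j<m. x j * x (m - 1 - j)) + 0 * (x m * x 0) \<le> E"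
          by (simp add: E_def distrib_right)
      qed
      have E0: "0 \<le> E" using A_nonneg B0 x0 by (simp add: E_def)
      have 1: "bnd 0 (\<Sum>l\<in>(UNIV::'i set). \<Sum>l'\<in>(UNIV::'i set). cM * a * E) (\<lambda>k. \<Sum>l\<in>UNIV. \<Sum>l'\<in>UNIV. M i l l' k * conv m Y l l' k 0)" for i
        using a0 cM by (intro bnd_sum bnd_mult_support[of _ _ a] bc sc M_meas order_trans[OF M_le] mult_left_mono) auto
      have 2: "bnd 0 (\<Sum>l\<in>(UNIV::'i set). cN * x m) (\<lambda>k. \<Sum>l\<in>UNIV. N i l k * Y m l k 0)" for i
        by (intro bnd_sum bnd_mult N_le cN N_meas b) auto
      define q where "q = \<kappa>m * (real (m + 2) * K)\<^sup>2"
      have q0: "0 \<le> q" using \<kappa>m_pos by (simp add: q_def)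
      have 3: "bnd 0 (1 * (q * x m)) (\<lambda>k. - 1 * (of_real (\<kappa> i * (norm k)\<^sup>2) * Y m i k 0))" for i
      proof (rule bnd_mult)
        show "bnd 0 (q * x m) (\<lambda>k. of_real (\<kappa> i * (norm k)\<^sup>2) * Y m i k 0)"
        proof (rule bnd_mult_support[OF b[OF order_refl], where a = "real (m + 2) * K"])
          show "norm (complex_of_real (\<kappa> i * (norm k)\<^sup>2)) \<le> q" if "norm k \<le> real (m + 2) * K" for k :: "real ^ 'n"
            unfolding norm_of_real q_def abs_mult using \<kappa>m[of i] \<kappa>[of i] \<kappa>m_pos that
            by (intro mult_mono) (auto intro: power_mono)
        qed (use s q0 in auto)
      qed auto
      have bQ: "bnd 0 (cI\<^sup>2 * (cM * a) * E + cI * cN * x m + q * x m) (\<lambda>k. Q m Y i k 0)" for i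
      proof -
        have "bnd 0 ((\<Sum>l\<in>(UNIV::'i set). \<Sum>l'\<in>(UNIV::'i set). cM * a * E) + (\<Sum>l\<in>(UNIV::'i set). cN * x m) + 1 * (q * x m)) (\<lambda>k. Q m Y i k 0)"
          unfolding Q_def R_def by (intro bnd_add 1 2 3)
        then show ?thesis by (simp add: cI_def power2_eq_square mult_ac)
      qed
      have le: "(cI\<^sup>2 * (cM * a) * E + cI * cN * x m + q * x m) / real (Suc (Suc m)) \<le> x n"
      proof -
        have a2: "a \<le> 2 * K * real (m + 2)"
        proof -
          have "real (m + 3) * K \<le> (2 * real (m + 2)) * K" using K by (intro mult_right_mono) auto
          then show ?thesis by (simp only: a_def mult_ac)
        qed
        have "cI\<^sup>2 * (cM * a) * E \<le> cI\<^sup>2 * (cM * (2 * K * real (m + 2))) * E"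
          using cM E0 cI by (intro mult_right_mono mult_left_mono a2) auto
        moreover have "cI * cN * x m * 1 \<le> cI * cN * x m * real (m + 2)"
          using cI cN x0 by (intro mult_left_mono) auto
        ultimately have "cI\<^sup>2 * (cM * a) * E + cI * cN * x m + q * x m
          \<le> cI\<^sup>2 * (cM * (2 * K * real (m + 2))) * E + cI * cN * x m * real (m + 2) + q * x m" by linarith
        also have "\<dots> = real (m + 2) * (G * x m + \<kappa>m * K\<^sup>2 * (real (m + 2) * x m))"
          unfolding G_def E_def q_def power2_eq_square by (simp only: distrib_left distrib_right mult_ac)
        finally have "(cI\<^sup>2 * (cM * a) * E + cI * cN * x m + q * x m) / real (Suc (Suc m))
            \<le> G * x m + \<kappa>m * K\<^sup>2 * (real (m + 2) * x m)"
          by (simp only: divide_le_eq of_nat_0_less_iff) (simp add: mult.commute)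
        \<comment> \<open>The two lower bounds on the growth of \<open>trunc_fact\<close> are used
          side by side: the data terms are covered by the growth \<alpha> and account for the 1 in
          L, the diffusion term by the growth m + 1, through m + 2 \<le> 2 (m + 1), and accounts for
          the rest of L.\<close>
        also have "\<dots> \<le> real \<alpha> * x m + \<kappa>m * K\<^sup>2 * (2 * real (Suc m) * x m)"
          using \<alpha> x0[of m] \<kappa>m_pos by (intro add_mono mult_right_mono mult_left_mono) auto
        also have "\<dots> = B * L ^ m * (real \<alpha> * trunc_fact \<alpha> m) + 2 * \<kappa>m * K\<^sup>2 * (B * L ^ m * (real (Suc m) * trunc_fact \<alpha> m))"
          unfolding x_def by (simp only: mult_ac)
        also have "\<dots> \<le> B * L ^ m * trunc_fact \<alpha> n + 2 * \<kappa>m * K\<^sup>2 * (B * L ^ m * trunc_fact \<alpha> n)"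
          unfolding Suc using B0 L1 \<kappa>m_pos by (intro add_mono mult_left_mono trunc_fact_ge) auto
        also have "\<dots> = x n" unfolding x_def Suc L \<kappa>m_def power_Suc by (simp add: algebra_simps)
        finally show ?thesis .
      qed
      have "bnd 0 (x n) (\<lambda>k. Y n i k 0)" for i
      proof (rule bnd_mono[OF _ le])
        \<comment> \<open>With p = 0 the range of \<open>bnd_avg\<close> shrinks to the single point
          0, where \<open>bQ\<close> applies.\<close>
        show "bnd 0 ((cI\<^sup>2 * (cM * a) * E + cI * cN * x m + q * x m) / real (Suc (Suc m))) (\<lambda>k. Y n i k 0)"
          unfolding Suc Y_Suc
          by (rule bnd_avg[OF Q_meas[OF Y_meas]]) (use bQ in \<open>auto dest: order_antisym\<close>)
      qed
      then show ?thesis using sY by blast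
    qed
  qed
  have "bnd 0 (B * real \<alpha> ^ \<alpha> * fact n * L ^ n) (\<lambda>k. Y n i k 0)" for n i
  proof (rule bnd_mono)
    show "bnd 0 (x n) (\<lambda>k. Y n i k 0)" using main by blast
    have "B * L ^ n * trunc_fact \<alpha> n \<le> B * L ^ n * (fact n * real \<alpha> ^ \<alpha>)"
      using B0 L1 by (intro mult_left_mono trunc_fact_le \<alpha>) auto
    then show "x n \<le> B * real \<alpha> ^ \<alpha> * fact n * L ^ n" by (simp add: x_def mult_ac)
  qed
  then show ?thesis by blast
qed

lemma finite_modes_coef_bound:
  assumes B: "\<And>n i. bnd 0 (B * fact n * L ^ n) (\<lambda>k. Y n i k 0)" and L: "1 \<le> L" and m: "1 \<le> m"
  shows "norm (coef m i x) \<le> fact m * B * L ^ m"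
proof -
  obtain n where n: "m = Suc n" using m by (cases m) auto
  have B0: "0 \<le> B" using bnd_nonneg[OF B[of 0]] by simp
  have "norm (\<integral>k. exp (\<i> * cdot k (cvec x)) * Y n i k 0 \<partial>lborel) \<le> (\<integral>k. norm (Y n i k 0) \<partial>lborel)"
    by (rule order_trans[OF integral_norm_bound]) (simp add: norm_mult cdot_cvec)
  also have "\<dots> \<le> B * fact n * L ^ n" using bnd_weight_integrable(2)[OF B] by simp
  also have "\<dots> \<le> B * fact m * L ^ m"
    using B0 L n fact_mono[of n m, where 'a = real] by (intro mult_mono power_increasing) auto
  finally show ?thesis by (simp add: coef_def fint_def n mult_ac)
qed

end

section \<open>The Boussinesq equations as a quadratic system\<close>

lemma nn_integral_inverse_power_finite:
  assumes s: "1 < s"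
  shows "(\<integral>\<^sup>+x. ennreal ((1 + \<bar>x\<bar>) powr - s) \<partial>lborel) < \<infinity>"
proof -
  have half: "(\<integral>\<^sup>+x. ennreal ((1 + \<bar>x\<bar>) powr - s) * indicator {0..} x \<partial>lborel) = ennreal (1 / (s - 1))"
  proof -
    have "(\<integral>\<^sup>+x. ennreal ((1 + \<bar>x\<bar>) powr - s) * indicator {0..} x \<partial>lborel)
        = (\<integral>\<^sup>+x. ennreal ((1 + x) powr - s) * indicator {0..} x \<partial>lborel)"
      by (intro nn_integral_cong) (auto simp: indicator_def)
    also have "\<dots> = ennreal (0 - (1 + 0) powr (1 - s) / (1 - s))"
    proof (rule nn_integral_FTC_atLeast)
      show "((\<lambda>x. (1 + x) powr (1 - s) / (1 - s)) has_real_derivative (1 + x) powr - s) (at x)" if "0 \<le> x" for x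
        using that s by (auto intro!: derivative_eq_intros)
      have "((\<lambda>x. (1 + x) powr (1 - s)) \<longlongrightarrow> 0) at_top"
        using s by (intro tendsto_neg_powr filterlim_tendsto_add_at_top[OF tendsto_const] filterlim_ident) auto
      then show "((\<lambda>x. (1 + x) powr (1 - s) / (1 - s)) \<longlongrightarrow> 0) at_top"
        by (rule tendsto_divide_zero)
    qed auto
    also have "0 - (1 + 0) powr (1 - s) / (1 - s) = 1 / (s - 1)" using s by (simp add: divide_simps)
    finally show ?thesis .
  qed
  have "(\<integral>\<^sup>+x. ennreal ((1 + \<bar>x\<bar>) powr - s) \<partial>lborel)
      \<le> (\<integral>\<^sup>+x. ennreal ((1 + \<bar>x\<bar>) powr - s) * indicator {0..} x + ennreal ((1 + \<bar>- x\<bar>) powr - s) * indicator {0..} (- x) \<partial>lborel)"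
    by (intro nn_integral_mono) (auto simp: indicator_def)
  also have "\<dots> = (\<integral>\<^sup>+x. ennreal ((1 + \<bar>x\<bar>) powr - s) * indicator {0..} x \<partial>lborel)
      + (\<integral>\<^sup>+x. ennreal ((1 + \<bar>- x\<bar>) powr - s) * indicator {0..} (- x) \<partial>lborel)"
    by (rule nn_integral_add) measurable
  also have "(\<integral>\<^sup>+x. ennreal ((1 + \<bar>- x\<bar>) powr - s) * indicator {0..} (- x) \<partial>lborel)
      = (\<integral>\<^sup>+x. ennreal ((1 + \<bar>x\<bar>) powr - s) * indicator {0..} x \<partial>lborel)"
    using nn_integral_real_affine[of "\<lambda>x. ennreal ((1 + \<bar>x\<bar>) powr - s) * indicator {0..} x" "-1" 0] by simp
  finally show ?thesis unfolding half by (auto simp: less_top[symmetric] top_unique)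
qed

text \<open>With d the dimension and s = \<gamma> / d > 1, the weight is the d-th power of (1 +
  |k|)^(-s) and is dominated by the product of the one-dimensional weights of the
  coordinates.\<close>

lemma nn_integral_weight_finite:
  assumes \<gamma>: "real CARD('n) < \<gamma>"
  shows "(\<integral>\<^sup>+k. ennreal ((1 + norm (k :: real ^ 'n)) powr - \<gamma>) \<partial>lborel) < \<infinity>"
proof -
  define s where "s = \<gamma> / real CARD('n)"
  have s: "1 < s" using \<gamma> by (simp add: s_def)
  have "(\<integral>\<^sup>+k. ennreal ((1 + norm (k :: real ^ 'n)) powr - \<gamma>) \<partial>lborel)
      \<le> (\<integral>\<^sup>+k. (\<Prod>b\<in>Basis. ennreal ((1 + \<bar>(k :: real ^ 'n) \<bullet> b\<bar>) powr - s)) \<partial>lborel)"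
  proof (rule nn_integral_mono)
    fix k :: "real ^ 'n"
    have "(1 + norm k) powr - \<gamma> = ((1 + norm k) powr - s) ^ CARD('n)"
    proof -
      have "0 < (1 + norm k) powr - s" using norm_ge_zero[of k] by (simp add: add_nonneg_eq_0_iff)
      from powr_realpow[OF this, of "CARD('n)"] show ?thesis by (simp add: powr_powr s_def)
    qed
    also have "\<dots> = (\<Prod>b\<in>(Basis :: (real ^ 'n) set). (1 + norm k) powr - s)" by simp
    also have "\<dots> \<le> (\<Prod>b\<in>Basis. (1 + \<bar>k \<bullet> b\<bar>) powr - s)"
      using s by (intro prod_mono conjI powr_mono2') (auto simp: Basis_le_norm)
    finally have "ennreal ((1 + norm k) powr - \<gamma>) \<le> ennreal (\<Prod>b\<in>Basis. (1 + \<bar>k \<bullet> b\<bar>) powr - s)"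
      by (rule ennreal_leI)
    then show "ennreal ((1 + norm k) powr - \<gamma>) \<le> (\<Prod>b\<in>Basis. ennreal ((1 + \<bar>k \<bullet> b\<bar>) powr - s))"
      by (simp add: prod_ennreal)
  qed
  also have "\<dots> = (\<Prod>b\<in>(Basis :: (real ^ 'n) set). (\<integral>\<^sup>+x. ennreal ((1 + \<bar>x\<bar>) powr - s) \<partial>lborel))"
    by (rule nn_integral_lborel_prod) auto
  also have "\<dots> < \<infinity>" using nn_integral_inverse_power_finite[OF s] by (simp add: power_less_top_ennreal)
  finally show ?thesis .
qed

lemma vec_component_measurable:
  fixes F :: "'a \<Rightarrow> complex ^ 'n"
  assumes "F \<in> borel_measurable M"
  shows "(\<lambda>x. F x $ i) \<in> borel_measurable M"
  by (rule borel_measurable_continuous_on[OF linear_continuous_on[OF bounded_linear_vec_nth] assms])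

text \<open>Integrability of the vector has to be derived from that of the components, because a
  non-integrable function has integral 0 by convention and components could not be read off.\<close>

lemma vec_integral:
  fixes F :: "'a \<Rightarrow> complex ^ 'n"
  assumes "\<And>i. set_integrable M A (\<lambda>x. F x $ i)"
  shows "set_integrable M A F" and "(LINT x:A|M. F x) $ i = (LINT x:A|M. F x $ i)"
proof -
  have ax: "bounded_linear (axis i :: complex \<Rightarrow> complex ^ 'n)" for i
    by (intro linear_conv_bounded_linear[THEN iffD1] linearI) (auto simp: axis_def vec_eq_iff)
  have "integrable M (\<lambda>x. \<Sum>i\<in>UNIV. axis i (indicator A x *\<^sub>R F x $ i))"
    using assms unfolding set_integrable_def
    by (intro Bochner_Integration.integrable_sum integrable_bounded_linear[OF ax])
  moreover have "(\<Sum>i\<in>UNIV. axis i (indicator A x *\<^sub>R F x $ i)) = indicator A x *\<^sub>R F x" for x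
    by (simp add: vec_eq_iff axis_def if_distrib cong: if_cong)
  ultimately show i: "set_integrable M A F" by (simp add: set_integrable_def)
  show "(LINT x:A|M. F x) $ i = (LINT x:A|M. F x $ i)"
    using integral_bounded_linear[OF bounded_linear_vec_nth i[unfolded set_integrable_def], of i]
    by (simp add: set_lebesgue_integral_def)
qed

lemma sum_UNIV_option: "(\<Sum>l\<in>(UNIV :: 'a::finite option set). f l) = f None + (\<Sum>j\<in>UNIV. f (Some j))"
  by (simp add: UNIV_option_conv sum.reindex)

lemma norm_vec_le_sum: "norm (v :: complex ^ 'n) \<le> (\<Sum>i\<in>UNIV. norm (v $ i))"
  unfolding norm_vec_def by (rule L2_set_le_sum) simp

lemma inv_fourier_cong:
  assumes "\<And>k. k \<noteq> 0 \<Longrightarrow> F k = G k"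
  shows "inv_fourier F x = inv_fourier G x"
  unfolding inv_fourier_def by (rule integral_discrete_difference[of "{0}"]) (auto simp: assms)

section \<open>The Boussinesq unknowns as an indexed family\<close>

locale boussinesq =
  fixes \<nu> \<mu> a \<gamma> \<beta> :: real and e2 :: "real ^ 'n" and u0 :: "real ^ 'n \<Rightarrow> complex ^ 'n"
    and \<theta>0 :: "real ^ 'n \<Rightarrow> complex" and f :: "real ^ 'n \<Rightarrow> complex ^ 'n" and \<omega> :: real
    and Hh :: "real ^ 'n \<Rightarrow> real \<Rightarrow> complex ^ 'n" and Sh :: "real ^ 'n \<Rightarrow> real \<Rightarrow> complex"
  assumes \<nu>: "0 < \<nu>" and \<mu>: "0 < \<mu>" and a: "0 < a" and e2: "norm e2 = 1" and \<beta>: "0 < \<beta>"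
    and \<gamma>: "real CARD('n) < \<gamma>" and data: "data_ok \<gamma> \<beta> u0 \<theta>0 f" and \<omega>: "0 < \<omega>"
    and sol: "IE_solution \<nu> \<mu> a e2 \<gamma> \<beta> u0 \<theta>0 f \<omega> Hh Sh"
begin

text \<open>The index \<^term>\<open>None\<close> stands for the temperature, \<^term>\<open>Some j\<close> for the \<open>j\<close>-th component of the velocity.\<close>

definition \<kappa> :: "'n option \<Rightarrow> real" where "\<kappa> = case_option \<mu> (\<lambda>_. \<nu>)"

text \<open>Matrix entries of the Hodge symbol. At k = 0 the quotient is 0 and the matrix is the
  identity, in agreement with \<open>hodge\<close> as defined.\<close>

definition Pr :: "'n \<Rightarrow> 'n \<Rightarrow> real ^ 'n \<Rightarrow> complex" where
  "Pr i m k = of_real ((if i = m then 1 else 0) - k $ i * k $ m / (norm k)\<^sup>2)"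

text \<open>The index l is the transporting quantity and has to be a velocity component; m is the
  transported one. Temperature transports as a scalar, velocity with the projection mixing its
  components.\<close>

definition M :: "'n option \<Rightarrow> 'n option \<Rightarrow> 'n option \<Rightarrow> real ^ 'n \<Rightarrow> complex" where
  "M i l m k = (case l of None \<Rightarrow> 0 | Some j \<Rightarrow>
     (case i of None \<Rightarrow> (if m = None then - (\<i> * of_real (k $ j)) else 0)
      | Some i' \<Rightarrow> (case m of None \<Rightarrow> 0 | Some m' \<Rightarrow> - (\<i> * of_real (k $ j)) * Pr i' m' k)))"

definition N :: "'n option \<Rightarrow> 'n option \<Rightarrow> real ^ 'n \<Rightarrow> complex" where
  "N i l k = (case i of None \<Rightarrow> 0 | Some i' \<Rightarrow>
     if l = None then of_real a * (\<Sum>m\<in>UNIV. Pr i' m k * of_real (e2 $ m)) else 0)"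

definition W0 :: "'n option \<Rightarrow> real ^ 'n \<Rightarrow> complex" where
  "W0 l k = (case l of None \<Rightarrow> \<theta>0 k | Some j \<Rightarrow> u0 k $ j)"

definition U1 :: "'n option \<Rightarrow> real ^ 'n \<Rightarrow> complex" where
  "U1 l k = (case l of None \<Rightarrow> \<theta>1_hat \<mu> u0 \<theta>0 k | Some j \<Rightarrow> u1_hat \<nu> a e2 u0 \<theta>0 f k $ j)"

definition Z :: "'n option \<Rightarrow> real ^ 'n \<Rightarrow> real \<Rightarrow> complex" where
  "Z l k p = (case l of None \<Rightarrow> Sh k p | Some j \<Rightarrow> Hh k p $ j)"

text \<open>The value of the transforms at \<open>p = 0\<close> is their limit there, since \<open>2 J\<^sub>1(z) / z \<rightarrow> 1\<close>.\<close>

definition Y0 :: "'n option \<Rightarrow> real ^ 'n \<Rightarrow> real \<Rightarrow> complex" where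
  "Y0 l k p = (if p \<le> 0 then U1 l k else Z l k p)"

definition C\<gamma> :: real where
  "C\<gamma> = max 1 (enn2real (\<integral>\<^sup>+k. ennreal ((1 + norm (k :: real ^ 'n)) powr - \<gamma>) \<partial>lborel))"

text \<open>Here \<gamma> > d enters: the algebraic weight is given up in exchange for integrability
  in k. The maximum with 1 in \<open>C\<gamma>\<close> lets the same constant serve the pointwise
  part.\<close>

lemma bnd_of_weight:
  fixes F :: "real ^ 'n \<Rightarrow> complex"
  assumes [measurable]: "F \<in> borel_measurable borel" and c: "0 \<le> c"
    and le: "\<And>k. (1 + norm k) powr \<gamma> * exp (\<beta> * norm k) * norm (F k) \<le> c"
  shows "bnd \<beta> (C\<gamma> * c) F"
proof -
  have le': "norm (F k) * exp (\<beta> * norm k) \<le> c * (1 + norm k) powr - \<gamma>" for k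
  proof -
    have "0 < (1 + norm k) powr \<gamma>" using norm_ge_zero[of k] by (simp add: add_nonneg_eq_0_iff)
    then show ?thesis using le[of k] by (simp add: powr_minus divide_inverse[symmetric] pos_le_divide_eq mult_ac)
  qed
  have "0 \<le> \<gamma>" using \<gamma> by (meson less_eq_real_def of_nat_0_le_iff order_trans)
  then have w: "(1 + norm k) powr - \<gamma> \<le> 1" for k :: "real ^ 'n"
    using powr_mono2'[of "- \<gamma>" 1 "1 + norm k"] by simp
  have C1: "1 \<le> C\<gamma>" by (simp add: C\<gamma>_def)
  show ?thesis
    unfolding bnd_def
  proof (intro conjI allI impI)
    fix k :: "real ^ 'n"
    have "c * (1 + norm k) powr - \<gamma> \<le> c * 1" using c w by (intro mult_left_mono) auto
    also have "\<dots> \<le> C\<gamma> * c" using C1 c mult_right_mono[of 1 C\<gamma> c] by simp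
    finally show "norm (F k) * exp (\<beta> * norm k) \<le> C\<gamma> * c" using le'[of k] by linarith
  next
    have "(\<integral>\<^sup>+k. ennreal (norm (F k) * exp (\<beta> * norm k)) \<partial>lborel)
        \<le> (\<integral>\<^sup>+k. ennreal c * ennreal ((1 + norm (k :: real ^ 'n)) powr - \<gamma>) \<partial>lborel)"
      by (intro nn_integral_mono) (simp add: ennreal_mult[symmetric] c le' ennreal_leI)
    also have "\<dots> = ennreal c * (\<integral>\<^sup>+k. ennreal ((1 + norm (k :: real ^ 'n)) powr - \<gamma>) \<partial>lborel)"
      by (rule nn_integral_cmult) simp
    also have "\<dots> \<le> ennreal c * ennreal C\<gamma>"
      using nn_integral_weight_finite[OF \<gamma>]
      by (intro mult_left_mono) (auto simp: C\<gamma>_def ennreal_enn2real_if less_top intro!: order_trans[OF _ ennreal_leI[OF max.cobounded2]])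
    finally show "(\<integral>\<^sup>+k. ennreal (norm (F k) * exp (\<beta> * norm k)) \<partial>lborel) \<le> ennreal (C\<gamma> * c)"
      using c C1 by (simp add: ennreal_mult[symmetric] mult.commute)
  qed simp
qed

lemma wnorm_finite:
  assumes "wnorm \<gamma> \<beta> F < \<infinity>"
  shows "(1 + norm k) powr \<gamma> * exp (\<beta> * norm k) * norm (F k) \<le> enn2real (wnorm \<gamma> \<beta> F)"
proof -
  have "ennreal ((1 + norm k) powr \<gamma> * exp (\<beta> * norm k) * norm (F k)) \<le> wnorm \<gamma> \<beta> F"
    unfolding wnorm_def by (rule SUP_upper) simp
  then show ?thesis using assms by (metis enn2real_ennreal enn2real_mono infinity_ennreal_def mult_nonneg_nonneg norm_ge_zero powr_ge_zero exp_ge_zero)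
qed

lemma \<kappa>_pos: "0 < \<kappa> i" using \<nu> \<mu> by (simp add: \<kappa>_def split: option.split)

lemma Pr_le: "norm (Pr i m k) \<le> 2"
proof -
  have "\<bar>k $ i * k $ m / (norm k)\<^sup>2\<bar> \<le> 1"
  proof (cases "k = 0")
    case False
    have "\<bar>k $ i\<bar> * \<bar>k $ m\<bar> \<le> norm k * norm k" by (intro mult_mono component_le_norm_cart) auto
    then show ?thesis using False by (simp add: abs_mult divide_le_eq power2_eq_square)
  qed simp
  moreover have "\<bar>(if i = m then 1 else 0) - r\<bar> \<le> 2" if "\<bar>r\<bar> \<le> 1" for r :: real
    using that by (cases "i = m") auto
  ultimately show ?thesis unfolding Pr_def norm_of_real by blast
qed

lemma Pr_meas[measurable]: "Pr i m \<in> borel_measurable borel"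
  unfolding Pr_def[abs_def] by measurable

lemma M_meas[measurable]: "M i l m \<in> borel_measurable borel"
  unfolding M_def[abs_def] by (cases i; cases l; cases m; simp; measurable)

lemma M_le: "norm (M i l m k) \<le> 2 * norm k"
proof -
  have *: "\<bar>k $ j\<bar> \<le> 2 * norm k" for j using component_le_norm_cart[of k j] norm_ge_zero[of k] by linarith
  have "\<bar>k $ j\<bar> * norm (Pr i m k) \<le> norm k * 2" for i m j
    by (intro mult_mono component_le_norm_cart Pr_le) auto
  then show ?thesis using * by (cases i; cases l; cases m) (auto simp: M_def norm_mult mult.commute)
qed

definition cN :: real where "cN = a * (2 * real CARD('n))"

lemma N_meas[measurable]: "N i l \<in> borel_measurable borel"
  unfolding N_def[abs_def] by (cases i; simp; measurable)

lemma N_le: "norm (N i l k) \<le> cN"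
proof -
  have "norm (\<Sum>m\<in>UNIV. Pr i m k * of_real (e2 $ m)) \<le> (\<Sum>m\<in>(UNIV :: 'n set). 2 * 1)" for i
  proof (rule sum_norm_le)
    fix m
    show "norm (Pr i m k * of_real (e2 $ m)) \<le> 2 * 1"
      unfolding norm_mult using component_le_norm_cart[of e2 m] by (intro mult_mono Pr_le) (simp_all add: e2)
  qed
  then have "a * norm (\<Sum>m\<in>UNIV. Pr i m k * of_real (e2 $ m)) \<le> cN" for i
    unfolding cN_def using a by (intro mult_left_mono) (auto simp: mult.commute)
  then show ?thesis using a by (cases i) (auto simp: N_def norm_mult cN_def)
qed

lemma cN_nonneg: "0 \<le> cN" using a by (simp add: cN_def)

lemma W0_simps: "W0 (Some j) = (\<lambda>k. u0 k $ j)" "W0 None = \<theta>0"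
  by (simp_all add: W0_def fun_eq_iff)

lemma hodge_nth: "hodge k v $ i = (\<Sum>m\<in>UNIV. Pr i m k * v $ m)"
proof -
  have "(\<Sum>m\<in>UNIV. Pr i m k * v $ m) = (\<Sum>m\<in>UNIV. (if i = m then v $ m else 0) - of_real (k $ i) / of_real ((norm k)\<^sup>2) * (of_real (k $ m) * v $ m))"
    by (intro sum.cong refl) (simp add: Pr_def algebra_simps)
  also have "\<dots> = v $ i - of_real (k $ i) / of_real ((norm k)\<^sup>2) * (\<Sum>m\<in>UNIV. of_real (k $ m) * v $ m)"
    by (simp add: sum_subtractf sum_distrib_left)
  finally show ?thesis by (simp add: hodge_def cvec_def)
qed

lemma quad_Some: "(\<Sum>l\<in>UNIV. \<Sum>m\<in>UNIV. M (Some i) l m k * c l m)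
   = - (\<Sum>j\<in>UNIV. \<i> * of_real (k $ j) * hodge k (\<chi> m. c (Some j) (Some m)) $ i)"
  by (simp add: sum_UNIV_option M_def hodge_nth sum_distrib_left sum_negf mult.assoc)

lemma quad_None: "(\<Sum>l\<in>UNIV. \<Sum>m\<in>UNIV. M None l m k * c l m) = - (\<Sum>j\<in>UNIV. \<i> * of_real (k $ j) * c (Some j) None)"
  by (simp add: sum_UNIV_option M_def sum_negf)

lemma lin_Some: "(\<Sum>l\<in>UNIV. N (Some i) l k * w l) = of_real a * hodge k (w None *s cvec e2) $ i"
  by (simp add: sum_UNIV_option N_def hodge_nth cvec_def sum_distrib_left sum_distrib_right mult_ac)

lemma lin_None: "(\<Sum>l\<in>UNIV. N None l k * w l) = 0"
  by (simp add: N_def)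

definition fc :: "'n option \<Rightarrow> real ^ 'n \<Rightarrow> complex" where
  "fc l k = (case l of None \<Rightarrow> 0 | Some j \<Rightarrow> f k $ j)"

lemma U1_eq: "U1 i k = - of_real (\<kappa> i * (norm k)\<^sup>2) * W0 i k
   + (\<Sum>l\<in>UNIV. \<Sum>m\<in>UNIV. M i l m k * fconv (W0 l) (W0 m) k) + (\<Sum>l\<in>UNIV. N i l k * W0 l k) + fc i k"
proof (cases i)
  case None
  then show ?thesis
    by (simp add: U1_def \<theta>1_hat_def quad_None lin_None fc_def W0_simps \<kappa>_def scaleR_conv_of_real)
next
  case (Some j)
  then show ?thesis
    by (simp add: U1_def u1_hat_def quad_Some lin_Some fc_def W0_simps \<kappa>_def) (simp add: scaleR_conv_of_real)
qed

definition c1 :: real where "c1 = enn2real (wnorm \<gamma> \<beta> (\<lambda>k. (1 + norm k)\<^sup>2 *\<^sub>R (u0 k, \<theta>0 k)))"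

lemma W0_meas[measurable]: "W0 l \<in> borel_measurable borel"
  using data by (cases l) (auto simp: W0_simps data_ok_def intro: vec_component_measurable)

lemma W0_le: "norm (W0 l k) \<le> norm (u0 k, \<theta>0 k)"
proof (cases l)
  case None
  then show ?thesis by (simp add: W0_simps norm_snd_le)
next
  case (Some j)
  then show ?thesis by (simp add: W0_simps order_trans[OF Finite_Cartesian_Product.norm_nth_le norm_fst_le])
qed

lemma W0_weight: "(1 + norm k) powr \<gamma> * exp (\<beta> * norm k) * ((1 + norm k)\<^sup>2 * norm (W0 l k)) \<le> c1"
proof -
  have "(1 + norm k) powr \<gamma> * exp (\<beta> * norm k) * ((1 + norm k)\<^sup>2 * norm (W0 l k))
      \<le> (1 + norm k) powr \<gamma> * exp (\<beta> * norm k) * norm ((1 + norm k)\<^sup>2 *\<^sub>R (u0 k, \<theta>0 k))"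
    unfolding norm_scaleR abs_power2 by (intro mult_left_mono W0_le) auto
  also have "\<dots> \<le> c1" unfolding c1_def using data by (intro wnorm_finite) (simp add: data_ok_def)
  finally show ?thesis .
qed

text \<open>The extra factor (1 + |k|)^2 in the hypothesis on the initial data is there to be spent
  on |k|^2 in the first coefficient.\<close>

lemma W0_bnd_weight:
  assumes [measurable]: "w \<in> borel_measurable borel" and w: "\<And>k. norm (w k) \<le> (1 + norm k)\<^sup>2"
  shows "bnd \<beta> (C\<gamma> * c1) (\<lambda>k. w k * W0 l k)"
proof (rule bnd_of_weight)
  fix k
  have "(1 + norm k) powr \<gamma> * exp (\<beta> * norm k) * norm (w k * W0 l k)
     \<le> (1 + norm k) powr \<gamma> * exp (\<beta> * norm k) * ((1 + norm k)\<^sup>2 * norm (W0 l k))"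
    unfolding norm_mult by (intro mult_left_mono mult_right_mono w) auto
  also note W0_weight
  finally show "(1 + norm k) powr \<gamma> * exp (\<beta> * norm k) * norm (w k * W0 l k) \<le> c1" .
qed (simp_all add: c1_def)

lemma W0_bnd: "bnd \<beta> (C\<gamma> * c1) (W0 l)"
  using W0_bnd_weight[of "\<lambda>_. 1" l] by (simp add: one_le_power)

lemma fc_bnd: "\<exists>c. \<forall>l. bnd \<beta> c (fc l)"
proof -
  define c where "c = enn2real (wnorm \<gamma> \<beta> f)"
  have "bnd \<beta> (C\<gamma> * c) (fc l)" for l
  proof (rule bnd_of_weight)
    show "fc l \<in> borel_measurable borel"
      using data by (cases l) (auto simp: fc_def[abs_def] data_ok_def intro: vec_component_measurable)
    fix k
    have "norm (fc l k) \<le> norm (f k)" by (cases l) (auto simp: fc_def Finite_Cartesian_Product.norm_nth_le)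
    then have "(1 + norm k) powr \<gamma> * exp (\<beta> * norm k) * norm (fc l k) \<le> (1 + norm k) powr \<gamma> * exp (\<beta> * norm k) * norm (f k)"
      by (intro mult_left_mono) auto
    also have "\<dots> \<le> c" unfolding c_def using data by (intro wnorm_finite) (simp add: data_ok_def)
    finally show "(1 + norm k) powr \<gamma> * exp (\<beta> * norm k) * norm (fc l k) \<le> c" .
  qed (simp add: c_def)
  then show ?thesis by blast
qed

text \<open>The diffusion term uses the extra weight of the data, the quadratic term of order one
  uses the division by 1 + |k|, and buoyancy and forcing are bounded as they are.\<close>

lemma U1_bnd: "\<exists>c. \<forall>i. bnd \<beta> c (\<lambda>k. U1 i k / of_real (1 + norm k))"
proof -
  obtain cf where cf: "\<And>l. bnd \<beta> cf (fc l)" using fc_bnd by blast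
  define A where "A = C\<gamma> * c1"
  define \<kappa>m where "\<kappa>m = \<nu> + \<mu>"
  have \<kappa>m: "\<kappa> i \<le> \<kappa>m" for i using \<nu> \<mu> by (simp add: \<kappa>_def \<kappa>m_def split: option.split)
  define c where "c = \<kappa>m * A + (\<Sum>l\<in>(UNIV :: 'n option set). \<Sum>m\<in>(UNIV :: 'n option set). 2 * (A * A)) + (\<Sum>l\<in>(UNIV :: 'n option set). cN * A) + 1 * cf"
  have "bnd \<beta> c (\<lambda>k. U1 i k / of_real (1 + norm k))" for i
  proof -
    have p: "0 < 1 + norm k" for k :: "real ^ 'n" by (simp add: add_pos_nonneg)
    have inv: "norm (1 / complex_of_real (1 + norm k)) \<le> 1" for k :: "real ^ 'n"
      using p[of k] by (simp add: norm_divide del: of_real_add)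
    have 1: "bnd \<beta> (\<kappa>m * A) (\<lambda>k. (- of_real (\<kappa> i) / of_real (1 + norm k)) * (of_real ((norm k)\<^sup>2) * W0 i k))"
    proof (rule bnd_mult)
      show "bnd \<beta> A (\<lambda>k. of_real ((norm k)\<^sup>2) * W0 i k)"
        unfolding A_def by (rule W0_bnd_weight) (auto simp: norm_power intro: power_mono)
      fix k :: "real ^ 'n"
      have "\<kappa> i / (1 + norm k) \<le> \<kappa>m / 1"
        using \<kappa>m[of i] \<kappa>_pos[of i] by (intro frac_le) auto
      then show "norm (- of_real (\<kappa> i) / complex_of_real (1 + norm k)) \<le> \<kappa>m"
        using p[of k] \<kappa>_pos[of i] by (simp add: norm_divide del: of_real_add)
    qed (use \<nu> \<mu> in \<open>auto simp: \<kappa>m_def\<close>)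
    have m1: "norm (M i l m k / of_real (1 + norm k)) \<le> 2" for l m k
    proof -
      have "norm (M i l m k) \<le> 2 * (1 + norm k)" using M_le[of i l m k] by simp
      then show ?thesis using p[of k] by (simp add: norm_divide divide_le_eq del: of_real_add)
    qed
    have n1: "norm (N i l k / of_real (1 + norm k)) \<le> cN" for l k
    proof -
      have "norm (N i l k) \<le> cN * (1 + norm k)"
        using N_le[of i l k] mult_left_mono[of 1 "1 + norm k" cN] cN_nonneg by simp
      then show ?thesis using p[of k] by (simp add: norm_divide divide_le_eq del: of_real_add)
    qed
    have "bnd \<beta> c (\<lambda>k. (- of_real (\<kappa> i) / of_real (1 + norm k)) * (of_real ((norm k)\<^sup>2) * W0 i k)
      + (\<Sum>l\<in>UNIV. \<Sum>m\<in>UNIV. M i l m k / of_real (1 + norm k) * fconv (W0 l) (W0 m) k)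
      + (\<Sum>l\<in>UNIV. N i l k / of_real (1 + norm k) * W0 l k) + 1 / of_real (1 + norm k) * fc i k)"
      unfolding c_def
    proof (intro bnd_add 1 bnd_sum finite)
      show "bnd \<beta> (2 * (A * A)) (\<lambda>k. M i l m k / of_real (1 + norm k) * fconv (W0 l) (W0 m) k)" for l m
        unfolding A_def using \<beta> by (intro bnd_mult bnd_fconv W0_bnd m1) auto
      show "bnd \<beta> (cN * A) (\<lambda>k. N i l k / of_real (1 + norm k) * W0 l k)" for l
        unfolding A_def by (intro bnd_mult W0_bnd n1 cN_nonneg) auto
      show "bnd \<beta> (1 * cf) (\<lambda>k. 1 / of_real (1 + norm k) * fc i k)"
        by (intro bnd_mult cf inv) auto
    qed
    then show ?thesis
      by (rule bnd_cong) (simp add: U1_eq add_divide_distrib diff_divide_distrib sum_divide_distrib mult.assoc)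
  qed
  then show ?thesis by blast
qed

lemma U1_meas: "U1 i \<in> borel_measurable borel"
proof -
  have [measurable]: "fc i \<in> borel_measurable borel" for i using fc_bnd bnd_meas by blast
  have [measurable]: "fconv (W0 l) (W0 m) \<in> borel_measurable borel" for l m
    using bnd_fconv[OF W0_bnd W0_bnd] \<beta> bnd_meas by (meson less_imp_le)
  show ?thesis unfolding U1_eq[abs_def] by measurable
qed

text \<open>The class grants joint measurability on p > 0. The transform is extended by 0 to the
  other p and then glued to \<open>U1\<close>.\<close>

lemma Y0_meas: "(\<lambda>(k, p). Y0 i k p) \<in> borel_measurable (borel \<Otimes>\<^sub>M borel)"
proof -
  define G where "G z = indicator (UNIV \<times> {0<..}) z *\<^sub>R (case z of (k, p) \<Rightarrow> (Hh k p, Sh k p))" for z :: "(real ^ 'n) \<times> real"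
  have o: "open ((UNIV :: (real ^ 'n) set) \<times> {0::real<..})" by (intro open_Times) auto
  have G[measurable]: "G \<in> borel_measurable (borel \<Otimes>\<^sub>M borel)"
    using sol o unfolding IE_solution_def in_laplace_class_def borel_prod G_def[abs_def]
    by (subst (asm) borel_measurable_restrict_space_iff) auto
  have 1[measurable]: "(\<lambda>z. snd (G z)) \<in> borel_measurable (borel \<Otimes>\<^sub>M borel)"
    by (rule borel_measurable_continuous_on[OF _ G]) (intro continuous_intros)
  have "(\<lambda>z. fst (G z)) \<in> borel_measurable (borel \<Otimes>\<^sub>M borel)"
    by (rule borel_measurable_continuous_on[OF _ G]) (intro continuous_intros)
  then have 2[measurable]: "(\<lambda>z. fst (G z) $ j) \<in> borel_measurable (borel \<Otimes>\<^sub>M borel)" for j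
    by (rule vec_component_measurable)
  note [measurable] = U1_meas
  have "(\<lambda>z. if snd z \<le> 0 then U1 i (fst z) else (case i of None \<Rightarrow> snd (G z) | Some j \<Rightarrow> fst (G z) $ j)) \<in> borel_measurable (borel \<Otimes>\<^sub>M borel)"
  proof (cases i)
    case None show ?thesis unfolding None option.case by measurable
  next
    case (Some j) show ?thesis unfolding Some option.case by measurable
  qed
  also have "(\<lambda>z. if snd z \<le> 0 then U1 i (fst z) else (case i of None \<Rightarrow> snd (G z) | Some j \<Rightarrow> fst (G z) $ j)) = (\<lambda>(k, p). Y0 i k p)"
    by (auto simp: fun_eq_iff Y0_def Z_def G_def split: option.split)
  finally show ?thesis .
qed

lemma Z_le: "norm (Z i k p) \<le> norm (Hh k p, Sh k p)"
proof (cases i)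
  case None
  then show ?thesis by (simp add: Z_def norm_snd_le)
next
  case (Some j)
  then show ?thesis by (simp add: Z_def order_trans[OF Finite_Cartesian_Product.norm_nth_le norm_fst_le])
qed

text \<open>As an uncountable supremum the norm is Lebesgue measurable in p only. The majorant is
  built from a Borel function that agrees with it almost everywhere, turned from extended to real
  values.\<close>

lemma laplace_majorant:
  "\<exists>h. h \<in> borel_measurable borel \<and> (\<forall>p. 0 \<le> h p) \<and> (\<forall>p\<le>0. h p = 0) \<and>
    integrable lborel (\<lambda>p. exp (- (\<omega> * p)) * h p) \<and>
    (AE p in lborel. 0 < p \<longrightarrow> (\<forall>i. bnd \<beta> (h p) (\<lambda>k. Y0 i k p)))"
proof -
  define w where "w p = wnorm \<gamma> \<beta> (\<lambda>k. (Hh k p, Sh k p))" for p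
  have w: "w \<in> borel_measurable (lebesgue_on {0<..})" "(\<integral>\<^sup>+p. ennreal (exp (- \<omega> * p)) * w p \<partial>lebesgue_on {0<..}) < \<infinity>"
    using sol by (auto simp: IE_solution_def in_laplace_class_def w_def[abs_def])
  have "(\<lambda>p. w p * indicator {0<..} p) \<in> borel_measurable lebesgue"
    using w(1) by (subst (asm) borel_measurable_restrict_space_iff_ennreal) auto
  then obtain g where g[measurable]: "g \<in> borel_measurable borel" and ae: "AE p in lborel. w p * indicator {0<..} p = g p"
    using completion_ex_borel_measurable[of "\<lambda>p. w p * indicator {0<..} p" lborel] by auto
  have "(\<integral>\<^sup>+p. ennreal (exp (- \<omega> * p)) * w p \<partial>lebesgue_on {0<..})
      = (\<integral>\<^sup>+p. ennreal (exp (- \<omega> * p)) * w p * indicator {0<..} p \<partial>lebesgue)"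
    by (rule nn_integral_restrict_space) simp
  also have "\<dots> = (\<integral>\<^sup>+p. ennreal (exp (- \<omega> * p)) * w p * indicator {0<..} p \<partial>lborel)"
    by (rule nn_integral_completion)
  also have "\<dots> = (\<integral>\<^sup>+p. ennreal (exp (- \<omega> * p)) * g p \<partial>lborel)"
    using ae by (intro nn_integral_cong_AE) (auto elim!: eventually_mono simp: mult.assoc)
  finally have fin: "(\<integral>\<^sup>+p. ennreal (exp (- \<omega> * p)) * g p \<partial>lborel) < \<infinity>" using w(2) by simp
  have "AE p in lborel. ennreal (exp (- \<omega> * p)) * g p \<noteq> \<infinity>"
    using fin by (intro nn_integral_noteq_infinite) auto
  then have gfin: "AE p in lborel. g p < \<infinity>"
    by eventually_elim (auto simp: ennreal_mult_eq_top_iff less_top)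
  define h where "h p = (if p \<le> 0 then 0 else C\<gamma> * enn2real (g p))" for p
  have C1: "1 \<le> C\<gamma>" by (simp add: C\<gamma>_def)
  have h: "0 \<le> h p" for p using C1 by (simp add: h_def)
  have hm[measurable]: "h \<in> borel_measurable borel" unfolding h_def[abs_def] by measurable
  have "(\<integral>\<^sup>+p. ennreal (exp (- (\<omega> * p)) * h p) \<partial>lborel) \<le> (\<integral>\<^sup>+p. ennreal C\<gamma> * (ennreal (exp (- \<omega> * p)) * g p) \<partial>lborel)"
  proof (rule nn_integral_mono)
    fix p
    have "ennreal (h p) \<le> ennreal C\<gamma> * g p"
    proof (cases "p \<le> 0 \<or> g p = \<infinity>")
      case False
      then show ?thesis using C1 by (simp add: h_def ennreal_mult ennreal_enn2real_if)
    qed (use C1 in \<open>auto simp: h_def\<close>)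
    then have "ennreal (exp (- \<omega> * p)) * ennreal (h p) \<le> ennreal (exp (- \<omega> * p)) * (ennreal C\<gamma> * g p)"
      by (rule mult_left_mono) simp
    then show "ennreal (exp (- (\<omega> * p)) * h p) \<le> ennreal C\<gamma> * (ennreal (exp (- \<omega> * p)) * g p)"
      using h by (simp add: ennreal_mult mult_ac)
  qed
  also have "\<dots> = ennreal C\<gamma> * (\<integral>\<^sup>+p. ennreal (exp (- \<omega> * p)) * g p \<partial>lborel)"
    by (rule nn_integral_cmult) measurable
  also have "\<dots> < \<infinity>" using fin by (simp add: ennreal_mult_less_top)
  finally have "integrable lborel (\<lambda>p. exp (- (\<omega> * p)) * h p)"
    using h by (intro integrableI_nonneg) auto
  moreover have "AE p in lborel. 0 < p \<longrightarrow> (\<forall>i. bnd \<beta> (h p) (\<lambda>k. Y0 i k p))"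
    using ae gfin
  proof eventually_elim
    case (elim p)
    show ?case
    proof (intro impI allI)
      fix i assume p: "0 < p"
      then have wp: "w p = g p" "wnorm \<gamma> \<beta> (\<lambda>k. (Hh k p, Sh k p)) < \<infinity>" using elim by (auto simp: w_def)
      have "bnd \<beta> (C\<gamma> * enn2real (w p)) (\<lambda>k. Y0 i k p)"
      proof (rule bnd_of_weight)
        show "(\<lambda>k. Y0 i k p) \<in> borel_measurable borel" by (rule tb_meas1(2)[OF Y0_meas])
        fix k
        have "(1 + norm k) powr \<gamma> * exp (\<beta> * norm k) * norm (Y0 i k p)
            \<le> (1 + norm k) powr \<gamma> * exp (\<beta> * norm k) * norm (Hh k p, Sh k p)"
          using p by (intro mult_left_mono) (auto simp: Y0_def Z_le)
        also have "\<dots> \<le> enn2real (w p)" unfolding w_def by (rule wnorm_finite[OF wp(2)])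
        finally show "(1 + norm k) powr \<gamma> * exp (\<beta> * norm k) * norm (Y0 i k p) \<le> enn2real (w p)" .
      qed simp
      then show "bnd \<beta> (h p) (\<lambda>k. Y0 i k p)" using p wp by (simp add: h_def)
    qed
  qed
  ultimately show ?thesis using h by (intro exI[of _ h]) (auto simp: h_def)
qed

end

section \<open>Verification that the Boussinesq transforms solve the abstract system\<close>

context boussinesq
begin

lemma Z_simps: "Z (Some j) = (\<lambda>k p. Hh k p $ j)" "Z None = Sh"
  by (simp_all add: Z_def fun_eq_iff)

lemma \<kappa>_simps: "\<kappa> (Some j) = \<nu>" "\<kappa> None = \<mu>"
  by (simp_all add: \<kappa>_def)

lemma laplace_class_ex: "\<exists>h. laplace_class \<kappa> M N W0 Y0 2 cN (C\<gamma> * c1) \<beta> h \<omega>"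
proof -
  obtain h where "h \<in> borel_measurable borel" "\<And>p. 0 \<le> h p" "\<And>p. p \<le> 0 \<Longrightarrow> h p = 0"
    "integrable lborel (\<lambda>p. exp (- (\<omega> * p)) * h p)"
    "AE p in lborel. 0 < p \<longrightarrow> (\<forall>i. bnd \<beta> (h p) (\<lambda>k. Y0 i k p))"
    using laplace_majorant by blast
  then have "laplace_class \<kappa> M N W0 Y0 2 cN (C\<gamma> * c1) \<beta> h \<omega>"
    by unfold_locales (auto intro: \<kappa>_pos M_le N_le cN_nonneg W0_bnd \<beta> \<omega> Y0_meas)
  then show ?thesis by blast
qed

text \<open>A fixed choice of the majorant, so that the abstract development can be attached as a
  sublocale without a further parameter; \<open>cU\<close> below serves the same end.\<close>

definition h :: "real \<Rightarrow> real" where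
  "h = (SOME h. laplace_class \<kappa> M N W0 Y0 2 cN (C\<gamma> * c1) \<beta> h \<omega>)"

sublocale L: laplace_class \<kappa> M N W0 Y0 2 cN "C\<gamma> * c1" \<beta> h \<omega>
  unfolding h_def by (rule someI_ex[OF laplace_class_ex])

lemma conv0: "0 < s \<Longrightarrow> L.conv 0 L.Y l m k s
    = fconv (W0 l) (\<lambda>k. Z m k s) k + fconv (\<lambda>k. Z l k s) (W0 m) k + fpconv (Z l) (Z m) k s"
proof -
  assume s: "0 < s"
  have "fpconv (Y0 l) (Y0 m) k s = fpconv (Z l) (Z m) k s"
    unfolding fpconv_def by (rule set_lebesgue_integral_cong) (auto simp: Y0_def)
  then show ?thesis using s by (simp add: L.conv_def Y0_def)
qed

lemma R_Some: "0 < s \<Longrightarrow> L.R 0 L.Y (Some i) k s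
   = (- (\<Sum>j\<in>UNIV. (\<i> * of_real (k $ j)) *s G1_hat u0 Hh j k s) + a *\<^sub>R hodge k (Sh k s *s cvec e2)) $ i"
  by (simp add: L.R_def quad_Some lin_Some conv0 G1_hat_def W0_simps Z_simps Y0_def) (simp add: scaleR_conv_of_real)

lemma R_None: "0 < s \<Longrightarrow> L.R 0 L.Y None k s = - (\<Sum>j\<in>UNIV. \<i> * of_real (k $ j) * G2_hat u0 \<theta>0 Hh Sh j k s)"
  by (simp add: L.R_def quad_None lin_None conv0 G2_hat_def W0_simps Z_simps)

text \<open>Needed to take components of the vector-valued integral in the velocity equation. It
  follows from |K| \<le> 1 and the locally integrable majorant \<open>g\<close>, at fixed k.\<close>

lemma K_R_integrable:
  assumes k: "k \<noteq> 0" and p: "0 < p"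
  shows "set_integrable lborel {0<..<p} (\<lambda>s. bes_K (\<kappa> i * (norm k)\<^sup>2) p s *\<^sub>R L.R 0 L.Y i k s)"
  unfolding set_integrable_def
proof (rule Bochner_Integration.integrable_bound)
  show "integrable lborel (\<lambda>s. (1 + norm k) * (indicat_real {0<..<p} s *\<^sub>R L.g s))"
    using L.g_set_integrable[of p] by (intro integrable_mult_right) (simp add: set_integrable_def)
  have [measurable]: "L.R 0 L.Y i k \<in> borel_measurable borel" by (rule tb_meas1(1)[OF L.R_meas])
  show "(\<lambda>s. indicat_real {0<..<p} s *\<^sub>R bes_K (\<kappa> i * (norm k)\<^sup>2) p s *\<^sub>R L.R 0 L.Y i k s) \<in> borel_measurable lborel"
    by measurable
  show "AE s in lborel. norm (indicat_real {0<..<p} s *\<^sub>R bes_K (\<kappa> i * (norm k)\<^sup>2) p s *\<^sub>R L.R 0 L.Y i k s)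
    \<le> norm ((1 + norm k) * (indicat_real {0<..<p} s *\<^sub>R L.g s))"
    using L.R0_bnd
  proof eventually_elim
    case (elim s)
    show ?case
    proof (cases "s \<in> {0<..<p}")
      case True
      then have "bnd 0 (L.g s) (\<lambda>k. L.R 0 L.Y i k s / of_real (1 + norm k))"
        using elim \<beta> by (auto intro: bnd_mono_b)
      from bnd_sup[OF this k] have "norm (L.R 0 L.Y i k s) \<le> (1 + norm k) * L.g s"
        using norm_ge_zero[of k] by (simp add: norm_divide divide_le_eq mult.commute add_pos_nonneg del: of_real_add)
      moreover have "\<bar>bes_K (\<kappa> i * (norm k)\<^sup>2) p s\<bar> \<le> 1"
        using True k \<kappa>_pos by (intro abs_K_le_1) auto
      ultimately have "\<bar>bes_K (\<kappa> i * (norm k)\<^sup>2) p s\<bar> * norm (L.R 0 L.Y i k s) \<le> 1 * ((1 + norm k) * L.g s)"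
        by (intro mult_mono) auto
      also have "\<dots> \<le> norm ((1 + norm k) * L.g s)" by simp
      finally show ?thesis using True by simp
    qed simp
  qed
qed

text \<open>The factor pi in front of the integral belongs to the kernel, which by
  \<open>bessel_kernel_eq\<close> then becomes \<open>bes_K\<close>. The temperature equation is
  scalar; the velocity equation is rewritten as a vector and read off by components.\<close>

lemma Y0_IE:
  assumes k: "k \<noteq> 0" and p: "0 < p"
  shows "Y0 i k p = (LINT s:{0<..<p}|lborel. bes_K (\<kappa> i * (norm k)\<^sup>2) p s *\<^sub>R L.R 0 L.Y i k s)
      + bes_j (\<kappa> i * (norm k)\<^sup>2 * p) *\<^sub>R Y0 i k 0"
proof -
  have "integral_eqs \<nu> \<mu> a e2 u0 \<theta>0 f Hh Sh" using sol by (simp add: IE_solution_def)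
  note ie = this[unfolded integral_eqs_def Let_def, rule_format, OF k p]
  have nk: "0 < norm k" using k by simp
  have G: "bessel_G (2 * norm k * sqrt (c * p)) (2 * norm k * sqrt (c * s)) / (2 * norm k * sqrt (c * p))
      = (1 / pi) * bes_K (c * (norm k)\<^sup>2) p s" if "0 < c" "s \<in> {0<..<p}" for c s
    using bessel_kernel_eq[OF that(1) nk p, of s] that(2) by (simp add: field_simps)
  have J: "2 * bessel_J1 (2 * norm k * sqrt (c * p)) / (2 * norm k * sqrt (c * p)) = bes_j (c * (norm k)\<^sup>2 * p)" if "0 < c" for c
    by (rule bessel_free_eq) (use that nk p in auto)
  show ?thesis
  proof (cases i)
    case None
    define v where "v s = - (\<Sum>j\<in>UNIV. \<i> * of_real (k $ j) * G2_hat u0 \<theta>0 Hh Sh j k s)" for s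
    have "Sh k p = pi *\<^sub>R (LINT s:{0<..<p}|lborel. (bessel_G (2 * norm k * sqrt (\<mu> * p)) (2 * norm k * sqrt (\<mu> * s)) / (2 * norm k * sqrt (\<mu> * p))) *\<^sub>R v s)
       + bes_j (\<mu> * (norm k)\<^sup>2 * p) *\<^sub>R \<theta>1_hat \<mu> u0 \<theta>0 k"
      unfolding v_def J[OF \<mu>, symmetric] by (rule conjunct2[OF ie])
    also have "(LINT s:{0<..<p}|lborel. (bessel_G (2 * norm k * sqrt (\<mu> * p)) (2 * norm k * sqrt (\<mu> * s)) / (2 * norm k * sqrt (\<mu> * p))) *\<^sub>R v s)
      = (LINT s:{0<..<p}|lborel. (1 / pi) *\<^sub>R (bes_K (\<kappa> i * (norm k)\<^sup>2) p s *\<^sub>R L.R 0 L.Y i k s))"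
      by (intro set_lebesgue_integral_cong) (auto simp: None \<kappa>_simps R_None v_def G[OF \<mu>])
    also have "\<dots> = (1 / pi) *\<^sub>R (LINT s:{0<..<p}|lborel. bes_K (\<kappa> i * (norm k)\<^sup>2) p s *\<^sub>R L.R 0 L.Y i k s)"
      by (rule set_integral_scaleR_right)
    finally show ?thesis using p by (simp add: Y0_def Z_def U1_def None \<kappa>_simps)
  next
    case (Some j)
    define v where "v s = - (\<Sum>j\<in>UNIV. (\<i> * of_real (k $ j)) *s G1_hat u0 Hh j k s) + a *\<^sub>R hodge k (Sh k s *s cvec e2)" for s
    have "Hh k p = pi *\<^sub>R (LINT s:{0<..<p}|lborel. (bessel_G (2 * norm k * sqrt (\<nu> * p)) (2 * norm k * sqrt (\<nu> * s)) / (2 * norm k * sqrt (\<nu> * p))) *\<^sub>R v s)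
       + bes_j (\<nu> * (norm k)\<^sup>2 * p) *\<^sub>R u1_hat \<nu> a e2 u0 \<theta>0 f k"
      unfolding v_def J[OF \<nu>, symmetric] by (rule conjunct1[OF ie])
    also have "(LINT s:{0<..<p}|lborel. (bessel_G (2 * norm k * sqrt (\<nu> * p)) (2 * norm k * sqrt (\<nu> * s)) / (2 * norm k * sqrt (\<nu> * p))) *\<^sub>R v s)
      = (LINT s:{0<..<p}|lborel. (1 / pi) *\<^sub>R (bes_K (\<nu> * (norm k)\<^sup>2) p s *\<^sub>R v s))"
      by (intro set_lebesgue_integral_cong) (auto simp: G[OF \<nu>])
    also have "\<dots> = (1 / pi) *\<^sub>R (LINT s:{0<..<p}|lborel. bes_K (\<nu> * (norm k)\<^sup>2) p s *\<^sub>R v s)"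
      by (rule set_integral_scaleR_right)
    finally have H: "Hh k p = (LINT s:{0<..<p}|lborel. bes_K (\<nu> * (norm k)\<^sup>2) p s *\<^sub>R v s) + bes_j (\<nu> * (norm k)\<^sup>2 * p) *\<^sub>R u1_hat \<nu> a e2 u0 \<theta>0 f k"
      by simp
    have vR: "v s $ j' = L.R 0 L.Y (Some j') k s" if "s \<in> {0<..<p}" for s j'
      using that by (simp only: R_Some v_def greaterThanLessThan_iff)
    have "set_integrable lborel {0<..<p} (\<lambda>s. (bes_K (\<nu> * (norm k)\<^sup>2) p s *\<^sub>R v s) $ j')" for j'
      using K_R_integrable[OF k p, of "Some j'"]
      by (rule set_integrable_cong[THEN iffD1, rotated -1]) (auto simp: vR \<kappa>_simps)
    from vec_integral(2)[OF this, of j]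
    have "(LINT s:{0<..<p}|lborel. bes_K (\<nu> * (norm k)\<^sup>2) p s *\<^sub>R v s) $ j
       = (LINT s:{0<..<p}|lborel. bes_K (\<nu> * (norm k)\<^sup>2) p s *\<^sub>R v s $ j)" by simp
    also have "\<dots> = (LINT s:{0<..<p}|lborel. bes_K (\<kappa> i * (norm k)\<^sup>2) p s *\<^sub>R L.R 0 L.Y i k s)"
      by (intro set_lebesgue_integral_cong) (auto simp: Some vR \<kappa>_simps)
    finally show ?thesis using p H by (simp add: Y0_def Z_def U1_def Some \<kappa>_simps)
  qed
qed

definition cU :: real where "cU = (SOME c. \<forall>i. bnd \<beta> c (\<lambda>k. U1 i k / of_real (1 + norm k)))"

sublocale B: borel_solution \<kappa> M N W0 Y0 2 cN "C\<gamma> * c1" \<beta> h \<omega> cU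
proof
  show "bnd \<beta> cU (\<lambda>k. Y0 i k 0 / of_real (1 + norm k))" for i
    using someI_ex[OF U1_bnd] by (simp add: cU_def Y0_def)
qed (rule Y0_IE)

section \<open>Results for the Boussinesq solution\<close>

lemma laplace_vec:
  assumes t: "Re (1 / t) > \<omega>" and k: "k \<noteq> 0"
  shows "(LINT p:{0<..}|lborel. exp (- of_real p / t) *s Hh k p) $ i = (LINT p:{0<..}|lborel. exp (- of_real p / t) * Y0 (Some i) k p)"
proof -
  have "set_integrable lborel {0<..} (\<lambda>p. (exp (- of_real p / t) *s Hh k p) $ i)" for i
    using B.Y0_laplace_integrable[OF t k, of "Some i"]
    by (rule set_integrable_cong[THEN iffD1, rotated -1]) (auto simp: Y0_def Z_def)
  note this[THEN vec_integral(2), of i]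
  also have "(LINT p:{0<..}|lborel. (exp (- of_real p / t) *s Hh k p) $ i) = (LINT p:{0<..}|lborel. exp (- of_real p / t) * Y0 (Some i) k p)"
    by (rule set_lebesgue_integral_cong) (auto simp: Y0_def Z_def)
  finally show ?thesis .
qed

lemma laplace_None: "(LINT p:{0<..}|lborel. exp (- of_real p / t) * Sh k p) = (LINT p:{0<..}|lborel. exp (- of_real p / t) * Y0 None k p)"
  by (rule set_lebesgue_integral_cong) (auto simp: Y0_def Z_def)

lemma boussinesq_solution_eq:
  assumes t: "Re (1 / t) > \<omega>"
  shows "boussinesq_solution u0 \<theta>0 Hh Sh x t = initial_state u0 \<theta>0 x +
     ((\<chi> i. LINT p:{0<..}|lborel. exp (- of_real p / t) * B.HH (Some i) (cvec x) (of_real p)),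
      LINT p:{0<..}|lborel. exp (- of_real p / t) * B.HH None (cvec x) (of_real p))"
proof -
  have "inv_fourier (\<lambda>k. (u0 k + (LINT p:{0<..}|lborel. exp (- of_real p / t) *s Hh k p)) $ i) x
      = inv_fourier (\<lambda>k. u0 k $ i) x + (LINT p:{0<..}|lborel. exp (- of_real p / t) * B.HH (Some i) (cvec x) (of_real p))" for i
    unfolding B.laplace_fint(2)[OF t, of "Some i" x, unfolded W0_simps, symmetric]
    by (rule inv_fourier_cong) (simp only: vector_add_component laplace_vec[OF t] simp_thms)
  then show ?thesis
    using B.laplace_fint(2)[OF t, of None x, unfolded W0_simps laplace_None[symmetric]]
    by (simp add: boussinesq_solution_def initial_state_def inv_fourier_vec_def vec_eq_iff)
qed

definition H :: "complex ^ 'n \<Rightarrow> complex \<Rightarrow> complex ^ 'n" where "H x p = (\<chi> i. B.HH (Some i) x p)"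
definition S :: "complex ^ 'n \<Rightarrow> complex \<Rightarrow> complex" where "S = B.HH None"

lemma norm_pair_le:
  assumes "\<And>i. norm (F i) \<le> C"
  shows "norm ((\<chi> i. F (Some i)) :: complex ^ 'n, F None :: complex) \<le> (real CARD('n) + 1) * C"
proof -
  have "norm ((\<chi> i. F (Some i)) :: complex ^ 'n, F None) \<le> norm ((\<chi> i. F (Some i)) :: complex ^ 'n) + norm (F None)"
    by (rule norm_Pair_le)
  also have "norm ((\<chi> i. F (Some i)) :: complex ^ 'n) \<le> (\<Sum>i\<in>(UNIV :: 'n set). C)"
    using norm_vec_le_sum[of "\<chi> i. F (Some i)"] sum_mono[of UNIV "\<lambda>i. norm (F (Some i))" "\<lambda>_. C"] assms by simp
  finally show ?thesis using assms[of None] by (simp add: distrib_right)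
qed

lemma borel_sum:
  shows "0 < b \<Longrightarrow> b < \<beta> \<Longrightarrow> \<exists>N. open N \<and> of_real ` {0::real..} \<subseteq> N \<and>
             (\<forall>x\<in>tube b. (\<forall>i. (\<lambda>p. H x p $ i) holomorphic_on N) \<and> (\<lambda>p. S x p) holomorphic_on N) \<and>
             (\<forall>p\<in>N. (\<forall>i. holomorphic_vec (\<lambda>x. H x p $ i) (tube b)) \<and> holomorphic_vec (\<lambda>x. S x p) (tube b))"
    and "\<exists>C M p0. \<forall>x\<in>tube \<beta>. \<forall>p::real. p \<ge> p0 \<longrightarrow> norm (H x (of_real p), S x (of_real p)) \<le> C * exp (M * p)"
    and "Re (1 / t) > \<omega> \<Longrightarrow> set_integrable lborel {0<..} (\<lambda>p. exp (- of_real p / t) *s H (cvec x) (of_real p)) \<and>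
             set_integrable lborel {0<..} (\<lambda>p. exp (- of_real p / t) * S (cvec x) (of_real p)) \<and>
             boussinesq_solution u0 \<theta>0 Hh Sh x t = initial_state u0 \<theta>0 x +
               (LINT p:{0<..}|lborel. exp (- of_real p / t) *s H (cvec x) (of_real p),
                LINT p:{0<..}|lborel. exp (- of_real p / t) * S (cvec x) (of_real p))"
proof -
  assume "0 < b" "b < \<beta>"
  from B.HH_neighbourhood[OF this] show "\<exists>N. open N \<and> of_real ` {0::real..} \<subseteq> N \<and>
             (\<forall>x\<in>tube b. (\<forall>i. (\<lambda>p. H x p $ i) holomorphic_on N) \<and> (\<lambda>p. S x p) holomorphic_on N) \<and>
             (\<forall>p\<in>N. (\<forall>i. holomorphic_vec (\<lambda>x. H x p $ i) (tube b)) \<and> holomorphic_vec (\<lambda>x. S x p) (tube b))"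
    by (simp add: H_def S_def) blast
next
  obtain C where C: "\<And>x p i. x \<in> tube \<beta> \<Longrightarrow> 1 \<le> p \<Longrightarrow> norm (B.HH i x (of_real p)) \<le> C * exp (\<omega> * p)"
    using B.HH_exp_bound by blast
  have "norm (H x (of_real p), S x (of_real p)) \<le> (real CARD('n) + 1) * C * exp (\<omega> * p)" if "x \<in> tube \<beta>" "1 \<le> p" for x p
    using norm_pair_le[OF C[OF that]] by (simp add: H_def S_def mult.assoc)
  then show "\<exists>C M p0. \<forall>x\<in>tube \<beta>. \<forall>p::real. p \<ge> p0 \<longrightarrow> norm (H x (of_real p), S x (of_real p)) \<le> C * exp (M * p)"
    by blast
next
  assume t: "Re (1 / t) > \<omega>"
  have i: "set_integrable lborel {0<..} (\<lambda>p. (exp (- of_real p / t) *s H (cvec x) (of_real p)) $ i)" for i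
    using B.laplace_fint(1)[OF t, of "Some i" x] by (simp add: H_def)
  have "(LINT p:{0<..}|lborel. exp (- of_real p / t) *s H (cvec x) (of_real p))
      = (\<chi> i. LINT p:{0<..}|lborel. exp (- of_real p / t) * B.HH (Some i) (cvec x) (of_real p))"
    unfolding vec_eq_iff vec_integral(2)[OF i] by (simp add: H_def)
  then show "set_integrable lborel {0<..} (\<lambda>p. exp (- of_real p / t) *s H (cvec x) (of_real p)) \<and>
             set_integrable lborel {0<..} (\<lambda>p. exp (- of_real p / t) * S (cvec x) (of_real p)) \<and>
             boussinesq_solution u0 \<theta>0 Hh Sh x t = initial_state u0 \<theta>0 x +
               (LINT p:{0<..}|lborel. exp (- of_real p / t) *s H (cvec x) (of_real p),
                LINT p:{0<..}|lborel. exp (- of_real p / t) * S (cvec x) (of_real p))"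
    using vec_integral(1)[OF i] B.laplace_fint(1)[OF t, of None x] boussinesq_solution_eq[OF t, of x] by (simp add: S_def)
qed

text \<open>The finitely many components have errors of order t^(K + 1), which yields the required
  o(t^K). Coefficient bounds enter as a hypothesis so that the same argument covers general data and
  finitely many modes.\<close>

lemma gevrey_of_coef_bound:
  assumes "\<And>m i x. 1 \<le> m \<Longrightarrow> norm (B.coef m i x) \<le> fact m * A0 * D0 ^ m"
  shows "gevrey_expansion (initial_state u0 \<theta>0) (boussinesq_solution u0 \<theta>0 Hh Sh) ((real CARD('n) + 1) * A0) D0"
  unfolding gevrey_expansion_def
proof (intro exI conjI allI impI)
  let ?c = "\<lambda>m x. ((\<chi> i. B.coef m (Some i) x), B.coef m None x)"
  show "norm (?c m x) \<le> fact m * ((real CARD('n) + 1) * A0) * D0 ^ m" if "1 \<le> m" for m x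
    using norm_pair_le[of "\<lambda>i. B.coef m i x", OF assms[OF that]] by (simp add: mult_ac)
  fix x :: "real ^ 'n" and K :: nat
  define E where "E i t = (LINT p:{0<..}|lborel. exp (- of_real p / of_real t) * B.HH i (cvec x) (of_real p)) - (\<Sum>m=1..K. of_real (t ^ m) * B.coef m i x)" for i t
  have "\<forall>i. \<exists>C \<delta>. 0 < \<delta> \<and> (\<forall>t. 0 < t \<longrightarrow> t < \<delta> \<longrightarrow> norm (E i t) \<le> C * t ^ Suc K)"
    unfolding E_def using B.laplace_asymptotics by blast
  then obtain C \<delta> where \<delta>: "\<And>i. 0 < \<delta> i" and C: "\<And>i t. 0 < t \<Longrightarrow> t < \<delta> i \<Longrightarrow> norm (E i t) \<le> C i * t ^ Suc K"
    by metis
  define C' where "C' = (\<Sum>i\<in>UNIV. \<bar>C i\<bar>)"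
  \<comment> \<open>Common range for the components; the bound 1 / \<omega> ensures Re (1 / t) >
    \<omega>, where the Laplace representation holds.\<close>
  define \<delta>' where "\<delta>' = min (Min (range \<delta>)) (1 / \<omega>)"
  have \<delta>': "0 < \<delta>'" "\<And>i. \<delta>' \<le> \<delta> i" "\<delta>' \<le> 1 / \<omega>" using \<delta> \<omega> by (auto simp: \<delta>'_def min_le_iff_disj)
  have C': "C i \<le> C'" for i
    using member_le_sum[of i UNIV "\<lambda>i. \<bar>C i\<bar>"] abs_ge_self[of "C i"] unfolding C'_def by simp
  have bound: "norm (boussinesq_solution u0 \<theta>0 Hh Sh x (of_real t) - initial_state u0 \<theta>0 x - (\<Sum>m=1..K. t ^ m *\<^sub>R ?c m x))
     \<le> (real CARD('n) + 1) * C' * t ^ Suc K" if t: "0 < t" "t < \<delta>'" for t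
  proof -
    have "t < 1 / \<omega>" using t \<delta>' by linarith
    then have Re: "\<omega> < Re (1 / complex_of_real t)"
    proof -
      have "Re (1 / complex_of_real t) = 1 / t" by (metis Re_complex_of_real of_real_1 of_real_divide)
      moreover have "\<omega> < 1 / t" using \<open>t < 1 / \<omega>\<close> t \<omega> by (simp add: field_simps)
      ultimately show ?thesis by simp
    qed
    have "boussinesq_solution u0 \<theta>0 Hh Sh x (of_real t) - initial_state u0 \<theta>0 x - (\<Sum>m=1..K. t ^ m *\<^sub>R ?c m x)
       = ((\<chi> i. E (Some i) t), E None t)"
      unfolding boussinesq_solution_eq[OF Re]
      by (simp add: prod_eq_iff fst_sum snd_sum vec_eq_iff E_def scaleR_conv_of_real[where 'a = complex])
    also have "norm \<dots> \<le> (real CARD('n) + 1) * (C' * t ^ Suc K)"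
    proof (rule norm_pair_le)
      fix i
      have "norm (E i t) \<le> C i * t ^ Suc K" using t \<delta>'(2)[of i] by (intro C) auto
      also have "\<dots> \<le> C' * t ^ Suc K" using t C' by (intro mult_right_mono) auto
      finally show "norm (E i t) \<le> C' * t ^ Suc K" .
    qed
    finally show ?thesis by (simp only: mult.assoc)
  qed
  have "(\<lambda>t. norm (boussinesq_solution u0 \<theta>0 Hh Sh x (of_real t) - initial_state u0 \<theta>0 x - (\<Sum>m=1..K. t ^ m *\<^sub>R ?c m x)))
      \<in> O[at_right 0](\<lambda>t::real. t ^ Suc K)"
  proof (rule bigoI)
    show "eventually (\<lambda>t. norm (norm (boussinesq_solution u0 \<theta>0 Hh Sh x (of_real t) - initial_state u0 \<theta>0 x - (\<Sum>m=1..K. t ^ m *\<^sub>R ?c m x)))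
        \<le> (real CARD('n) + 1) * C' * norm (t ^ Suc K)) (at_right 0)"
      unfolding eventually_at_right_field using \<delta>' bound by (intro exI[of _ \<delta>']) auto
  qed
  also have "(\<lambda>t::real. t ^ Suc K) \<in> o[at_right 0](\<lambda>t. t ^ K)" by real_asymp
  finally show "(\<lambda>t. norm (boussinesq_solution u0 \<theta>0 Hh Sh x (of_real t) - initial_state u0 \<theta>0 x - (\<Sum>m=1..K. t ^ m *\<^sub>R ?c m x)))
      \<in> o[at_right 0](\<lambda>t::real. t ^ K)" .
qed

lemma mode_radius_support:
  assumes "mode_radius u0 \<theta>0 f = ennreal K" "0 \<le> K" "K < norm k"
  shows "u0 k = 0" "\<theta>0 k = 0" "f k = 0"
proof -
  have *: "k \<notin> Q" if "(SUP k\<in>closure Q. ennreal (norm k)) \<le> ennreal K" for Q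
  proof
    assume "k \<in> Q"
    then have "ennreal (norm k) \<le> ennreal K"
      using that closure_subset[of Q] by (meson SUP_upper order_trans subsetD)
    then show False using assms(2,3) by simp
  qed
  have "k \<notin> {k. (u0 k, \<theta>0 k) \<noteq> 0}" "k \<notin> {k. f k \<noteq> 0}"
    using assms(1) by (intro *; simp only: mode_radius_def flip: assms(1); simp)+
  then show "u0 k = 0" "\<theta>0 k = 0" "f k = 0" by (auto simp: zero_prod_def)
qed

text \<open>The bound \<open>D0\<close>^n n! at p = 0 is used twice: with
  \<open>power_series_Y0\<close> for the series in p at each k, and after Fourier inversion for the
  coefficients of the expansion in t.\<close>

lemma finite_modes:
  assumes K: "0 \<le> K" and modes: "mode_radius u0 \<theta>0 f = ennreal K" and D0: "D0 = 2 * (\<Sum>i\<in>UNIV. \<kappa> i) * K\<^sup>2 + 1"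
  shows "\<exists>c. \<forall>k. k \<noteq> 0 \<longrightarrow> ereal (1 / D0) \<le> conv_radius (\<lambda>m. norm (c m k)) \<and>
            (\<forall>p. 0 < p \<and> p < 1 / D0 \<longrightarrow> (\<lambda>m. p ^ m *\<^sub>R c m k) sums (Hh k p, Sh k p))"
    and "\<exists>A0>0. gevrey_expansion (initial_state u0 \<theta>0) (boussinesq_solution u0 \<theta>0 Hh Sh) A0 D0"
proof -
  have W: "W0 l k = 0" if "K < norm k" for l k
    using mode_radius_support[OF modes K that] by (cases l) (simp_all add: W0_simps)
  have fcz: "fc l k = 0" if "K < norm k" for l k
    using mode_radius_support[OF modes K that] by (cases l) (simp_all add: fc_def)
  have Z: "Y0 l k 0 = 0" if "2 * K < norm k" for l k
  proof -
    have k: "K < norm k" using that K by simp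
    have "fconv (W0 l) (W0 m) k = 0" for l m by (rule fconv_eq_zero[of K _ K]) (use W that in auto)
    then show ?thesis using W[OF k] fcz[OF k] by (simp add: Y0_def U1_eq)
  qed
  have D1: "1 \<le> D0" using sum_nonneg[of UNIV \<kappa>] \<kappa>_pos by (simp add: D0 less_imp_le)
  obtain B where "\<And>n i. bnd 0 (B * fact n * D0 ^ n) (\<lambda>k. L.Y n i k 0)"
    using B.finite_modes_bound[OF K W Z D0] by blast
  \<comment> \<open>The maximum with 1 keeps the constant of the expansion positive, even for
    vanishing data.\<close>
  then have B: "bnd 0 (max 1 B * fact n * D0 ^ n) (\<lambda>k. L.Y n i k 0)" for n i
    by (rule bnd_mono) (use D1 in \<open>intro mult_right_mono; simp\<close>)
  define c where "c m k = ((\<chi> i. L.Y m (Some i) k 0 / fact m) :: complex ^ 'n, L.Y m None k 0 / fact m)" for m k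
  have Yb: "norm (L.Y n i k 0) \<le> max 1 B * fact n * D0 ^ n" if "k \<noteq> 0" for n i k
    using bnd_sup[OF B that] by simp
  have cb: "norm (c m k) \<le> (real CARD('n) + 1) * (max 1 B * D0 ^ m)" if "k \<noteq> 0" for m k
    unfolding c_def by (rule norm_pair_le) (use Yb[OF that, of m] in \<open>simp add: norm_divide divide_le_eq mult_ac\<close>)
  have "ereal (1 / D0) \<le> conv_radius (\<lambda>m. norm (c m k))" if k: "k \<noteq> 0" for k
  proof (rule conv_radius_geI_ex)
    fix r :: real assume r: "0 < r" "ereal r < ereal (1 / D0)"
    then have "D0 * r < 1" using D1 by (simp add: field_simps)
    then have "summable (\<lambda>m. (real CARD('n) + 1) * max 1 B * (D0 * r) ^ m)"
      using r D1 by (intro summable_mult summable_geometric) simp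
    then have "summable (\<lambda>m. norm (c m k) * r ^ m)"
    proof (rule summable_comparison_test'[where N = 0])
      fix m
      have "norm (c m k) * r ^ m \<le> (real CARD('n) + 1) * (max 1 B * D0 ^ m) * r ^ m"
        using r by (intro mult_right_mono cb k) simp
      then show "norm (norm (c m k) * r ^ m) \<le> (real CARD('n) + 1) * max 1 B * (D0 * r) ^ m"
        using r by (simp add: power_mult_distrib mult_ac)
    qed
    then show "\<exists>z. norm z = r \<and> summable (\<lambda>n. norm (c n k) * z ^ n)" using r by (intro exI[of _ r]) simp
  qed
  moreover have "(\<lambda>m. p ^ m *\<^sub>R c m k) sums (Hh k p, Sh k p)" if k: "k \<noteq> 0" and p: "0 < p" "p < 1 / D0" for k p
  proof -
    have s: "(\<lambda>n. \<Sum>m<n. L.Y m i k 0 / fact m * of_real p ^ m) \<longlonglongrightarrow> Z i k p" for i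
      using B.power_series_Y0[OF _ Yb[OF k] p k, of i] D1 p by (simp add: sums_def Y0_def)
    have "(\<lambda>n. (\<chi> i. \<Sum>m<n. L.Y m (Some i) k 0 / fact m * of_real p ^ m, \<Sum>m<n. L.Y m None k 0 / fact m * of_real p ^ m)) \<longlonglongrightarrow> ((\<chi> i. Z (Some i) k p), Z None k p)"
      by (intro tendsto_Pair tendsto_vec_lambda s)
    moreover have "(\<Sum>m<n. p ^ m *\<^sub>R c m k) = (\<chi> i. \<Sum>m<n. L.Y m (Some i) k 0 / fact m * of_real p ^ m, \<Sum>m<n. L.Y m None k 0 / fact m * of_real p ^ m)" for n
      by (simp add: c_def prod_eq_iff fst_sum snd_sum vec_eq_iff scaleR_conv_of_real[where 'a = complex] mult.commute)
    moreover have "((\<chi> i. Z (Some i) k p), Z None k p) = (Hh k p, Sh k p)" by (simp add: Z_simps)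
    ultimately show ?thesis by (simp add: sums_def)
  qed
  ultimately show "\<exists>c. \<forall>k. k \<noteq> 0 \<longrightarrow> ereal (1 / D0) \<le> conv_radius (\<lambda>m. norm (c m k)) \<and>
            (\<forall>p. 0 < p \<and> p < 1 / D0 \<longrightarrow> (\<lambda>m. p ^ m *\<^sub>R c m k) sums (Hh k p, Sh k p))"
    by blast
  have "0 < (real CARD('n) + 1) * max 1 B" by (simp add: add_pos_nonneg)
  moreover have "gevrey_expansion (initial_state u0 \<theta>0) (boussinesq_solution u0 \<theta>0 Hh Sh) ((real CARD('n) + 1) * max 1 B) D0"
    by (intro gevrey_of_coef_bound B.finite_modes_coef_bound B D1)
  ultimately show "\<exists>A0>0. gevrey_expansion (initial_state u0 \<theta>0) (boussinesq_solution u0 \<theta>0 Hh Sh) A0 D0" by blast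
qed

lemma gevrey: "\<exists>A0>0. \<exists>D0>0. gevrey_expansion (initial_state u0 \<theta>0) (boussinesq_solution u0 \<theta>0 Hh Sh) A0 D0"
proof -
  obtain A0 D0 where "0 < A0" "0 < D0" "\<And>m i x. 1 \<le> m \<Longrightarrow> norm (B.coef m i x) \<le> fact m * A0 * D0 ^ m"
    using B.coef_bound by blast
  then show ?thesis
    using gevrey_of_coef_bound[of A0 D0] by (intro exI[of _ "(real CARD('n) + 1) * A0"] conjI exI[of _ D0]) auto
qed

end

theorem theorem2p2:
  fixes \<nu> \<mu> a \<gamma> \<beta> :: real and e2 :: "real ^ 'n"
  assumes "CARD('n) \<in> {2, 3}"
    and "\<nu> > 0" and "\<mu> > 0" and "a > 0" and "norm e2 = 1"
    and "\<beta> > 0" and "\<gamma> > real CARD('n)"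
  shows
    "(\<forall>(u0 :: real ^ 'n \<Rightarrow> complex ^ 'n) \<theta>0 f \<omega> Hh Sh.
       data_ok \<gamma> \<beta> u0 \<theta>0 f \<longrightarrow> \<omega> > 0 \<longrightarrow> IE_solution \<nu> \<mu> a e2 \<gamma> \<beta> u0 \<theta>0 f \<omega> Hh Sh \<longrightarrow>
       (\<exists>(H :: complex ^ 'n \<Rightarrow> complex \<Rightarrow> complex ^ 'n) (S :: complex ^ 'n \<Rightarrow> complex \<Rightarrow> complex).
          (\<forall>b. 0 < b \<and> b < \<beta> \<longrightarrow> (\<exists>N. open N \<and> of_real ` {0::real..} \<subseteq> N \<and>
             (\<forall>x\<in>tube b. (\<forall>i. (\<lambda>p. H x p $ i) holomorphic_on N) \<and> (\<lambda>p. S x p) holomorphic_on N) \<and>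
             (\<forall>p\<in>N. (\<forall>i. holomorphic_vec (\<lambda>x. H x p $ i) (tube b)) \<and>
                     holomorphic_vec (\<lambda>x. S x p) (tube b)))) \<and>
          (\<exists>C M p0. \<forall>x\<in>tube \<beta>. \<forall>p::real. p \<ge> p0 \<longrightarrow>
             norm (H x (of_real p), S x (of_real p)) \<le> C * exp (M * p)) \<and>
          (\<forall>x t. Re (1 / t) > \<omega> \<longrightarrow>
             set_integrable lborel {0<..} (\<lambda>p. exp (- of_real p / t) *s H (cvec x) (of_real p)) \<and>
             set_integrable lborel {0<..} (\<lambda>p. exp (- of_real p / t) * S (cvec x) (of_real p)) \<and>
             boussinesq_solution u0 \<theta>0 Hh Sh x t = initial_state u0 \<theta>0 x +
               (LINT p:{0<..}|lborel. exp (- of_real p / t) *s H (cvec x) (of_real p),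
                LINT p:{0<..}|lborel. exp (- of_real p / t) * S (cvec x) (of_real p)))) \<and>
       (\<exists>A0>0. \<exists>D0>0. gevrey_expansion (initial_state u0 \<theta>0) (boussinesq_solution u0 \<theta>0 Hh Sh) A0 D0))
     \<and>
     (\<forall>K\<ge>0. \<exists>D0>0. \<forall>(u0 :: real ^ 'n \<Rightarrow> complex ^ 'n) \<theta>0 f \<omega> Hh Sh.
       data_ok \<gamma> \<beta> u0 \<theta>0 f \<longrightarrow> \<omega> > 0 \<longrightarrow> IE_solution \<nu> \<mu> a e2 \<gamma> \<beta> u0 \<theta>0 f \<omega> Hh Sh \<longrightarrow>
       mode_radius u0 \<theta>0 f = ennreal K \<longrightarrow>
       (\<exists>c. \<forall>k. k \<noteq> 0 \<longrightarrow> ereal (1 / D0) \<le> conv_radius (\<lambda>m. norm (c m k)) \<and>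
            (\<forall>p. 0 < p \<and> p < 1 / D0 \<longrightarrow> (\<lambda>m. p ^ m *\<^sub>R c m k) sums (Hh k p, Sh k p))) \<and>
       (\<exists>A0>0. gevrey_expansion (initial_state u0 \<theta>0) (boussinesq_solution u0 \<theta>0 Hh Sh) A0 D0))"
proof (rule conjI, intro allI impI, goal_cases)
  case (1 u0 \<theta>0 f \<omega> Hh Sh)
  then interpret boussinesq \<nu> \<mu> a \<gamma> \<beta> e2 u0 \<theta>0 f \<omega> Hh Sh
    using assms by unfold_locales auto
  show ?case
    by (intro conjI gevrey exI[of _ H] exI[of _ S] allI impI borel_sum) auto
next
  case 2
  show ?case
  proof (intro allI impI)
    fix K :: real assume K: "0 \<le> K"
    \<comment> \<open>Chosen before the data are introduced, which is the asserted independence of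
      their size. The bracket is the sum of all diffusivities: \<mu> for the temperature and \<nu>
      for each velocity component.\<close>
    define D0 where "D0 = 2 * (\<mu> + real CARD('n) * \<nu>) * K\<^sup>2 + 1"
    have D0: "0 < D0" using assms by (simp add: D0_def add_nonneg_pos)
    show "\<exists>D0>0. \<forall>(u0 :: real ^ 'n \<Rightarrow> complex ^ 'n) \<theta>0 f \<omega> Hh Sh.
       data_ok \<gamma> \<beta> u0 \<theta>0 f \<longrightarrow> \<omega> > 0 \<longrightarrow> IE_solution \<nu> \<mu> a e2 \<gamma> \<beta> u0 \<theta>0 f \<omega> Hh Sh \<longrightarrow>
       mode_radius u0 \<theta>0 f = ennreal K \<longrightarrow>
       (\<exists>c. \<forall>k. k \<noteq> 0 \<longrightarrow> ereal (1 / D0) \<le> conv_radius (\<lambda>m. norm (c m k)) \<and>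
            (\<forall>p. 0 < p \<and> p < 1 / D0 \<longrightarrow> (\<lambda>m. p ^ m *\<^sub>R c m k) sums (Hh k p, Sh k p))) \<and>
       (\<exists>A0>0. gevrey_expansion (initial_state u0 \<theta>0) (boussinesq_solution u0 \<theta>0 Hh Sh) A0 D0)"
    proof (intro exI[of _ D0] conjI[OF D0] allI impI)
      fix u0 :: "real ^ 'n \<Rightarrow> complex ^ 'n" and \<theta>0 f \<omega> Hh Sh
      assume *: "data_ok \<gamma> \<beta> u0 \<theta>0 f" "\<omega> > 0" "IE_solution \<nu> \<mu> a e2 \<gamma> \<beta> u0 \<theta>0 f \<omega> Hh Sh"
        and modes: "mode_radius u0 \<theta>0 f = ennreal K"
      interpret boussinesq \<nu> \<mu> a \<gamma> \<beta> e2 u0 \<theta>0 f \<omega> Hh Sh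
        using assms * by unfold_locales auto
      have "D0 = 2 * (\<Sum>i\<in>UNIV. \<kappa> i) * K\<^sup>2 + 1" by (simp add: D0_def sum_UNIV_option \<kappa>_simps)
      from finite_modes[OF K modes this]
      show "(\<exists>c. \<forall>k. k \<noteq> 0 \<longrightarrow> ereal (1 / D0) \<le> conv_radius (\<lambda>m. norm (c m k)) \<and>
            (\<forall>p. 0 < p \<and> p < 1 / D0 \<longrightarrow> (\<lambda>m. p ^ m *\<^sub>R c m k) sums (Hh k p, Sh k p))) \<and>
       (\<exists>A0>0. gevrey_expansion (initial_state u0 \<theta>0) (boussinesq_solution u0 \<theta>0 Hh Sh) A0 D0)" by blast
    qed
  qed
qed

end
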